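(* Let $\phi\in\mathrm{Hom}^+(\mathcal{A}^0,\mathbb{R})$ be a positive homomorphism in the theory of tournaments. The following are equivalent. ($L_1$) $\phi=\phi_{\vec C_3}$. ($L_2$) $\phi$ maximizes the density of $T_5^9$: $\phi(T_5^9)=\max\{\psi(T_5^9):\psi\in\mathrm{Hom}^+(\mathcal{A}^0,\mathbb{R})\}$. ($L_3$) $\phi$ maximizes the density of $T_5^{11}$: $\phi(T_5^{11})=\max\{\psi(T_5^{11}):\psi\in\mathrm{Hom}^+(\mathcal{A}^0,\mathbb{R})\}$. ($L_4$) $\phi$ is balanced and $\vec C_3$-decomposable, the latter meaning $\phi(T_5^8+T_5^{10}+T_5^{12})=0$. ($L_5$) For every $k\in\mathbb{N}$ there exists a sequence $(T_n^{(k)})_{n\in\mathbb{N}}$ of $k$-equally $\vec C_3$-decomposable tournaments that converges to $\phi$.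
   Context: Tournaments are finite, have exactly one arc between each pair of distinct vertices, and may be empty; $|T|=|V(T)|$, and $A(T)$ is the arc set. $\mathbb{N}$ includes $0$. For $|T|\le|T'|$, $p(T;T')$ is the probability that a uniformly random $|T|$-subset of $V(T')$ induces a copy of $T$. Positive homomorphisms. Let $\mathcal{T}$ be the set of isomorphism classes of tournaments and $\mathcal{T}_\ell$ those of size $\ell$. $\mathcal{A}^0$ is the quotient of the real vector space of formal linear combinations of elements of $\mathcal{T}$ by the span of all $\widetilde T-\sum_{T\in\mathcal{T}_\ell}p(\widetilde T;T)T$ with $\ell\ge|\widetilde T|$; it is a commutative unital algebra with product $F_1\cdot F_2=\sum_{T\in\mathcal{T}_\ell}p(F_1,F_2;T)T$ (any $\ell\ge|F_1|+|F_2|$), where $p(F_1,F_2;T)$ is the probability that uniformly random disjoint sets $W_1,W_2\subset V(T)$ of sizes $|F_1|,|F_2|$ induce copies of $F_1,F_2$ respectively; the unit is the empty tournament. $\mathrm{Hom}^+(\mathcal{A}^0,\mathbb{R})$ is the set of $\mathbb{R}$-algebra homomorphisms $\phi:\mathcal{A}^0\to\mathbb{R}$ with $\phi(T)\in[0,1]$ for all $T\in\mathcal{T}$. A sequence $(T_n)$ of tournaments converges to $\phi$ if $|T_n|<|T_{n+1}|$ for all $n$ and $\lim_n p(T;T_n)=\phi(T)$ for every $T\in\mathcal{T}$. It is a known theorem that $\mathrm{Hom}^+(\mathcal{A}^0,\mathbb{R})$ is exactly the set of limits of convergent sequences of tournaments (equivalently, such $\phi$ are the functions $T\mapsto\lim_n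 p(T;T_n)$). Balanced. A sequence $(T_n)$ of tournaments of increasing sizes is asymptotically balanced if all but $o(|T_n|)$ vertices of $T_n$ have outdegree $(1/2+o(1))|T_n|$; $\phi$ is balanced if it is the limit of an asymptotically balanced sequence. $\vec C_3$-decomposable tournaments, recursively: every tournament of size at most $1$ is $\vec C_3$-decomposable; $T$ with $|T|\ge2$ is $\vec C_3$-decomposable if there are pairwise disjoint (possibly empty) sets $A,B,C\subsetneq V(T)$ with union $V(T)$, with $T|_A,T|_B,T|_C$ all $\vec C_3$-decomposable, and with $A\times B,B\times C,C\times A\subset A(T)$. A tournament is $0$-equally $\vec C_3$-decomposable if it is $\vec C_3$-decomposable. For $k>0$, $T$ is $k$-equally $\vec C_3$-decomposable if either $|T|\le1$ or there is a triple $(A,B,C)$ as in the previous definition with additionally $\max\{|A|,|B|,|C|\}-\min\{|A|,|B|,|C|\}\le1$ and with $T|_A,T|_B,T|_C$ all $(k-1)$-equally $\vec C_3$-decomposable. Recursive blow-ups of the $3$-cycle: for $n\le2$, $\vec C^3_n$ is the unique (up to isomorphism) tournament of size $n$. For $n\ge3$ let $n_0\ge n_1\ge n_2$ with $n_0+n_1+n_2=n$ and each $n_i\in\{\lfloor n/3\rfloor,\lceil n/3\rceil\}$; $\vec C^3_n$ has vertex set partitioned into $A_0,A_1,A_2$ with $|A_i|=n_i$, all arcs from $A_i$ to $A_{(i+1)\bmod3}$, and $A_i$ induces a copy of $\vec C^3_{n_i}$. The sequence $(\vec C^3_n)_n$ converges, and $\phi_{\vec C_3}$ denotes its limit. Specific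 tournaments (on vertices $1,\dots,5$ unless indicated): - $T_5^8$: $1\to2,\ 1\to3,\ 1\to4,\ 2\to3,\ 2\to4,\ 2\to5,\ 3\to4,\ 4\to5,\ 5\to1,\ 5\to3$. - $T_5^9$: $i\to j$ for all $i<j$ except $5\to1$ and $5\to2$. - $T_5^{10}$: $1\to2,\ 1\to4,\ 2\to3,\ 2\to4,\ 3\to1,\ 3\to4,\ 3\to5,\ 4\to5,\ 5\to1,\ 5\to2$. - $T_5^{11}$: $2\to3\to4\to2$; $1\to2,3,4$; $2,3,4\to5$; $5\to1$. - $T_5^{12}$: vertices $\mathbb{Z}_5$, $i\to i+1$ and $i\to i+2$ for all $i$. *)

theory Defs
  imports
    "HOL-Analysis.Analysis"
    "HOL-Analysis.Finite_Function_Topology"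
    "HOL-Library.Landau_Symbols"
begin

section \<open>Tournaments\<close>

definition is_tournament :: "nat set \<Rightarrow> (nat \<times> nat) set \<Rightarrow> bool" where
  "is_tournament V A \<longleftrightarrow> finite V \<and> A \<subseteq> V \<times> V \<and>
     (\<forall>v. (v, v) \<notin> A) \<and>
     (\<forall>u\<in>V. \<forall>v\<in>V. u \<noteq> v \<longrightarrow>
        ((u, v) \<in> A \<or> (v, u) \<in> A) \<and> \<not> ((u, v) \<in> A \<and> (v, u) \<in> A))"

text \<open>Fixing the vertices to be natural numbers loses nothing: every finite tournament is
  isomorphic to one of this form, and everything below is invariant under isomorphism.\<close>

typedef tournament = "{(V, A). is_tournament V A}"
  by (rule exI[of _ "({}, {})"]) (simp add: is_tournament_def)

setup_lifting type_definition_tournament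

lift_definition verts :: "tournament \<Rightarrow> nat set" is fst .

lift_definition arcs :: "tournament \<Rightarrow> (nat \<times> nat) set" is snd .

definition tsize :: "tournament \<Rightarrow> nat" where
  "tsize T = card (verts T)"

lift_definition induced :: "tournament \<Rightarrow> nat set \<Rightarrow> tournament"
  is "\<lambda>(V, A) W. (V \<inter> W, A \<inter> W \<times> W)"
  by (auto simp: is_tournament_def)

definition tiso :: "tournament \<Rightarrow> tournament \<Rightarrow> bool" where
  "tiso T T' \<longleftrightarrow> (\<exists>f. bij_betw f (verts T) (verts T') \<and>
     (\<forall>u\<in>verts T. \<forall>v\<in>verts T. (u, v) \<in> arcs T \<longleftrightarrow> (f u, f v) \<in> arcs T'))"

lemma tournament_tournament: "is_tournament (verts T) (arcs T)"
  by transfer auto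

lemma finite_verts [simp]: "finite (verts T)"
  using tournament_tournament[of T] by (simp add: is_tournament_def)

lemma arcs_subset: "arcs T \<subseteq> verts T \<times> verts T"
  using tournament_tournament[of T] by (simp add: is_tournament_def)

lemma tournament_eqI: "verts T = verts T' \<Longrightarrow> arcs T = arcs T' \<Longrightarrow> T = T'"
  by transfer auto

lemma verts_induced [simp]: "verts (induced T W) = verts T \<inter> W"
  by transfer auto

lemma arcs_induced [simp]: "arcs (induced T W) = arcs T \<inter> W \<times> W"
  by transfer auto

lemma induced_induced: "W \<subseteq> X \<Longrightarrow> induced (induced T X) W = induced T W"
  by (rule tournament_eqI) auto

lemma induced_verts [simp]: "induced T (verts T) = T"
  using arcs_subset[of T] by (intro tournament_eqI) auto

lemma tsize_induced: "W \<subseteq> verts T \<Longrightarrow> tsize (induced T W) = card W"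
  by (simp add: tsize_def Int_absorb1)

lemma tiso_refl: "tiso T T"
  unfolding tiso_def by (rule exI[of _ id]) auto

lemma tiso_sym: "tiso T T' \<Longrightarrow> tiso T' T"
proof -
  assume "tiso T T'"
  then obtain f where f: "bij_betw f (verts T) (verts T')"
    "\<And>u v. u \<in> verts T \<Longrightarrow> v \<in> verts T \<Longrightarrow> (u, v) \<in> arcs T \<longleftrightarrow> (f u, f v) \<in> arcs T'"
    unfolding tiso_def by blast
  have "bij_betw (inv_into (verts T) f) (verts T') (verts T)"
    using f(1) by (rule bij_betw_inv_into)
  moreover have "(u, v) \<in> arcs T' \<longleftrightarrow>
      (inv_into (verts T) f u, inv_into (verts T) f v) \<in> arcs T"
    if "u \<in> verts T'" "v \<in> verts T'" for u v
    using that f(2)[of "inv_into (verts T) f u" "inv_into (verts T) f v"]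
      bij_betw_inv_into_right[OF f(1)] calculation by (simp add: bij_betw_apply)
  ultimately show ?thesis unfolding tiso_def by blast
qed

lemma tiso_trans: "tiso T T' \<Longrightarrow> tiso T' T'' \<Longrightarrow> tiso T T''"
proof -
  assume "tiso T T'" "tiso T' T''"
  then obtain f g where f: "bij_betw f (verts T) (verts T')"
    "\<forall>u\<in>verts T. \<forall>v\<in>verts T. (u, v) \<in> arcs T \<longleftrightarrow> (f u, f v) \<in> arcs T'"
    and g: "bij_betw g (verts T') (verts T'')"
    "\<forall>u\<in>verts T'. \<forall>v\<in>verts T'. (u, v) \<in> arcs T' \<longleftrightarrow> (g u, g v) \<in> arcs T''"
    unfolding tiso_def by blast
  have "bij_betw (g \<circ> f) (verts T) (verts T'')" using f g by (blast intro: bij_betw_trans)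
  moreover have "\<forall>u\<in>verts T. \<forall>v\<in>verts T. (u, v) \<in> arcs T \<longleftrightarrow>
      ((g \<circ> f) u, (g \<circ> f) v) \<in> arcs T''"
    using f g by (metis bij_betwE comp_apply)
  ultimately show ?thesis unfolding tiso_def by blast
qed

lemma tiso_tsize: "tiso T T' \<Longrightarrow> tsize T = tsize T'"
  unfolding tiso_def tsize_def using bij_betw_same_card by blast

quotient_type tclass = tournament / tiso
  by (rule equivpI) (auto simp: reflp_def symp_def transp_def tiso_refl intro: tiso_sym tiso_trans)

abbreviation class_of :: "tournament \<Rightarrow> tclass" where
  "class_of \<equiv> abs_tclass"

lift_definition csize :: "tclass \<Rightarrow> nat" is tsize by (rule tiso_tsize)

declare csize.abs_eq [simp]

lemmas class_of_eq_iff = tclass.abs_eq_iff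

section \<open>Densities\<close>

definition tdensity_raw :: "tclass \<Rightarrow> tournament \<Rightarrow> real" where
  "tdensity_raw F T =
     real (card {W. W \<subseteq> verts T \<and> card W = csize F \<and> class_of (induced T W) = F})
       / real (tsize T choose csize F)"

definition tdensity2_raw :: "tclass \<Rightarrow> tclass \<Rightarrow> tournament \<Rightarrow> real" where
  "tdensity2_raw F\<^sub>1 F\<^sub>2 T =
     real (card {(W\<^sub>1, W\<^sub>2). W\<^sub>1 \<subseteq> verts T \<and> W\<^sub>2 \<subseteq> verts T \<and> W\<^sub>1 \<inter> W\<^sub>2 = {} \<and>
             card W\<^sub>1 = csize F\<^sub>1 \<and> card W\<^sub>2 = csize F\<^sub>2 \<and>
             class_of (induced T W\<^sub>1) = F\<^sub>1 \<and> class_of (induced T W\<^sub>2) = F\<^sub>2})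
       / real (card {(W\<^sub>1, W\<^sub>2). W\<^sub>1 \<subseteq> verts T \<and> W\<^sub>2 \<subseteq> verts T \<and> W\<^sub>1 \<inter> W\<^sub>2 = {} \<and>
             card W\<^sub>1 = csize F\<^sub>1 \<and> card W\<^sub>2 = csize F\<^sub>2})"

lemma tiso_induced_image:
  assumes f: "bij_betw f (verts T) (verts T')"
    "\<And>u v. u \<in> verts T \<Longrightarrow> v \<in> verts T \<Longrightarrow> (u, v) \<in> arcs T \<longleftrightarrow> (f u, f v) \<in> arcs T'"
    and W: "W \<subseteq> verts T"
  shows "class_of (induced T' (f ` W)) = class_of (induced T W)"
proof -
  have "f ` W \<subseteq> verts T'" using W f(1) by (auto simp: bij_betw_def)
  then have "bij_betw f (verts (induced T W)) (verts (induced T' (f ` W)))"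
    using f(1) W by (simp add: Int_absorb1) (meson bij_betw_subset)
  then have "tiso (induced T W) (induced T' (f ` W))"
    unfolding tiso_def using f(2) W by (intro exI[of _ f]) auto
  then show ?thesis by (metis class_of_eq_iff)
qed

lemma tdensity_raw_cong:
  assumes "tiso T T'" shows "tdensity_raw F T = tdensity_raw F T'"
proof -
  obtain f where f: "bij_betw f (verts T) (verts T')"
    "\<And>u v. u \<in> verts T \<Longrightarrow> v \<in> verts T \<Longrightarrow> (u, v) \<in> arcs T \<longleftrightarrow> (f u, f v) \<in> arcs T'"
    using assms unfolding tiso_def by blast
  have inj: "inj_on f (verts T)" and im: "f ` verts T = verts T'"
    using f(1) by (auto simp: bij_betw_def)
  have "bij_betw (image f)
      {W. W \<subseteq> verts T \<and> card W = csize F \<and> class_of (induced T W) = F}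
      {W. W \<subseteq> verts T' \<and> card W = csize F \<and> class_of (induced T' W) = F}"
  proof (rule bij_betw_imageI)
    show "inj_on (image f) {W. W \<subseteq> verts T \<and> card W = csize F \<and> class_of (induced T W) = F}"
      using inj_on_image_Pow[OF inj] by (rule inj_on_subset) auto
    have "W \<in> image f ` {W. W \<subseteq> verts T \<and> card W = csize F \<and> class_of (induced T W) = F}"
      if "W \<subseteq> verts T' \<and> card W = csize F \<and> class_of (induced T' W) = F" for W
    proof -
      obtain U where U: "U \<subseteq> verts T" "W = f ` U" using \<open>_ \<and> _\<close> im by (metis subset_image_iff)
      then show ?thesis
        using that tiso_induced_image[OF f U(1)] card_image[OF inj_on_subset[OF inj U(1)]] by auto
    qed
    moreover have "f ` W \<subseteq> verts T' \<and> card (f ` W) = csize F \<and> class_of (induced T' (f ` W)) = F"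
      if "W \<subseteq> verts T \<and> card W = csize F \<and> class_of (induced T W) = F" for W
      using that tiso_induced_image[OF f, of W] card_image[OF inj_on_subset[OF inj, of W]]
        image_mono[of W "verts T" f] im by simp
    ultimately show "image f ` {W. W \<subseteq> verts T \<and> card W = csize F \<and> class_of (induced T W) = F} =
      {W. W \<subseteq> verts T' \<and> card W = csize F \<and> class_of (induced T' W) = F}"
      by blast
  qed
  from bij_betw_same_card[OF this] show ?thesis
    unfolding tdensity_raw_def by (simp add: tiso_tsize[OF assms])
qed

text \<open>For the proofs: \<open>avg T F g X\<close> is the average over all \<open>W \<subseteq> X\<close> with \<open>|W| = |F|\<close> of \<open>g (X - W)\<close> if \<open>W\<close>
  induces a copy of \<open>F\<close> and of 0
  otherwise. These operators commute, and they compute both densities.\<close>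

definition copies :: "tournament \<Rightarrow> tclass \<Rightarrow> nat set \<Rightarrow> nat set set" where
  "copies T F X = {W. W \<subseteq> X \<and> class_of (induced T W) = F}"

definition avg :: "tournament \<Rightarrow> tclass \<Rightarrow> (nat set \<Rightarrow> real) \<Rightarrow> nat set \<Rightarrow> real" where
  "avg T F g X = (\<Sum>W\<in>copies T F X. g (X - W)) / real (card X choose csize F)"

lemma card_copies: "X \<subseteq> verts T \<Longrightarrow> W \<in> copies T F X \<Longrightarrow> card W = csize F"
  unfolding copies_def using tsize_induced by fastforce

lemma finite_sub: "X \<subseteq> verts T \<Longrightarrow> finite X"
  using finite_verts finite_subset by blast

lemma finite_copies: "X \<subseteq> verts T \<Longrightarrow> finite (copies T F X)"
  unfolding copies_def using finite_sub by simp

lemma avg_cong: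
  assumes "X \<subseteq> verts T"
    "\<And>Y. Y \<subseteq> X \<Longrightarrow> card Y = card X - csize F \<Longrightarrow> csize F \<le> card X \<Longrightarrow> g Y = g' Y"
  shows "avg T F g X = avg T F g' X"
proof -
  have "g (X - W) = g' (X - W)" if "W \<in> copies T F X" for W
  proof (rule assms(2))
    have W: "W \<subseteq> X" "card W = csize F"
      using that card_copies[OF assms(1)] by (auto simp: copies_def)
    then show "card (X - W) = card X - csize F"
      using finite_sub[OF assms(1)] by (metis card_Diff_subset finite_subset)
    show "csize F \<le> card X" using W finite_sub[OF assms(1)] by (metis card_mono)
  qed auto
  then show ?thesis unfolding avg_def by (simp cong: sum.cong)
qed

lemma tdensity_raw_avg: "X \<subseteq> verts T \<Longrightarrow> tdensity_raw F (induced T X) = avg T F (\<lambda>_. 1) X"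
proof -
  assume X: "X \<subseteq> verts T"
  have "{W. W \<subseteq> verts (induced T X) \<and> card W = csize F \<and> class_of (induced (induced T X) W) = F}
      = copies T F X"
    using card_copies[OF X] X by (auto simp: copies_def induced_induced Int_absorb1)
  then show ?thesis
    unfolding tdensity_raw_def avg_def by (simp add: tsize_induced X)
qed

lemma choose_swap:
  "(n choose a) * ((n - a) choose b) = (n choose b) * ((n - b) choose (a::nat))"
proof (cases "a + b \<le> n")
  case True
  have "(n choose (a + b)) * ((a + b) choose a) = (n choose a) * ((n - a) choose b)"
    using choose_mult[of a "a + b" n] True by simp
  moreover have "(n choose (a + b)) * ((a + b) choose b) = (n choose b) * ((n - b) choose a)"
    using choose_mult[of b "a + b" n] True by simp
  moreover have "(a + b) choose a = (a + b) choose b"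
    using binomial_symmetric[of a "a + b"] by simp
  ultimately show ?thesis by simp
next
  case False
  then have "(n choose a) * ((n - a) choose b) = 0" "(n choose b) * ((n - b) choose a) = 0"
    unfolding mult_eq_0_iff binomial_eq_0_iff by linarith+
  then show ?thesis by (rule trans[OF _ sym])
qed

lemma avg_commute:
  assumes X: "X \<subseteq> verts T"
  shows "avg T F (avg T G g) X = avg T G (avg T F g) X"
proof -
  have fin: "finite X" using finite_sub[OF X] .
  have expand: "avg T F (avg T G g) X =
      (\<Sum>(W, U) \<in> {(W, U). W \<subseteq> X \<and> U \<subseteq> X \<and> W \<inter> U = {} \<and>
         class_of (induced T W) = F \<and> class_of (induced T U) = G}. g (X - W - U))
      / real ((card X choose csize F) * ((card X - csize F) choose csize G))" for F G
  proof -
    have "avg T F (avg T G g) X =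
        (\<Sum>W\<in>copies T F X. (\<Sum>U\<in>copies T G (X - W). g (X - W - U)) /
          real ((card X - csize F) choose csize G)) / real (card X choose csize F)"
      unfolding avg_def
    proof (intro arg_cong2[where f = "(/)"] sum.cong refl)
      fix W assume "W \<in> copies T F X"
      then have "card (X - W) = card X - csize F"
        using card_copies[OF X] fin by (metis (no_types, lifting) card_Diff_subset copies_def
            finite_subset mem_Collect_eq)
      then show "real (card (X - W) choose csize G) = real ((card X - csize F) choose csize G)"
        by simp
    qed
    also have "\<dots> = (\<Sum>W\<in>copies T F X. \<Sum>U\<in>copies T G (X - W). g (X - W - U)) /
          real ((card X choose csize F) * ((card X - csize F) choose csize G))"
      by (simp add: sum_divide_distrib[symmetric])
    also have "(\<Sum>W\<in>copies T F X. \<Sum>U\<in>copies T G (X - W). g (X - W - U)) =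
       (\<Sum>(W, U) \<in> Sigma (copies T F X) (\<lambda>W. copies T G (X - W)). g (X - W - U))"
      using X finite_copies[of "X - _" T G]
      by (subst sum.Sigma) (auto intro: finite_copies)
    also have "Sigma (copies T F X) (\<lambda>W. copies T G (X - W)) =
      {(W, U). W \<subseteq> X \<and> U \<subseteq> X \<and> W \<inter> U = {} \<and>
         class_of (induced T W) = F \<and> class_of (induced T U) = G}"
      by (auto simp: copies_def)
    finally show ?thesis .
  qed
  have "(\<Sum>(W, U) \<in> {(W, U). W \<subseteq> X \<and> U \<subseteq> X \<and> W \<inter> U = {} \<and>
         class_of (induced T W) = F \<and> class_of (induced T U) = G}. g (X - W - U)) =
     (\<Sum>(U, W) \<in> {(U, W). U \<subseteq> X \<and> W \<subseteq> X \<and> U \<inter> W = {} \<and>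
         class_of (induced T U) = G \<and> class_of (induced T W) = F}. g (X - U - W))"
    by (rule sum.reindex_bij_witness[of _ prod.swap prod.swap])
       (auto intro!: arg_cong[where f = g])
  then show ?thesis by (simp only: expand choose_swap)
qed

lemma card_disjoint_pairs:
  assumes "finite V"
  shows "card {(W\<^sub>1, W\<^sub>2). W\<^sub>1 \<subseteq> V \<and> W\<^sub>2 \<subseteq> V \<and> W\<^sub>1 \<inter> W\<^sub>2 = {} \<and> card W\<^sub>1 = a \<and> card W\<^sub>2 = b}
    = (card V choose a) * ((card V - a) choose b)"
proof -
  have "{(W\<^sub>1, W\<^sub>2). W\<^sub>1 \<subseteq> V \<and> W\<^sub>2 \<subseteq> V \<and> W\<^sub>1 \<inter> W\<^sub>2 = {} \<and> card W\<^sub>1 = a \<and> card W\<^sub>2 = b}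
      = Sigma {W. W \<subseteq> V \<and> card W = a} (\<lambda>W. {U. U \<subseteq> V - W \<and> card U = b})"
    by auto
  also have "card \<dots> = (\<Sum>W | W \<subseteq> V \<and> card W = a. card {U. U \<subseteq> V - W \<and> card U = b})"
    using assms by (intro card_SigmaI) auto
  also have "\<dots> = (\<Sum>W | W \<subseteq> V \<and> card W = a. (card V - a) choose b)"
  proof (rule sum.cong[OF refl])
    fix W assume "W \<in> {W. W \<subseteq> V \<and> card W = a}"
    then have "card (V - W) = card V - a" using assms by (auto simp: card_Diff_subset finite_subset)
    then show "card {U. U \<subseteq> V - W \<and> card U = b} = (card V - a) choose b"
      using assms by (simp add: n_subsets)
  qed
  also have "\<dots> = (card V choose a) * ((card V - a) choose b)"
    using assms by (simp add: n_subsets)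
  finally show ?thesis .
qed

lemma tdensity2_raw_avg:
  assumes X: "X \<subseteq> verts T"
  shows "tdensity2_raw F G (induced T X) = avg T F (avg T G (\<lambda>_. 1)) X"
proof -
  have fin: "finite X" using finite_sub[OF X] .
  have "{(W\<^sub>1, W\<^sub>2). W\<^sub>1 \<subseteq> verts (induced T X) \<and> W\<^sub>2 \<subseteq> verts (induced T X) \<and> W\<^sub>1 \<inter> W\<^sub>2 = {} \<and>
             card W\<^sub>1 = csize F \<and> card W\<^sub>2 = csize G \<and>
             class_of (induced (induced T X) W\<^sub>1) = F \<and> class_of (induced (induced T X) W\<^sub>2) = G}
      = Sigma (copies T F X) (\<lambda>W. copies T G (X - W))"
  proof -
    have "copies T G (X - W) = {U. U \<subseteq> X \<and> W \<inter> U = {} \<and> class_of (induced T U) = G}" for W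
      by (auto simp: copies_def)
    then show ?thesis
      using X card_copies[OF X] by (auto simp: copies_def Int_absorb1 induced_induced)
  qed
  note set = this
  have num: "real (card {(W\<^sub>1, W\<^sub>2). W\<^sub>1 \<subseteq> verts (induced T X) \<and> W\<^sub>2 \<subseteq> verts (induced T X) \<and>
             W\<^sub>1 \<inter> W\<^sub>2 = {} \<and> card W\<^sub>1 = csize F \<and> card W\<^sub>2 = csize G \<and>
             class_of (induced (induced T X) W\<^sub>1) = F \<and> class_of (induced (induced T X) W\<^sub>2) = G})
      = (\<Sum>W\<in>copies T F X. real (card (copies T G (X - W))))"
  proof -
    have "\<forall>W\<in>copies T F X. finite (copies T G (X - W))"
      using X by (blast intro: finite_copies)
    from card_SigmaI[OF finite_copies[OF X] this] set show ?thesis by simp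
  qed
  have "avg T F (avg T G (\<lambda>_. 1)) X =
      (\<Sum>W\<in>copies T F X. real (card (copies T G (X - W))) / real ((card X - csize F) choose csize G))
        / real (card X choose csize F)"
    unfolding avg_def
  proof (intro arg_cong2[where f = "(/)"] sum.cong refl)
    fix W assume W: "W \<in> copies T F X"
    then have "card (X - W) = card X - csize F"
      using card_copies[OF X] fin by (metis (no_types, lifting) card_Diff_subset copies_def
          finite_subset mem_Collect_eq)
    then show "real (card (X - W) choose csize G) = real ((card X - csize F) choose csize G)"
      by simp
    show "(\<Sum>W\<in>copies T G (X - W). 1) = real (card (copies T G (X - W)))" by simp
  qed
  then show ?thesis
    unfolding tdensity2_raw_def num using card_disjoint_pairs[OF fin] X
    by (simp add: Int_absorb1 sum_divide_distrib[symmetric])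
qed

lemma avg_tiso:
  assumes "tiso T T'"
  shows "avg T F (\<lambda>X. tdensity_raw G (induced T X)) (verts T) =
         avg T' F (\<lambda>X. tdensity_raw G (induced T' X)) (verts T')"
proof -
  obtain f where f: "bij_betw f (verts T) (verts T')"
    "\<And>u v. u \<in> verts T \<Longrightarrow> v \<in> verts T \<Longrightarrow> (u, v) \<in> arcs T \<longleftrightarrow> (f u, f v) \<in> arcs T'"
    using assms unfolding tiso_def by blast
  have inj: "inj_on f (verts T)" and im: "f ` verts T = verts T'"
    using f(1) by (auto simp: bij_betw_def)
  have "bij_betw (image f) (copies T F (verts T)) (copies T' F (verts T'))"
  proof (rule bij_betw_imageI)
    show "inj_on (image f) (copies T F (verts T))"
      using inj_on_image_Pow[OF inj] by (rule inj_on_subset) (auto simp: copies_def)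
    have "W \<in> image f ` copies T F (verts T)" if "W \<in> copies T' F (verts T')" for W
    proof -
      have "W \<subseteq> f ` verts T" using that im by (simp add: copies_def)
      then obtain U where U: "U \<subseteq> verts T" "W = f ` U" by (auto simp: subset_image_iff)
      have "U \<in> copies T F (verts T)"
        using that U tiso_induced_image[OF f U(1)] by (simp add: copies_def)
      then show ?thesis using U(2) by (rule rev_image_eqI)
    qed
    moreover have "f ` W \<in> copies T' F (verts T')" if "W \<in> copies T F (verts T)" for W
      using that tiso_induced_image[OF f, of W] image_mono[of W "verts T" f] im
      by (simp add: copies_def)
    ultimately show "image f ` copies T F (verts T) = copies T' F (verts T')"
      by blast
  qed
  moreover have "tdensity_raw G (induced T' (verts T' - f ` W)) =
      tdensity_raw G (induced T (verts T - W))" if "W \<in> copies T F (verts T)" for W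
  proof -
    have "verts T' - f ` W = f ` (verts T - W)"
      using that inj im by (auto simp: copies_def inj_on_image_set_diff)
    then have "class_of (induced T' (verts T' - f ` W)) = class_of (induced T (verts T - W))"
      using tiso_induced_image[OF f, of "verts T - W"] by auto
    then show ?thesis using tdensity_raw_cong class_of_eq_iff by blast
  qed
  ultimately show ?thesis
    unfolding avg_def using tiso_tsize[OF assms]
    by (simp add: tsize_def sum.reindex_bij_betw[symmetric, of "image f" "copies T F (verts T)"])
qed

lemma tdensity2_raw_cong:
  assumes "tiso T T'" shows "tdensity2_raw F G T = tdensity2_raw F G T'"
proof -
  have "tdensity2_raw F G T = avg T F (\<lambda>X. tdensity_raw G (induced T X)) (verts T)" for T
    using tdensity2_raw_avg[of "verts T" T F G]
    by (simp, intro avg_cong) (auto simp: tdensity_raw_avg)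
  then show ?thesis using avg_tiso[OF assms] by simp
qed

text \<open>The density \<open>p(F; T)\<close>; it is \<open>0\<close> when \<open>|F| > |T|\<close>.\<close>

lift_definition tdensity :: "tclass \<Rightarrow> tclass \<Rightarrow> real" is tdensity_raw
  by (rule tdensity_raw_cong)

text \<open>The density \<open>p(F\<^sub>1, F\<^sub>2; T)\<close>; it is \<open>0\<close> when \<open>|F\<^sub>1| + |F\<^sub>2| > |T|\<close>.\<close>

lift_definition tdensity2 :: "tclass \<Rightarrow> tclass \<Rightarrow> tclass \<Rightarrow> real" is tdensity2_raw
  by (rule tdensity2_raw_cong)

section \<open>The algebra \<open>\<A>\<^sup>0\<close>\<close>

text \<open>\<open>lext h\<close> is the linear extension of \<open>h\<close> to formal linear combinations.\<close>

definition lext :: "('a \<Rightarrow> 'b::real_vector) \<Rightarrow> ('a \<Rightarrow>\<^sub>0 real) \<Rightarrow> 'b" where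
  "lext h f = (\<Sum>a\<in>Poly_Mapping.keys f. Poly_Mapping.lookup f a *\<^sub>R h a)"

abbreviation gen :: "'a \<Rightarrow> ('a \<Rightarrow>\<^sub>0 real)" where
  "gen a \<equiv> Poly_Mapping.single a 1"

definition density_relations :: "(tclass \<Rightarrow>\<^sub>0 real) set" where
  "density_relations =
     span {gen F - (\<Sum>H | csize H = l. tdensity F H *\<^sub>R gen H) | F l. csize F \<le> l}"

definition formal_mult ::
    "(tclass \<Rightarrow>\<^sub>0 real) \<Rightarrow> (tclass \<Rightarrow>\<^sub>0 real) \<Rightarrow> (tclass \<Rightarrow>\<^sub>0 real)" where
  "formal_mult f g =
     lext (\<lambda>F. lext (\<lambda>G. \<Sum>H | csize H = csize F + csize G. tdensity2 F G H *\<^sub>R gen H) g) f"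

lift_definition empty_tournament :: tournament is "({}, {})"
  by (simp add: is_tournament_def)

lemma lookup_scaleR: "Poly_Mapping.lookup (c *\<^sub>R f) a = c * Poly_Mapping.lookup (f :: 'a \<Rightarrow>\<^sub>0 real) a"
proof -
  have "finite {i. c *\<^sub>R Poly_Mapping.lookup f i \<noteq> 0}"
    by (rule finite_subset[OF _ finite_lookup[of f]]) auto
  then show ?thesis by (simp add: scaleR_poly_mapping_def lookup_Abs_poly_mapping)
qed

lemma lext_superset:
  "finite S \<Longrightarrow> Poly_Mapping.keys f \<subseteq> S \<Longrightarrow> lext h f = (\<Sum>a\<in>S. Poly_Mapping.lookup f a *\<^sub>R h a)"
  unfolding lext_def by (rule sum.mono_neutral_left) (auto simp: in_keys_iff)

lemma linear_lext: "linear (lext h)"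
proof (rule linearI)
  fix f g :: "'a \<Rightarrow>\<^sub>0 real" and c :: real
  let ?S = "Poly_Mapping.keys f \<union> Poly_Mapping.keys g"
  have "lext h (f + g) = (\<Sum>a\<in>?S. Poly_Mapping.lookup (f + g) a *\<^sub>R h a)"
    by (rule lext_superset) (auto simp: in_keys_iff lookup_add)
  then show "lext h (f + g) = lext h f + lext h g"
    by (simp add: lookup_add scaleR_add_left sum.distrib lext_superset[of ?S])
  have "lext h (c *\<^sub>R f) = (\<Sum>a\<in>Poly_Mapping.keys f. Poly_Mapping.lookup (c *\<^sub>R f) a *\<^sub>R h a)"
    by (rule lext_superset) (auto simp: in_keys_iff lookup_scaleR)
  then show "lext h (c *\<^sub>R f) = c *\<^sub>R lext h f"
    by (simp add: lookup_scaleR lext_def scaleR_sum_right)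
qed

lemma lext_gen [simp]: "lext h (gen a) = h a"
  by (simp add: lext_def)

lemma lext_id: "lext gen f = f"
proof (rule poly_mapping_eqI)
  fix a
  have "Poly_Mapping.lookup (lext gen f) a =
      (\<Sum>b\<in>Poly_Mapping.keys f. if b = a then Poly_Mapping.lookup f b else 0)"
    unfolding lext_def lookup_sum
    by (rule sum.cong) (auto simp: lookup_scaleR lookup_single)
  then show "Poly_Mapping.lookup (lext gen f) a = Poly_Mapping.lookup f a"
    by (simp add: sum.delta in_keys_iff)
qed

lemma linear_comp_lext: "linear L \<Longrightarrow> L (lext h f) = lext (\<lambda>a. L (h a)) f"
  by (simp add: lext_def linear_sum linear_scale)

lemma lext_cong: "(\<And>a. a \<in> Poly_Mapping.keys f \<Longrightarrow> h a = h' a) \<Longrightarrow> lext h f = lext h' f"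
  by (simp add: lext_def)

lemma lext_diff_fun: "lext (\<lambda>a. h a - h' a) f = lext h f - lext h' f"
  by (simp add: lext_def scaleR_diff_right sum_subtractf)

lemma lext_swap: "lext (\<lambda>a. lext (h a) g) f = lext (\<lambda>b. lext (\<lambda>a. h a b) f) g"
  unfolding lext_def scaleR_sum_right
  by (subst sum.swap) (simp add: mult.commute)

lemma lext_zero_fun [simp]: "lext (\<lambda>_. 0) f = 0"
  by (simp add: lext_def)

lemma keys_csize_bound: obtains b where "\<forall>F\<in>Poly_Mapping.keys (f :: tclass \<Rightarrow>\<^sub>0 real). csize F \<le> b"
proof
  show "\<forall>F\<in>Poly_Mapping.keys f. csize F \<le> Max (csize ` Poly_Mapping.keys f)"
    by simp
qed

lemma finite_classes: "finite {F. csize F = l}"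
proof -
  have "inj_on arcs {T. verts T = {..<l}}"
    by (rule inj_onI) (auto intro: tournament_eqI)
  moreover have "arcs ` {T. verts T = {..<l}} \<subseteq> Pow ({..<l} \<times> {..<l})"
    using arcs_subset by fastforce
  ultimately have fin: "finite {T. verts T = {..<l}}"
    by (metis finite_Pow_iff finite_SigmaI finite_imageD finite_lessThan finite_subset)
  have "F \<in> class_of ` {T. verts T = {..<l}}" if "csize F = l" for F
  proof -
    obtain T where T: "F = class_of T" by (metis Quotient3_abs_rep Quotient3_tclass)
    then have "card (verts T) = l" using that by (simp add: tsize_def)
    then obtain f where f: "bij_betw f (verts T) {..<l}"
      using ex_bij_betw_finite_nat[OF finite_verts[of T]] by (auto simp: atLeast0LessThan)
    define T' where "T' = Abs_tournament ({..<l}, map_prod f f ` arcs T)"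
    have inj: "inj_on f (verts T)" and im: "f ` verts T = {..<l}"
      using f by (auto simp: bij_betw_def)
    have arc: "(f u, f v) \<in> map_prod f f ` arcs T \<longleftrightarrow> (u, v) \<in> arcs T"
      if "u \<in> verts T" "v \<in> verts T" for u v
    proof
      assume "(f u, f v) \<in> map_prod f f ` arcs T"
      then obtain u' v' where uv: "(u', v') \<in> arcs T" "f u = f u'" "f v = f v'" by auto
      then show "(u, v) \<in> arcs T"
        using arcs_subset[of T] that inj_onD[OF inj, of u u'] inj_onD[OF inj, of v v'] by auto
    qed force
    have "is_tournament {..<l} (map_prod f f ` arcs T)"
      unfolding is_tournament_def im[symmetric]
    proof (intro conjI ballI allI impI)
      show "map_prod f f ` arcs T \<subseteq> f ` verts T \<times> f ` verts T"
        using arcs_subset[of T] by auto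
      fix v show "(v, v) \<notin> map_prod f f ` arcs T"
      proof
        assume "(v, v) \<in> map_prod f f ` arcs T"
        then obtain a b where ab: "(a, b) \<in> arcs T" "f a = f b" by auto
        then have "a = b" using arcs_subset[of T] inj by (auto dest: inj_onD)
        then show False using ab tournament_tournament[of T] by (simp add: is_tournament_def)
      qed
    next
      fix x y assume "x \<in> f ` verts T" "y \<in> f ` verts T" "x \<noteq> y"
      then obtain u v where "u \<in> verts T" "v \<in> verts T" "x = f u" "y = f v" "u \<noteq> v" by auto
      then show "(x, y) \<in> map_prod f f ` arcs T \<or> (y, x) \<in> map_prod f f ` arcs T"
        "\<not> ((x, y) \<in> map_prod f f ` arcs T \<and> (y, x) \<in> map_prod f f ` arcs T)"
        using arc tournament_tournament[of T] by (simp_all add: is_tournament_def)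
    qed simp
    then have T': "verts T' = {..<l}" "arcs T' = map_prod f f ` arcs T"
      by (simp_all add: T'_def verts.rep_eq arcs.rep_eq Abs_tournament_inverse)
    have "tiso T T'" unfolding tiso_def T' by (intro exI[of _ f] conjI ballI f) (simp only: arc)
    then have "F = class_of T'" using T by (simp add: class_of_eq_iff)
    then show ?thesis using T' by auto
  qed
  then have "{F. csize F = l} \<subseteq> class_of ` {T. verts T = {..<l}}" by auto
  then show ?thesis using fin finite_surj by blast
qed

lemma tdensity_avg: "X \<subseteq> verts T \<Longrightarrow> tdensity F (class_of (induced T X)) = avg T F (\<lambda>_. 1) X"
  by (simp add: tdensity.abs_eq tdensity_raw_avg)

lemma tdensity2_avg:
  "X \<subseteq> verts T \<Longrightarrow> tdensity2 F G (class_of (induced T X)) = avg T F (avg T G (\<lambda>_. 1)) X"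
  by (simp add: tdensity2.abs_eq tdensity2_raw_avg)

text \<open>The average of \<open>g\<close> over the subsets of size \<open>l\<close>.\<close>

definition savg :: "nat \<Rightarrow> (nat set \<Rightarrow> real) \<Rightarrow> nat set \<Rightarrow> real" where
  "savg l g X = (\<Sum>Y | Y \<subseteq> X \<and> card Y = l. g Y) / real (card X choose l)"

lemma savg_cong: "(\<And>Y. Y \<subseteq> X \<Longrightarrow> card Y = l \<Longrightarrow> g Y = g' Y) \<Longrightarrow> savg l g X = savg l g' X"
  unfolding savg_def by (intro arg_cong2[where f = "(/)"] sum.cong) auto

lemma savg_one: "finite X \<Longrightarrow> l \<le> card X \<Longrightarrow> savg l (\<lambda>_. 1) X = 1"
  by (simp add: savg_def n_subsets)

lemma sum_classes_savg:
  assumes X: "X \<subseteq> verts T"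
  shows "(\<Sum>H | csize H = l. h H * tdensity H (class_of (induced T X))) =
    savg l (\<lambda>Y. h (class_of (induced T Y))) X"
proof -
  have fin: "finite X" using finite_sub[OF X] .
  have "(\<Sum>H | csize H = l. h H * tdensity H (class_of (induced T X))) =
    (\<Sum>H | csize H = l. \<Sum>Y | Y \<in> {Y. Y \<subseteq> X \<and> card Y = l} \<and> class_of (induced T Y) = H.
       h (class_of (induced T Y))) / real (card X choose l)"
    unfolding sum_divide_distrib[of _ "{H. csize H = l}"]
  proof (rule sum.cong[OF refl])
    fix H assume H: "H \<in> {H. csize H = l}"
    then have eq: "{Y \<in> {Y. Y \<subseteq> X \<and> card Y = l}. class_of (induced T Y) = H} = copies T H X"
      using card_copies[OF X] by (auto simp: copies_def)
    have "(\<Sum>Y\<in>copies T H X. h (class_of (induced T Y))) = (\<Sum>Y\<in>copies T H X. h H)"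
      by (rule sum.cong) (auto simp: copies_def)
    then show "h H * tdensity H (class_of (induced T X)) =
        (\<Sum>Y\<in>{Y \<in> {Y. Y \<subseteq> X \<and> card Y = l}. class_of (induced T Y) = H}.
          h (class_of (induced T Y))) / real (card X choose l)"
      unfolding eq using H by (simp add: tdensity_avg[OF X] avg_def)
  qed
  also have "(\<Sum>H | csize H = l. \<Sum>Y | Y \<in> {Y. Y \<subseteq> X \<and> card Y = l} \<and> class_of (induced T Y) = H.
       h (class_of (induced T Y))) = (\<Sum>Y | Y \<subseteq> X \<and> card Y = l. h (class_of (induced T Y)))"
    using fin X by (intro sum.group finite_classes) (auto simp: tsize_induced)
  finally show ?thesis by (simp add: savg_def)
qed

lemma savg_avg:
  assumes X: "X \<subseteq> verts T" and l: "csize F \<le> l" "l \<le> card X"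
  shows "savg l (avg T F g) X = avg T F (savg (l - csize F) g) X"
proof -
  have fin: "finite X" using finite_sub[OF X] .
  have W: "finite W \<and> card W = csize F" if "W \<subseteq> X" "class_of (induced T W) = F" for W
    using that card_copies[OF X, of W F] fin by (auto simp: copies_def intro: finite_subset)
  have "savg l (avg T F g) X =
      (\<Sum>Y | Y \<subseteq> X \<and> card Y = l. \<Sum>W\<in>copies T F Y. g (Y - W)) / real ((card X choose l) * (l choose csize F))"
    unfolding savg_def avg_def by (simp add: sum_divide_distrib divide_divide_eq_left mult.commute)
  also have "(\<Sum>Y | Y \<subseteq> X \<and> card Y = l. \<Sum>W\<in>copies T F Y. g (Y - W)) =
      (\<Sum>(Y, W)\<in>Sigma {Y. Y \<subseteq> X \<and> card Y = l} (copies T F). g (Y - W))"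
    using fin X by (subst sum.Sigma) (auto intro!: finite_copies)
  also have "\<dots> = (\<Sum>(W, Z)\<in>Sigma (copies T F X) (\<lambda>W. {Z. Z \<subseteq> X - W \<and> card Z = l - csize F}). g Z)"
  proof (rule sum.reindex_bij_witness[of _ "\<lambda>(W, Z). (W \<union> Z, W)" "\<lambda>(Y, W). (W, Y - W)"])
    fix p assume "p \<in> Sigma {Y. Y \<subseteq> X \<and> card Y = l} (copies T F)"
    then obtain Y V where p: "p = (Y, V)" "Y \<subseteq> X" "card Y = l" "V \<subseteq> Y" "class_of (induced T V) = F"
      by (auto simp: copies_def)
    then show "(case case p of (Y, W) \<Rightarrow> (W, Y - W) of (W, Z) \<Rightarrow> (W \<union> Z, W)) = p" by auto
    show "(case p of (Y, W) \<Rightarrow> (W, Y - W)) \<in>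
        Sigma (copies T F X) (\<lambda>W. {Z. Z \<subseteq> X - W \<and> card Z = l - csize F})"
      using p W[of V] by (auto simp: copies_def card_Diff_subset)
    show "(case case p of (Y, W) \<Rightarrow> (W, Y - W) of (W, Z) \<Rightarrow> g Z) = (case p of (Y, W) \<Rightarrow> g (Y - W))"
      using p by simp
  next
    fix p assume "p \<in> Sigma (copies T F X) (\<lambda>W. {Z. Z \<subseteq> X - W \<and> card Z = l - csize F})"
    then obtain V Z where p: "p = (V, Z)" "V \<subseteq> X" "class_of (induced T V) = F" "Z \<subseteq> X - V"
      "card Z = l - csize F"
      by (auto simp: copies_def)
    moreover have "V \<union> Z - V = Z" using p by auto
    ultimately show "(case case p of (W, Z) \<Rightarrow> (W \<union> Z, W) of (Y, W) \<Rightarrow> (W, Y - W)) = p" by simp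
    have "finite Z" using p fin finite_subset by blast
    then have "card (V \<union> Z) = l" using p W[of V] l by (subst card_Un_disjoint) auto
    then show "(case p of (W, Z) \<Rightarrow> (W \<union> Z, W)) \<in> Sigma {Y. Y \<subseteq> X \<and> card Y = l} (copies T F)"
      using p by (auto simp: copies_def)
  qed
  also have "\<dots> = (\<Sum>W\<in>copies T F X. \<Sum>Z | Z \<subseteq> X - W \<and> card Z = l - csize F. g Z)"
    using fin X by (subst sum.Sigma) (auto intro: finite_copies)
  also have "(card X choose l) * (l choose csize F) =
      (card X choose csize F) * ((card X - csize F) choose (l - csize F))"
    using l by (rule choose_mult)
  also have "(\<Sum>W\<in>copies T F X. \<Sum>Z | Z \<subseteq> X - W \<and> card Z = l - csize F. g Z) /
      real ((card X choose csize F) * ((card X - csize F) choose (l - csize F))) =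
      (\<Sum>W\<in>copies T F X. (\<Sum>Z | Z \<subseteq> X - W \<and> card Z = l - csize F. g Z) /
        real ((card X - csize F) choose (l - csize F))) / real (card X choose csize F)"
    by (simp add: sum_divide_distrib divide_divide_eq_left mult.commute)
  also have "\<dots> = avg T F (savg (l - csize F) g) X"
    unfolding avg_def savg_def
  proof (intro arg_cong2[where f = "(/)"] sum.cong refl)
    fix V assume "V \<in> copies T F X"
    then have "card (X - V) = card X - csize F"
      using W[of V] by (auto simp: copies_def card_Diff_subset)
    then show "real ((card X - csize F) choose (l - csize F)) = real (card (X - V) choose (l - csize F))"
      by simp
  qed
  finally show ?thesis .
qed

lemma savg_avg_one:
  assumes X: "X \<subseteq> verts T" and l: "csize F \<le> l" "l \<le> card X"
  shows "savg l (avg T F (\<lambda>_. 1)) X = avg T F (\<lambda>_. 1) X"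
  unfolding savg_avg[OF assms]
proof (rule avg_cong[OF X])
  fix Y assume "Y \<subseteq> X" "card Y = card X - csize F"
  moreover from this have "finite Y" using finite_sub[OF X] finite_subset by blast
  ultimately show "savg (l - csize F) (\<lambda>_. 1) Y = 1" using l by (intro savg_one) auto
qed

lemma savg_avg2_one:
  assumes X: "X \<subseteq> verts T" and l: "csize F + csize G \<le> l" "l \<le> card X"
  shows "savg l (avg T F (avg T G (\<lambda>_. 1))) X = avg T F (avg T G (\<lambda>_. 1)) X"
proof -
  have "savg l (avg T F (avg T G (\<lambda>_. 1))) X = avg T F (savg (l - csize F) (avg T G (\<lambda>_. 1))) X"
    using l by (intro savg_avg[OF X]) auto
  also have "\<dots> = avg T F (avg T G (\<lambda>_. 1)) X"
    using l X by (intro avg_cong[OF X] savg_avg_one) auto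
  finally show ?thesis .
qed

lemma tdensity_chain:
  assumes X: "X \<subseteq> verts T" and l: "csize F \<le> l" "l \<le> card X"
  shows "(\<Sum>H | csize H = l. tdensity F H * avg T H (\<lambda>_. 1) X) = avg T F (\<lambda>_. 1) X"
proof -
  have "(\<Sum>H | csize H = l. tdensity F H * avg T H (\<lambda>_. 1) X) =
      savg l (\<lambda>Y. tdensity F (class_of (induced T Y))) X"
    using sum_classes_savg[OF X] by (simp add: tdensity_avg[OF X])
  also have "\<dots> = savg l (avg T F (\<lambda>_. 1)) X"
    using X by (intro savg_cong tdensity_avg) auto
  finally show ?thesis by (simp add: savg_avg_one[OF assms])
qed

lemma tdensity2_chain:
  assumes X: "X \<subseteq> verts T" and l: "csize F + csize G \<le> l" "l \<le> card X"
  shows "(\<Sum>H | csize H = l. tdensity2 F G H * avg T H (\<lambda>_. 1) X) = avg T F (avg T G (\<lambda>_. 1)) X"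
proof -
  have "(\<Sum>H | csize H = l. tdensity2 F G H * avg T H (\<lambda>_. 1) X) =
      savg l (\<lambda>Y. tdensity2 F G (class_of (induced T Y))) X"
    using sum_classes_savg[OF X] by (simp add: tdensity_avg[OF X])
  also have "\<dots> = savg l (avg T F (avg T G (\<lambda>_. 1))) X"
    using X by (intro savg_cong tdensity2_avg) auto
  finally show ?thesis by (simp add: savg_avg2_one[OF assms])
qed

definition opl :: "tournament \<Rightarrow> (tclass \<Rightarrow>\<^sub>0 real) \<Rightarrow> (nat set \<Rightarrow> real) \<Rightarrow> nat set \<Rightarrow> real" where
  "opl T f g X = lext (\<lambda>F. avg T F g X) f"

abbreviation large :: "(tournament \<Rightarrow> nat set \<Rightarrow> bool) \<Rightarrow> bool" where
  "large P \<equiv> \<exists>L. \<forall>T X. X \<subseteq> verts T \<longrightarrow> L \<le> card X \<longrightarrow> P T X"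

lemma large_conj: "large P \<Longrightarrow> large Q \<Longrightarrow> large (\<lambda>T X. P T X \<and> Q T X)"
proof -
  assume "large P" "large Q"
  then obtain L L' where "\<forall>T X. X \<subseteq> verts T \<longrightarrow> L \<le> card X \<longrightarrow> P T X"
    "\<forall>T X. X \<subseteq> verts T \<longrightarrow> L' \<le> card X \<longrightarrow> Q T X" by blast
  then show ?thesis by (intro exI[of _ "max L L'"]) auto
qed

lemma large_mono: "large P \<Longrightarrow> (\<And>T X. X \<subseteq> verts T \<Longrightarrow> P T X \<Longrightarrow> Q T X) \<Longrightarrow> large Q"
  by blast

lemma avg_lext: "avg T F (\<lambda>Y. lext (\<lambda>a. h a Y) f) X = lext (\<lambda>a. avg T F (h a) X) f"
  unfolding avg_def lext_def
  by (subst sum.swap) (simp add: sum_distrib_left sum_divide_distrib)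

lemma opl_commute:
  assumes X: "X \<subseteq> verts T"
  shows "opl T f (opl T g k) X = opl T g (opl T f k) X"
proof -
  have "opl T f (opl T g k) X = lext (\<lambda>F. lext (\<lambda>G. avg T F (avg T G k) X) g) f" for f g
    unfolding opl_def avg_lext ..
  then show ?thesis by (simp add: avg_commute[OF X, of _ _ k] lext_swap[of _ g f])
qed

lemma opl_large_cong:
  assumes "large (\<lambda>T X. g T X = g' T X)"
  shows "large (\<lambda>T X. opl T f (g T) X = opl T f (g' T) X)"
proof -
  obtain L where L: "\<forall>T X. X \<subseteq> verts T \<longrightarrow> L \<le> card X \<longrightarrow> g T X = g' T X" using assms by blast
  obtain b where b: "\<forall>F\<in>Poly_Mapping.keys f. csize F \<le> b" by (rule keys_csize_bound)
  have "opl T f (g T) X = opl T f (g' T) X" if X: "X \<subseteq> verts T" "L + b \<le> card X" for T X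
    unfolding opl_def
  proof (intro lext_cong avg_cong[OF X(1)])
    fix F Y assume "F \<in> Poly_Mapping.keys f" "Y \<subseteq> X" "card Y = card X - csize F"
    then have "csize F \<le> b" "Y \<subseteq> verts T" using b X by auto
    moreover from this have "L \<le> card Y" using X \<open>card Y = _\<close> by linarith
    ultimately show "g T Y = g' T Y" using L by blast
  qed
  then show ?thesis by blast
qed

lemma opl_zero [simp]: "opl T f (\<lambda>_. 0) X = 0"
  by (simp add: opl_def avg_def)

lemma opl_gen [simp]: "opl T (gen F) = avg T F"
  by (simp add: opl_def fun_eq_iff)

lemma linear_opl: "linear (\<lambda>f. opl T f g X)"
  unfolding opl_def by (rule linear_lext)

lemma opl_formal_mult:
  "large (\<lambda>T X. opl T (formal_mult f g) (\<lambda>_. 1) X = opl T f (opl T g (\<lambda>_. 1)) X)"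
proof -
  obtain a where a: "\<forall>F\<in>Poly_Mapping.keys f. csize F \<le> a" by (rule keys_csize_bound)
  obtain b where b: "\<forall>F\<in>Poly_Mapping.keys g. csize F \<le> b" by (rule keys_csize_bound)
  have "opl T (formal_mult f g) (\<lambda>_. 1) X = opl T f (opl T g (\<lambda>_. 1)) X"
    if X: "X \<subseteq> verts T" "a + b \<le> card X" for T X
  proof -
    have "opl T (formal_mult f g) (\<lambda>_. 1) X =
      lext (\<lambda>F. lext (\<lambda>G. \<Sum>H | csize H = csize F + csize G.
          tdensity2 F G H * avg T H (\<lambda>_. 1) X) g) f"
      unfolding formal_mult_def
      by (simp add: linear_comp_lext[OF linear_opl] linear_sum[OF linear_opl]
          linear_scale[OF linear_opl])
    also have "\<dots> = lext (\<lambda>F. lext (\<lambda>G. avg T F (avg T G (\<lambda>_. 1)) X) g) f"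
      using a b X by (intro lext_cong tdensity2_chain) (auto intro: order_trans[OF add_mono])
    finally show ?thesis unfolding opl_def avg_lext .
  qed
  then show ?thesis by blast
qed

lemma density_relations_iff:
  "f \<in> density_relations \<longleftrightarrow> large (\<lambda>T X. opl T f (\<lambda>_. 1) X = 0)"
proof
  have "subspace {f. large (\<lambda>T X. opl T f (\<lambda>_. 1) X = 0)}"
    unfolding subspace_def
  proof (intro conjI ballI allI)
    show "0 \<in> {f. large (\<lambda>T X. opl T f (\<lambda>_. 1) X = 0)}"
      by (simp add: linear_0[OF linear_opl])
  next
    fix f g assume "f \<in> {f. large (\<lambda>T X. opl T f (\<lambda>_. 1) X = 0)}"
      "g \<in> {f. large (\<lambda>T X. opl T f (\<lambda>_. 1) X = 0)}"
    then have "large (\<lambda>T X. opl T f (\<lambda>_. 1) X = 0 \<and> opl T g (\<lambda>_. 1) X = 0)"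
      by (intro large_conj) simp_all
    then have "large (\<lambda>T X. opl T (f + g) (\<lambda>_. 1) X = 0)"
      by (rule large_mono) (simp add: linear_add[OF linear_opl])
    then show "f + g \<in> {f. large (\<lambda>T X. opl T f (\<lambda>_. 1) X = 0)}" by simp
  next
    fix c f assume "f \<in> {f. large (\<lambda>T X. opl T f (\<lambda>_. 1) X = 0)}"
    then have "large (\<lambda>T X. opl T (c *\<^sub>R f) (\<lambda>_. 1) X = 0)"
      unfolding mem_Collect_eq by (rule large_mono) (simp add: linear_scale[OF linear_opl])
    then show "c *\<^sub>R f \<in> {f. large (\<lambda>T X. opl T f (\<lambda>_. 1) X = 0)}" by simp
  qed
  moreover have "large (\<lambda>T X. opl T
      (gen F - (\<Sum>H | csize H = l. tdensity F H *\<^sub>R gen H)) (\<lambda>_. 1) X = 0)"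
    if "csize F \<le> l" for F l
    using that tdensity_chain
    by (intro exI[of _ l]) (simp add: linear_diff[OF linear_opl] linear_sum[OF linear_opl]
          linear_scale[OF linear_opl])
  ultimately have "density_relations \<subseteq> {f. large (\<lambda>T X. opl T f (\<lambda>_. 1) X = 0)}"
    unfolding density_relations_def by (intro span_minimal) auto
  then show "f \<in> density_relations \<Longrightarrow> large (\<lambda>T X. opl T f (\<lambda>_. 1) X = 0)" by auto
next
  assume "large (\<lambda>T X. opl T f (\<lambda>_. 1) X = 0)"
  then obtain L where L: "\<And>T X. X \<subseteq> verts T \<Longrightarrow> L \<le> card X \<Longrightarrow> opl T f (\<lambda>_. 1) X = 0" by blast
  obtain b where b: "\<forall>F\<in>Poly_Mapping.keys f. csize F \<le> b" by (rule keys_csize_bound)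
  define l where "l = max L b"
  have zero: "lext (\<lambda>F. tdensity F H) f = 0" if "csize H = l" for H
  proof -
    obtain T where T: "H = class_of T" by (metis Quotient3_abs_rep Quotient3_tclass)
    have "lext (\<lambda>F. tdensity F H) f = opl T f (\<lambda>_. 1) (verts T)"
      unfolding opl_def T using tdensity_avg[of "verts T" T] by simp
    then show ?thesis using L[of "verts T" T] that T by (simp add: l_def tsize_def)
  qed
  have "lext (\<lambda>F. \<Sum>H | csize H = l. tdensity F H *\<^sub>R gen H) f =
      (\<Sum>H | csize H = l. lext (\<lambda>F. tdensity F H) f *\<^sub>R gen H)"
    unfolding lext_def scaleR_sum_right scaleR_sum_left by (subst sum.swap) simp
  also have "\<dots> = 0" by (rule sum.neutral) (simp add: zero)
  finally have "f = lext (\<lambda>F. gen F - (\<Sum>H | csize H = l. tdensity F H *\<^sub>R gen H)) f"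
    unfolding lext_diff_fun by (simp add: lext_id)
  also have "\<dots> \<in> density_relations"
    unfolding lext_def density_relations_def
  proof (intro span_sum span_scale span_base)
    fix F assume "F \<in> Poly_Mapping.keys f"
    then have "csize F \<le> l" using b by (auto simp: l_def le_max_iff_disj)
    then show "gen F - (\<Sum>H | csize H = l. tdensity F H *\<^sub>R gen H) \<in>
        {gen F - (\<Sum>H | csize H = l. tdensity F H *\<^sub>R gen H) | F l. csize F \<le> l}"
      by blast
  qed
  finally show "f \<in> density_relations" .
qed

lemma density_relations_diff_iff:
  "f - g \<in> density_relations \<longleftrightarrow> large (\<lambda>T X. opl T f (\<lambda>_. 1) X = opl T g (\<lambda>_. 1) X)"
  by (simp add: density_relations_iff linear_diff[OF linear_opl])

lemma large_trans: "large (\<lambda>T X. f T X = g T X) \<Longrightarrow> large (\<lambda>T X. g T X = h T X) \<Longrightarrow>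
    large (\<lambda>T X. f T X = h T X)"
  by (erule (1) large_mono[OF large_conj]) simp

lemma large_sym: "large (\<lambda>T X. f T X = g T X) \<Longrightarrow> large (\<lambda>T X. g T X = f T X)"
  by metis

lemma formal_mult_cong:
  assumes "f - f' \<in> density_relations" "g - g' \<in> density_relations"
  shows "formal_mult f g - formal_mult f' g' \<in> density_relations"
proof -
  let ?u = "\<lambda>_. 1 :: real"
  have f: "large (\<lambda>T X. opl T f ?u X = opl T f' ?u X)"
    and g: "large (\<lambda>T X. opl T g ?u X = opl T g' ?u X)"
    using assms by (simp_all add: density_relations_diff_iff)
  have comm: "large (\<lambda>T X. opl T f (opl T g ?u) X = opl T g (opl T f ?u) X)" for f g
    using opl_commute by blast
  note opl_formal_mult[of f g]
  also note opl_large_cong[OF g, of f]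
  also (large_trans) note comm
  also (large_trans) note opl_large_cong[OF f, of g']
  also (large_trans) note comm
  also (large_trans) note large_sym[OF opl_formal_mult[of f' g']]
  finally (large_trans) show ?thesis by (simp add: density_relations_diff_iff)
qed

lemma formal_mult_commute: "formal_mult f g - formal_mult g f \<in> density_relations"
proof -
  let ?u = "\<lambda>_. 1 :: real"
  have comm: "large (\<lambda>T X. opl T f (opl T g ?u) X = opl T g (opl T f ?u) X)" for f g
    using opl_commute by blast
  note opl_formal_mult[of f g]
  also note comm
  also (large_trans) note large_sym[OF opl_formal_mult[of g f]]
  finally (large_trans) show ?thesis by (simp add: density_relations_diff_iff)
qed

lemma formal_mult_assoc:
  "formal_mult (formal_mult f g) h - formal_mult f (formal_mult g h) \<in> density_relations"
proof -
  let ?u = "\<lambda>_. 1 :: real"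
  have comm: "large (\<lambda>T X. opl T f (opl T g k) X = opl T g (opl T f k) X)"
    for f g and k :: "nat set \<Rightarrow> real"
    using opl_commute by blast
  have comm': "large (\<lambda>T X. opl T f (opl T g (k T)) X = opl T g (opl T f (k T)) X)"
    for f g and k :: "tournament \<Rightarrow> nat set \<Rightarrow> real"
    using opl_commute by blast
  note opl_formal_mult[of "formal_mult f g" h]
  also note comm[of "formal_mult f g" h ?u]
  also (large_trans) note opl_large_cong[OF opl_formal_mult[of f g], of h]
  also (large_trans) note comm'[of h f "\<lambda>T. opl T g ?u"]
  also (large_trans) note opl_large_cong[OF comm[of h g ?u], of f]
  also (large_trans) note opl_large_cong[OF large_sym[OF opl_formal_mult[of g h]], of f]
  also (large_trans) note large_sym[OF opl_formal_mult[of f "formal_mult g h"]]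
  finally (large_trans) show ?thesis by (simp add: density_relations_diff_iff)
qed

lemma verts_empty_tournament [simp]: "verts empty_tournament = {}"
  by transfer simp

lemma avg_empty: "X \<subseteq> verts T \<Longrightarrow> avg T (class_of empty_tournament) g X = g X"
proof -
  assume X: "X \<subseteq> verts T"
  have "class_of (induced T {}) = class_of empty_tournament"
    by (rule arg_cong[of _ _ class_of], rule tournament_eqI)
       (use arcs_subset[of empty_tournament] in auto)
  then have "copies T (class_of empty_tournament) X = {{}}"
    using card_copies[OF X, of _ "class_of empty_tournament"] finite_sub[OF X]
    by (auto simp: copies_def tsize_def) (metis card_0_eq empty_iff finite_subset)
  then show ?thesis by (simp add: avg_def tsize_def)
qed

lemma formal_mult_unit: "formal_mult (gen (class_of empty_tournament)) f - f \<in> density_relations"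
proof -
  have "large (\<lambda>T X. opl T (gen (class_of empty_tournament)) (opl T f (\<lambda>_. 1)) X = opl T f (\<lambda>_. 1) X)"
    by (simp add: avg_empty)
  from large_trans[OF opl_formal_mult this] show ?thesis by (simp add: density_relations_diff_iff)
qed

lift_definition transitive_tournament :: "nat \<Rightarrow> tournament"
  is "\<lambda>n. ({..<n}, {(i, j). i < j \<and> j < n})"
  by (auto simp: is_tournament_def)

lemma verts_transitive_tournament [simp]: "verts (transitive_tournament n) = {..<n}"
  by transfer simp

lemma unit_notin_density_relations: "gen (class_of empty_tournament) \<notin> density_relations"
proof
  assume "gen (class_of empty_tournament) \<in> density_relations"
  then obtain L where L: "\<And>T X. X \<subseteq> verts T \<Longrightarrow> L \<le> card X \<Longrightarrow>
      opl T (gen (class_of empty_tournament)) (\<lambda>_. 1) X = 0"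
    by (auto simp: density_relations_iff)
  show False using L[of "{..<L}" "transitive_tournament L"] by (simp add: avg_empty)
qed

lemma density_relations_subspace: "subspace density_relations"
  by (simp add: density_relations_def)

lemma linear_formal_mult_left: "linear (\<lambda>f. formal_mult f g)"
  unfolding formal_mult_def by (rule linear_lext)

lemma linear_formal_mult_right: "linear (formal_mult f)"
  unfolding formal_mult_def lext_swap[of _ _ f] by (rule linear_lext)

quotient_type flag_algebra = "tclass \<Rightarrow>\<^sub>0 real" / "\<lambda>f g. f - g \<in> density_relations"
proof (rule equivpI)
  note sub = density_relations_subspace
  show "reflp (\<lambda>f g. f - g \<in> density_relations)"
    by (rule reflpI) (simp add: subspace_0[OF sub])
  show "symp (\<lambda>f g. f - g \<in> density_relations)"
    by (rule sympI) (use subspace_neg[OF sub] in fastforce)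
  show "transp (\<lambda>f g. f - g \<in> density_relations)"
    by (rule transpI) (use subspace_add[OF sub] in fastforce)
qed

instantiation flag_algebra :: "{real_algebra_1, comm_ring_1}"
begin

lift_definition zero_flag_algebra :: flag_algebra is 0 .

lift_definition one_flag_algebra :: flag_algebra is "gen (class_of empty_tournament)" .

lift_definition plus_flag_algebra :: "flag_algebra \<Rightarrow> flag_algebra \<Rightarrow> flag_algebra" is "(+)"
  by (simp only: add_diff_add subspace_add[OF density_relations_subspace])

lift_definition uminus_flag_algebra :: "flag_algebra \<Rightarrow> flag_algebra" is uminus
  by (simp only: minus_diff_minus subspace_neg[OF density_relations_subspace])

lift_definition minus_flag_algebra :: "flag_algebra \<Rightarrow> flag_algebra \<Rightarrow> flag_algebra" is "(-)"
proof -
  fix f f' g g' :: "tclass \<Rightarrow>\<^sub>0 real"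
  assume "f - f' \<in> density_relations" "g - g' \<in> density_relations"
  from subspace_diff[OF density_relations_subspace this]
  show "f - g - (f' - g') \<in> density_relations" by (simp add: algebra_simps)
qed

lift_definition scaleR_flag_algebra :: "real \<Rightarrow> flag_algebra \<Rightarrow> flag_algebra" is "(*\<^sub>R)"
  by (simp only: scaleR_diff_right[symmetric] subspace_scale[OF density_relations_subspace])

lift_definition times_flag_algebra :: "flag_algebra \<Rightarrow> flag_algebra \<Rightarrow> flag_algebra" is formal_mult
  by (rule formal_mult_cong)

instance
proof
  fix a b c :: flag_algebra and r s :: real
  note z = subspace_0[OF density_relations_subspace]
  note [simp] = linear_add[OF linear_formal_mult_left] linear_add[OF linear_formal_mult_right]
    linear_scale[OF linear_formal_mult_left] linear_scale[OF linear_formal_mult_right]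
  show "a + b + c = a + (b + c)" "a + b = b + a" "0 + a = a" "- a + a = 0" "a - b = a + - b"
    "r *\<^sub>R (a + b) = r *\<^sub>R a + r *\<^sub>R b" "(r + s) *\<^sub>R a = r *\<^sub>R a + s *\<^sub>R a"
    "r *\<^sub>R s *\<^sub>R a = (r * s) *\<^sub>R a" "1 *\<^sub>R a = a"
    by (transfer; simp add: z algebra_simps)+
  show "(a + b) * c = a * c + b * c" "a * (b + c) = a * b + a * c" "r *\<^sub>R a * b = r *\<^sub>R (a * b)" "a * r *\<^sub>R b = r *\<^sub>R (a * b)"
    by (transfer; simp add: z)+
  show "a * b * c = a * (b * c)" by transfer (rule formal_mult_assoc)
  have commute: "a * b = b * a" for a b :: flag_algebra by transfer (rule formal_mult_commute)
  then show "a * b = b * a" .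
  show unit: "1 * a = a" by transfer (rule formal_mult_unit)
  show "a * 1 = a" using unit by (simp only: commute)
  show "(0 :: flag_algebra) \<noteq> 1"
    by transfer (use unit_notin_density_relations subspace_neg[OF density_relations_subspace] in fastforce)
qed

end

definition flag :: "tclass \<Rightarrow> flag_algebra" where
  "flag F = abs_flag_algebra (gen F)"

lemma flag_empty: "flag (class_of empty_tournament) = 1"
  by (simp add: flag_def one_flag_algebra_def)

lemma scaleR_abs_flag: "c *\<^sub>R abs_flag_algebra f = abs_flag_algebra (c *\<^sub>R f)"
  by (simp add: scaleR_flag_algebra.abs_eq)

lemma abs_flag_sum: "abs_flag_algebra (\<Sum>i\<in>I. f i) = (\<Sum>i\<in>I. abs_flag_algebra (f i))"
  by (induction I rule: infinite_finite_induct)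
     (simp_all add: zero_flag_algebra_def plus_flag_algebra.abs_eq[symmetric])

lemma flag_relation:
  "csize F \<le> l \<Longrightarrow> flag F = (\<Sum>H | csize H = l. tdensity F H *\<^sub>R flag H)"
proof -
  assume "csize F \<le> l"
  then have "abs_flag_algebra (gen F) = abs_flag_algebra (\<Sum>H | csize H = l. tdensity F H *\<^sub>R gen H)"
    unfolding flag_algebra.abs_eq_iff density_relations_def by (intro span_base) blast
  then show ?thesis by (simp add: flag_def scaleR_abs_flag abs_flag_sum)
qed

text \<open>The product is defined above through \<open>l = |F| + |G|\<close>; any larger \<open>l\<close> gives the same.\<close>

lemma flag_mult:
  assumes l: "csize F + csize G \<le> l"
  shows "flag F * flag G = (\<Sum>H | csize H = l. tdensity2 F G H *\<^sub>R flag H)"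
proof -
  have "large (\<lambda>T X. opl T (formal_mult (gen F) (gen G)) (\<lambda>_. 1) X =
      opl T (\<Sum>H | csize H = l. tdensity2 F G H *\<^sub>R gen H) (\<lambda>_. 1) X)"
  proof (rule large_trans[OF opl_formal_mult], intro exI[of _ l] allI impI)
    fix T X assume "X \<subseteq> verts T" "l \<le> card X"
    then show "opl T (gen F) (opl T (gen G) (\<lambda>_. 1)) X =
        opl T (\<Sum>H | csize H = l. tdensity2 F G H *\<^sub>R gen H) (\<lambda>_. 1) X"
      using tdensity2_chain[OF _ l, of X T]
      by (simp add: linear_sum[OF linear_opl] linear_scale[OF linear_opl])
  qed
  then have "abs_flag_algebra (formal_mult (gen F) (gen G)) =
      abs_flag_algebra (\<Sum>H | csize H = l. tdensity2 F G H *\<^sub>R gen H)"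
    unfolding flag_algebra.abs_eq_iff by (simp add: density_relations_diff_iff)
  then show ?thesis by (simp add: flag_def times_flag_algebra.abs_eq scaleR_abs_flag abs_flag_sum)
qed

section \<open>Positive homomorphisms and convergence\<close>

definition pos_homs :: "(flag_algebra \<Rightarrow> real) set" where
  "pos_homs = {\<phi>. linear \<phi> \<and> \<phi> 1 = 1 \<and> (\<forall>x y. \<phi> (x * y) = \<phi> x * \<phi> y) \<and>
     (\<forall>F. 0 \<le> \<phi> (flag F) \<and> \<phi> (flag F) \<le> 1)}"

definition tconverges :: "(nat \<Rightarrow> tournament) \<Rightarrow> (flag_algebra \<Rightarrow> real) \<Rightarrow> bool" where
  "tconverges Ts \<phi> \<longleftrightarrow> (\<forall>n. tsize (Ts n) < tsize (Ts (Suc n))) \<and>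
     (\<forall>F. (\<lambda>n. tdensity F (class_of (Ts n))) \<longlonglongrightarrow> \<phi> (flag F))"

definition maximizes_density :: "tournament \<Rightarrow> (flag_algebra \<Rightarrow> real) \<Rightarrow> bool" where
  "maximizes_density T \<phi> \<longleftrightarrow>
     \<phi> \<in> pos_homs \<and> (\<forall>\<psi>\<in>pos_homs. \<psi> (flag (class_of T)) \<le> \<phi> (flag (class_of T)))"

definition outdegree :: "tournament \<Rightarrow> nat \<Rightarrow> nat" where
  "outdegree T v = card {w. (v, w) \<in> arcs T}"

text \<open>The two error terms \<open>o(1)\<close> and \<open>o(|T\<^sub>n|)\<close> are, in this order, \<open>\<epsilon> n\<close> and the number of
  exceptional vertices.\<close>

definition asymptotically_balanced :: "(nat \<Rightarrow> tournament) \<Rightarrow> bool" where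
  "asymptotically_balanced Ts \<longleftrightarrow> (\<forall>n. tsize (Ts n) < tsize (Ts (Suc n))) \<and>
     (\<exists>\<epsilon>. \<epsilon> \<longlonglongrightarrow> 0 \<and>
       (\<lambda>n. real (card {v \<in> verts (Ts n).
          \<bar>real (outdegree (Ts n) v) - real (tsize (Ts n)) / 2\<bar> > \<epsilon> n * real (tsize (Ts n))}))
       \<in> o(\<lambda>n. real (tsize (Ts n))))"

definition balanced :: "(flag_algebra \<Rightarrow> real) \<Rightarrow> bool" where
  "balanced \<phi> \<longleftrightarrow> (\<exists>Ts. asymptotically_balanced Ts \<and> tconverges Ts \<phi>)"

section \<open>\<open>C\<^sub>3\<close>-decomposability\<close>

definition cyclic_triple :: "tournament \<Rightarrow> nat set \<Rightarrow> nat set \<Rightarrow> nat set \<Rightarrow> bool" where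
  "cyclic_triple T A B C \<longleftrightarrow>
     A \<subset> verts T \<and> B \<subset> verts T \<and> C \<subset> verts T \<and>
     A \<inter> B = {} \<and> B \<inter> C = {} \<and> A \<inter> C = {} \<and> A \<union> B \<union> C = verts T \<and>
     A \<times> B \<subseteq> arcs T \<and> B \<times> C \<subseteq> arcs T \<and> C \<times> A \<subseteq> arcs T"

inductive C3_decomposable :: "tournament \<Rightarrow> bool" where
  small: "tsize T \<le> 1 \<Longrightarrow> C3_decomposable T"
| step: "2 \<le> tsize T \<Longrightarrow> cyclic_triple T A B C \<Longrightarrow> C3_decomposable (induced T A) \<Longrightarrow>
    C3_decomposable (induced T B) \<Longrightarrow> C3_decomposable (induced T C) \<Longrightarrow> C3_decomposable T"

primrec equally_C3_decomposable :: "nat \<Rightarrow> tournament \<Rightarrow> bool" where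
  "equally_C3_decomposable 0 T \<longleftrightarrow> C3_decomposable T"
| "equally_C3_decomposable (Suc k) T \<longleftrightarrow> tsize T \<le> 1 \<or>
     (\<exists>A B C. cyclic_triple T A B C \<and>
        C3_decomposable (induced T A) \<and> C3_decomposable (induced T B) \<and>
        C3_decomposable (induced T C) \<and>
        Max {card A, card B, card C} - Min {card A, card B, card C} \<le> 1 \<and>
        equally_C3_decomposable k (induced T A) \<and> equally_C3_decomposable k (induced T B) \<and>
        equally_C3_decomposable k (induced T C))"

section \<open>Recursive blow-ups of the 3-cycle\<close>

text \<open>The disjoint union of \<open>T 0\<close>, \<open>T 1\<close>, \<open>T 2\<close>, the vertex \<open>v\<close> of \<open>T i\<close> becoming \<open>3 * v + i\<close>,
  with all arcs from \<open>T i\<close> to \<open>T ((i + 1) mod 3)\<close>.\<close>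

lift_definition cyclic_join :: "(nat \<Rightarrow> tournament) \<Rightarrow> tournament" is
  "\<lambda>T. ({x. x div 3 \<in> fst (T (x mod 3))},
     {(x, y). x div 3 \<in> fst (T (x mod 3)) \<and> y div 3 \<in> fst (T (y mod 3)) \<and>
        (if x mod 3 = y mod 3 then (x div 3, y div 3) \<in> snd (T (x mod 3))
         else y mod 3 = (x mod 3 + 1) mod 3)})"
proof -
  fix T :: "nat \<Rightarrow> nat set \<times> (nat \<times> nat) set"
  assume T: "\<And>i. T i \<in> {(V, A). is_tournament V A}"
  then have T: "is_tournament (fst (T i)) (snd (T i))" for i
    by (metis case_prodD mem_Collect_eq prod.collapse)
  let ?V = "{x. x div 3 \<in> fst (T (x mod 3))}"
  let ?A = "{(x, y). x div 3 \<in> fst (T (x mod 3)) \<and> y div 3 \<in> fst (T (y mod 3)) \<and>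
        (if x mod 3 = y mod 3 then (x div 3, y div 3) \<in> snd (T (x mod 3))
         else y mod 3 = (x mod 3 + 1) mod 3)}"
  have "is_tournament ?V ?A"
    unfolding is_tournament_def
  proof (intro conjI ballI allI impI)
    have "?V \<subseteq> (\<Union>i\<in>{..<3}. (\<lambda>v. 3 * v + i) ` fst (T i))"
    proof
      fix x assume "x \<in> ?V"
      then have "x \<in> (\<lambda>v. 3 * v + x mod 3) ` fst (T (x mod 3))" by (intro image_eqI[of _ _ "x div 3"]) auto
      then show "x \<in> (\<Union>i\<in>{..<3}. (\<lambda>v. 3 * v + i) ` fst (T i))" by (intro UN_I[of "x mod 3"]) auto
    qed
    moreover have "finite (fst (T i))" for i using T[of i] by (simp add: is_tournament_def)
    ultimately show "finite ?V" by (auto intro: finite_subset)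
    show "?A \<subseteq> ?V \<times> ?V" by auto
    show "(v, v) \<notin> ?A" for v using T[of "v mod 3"] by (simp add: is_tournament_def)
  next
    fix x y assume xy: "x \<in> ?V" "y \<in> ?V" "x \<noteq> y"
    then have V: "x div 3 \<in> fst (T (x mod 3))" "y div 3 \<in> fst (T (y mod 3))" by auto
    have cyc: "y mod 3 = (x mod 3 + 1) mod 3 \<or> x mod 3 = (y mod 3 + 1) mod 3"
      "\<not> (y mod 3 = (x mod 3 + 1) mod 3 \<and> x mod 3 = (y mod 3 + 1) mod 3)"
      if "x mod 3 \<noteq> y mod 3"
    proof -
      have "x mod 3 \<in> {0, 1, 2}" "y mod 3 \<in> {0, 1, 2}" by auto
      then show "y mod 3 = (x mod 3 + 1) mod 3 \<or> x mod 3 = (y mod 3 + 1) mod 3"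
        "\<not> (y mod 3 = (x mod 3 + 1) mod 3 \<and> x mod 3 = (y mod 3 + 1) mod 3)"
        using that by (elim insertE; simp)+
    qed
    have same: "x div 3 \<noteq> y div 3" if "x mod 3 = y mod 3"
      using that xy(3) by (metis div_mult_mod_eq)
    have "((x, y) \<in> ?A \<or> (y, x) \<in> ?A) \<and> \<not> ((x, y) \<in> ?A \<and> (y, x) \<in> ?A)"
    proof (cases "x mod 3 = y mod 3")
      case True
      have "(x div 3, y div 3) \<in> snd (T (x mod 3)) \<or> (y div 3, x div 3) \<in> snd (T (x mod 3))"
        "\<not> ((x div 3, y div 3) \<in> snd (T (x mod 3)) \<and> (y div 3, x div 3) \<in> snd (T (x mod 3)))"
        using T[of "x mod 3", unfolded is_tournament_def] V[folded True] same[OF True] by blast+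
      then show ?thesis
        using True V by simp
    next
      case False
      then show ?thesis
        using cyc[OF False] V by simp
    qed
    then show "(x, y) \<in> ?A \<or> (y, x) \<in> ?A" "\<not> ((x, y) \<in> ?A \<and> (y, x) \<in> ?A)"
      by (rule conjunct1, rule conjunct2)
  qed
  then show "(?V, ?A) \<in> {(V, A). is_tournament V A}" by simp
qed

text \<open>Since \<open>cyclic_join\<close> only looks at \<open>i = 0, 1, 2\<close>, the parts have sizes
  \<open>\<lfloor>(n + 2) / 3\<rfloor> \<ge> \<lfloor>(n + 1) / 3\<rfloor> \<ge> \<lfloor>n / 3\<rfloor>\<close>, which sum to \<open>n\<close>; all tournaments of size at most 2 are
  transitive.\<close>

function C3_blowup :: "nat \<Rightarrow> tournament" where
  "C3_blowup n = (if n \<le> 2 then transitive_tournament n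
     else cyclic_join (\<lambda>i. C3_blowup ((n + 2 - i) div 3)))"
  by pat_completeness auto
termination
  by (relation "Wellfounded.measure id") auto

declare C3_blowup.simps [simp del]

definition phi_C3 :: "flag_algebra \<Rightarrow> real" where
  "phi_C3 = (THE \<phi>. \<phi> \<in> pos_homs \<and> tconverges C3_blowup \<phi>)"

lemma verts_cyclic_join: "verts (cyclic_join T) = {x. x div 3 \<in> verts (T (x mod 3))}"
  by transfer simp

lemma tsize_cyclic_join: "tsize (cyclic_join T) = tsize (T 0) + tsize (T 1) + tsize (T 2)"
proof -
  have mod3: "(3 * v + i) mod 3 = i" "(3 * v + i) div 3 = v" if "i \<in> {0, 1, 2}" for v i :: nat
    using that by auto
  have "verts (cyclic_join T) = (\<Union>i\<in>{0, 1, 2}. (\<lambda>v. 3 * v + i) ` verts (T i))"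
  proof (intro subset_antisym subsetI)
    fix x assume "x \<in> verts (cyclic_join T)"
    then have "x \<in> (\<lambda>v. 3 * v + x mod 3) ` verts (T (x mod 3))"
      by (intro image_eqI[of _ _ "x div 3"]) (auto simp: verts_cyclic_join)
    moreover have "x mod 3 \<in> {0, 1, 2}" by auto
    ultimately show "x \<in> (\<Union>i\<in>{0, 1, 2}. (\<lambda>v. 3 * v + i) ` verts (T i))"
      by (rule UN_I[rotated])
  next
    fix x assume "x \<in> (\<Union>i\<in>{0, 1, 2}. (\<lambda>v. 3 * v + i) ` verts (T i))"
    then obtain i v where "i \<in> {0, 1, 2}" "v \<in> verts (T i)" "x = 3 * v + i" by (elim UN_E imageE)
    then show "x \<in> verts (cyclic_join T)" by (simp only: verts_cyclic_join mod3 mem_Collect_eq)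
  qed
  then have "tsize (cyclic_join T) = card (\<Union>i\<in>{0, 1, 2}. (\<lambda>v. 3 * v + i) ` verts (T i))"
    by (simp only: tsize_def)
  also have "\<dots> = (\<Sum>i\<in>{0, 1, 2}. card ((\<lambda>v. 3 * v + i) ` verts (T i)))"
  proof (intro card_UN_disjoint ballI impI)
    fix i j :: nat assume "i \<in> {0, 1, 2}" "j \<in> {0, 1, 2}" "i \<noteq> j"
    then have "3 * v + i \<noteq> 3 * w + j" for v w by (metis mod3(1))
    then show "(\<lambda>v. 3 * v + i) ` verts (T i) \<inter> (\<lambda>v. 3 * v + j) ` verts (T j) = {}" by blast
  qed simp_all
  also have "\<dots> = (\<Sum>i\<in>{0, 1, 2}. tsize (T i))"
    by (intro sum.cong refl) (auto simp: tsize_def card_image inj_on_def)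
  finally show ?thesis by simp
qed

lemma sum_div3: "(n + 2) div 3 + (n + 1) div 3 + n div 3 = (n :: nat)"
proof (induction n)
  case (Suc n)
  have "(Suc n + 2) div 3 = n div 3 + 1" by simp
  moreover have "Suc n + 1 = n + 2" "Suc n = n + 1" by simp_all
  ultimately show ?case using Suc by (simp only:)
qed simp

lemma tsize_C3_blowup: "tsize (C3_blowup n) = n"
proof (induction n rule: less_induct)
  case (less n)
  show ?case
  proof (cases "n \<le> 2")
    case True
    then show ?thesis by (simp add: C3_blowup.simps[of n] tsize_def)
  next
    case False
    have "tsize (C3_blowup n) = (n + 2) div 3 + (n + 1) div 3 + n div 3"
      using False by (simp add: C3_blowup.simps[of n] tsize_cyclic_join less)
    also have "\<dots> = n" by (rule sum_div3)
    finally show ?thesis .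
  qed
qed

section \<open>Specific tournaments\<close>

lift_definition T5_8 :: tournament is "({1, 2, 3, 4, 5},
  {(1, 2), (1, 3), (1, 4), (2, 3), (2, 4), (2, 5), (3, 4), (4, 5), (5, 1), (5, 3)})"
  by (simp add: is_tournament_def)

lift_definition T5_9 :: tournament is "({1, 2, 3, 4, 5},
  {(1, 2), (1, 3), (1, 4), (2, 3), (2, 4), (3, 4), (3, 5), (4, 5), (5, 1), (5, 2)})"
  by (simp add: is_tournament_def)

lift_definition T5_10 :: tournament is "({1, 2, 3, 4, 5},
  {(1, 2), (1, 4), (2, 3), (2, 4), (3, 1), (3, 4), (3, 5), (4, 5), (5, 1), (5, 2)})"
  by (simp add: is_tournament_def)

lift_definition T5_11 :: tournament is "({1, 2, 3, 4, 5},
  {(2, 3), (3, 4), (4, 2), (1, 2), (1, 3), (1, 4), (2, 5), (3, 5), (4, 5), (5, 1)})"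
  by (simp add: is_tournament_def)

text \<open>On \<open>\<int>\<^sub>5\<close>: the arcs \<open>i \<rightarrow> i + 1\<close> and \<open>i \<rightarrow> i + 2\<close>.\<close>

lift_definition T5_12 :: tournament is "({0, 1, 2, 3, 4},
  {(0, 1), (1, 2), (2, 3), (3, 4), (4, 0), (0, 2), (1, 3), (2, 4), (3, 0), (4, 1)})"
  by (auto simp: is_tournament_def)

definition C3_decomposable_hom :: "(flag_algebra \<Rightarrow> real) \<Rightarrow> bool" where
  "C3_decomposable_hom \<phi> \<longleftrightarrow>
     \<phi> (flag (class_of T5_8) + flag (class_of T5_10) + flag (class_of T5_12)) = 0"

end

theory Submission
  imports Defs "HOL-Combinatorics.Multiset_Permutations"
begin

text \<open>
  A homomorphism \<open>F \<rightarrow> T\<close> into a tournament with a cyclic partition colours \<open>F\<close> by the three parts, so the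
  homomorphism densities of \<open>T\<close> are polynomials in the relative sizes of the parts and in the densities of
  the parts. By induction along a decomposition, every homomorphism density of a decomposable tournament
  differs from a constant depending only on \<open>F\<close> by at most a multiple of \<open>1/8 - t(C\<^sub>3, T) + 1/|T|\<close>; the
  error closes up because the deviation of \<open>t(C\<^sub>3, T)\<close> from \<open>1/8\<close> itself obeys the same recursion. By
  Goodman's identity this deviation vanishes in the limit exactly for balanced sequences. Hence there is only
  one balanced decomposable limit. A tournament is decomposable iff it has no copy of
  \<open>T\<^sub>5\<^sup>8\<close>, \<open>T\<^sub>5\<^sup>1\<^sup>0\<close>, \<open>T\<^sub>5\<^sup>1\<^sup>2\<close>, and sampling from \<open>\<phi>\<close> yields tournaments without flags of density \<open>0\<close>.
  For the two maximisation problems, sums of squares bound the density by its value in the blow-ups, with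
  slack for the three forbidden tournaments and for the fourth moment of the degrees, so that a
  maximiser is balanced and decomposable.
\<close>

section \<open>Homomorphism densities\<close>

text \<open>The obstacle is that a decomposition may be lopsided and arbitrarily deep: a part may be
  empty or contain almost every vertex, and transitive tournaments are decomposable too. A bound
  that loses a factor at each level is useless; the constant in front of the error must be
  reproduced exactly. This is why the error is measured by the imbalance. A split into parts of
  relative sizes \<open>x i\<close> adds \<open>3/8 * (e2 - 9 * e3)\<close> to it, where
  \<open>e2\<close> and \<open>e3\<close> are the elementary symmetric functions of the sizes. This
  gain pays for the distance of the sizes from \<open>(1/3, 1/3, 1/3)\<close>, and the errors of the
  parts are charged with weights that add up to those with which the parts enter the imbalance.

  The extremal densities \<open>1/320\<close> and \<open>1/640\<close> come from one self-similarity
  step: in the blow-ups a five-vertex tournament with a non-constant colouring whose fibres have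
  densities with product \<open>p\<close> has limit density at least \<open>p / 80\<close>, where
  \<open>80 = 3 ^ 4 - 1\<close>, and \<open>p\<close> is \<open>1/4\<close> and \<open>1/8\<close>.
  Five vertices are just enough to express the fourth moment of the degrees, so one certificate can
  also penalise imbalance.\<close>

lemma arcs_irrefl [simp]: "(v, v) \<notin> arcs T"
  using tournament_tournament[of T] by (simp add: is_tournament_def)

lemma arcs_total: "u \<in> verts T \<Longrightarrow> v \<in> verts T \<Longrightarrow> u \<noteq> v \<Longrightarrow> (u, v) \<in> arcs T \<or> (v, u) \<in> arcs T"
  using tournament_tournament[of T] by (simp add: is_tournament_def)

lemma arcs_vertsD: "(u, v) \<in> arcs T \<Longrightarrow> u \<in> verts T" "(u, v) \<in> arcs T \<Longrightarrow> v \<in> verts T"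
  using arcs_subset[of T] by auto

lemma arcs_asym: "(u, v) \<in> arcs T \<Longrightarrow> (v, u) \<notin> arcs T"
  using tournament_tournament[of T] arcs_vertsD[of u v T] arcs_irrefl[of u T]
  unfolding is_tournament_def by metis

lemma arcs_iff_not: "u \<in> verts T \<Longrightarrow> v \<in> verts T \<Longrightarrow> u \<noteq> v \<Longrightarrow> (u, v) \<in> arcs T \<longleftrightarrow> (v, u) \<notin> arcs T"
  using arcs_total arcs_asym by blast

definition homs :: "tournament \<Rightarrow> tournament \<Rightarrow> (nat \<Rightarrow> nat) set" where
  "homs F T = {h \<in> verts F \<rightarrow>\<^sub>E verts T. \<forall>u v. (u, v) \<in> arcs F \<longrightarrow> (h u, h v) \<in> arcs T}"

lemma homsD: "h \<in> homs F T \<Longrightarrow> (u, v) \<in> arcs F \<Longrightarrow> (h u, h v) \<in> arcs T"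
  "h \<in> homs F T \<Longrightarrow> v \<in> verts F \<Longrightarrow> h v \<in> verts T"
  "h \<in> homs F T \<Longrightarrow> v \<notin> verts F \<Longrightarrow> h v = undefined"
  by (auto simp: homs_def PiE_def extensional_def)

lemma finite_homs [simp]: "finite (homs F T)"
  by (rule finite_subset[of _ "verts F \<rightarrow>\<^sub>E verts T"]) (auto simp: homs_def intro: finite_PiE)

text \<open>Distinct vertices of \<open>F\<close> are joined by an arc, and arcs never map to loops.
  So homomorphisms between tournaments are embeddings onto induced copies, and counting them amounts
  to counting copies and automorphisms.\<close>

lemma homs_inj_on: "h \<in> homs F T \<Longrightarrow> inj_on h (verts F)"
  by (rule inj_onI) (metis arcs_irrefl arcs_total homsD(1))

lemma homs_arcs_iff:
  "h \<in> homs F T \<Longrightarrow> u \<in> verts F \<Longrightarrow> v \<in> verts F \<Longrightarrow> (h u, h v) \<in> arcs T \<longleftrightarrow> (u, v) \<in> arcs F"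
  by (metis arcs_asym arcs_irrefl arcs_total homsD(1))

lemma homs_self_image: "h \<in> homs F F \<Longrightarrow> h ` verts F = verts F"
  by (rule endo_inj_surj) (auto simp: homs_inj_on homsD)

lemma homs_image_copies:
  assumes h: "h \<in> homs F T" shows "h ` verts F \<in> copies T (class_of F) (verts T)"
proof -
  have sub: "h ` verts F \<subseteq> verts T" using homsD(2)[OF h] by auto
  have "tiso F (induced T (h ` verts F))"
    unfolding tiso_def
    using sub homs_inj_on[OF h] homs_arcs_iff[OF h]
    by (intro exI[of _ h]) (auto simp: bij_betw_def)
  then have "class_of (induced T (h ` verts F)) = class_of F"
    by (simp add: class_of_eq_iff tiso_sym)
  then show ?thesis using sub by (simp add: copies_def)
qed

text \<open>Composition with one fixed isomorphism from \<open>F\<close> onto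
  \<open>induced T W\<close> is a bijection from the endomorphisms of \<open>F\<close>, which are
  its automorphisms, to the homomorphisms with image \<open>W\<close>.\<close>

lemma card_homs_image:
  assumes W: "W \<in> copies T (class_of F) (verts T)"
  shows "card {h \<in> homs F T. h ` verts F = W} = card (homs F F)"
proof -
  have sub: "W \<subseteq> verts T" and "tiso F (induced T W)"
    using W by (auto simp: copies_def class_of_eq_iff intro: tiso_sym)
  then obtain f where f: "bij_betw f (verts F) W"
    "\<And>u v. u \<in> verts F \<Longrightarrow> v \<in> verts F \<Longrightarrow> (u, v) \<in> arcs F \<longleftrightarrow> (f u, f v) \<in> arcs T"
    unfolding tiso_def
    by (auto simp: Int_absorb1) (metis (no_types, lifting) bij_betw_apply)
  define g where "g = inv_into (verts F) f"
  have fv: "f v \<in> W" if "v \<in> verts F" for v using f(1) that by (auto simp: bij_betw_def)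
  have gv: "g w \<in> verts F" "f (g w) = w" if "w \<in> W" for w
    using f(1) that unfolding g_def by (auto simp: bij_betw_def inv_into_into f_inv_into_f)
  have gf: "g (f v) = v" if "v \<in> verts F" for v
    using f(1) that unfolding g_def by (simp add: bij_betw_def)
  have "bij_betw (\<lambda>k. \<lambda>v\<in>verts F. f (k v)) (homs F F) {h \<in> homs F T. h ` verts F = W}"
  proof (rule bij_betw_byWitness[where f' = "\<lambda>h. \<lambda>v\<in>verts F. g (h v)"])
    show "\<forall>k\<in>homs F F. (\<lambda>v\<in>verts F. g ((\<lambda>v\<in>verts F. f (k v)) v)) = k"
    proof (intro ballI ext)
      fix k v assume "k \<in> homs F F"
      then show "(\<lambda>v\<in>verts F. g ((\<lambda>v\<in>verts F. f (k v)) v)) v = k v"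
        using gf[of "k v"] homsD(2,3)[of k F F v] by (cases "v \<in> verts F") simp_all
    qed
    show "\<forall>h\<in>{h \<in> homs F T. h ` verts F = W}. (\<lambda>v\<in>verts F. f ((\<lambda>v\<in>verts F. g (h v)) v)) = h"
    proof (intro ballI ext)
      fix h v assume "h \<in> {h \<in> homs F T. h ` verts F = W}"
      then show "(\<lambda>v\<in>verts F. f ((\<lambda>v\<in>verts F. g (h v)) v)) v = h v"
        using gv(2)[of "h v"] homsD(3)[of h F T v] by (cases "v \<in> verts F") auto
    qed
    show "(\<lambda>k. \<lambda>v\<in>verts F. f (k v)) ` homs F F \<subseteq> {h \<in> homs F T. h ` verts F = W}"
    proof clarify
      fix k assume k: "k \<in> homs F F"
      have "(\<lambda>v\<in>verts F. f (k v)) ` verts F = f ` (k ` verts F)" by auto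
      also have "\<dots> = W" using f(1) by (simp add: homs_self_image[OF k] bij_betw_def)
      finally have im: "(\<lambda>v\<in>verts F. f (k v)) ` verts F = W" .
      have "(\<lambda>v\<in>verts F. f (k v)) \<in> homs F T"
        unfolding homs_def
      proof (intro CollectI conjI allI impI)
        show "(\<lambda>v\<in>verts F. f (k v)) \<in> verts F \<rightarrow>\<^sub>E verts T"
          using homsD(2)[OF k] fv sub by auto
        fix u v assume uv: "(u, v) \<in> arcs F"
        then have "(f (k u), f (k v)) \<in> arcs T"
          using homsD[OF k] arcs_vertsD[OF uv] f(2) by blast
        then show "((\<lambda>v\<in>verts F. f (k v)) u, (\<lambda>v\<in>verts F. f (k v)) v) \<in> arcs T"
          using arcs_vertsD[OF uv] by simp
      qed
      then show "(\<lambda>v\<in>verts F. f (k v)) \<in> homs F T \<and> (\<lambda>v\<in>verts F. f (k v)) ` verts F = W"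
        using im by blast
    qed
    show "(\<lambda>h. \<lambda>v\<in>verts F. g (h v)) ` {h \<in> homs F T. h ` verts F = W} \<subseteq> homs F F"
    proof clarify
      fix h assume h: "h \<in> homs F T" "W = h ` verts F"
      show "(\<lambda>v\<in>verts F. g (h v)) \<in> homs F F"
        unfolding homs_def
      proof (intro CollectI conjI allI impI)
        show "(\<lambda>v\<in>verts F. g (h v)) \<in> verts F \<rightarrow>\<^sub>E verts F"
          using gv(1) h(2) by auto
        fix u v assume uv: "(u, v) \<in> arcs F"
        then have "h u \<in> W" "h v \<in> W" using arcs_vertsD[OF uv] h(2) by auto
        then have "(g (h u), g (h v)) \<in> arcs F"
          using homsD(1)[OF h(1) uv] f(2)[of "g (h u)" "g (h v)"] gv by metis
        then show "((\<lambda>v\<in>verts F. g (h v)) u, (\<lambda>v\<in>verts F. g (h v)) v) \<in> arcs F"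
          using arcs_vertsD[OF uv] by simp
      qed
    qed
  qed
  then show ?thesis by (rule bij_betw_same_card[symmetric])
qed

lemma card_homs:
  "card (homs F T) = card (homs F F) * card (copies T (class_of F) (verts T))"
proof -
  have "card (homs F T) = card (\<Union>W\<in>copies T (class_of F) (verts T). {h \<in> homs F T. h ` verts F = W})"
    by (rule arg_cong[of _ _ card]) (use homs_image_copies in blast)
  also have "\<dots> = (\<Sum>W\<in>copies T (class_of F) (verts T). card {h \<in> homs F T. h ` verts F = W})"
    by (intro card_UN_disjoint) (auto simp: finite_copies)
  also have "\<dots> = card (homs F F) * card (copies T (class_of F) (verts T))"
    by (simp add: card_homs_image)
  finally show ?thesis .
qed

lemma card_homs_self_pos: "0 < card (homs F F)"
proof -
  have "(\<lambda>v\<in>verts F. v) \<in> homs F F" by (auto simp: homs_def dest: arcs_vertsD)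
  then show ?thesis using card_gt_0_iff finite_homs by blast
qed

text \<open>Normalised by the number of all maps, not of the injective ones: only then does
  splitting \<open>T\<close> along a cyclic partition give an exact polynomial in the relative part
  sizes.\<close>

definition hom_density :: "tournament \<Rightarrow> tournament \<Rightarrow> real" where
  "hom_density F T = real (card (homs F T)) / real (tsize T) ^ tsize F"

text \<open>Asymptotically the ratio of \<open>hom_density F\<close> to the induced density of \<open>F\<close>.\<close>

definition aut_ratio :: "tournament \<Rightarrow> real" where
  "aut_ratio F = real (card (homs F F)) / fact (tsize F)"

lemma aut_ratio_pos: "0 < aut_ratio F"
  using card_homs_self_pos[of F] by (simp add: aut_ratio_def)

lemma card_homs_le: "card (homs F T) \<le> tsize T ^ tsize F"
proof -
  have "card (homs F T) \<le> card (verts F \<rightarrow>\<^sub>E verts T)"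
    by (rule card_mono) (auto simp: homs_def intro: finite_PiE)
  also have "\<dots> = tsize T ^ tsize F" by (simp add: card_PiE tsize_def)
  finally show ?thesis .
qed

text \<open>Survives division by zero: if the number of maps is 0, so is the number of
  homomorphisms. The splitting identities rely on this for empty parts.\<close>

lemma hom_density_eq: "real (card (homs F T)) = hom_density F T * real (tsize T) ^ tsize F"
  using card_homs_le[of F T] by (cases "real (tsize T) ^ tsize F = 0") (auto simp: hom_density_def power_0_left simp del: card_0_eq split: if_splits)

lemma hom_density_nonneg: "0 \<le> hom_density F T"
  by (simp add: hom_density_def)

lemma hom_density_le_1: "hom_density F T \<le> 1"
proof (cases "real (tsize T) ^ tsize F = 0")
  case False
  then have pos: "0 < real (tsize T) ^ tsize F" by (metis of_nat_0_le_iff zero_le_power less_eq_real_def)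
  have "real (card (homs F T)) \<le> real (tsize T) ^ tsize F"
    using card_homs_le[of F T] by (metis of_nat_le_iff of_nat_power)
  then show ?thesis using pos by (simp add: hom_density_def)
qed (simp add: hom_density_def del: power_eq_0_iff)

lemma tdensity_card_copies:
  "tdensity (class_of F) (class_of T) =
     real (card (copies T (class_of F) (verts T))) / real (tsize T choose tsize F)"
  using tdensity_avg[of "verts T" T "class_of F"] by (simp add: avg_def tsize_def)

text \<open>The last factor is a falling factorial over a power and tends to 1, so the two kinds of
  density converge together. For \<open>F\<close> larger than \<open>T\<close> both sides
  vanish.\<close>

lemma hom_density_tdensity:
  "hom_density F T = aut_ratio F * tdensity (class_of F) (class_of T) *
     (fact (tsize F) * real (tsize T choose tsize F) / real (tsize T) ^ tsize F)"
proof (cases "tsize F \<le> tsize T")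
  case True
  then have "real (tsize T choose tsize F) \<noteq> 0" by simp
  then show ?thesis
    unfolding hom_density_def tdensity_card_copies aut_ratio_def card_homs[of F T] by simp
next
  case False
  have "copies T (class_of F) (verts T) = {}"
  proof (rule equals0I)
    fix W assume W: "W \<in> copies T (class_of F) (verts T)"
    then have "card W \<le> tsize T" by (auto simp: copies_def tsize_def intro: card_mono)
    then show False using card_copies[OF subset_refl W] False by simp
  qed
  then show ?thesis using False unfolding hom_density_def card_homs[of F T] by (simp add: binomial_eq_0)
qed

lemma falling_ratio_tendsto:
  assumes "filterlim s at_top sequentially"
  shows "(\<lambda>n. fact m * real (s n choose m) / real (s n) ^ m) \<longlonglongrightarrow> 1"
proof -
  have "(\<lambda>k. fact m * real (k choose m) / real k ^ m) \<longlonglongrightarrow> 1"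
  proof (induction m)
    case 0 then show ?case by simp
  next
    case (Suc m)
    \<comment> \<open>Passing from \<open>m\<close> to \<open>m + 1\<close> multiplies the falling
      factorial by \<open>k - m\<close> and the power by \<open>k\<close>.\<close>
    have eq: "fact (Suc m) * real (k choose Suc m) / real k ^ Suc m =
        (fact m * real (k choose m) / real k ^ m) * (1 - real m / real k)" if "k \<ge> max m 1" for k
    proof -
      have "real (Suc m * (k choose Suc m)) = real ((k - m) * (k choose m))"
        using binomial_absorb_comp[of k m] binomial_absorption[of m k] by metis
      then have "real (Suc m) * real (k choose Suc m) = (real k - real m) * real (k choose m)"
        using that by (simp only: of_nat_mult) (simp add: of_nat_diff)
      moreover have "fact (Suc m) * real (k choose Suc m) = fact m * (real (Suc m) * real (k choose Suc m))"
        by simp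
      ultimately have "fact (Suc m) * real (k choose Suc m) =
          fact m * ((real k - real m) * real (k choose m))" by simp
      moreover have "1 - real m / real k = (real k - real m) / real k"
        using that by (simp add: diff_divide_distrib)
      ultimately show ?thesis by (simp add: mult_ac del: fact_Suc of_nat_diff)
    qed
    have "(\<lambda>k. 1 - real m / real k) \<longlonglongrightarrow> 1 - 0"
      by (intro tendsto_diff tendsto_const lim_const_over_n)
    then have "(\<lambda>k. (fact m * real (k choose m) / real k ^ m) * (1 - real m / real k)) \<longlonglongrightarrow> 1 * (1 - 0)"
      using Suc by (rule tendsto_mult[rotated])
    then have "(\<lambda>k. fact (Suc m) * real (k choose Suc m) / real k ^ Suc m) \<longlonglongrightarrow> 1 * (1 - 0)"
      by (rule Lim_transform_eventually, intro eventually_sequentiallyI[of "max m 1"]) (rule eq[symmetric])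
    then show ?case by simp
  qed
  from filterlim_compose[OF this assms] show ?thesis by (simp add: o_def)
qed

lemma tdensity_tendsto_imp_hom_density:
  assumes "filterlim (\<lambda>n. tsize (Ts n)) at_top sequentially"
    and "(\<lambda>n. tdensity (class_of F) (class_of (Ts n))) \<longlonglongrightarrow> L"
  shows "(\<lambda>n. hom_density F (Ts n)) \<longlonglongrightarrow> aut_ratio F * L"
proof -
  have "(\<lambda>n. hom_density F (Ts n)) \<longlonglongrightarrow> aut_ratio F * L * 1"
    unfolding hom_density_tdensity
    by (intro tendsto_mult tendsto_const assms falling_ratio_tendsto)
  then show ?thesis by (simp only: mult_1_right)
qed

lemma hom_density_tendsto_imp_tdensity:
  assumes "filterlim (\<lambda>n. tsize (Ts n)) at_top sequentially"
    and "(\<lambda>n. hom_density F (Ts n)) \<longlonglongrightarrow> L"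
  shows "(\<lambda>n. tdensity (class_of F) (class_of (Ts n))) \<longlonglongrightarrow> L / aut_ratio F"
proof -
  let ?r = "\<lambda>n. fact (tsize F) * real (tsize (Ts n) choose tsize F) / real (tsize (Ts n)) ^ tsize F"
  have r: "?r \<longlonglongrightarrow> 1" by (rule falling_ratio_tendsto[OF assms(1)])
  have "(\<lambda>n. hom_density F (Ts n) / (aut_ratio F * ?r n)) \<longlonglongrightarrow> L / (aut_ratio F * 1)"
    using aut_ratio_pos[of F] by (intro tendsto_divide tendsto_mult assms r tendsto_const) auto
  moreover have "\<forall>\<^sub>F n in sequentially. ?r n > 0" using r by (rule order_tendstoD) simp
  then have "\<forall>\<^sub>F n in sequentially. hom_density F (Ts n) / (aut_ratio F * ?r n) =
      tdensity (class_of F) (class_of (Ts n))"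
  proof (rule eventually_mono)
    fix n assume "0 < ?r n"
    moreover have "a * p * r / (a * r) = p" if "0 < a" "0 < r" for a p r :: real
      using that by simp
    ultimately show "hom_density F (Ts n) / (aut_ratio F * ?r n) =
        tdensity (class_of F) (class_of (Ts n))"
      unfolding hom_density_tdensity using aut_ratio_pos by blast
  qed
  ultimately have "(\<lambda>n. tdensity (class_of F) (class_of (Ts n))) \<longlonglongrightarrow> L / (aut_ratio F * 1)"
    by (rule Lim_transform_eventually)
  then show ?thesis by (simp only: mult_1_right)
qed

section \<open>A rotation-invariant polynomial inequality\<close>

text \<open>First-order Taylor expansion of the product at the point with all factors 1/3, with a
  quadratic remainder; \<open>3 * (1/3) ^ card S\<close> is the partial derivative
  \<open>(1/3) ^ (card S - 1)\<close>.\<close>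

lemma prod_perturb_third:
  fixes u :: "'a \<Rightarrow> real"
  assumes "finite S" "0 \<le> U" "\<And>v. v \<in> S \<Longrightarrow> \<bar>u v\<bar> \<le> U" "\<And>v. v \<in> S \<Longrightarrow> \<bar>1/3 + u v\<bar> \<le> 1"
  shows "\<bar>(\<Prod>v\<in>S. 1/3 + u v) - (1/3) ^ card S - 3 * (1/3) ^ card S * (\<Sum>v\<in>S. u v)\<bar>
      \<le> 3 * (real (card S))\<^sup>2 * U\<^sup>2"
  using assms
proof (induction S rule: finite_induct)
  case (insert x S)
  define p where "p = (1/3 :: real) ^ card S"
  define s where "s = (\<Sum>v\<in>S. u v)"
  define P where "P = (\<Prod>v\<in>S. 1/3 + u v)"
  define k where "k = real (card S)"
  have IH: "\<bar>P - p - 3 * p * s\<bar> \<le> 3 * k\<^sup>2 * U\<^sup>2" using insert by (simp add: P_def p_def s_def k_def)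
  have s: "\<bar>s\<bar> \<le> k * U"
    using sum_norm_bound[of S u U] insert by (simp add: s_def k_def)
  have p: "0 \<le> p" "p \<le> 1" by (auto simp: p_def power_le_one)
  have k: "0 \<le> k" by (simp add: k_def)
  have "\<bar>(P - p - 3 * p * s) * (1/3 + u x)\<bar> \<le> 3 * k\<^sup>2 * U\<^sup>2 * 1"
    unfolding abs_mult using IH insert by (intro mult_mono) auto
  moreover have "\<bar>3 * p * s * u x\<bar> \<le> 3 * 1 * (k * U) * U"
    unfolding abs_mult using s p insert k by (intro mult_mono) auto
  moreover have "P * (1/3 + u x) - p / 3 - p * (s + u x) = (P - p - 3 * p * s) * (1/3 + u x) + 3 * p * s * u x"
    by (simp add: field_simps)
  ultimately have "\<bar>P * (1/3 + u x) - p / 3 - p * (s + u x)\<bar> \<le> 3 * k\<^sup>2 * U\<^sup>2 + 3 * k * U\<^sup>2"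
    by (simp add: power2_eq_square)
  also have "\<dots> \<le> 3 * (1 + k)\<^sup>2 * U\<^sup>2"
  proof -
    have "3 * (1 + k)\<^sup>2 * U\<^sup>2 - (3 * k\<^sup>2 * U\<^sup>2 + 3 * k * U\<^sup>2) = 3 * (1 + k) * U\<^sup>2"
      by (simp add: power2_eq_square algebra_simps)
    also have "\<dots> \<ge> 0" using k by simp
    finally show ?thesis by simp
  qed
  finally show ?case
    using insert.hyps by (simp add: P_def p_def s_def k_def mult.commute algebra_simps)
qed simp

text \<open>The generator of the cyclic group that permutes the three parts, acting on
  colourings.\<close>

definition rot :: "nat set \<Rightarrow> (nat \<Rightarrow> nat) \<Rightarrow> nat \<Rightarrow> nat" where
  "rot V g = (\<lambda>v\<in>V. (g v + 1) mod 3)"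

lemma lessThan_3_cases: "i \<in> {..<3::nat} \<Longrightarrow> i = 0 \<or> i = 1 \<or> i = 2"
  by auto

lemma rot_PiE: "g \<in> V \<rightarrow>\<^sub>E {..<3} \<Longrightarrow> rot V g \<in> V \<rightarrow>\<^sub>E {..<3}"
  by (auto simp: rot_def)

lemma rot_rot_rot:
  assumes g: "g \<in> V \<rightarrow>\<^sub>E {..<3}" shows "rot V (rot V (rot V g)) = g"
proof
  fix v
  show "rot V (rot V (rot V g)) v = g v"
  proof (cases "v \<in> V")
    case True
    with g have "g v = 0 \<or> g v = 1 \<or> g v = 2" using lessThan_3_cases PiE_mem by metis
    then show ?thesis using True by (elim disjE) (simp_all add: rot_def)
  next
    case False then show ?thesis using g by (simp add: rot_def PiE_def extensional_def)
  qed
qed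

lemma bij_rot: "bij_betw (rot V) (V \<rightarrow>\<^sub>E {..<3}) (V \<rightarrow>\<^sub>E {..<3})"
  by (rule bij_betw_byWitness[where f' = "\<lambda>g. rot V (rot V g)"])
     (auto simp: rot_rot_rot intro!: rot_PiE)

text \<open>Let \<open>e2\<close> and \<open>e3\<close> be the elementary symmetric functions of
  \<open>a\<close>, \<open>b\<close>, \<open>c\<close>. From \<open>3 * e3 \<le> e2\<^sup>2\<close>
  one gets \<open>e2 * (1 - 3 * e2) \<le> e2 - 9 * e3\<close>. The factor \<open>e2\<close> is small
  near the vertices of the simplex; by the second part \<open>1 - 3 * e2\<close> is proportional to
  the squared distance from its centre.\<close>

lemma sum_le_third_pairs:
  fixes a b c :: real
  assumes "0 \<le> a" "0 \<le> b" "0 \<le> c" "a + b + c = 1"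
  shows "(a * b + b * c + c * a) * (1 - 3 * (a * b + b * c + c * a)) \<le> a * b + b * c + c * a - 9 * (a * b * c)"
    "(a - 1/3)\<^sup>2 + (b - 1/3)\<^sup>2 + (c - 1/3)\<^sup>2 = (2/3) * (1 - 3 * (a * b + b * c + c * a))"
proof -
  have c: "c = 1 - a - b" using assms by simp
  have "3 * (a * b * c) \<le> (a * b + b * c + c * a)\<^sup>2"
  proof -
    have "(a * b + b * c + c * a)\<^sup>2 - 3 * (a * b * c) * (a + b + c) =
      ((a * b - b * c)\<^sup>2 + (b * c - c * a)\<^sup>2 + (c * a - a * b)\<^sup>2) / 2"
      by (simp add: power2_eq_square algebra_simps)
    also have "\<dots> \<ge> 0" by simp
    finally show ?thesis using assms(4) by simp
  qed
  then show "(a * b + b * c + c * a) * (1 - 3 * (a * b + b * c + c * a)) \<le> a * b + b * c + c * a - 9 * (a * b * c)"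
    by (simp add: power2_eq_square algebra_simps)
  show "(a - 1/3)\<^sup>2 + (b - 1/3)\<^sup>2 + (c - 1/3)\<^sup>2 = (2/3) * (1 - 3 * (a * b + b * c + c * a))"
    unfolding c by (simp add: power2_eq_square field_simps)
qed

text \<open>At \<open>(1/3, 1/3, 1/3)\<close> the rotation invariance of \<open>d\<close> kills the first-order term, and near the
  vertices of the simplex every monomial is at most \<open>x\<^sub>0 x\<^sub>1 + x\<^sub>1 x\<^sub>2 + x\<^sub>2 x\<^sub>0\<close>.\<close>

lemma rotation_invariant_polynomial_bound:
  fixes d :: "(nat \<Rightarrow> nat) \<Rightarrow> real"
  assumes V: "finite V"
    and rot: "\<And>g. g \<in> V \<rightarrow>\<^sub>E {..<3} \<Longrightarrow> d (rot V g) = d g"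
    and const: "\<And>g. g \<in> V \<rightarrow>\<^sub>E {..<3} \<Longrightarrow> \<forall>u\<in>V. \<forall>v\<in>V. g u = g v \<Longrightarrow> d g = 0"
    and sum0: "(\<Sum>g\<in>V \<rightarrow>\<^sub>E {..<3}. d g) = 0"
    and d1: "\<And>g. \<bar>d g\<bar> \<le> 1"
  shows "\<exists>K\<ge>0. \<forall>x :: nat \<Rightarrow> real. (\<forall>i<3. 0 \<le> x i) \<and> x 0 + x 1 + x 2 = 1 \<longrightarrow>
    \<bar>\<Sum>g\<in>V \<rightarrow>\<^sub>E {..<3}. d g * (\<Prod>v\<in>V. x (g v))\<bar> \<le>
      K * (x 0 * x 1 + x 1 * x 2 + x 2 * x 0 - 9 * (x 0 * x 1 * x 2))"
proof -
  let ?G = "V \<rightarrow>\<^sub>E {..<3::nat}"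
  have fin: "finite ?G" using V by (intro finite_PiE) auto
  define N where "N = real (card ?G)"
  define K2 where "K2 = N * (3 * (real (card V))\<^sup>2)"
  define K where "K = 4 * K2 + 2 * N"
  have K2: "0 \<le> K2" and N: "0 \<le> N" by (auto simp: K2_def N_def)
  show ?thesis
  proof (intro exI[of _ K] conjI allI impI)
    show "0 \<le> K" using K2 N by (simp add: K_def)
    fix x :: "nat \<Rightarrow> real" assume "(\<forall>i<3. 0 \<le> x i) \<and> x 0 + x 1 + x 2 = 1"
    then have x: "0 \<le> x 0" "0 \<le> x 1" "0 \<le> x 2" "x 0 + x 1 + x 2 = 1" by auto
    define e2 where "e2 = x 0 * x 1 + x 1 * x 2 + x 2 * x 0"
    have e2: "0 \<le> e2" using x by (simp add: e2_def)
    define p where "p = (\<Sum>g\<in>?G. d g * (\<Prod>v\<in>V. x (g v)))"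
    have "x 0 \<le> 1" "x 1 \<le> 1" "x 2 \<le> 1" using x by linarith+
    then have x1: "0 \<le> x i \<and> x i \<le> 1" if "i \<in> {..<3}" for i
      using lessThan_3_cases[OF that] x(1-3) by (elim disjE) simp_all
    \<comment> \<open>A non-constant colouring contributes a monomial with two different variables;
      the remaining factors are at most 1.\<close>
    have near_vertex: "\<bar>p\<bar> \<le> N * e2"
    proof -
      have "\<bar>d g * (\<Prod>v\<in>V. x (g v))\<bar> \<le> e2" if g: "g \<in> ?G" for g
      proof (cases "\<forall>u\<in>V. \<forall>v\<in>V. g u = g v")
        case True
        have "d g = 0" by (rule const[OF g True])
        then show ?thesis using e2 by simp
      next
        case False
        then obtain u v where uv: "u \<in> V" "v \<in> V" "g u \<noteq> g v" by blast
        have r: "0 \<le> x (g w)" "x (g w) \<le> 1" if "w \<in> V" for w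
          using x1[OF PiE_mem[OF g that]] by simp_all
        have "(\<Prod>w\<in>V. x (g w)) = x (g u) * (x (g v) * (\<Prod>w\<in>V - {u} - {v}. x (g w)))"
        proof -
          have "(\<Prod>w\<in>V. x (g w)) = x (g u) * (\<Prod>w\<in>V - {u}. x (g w))"
            using V uv by (simp add: prod.remove)
          also have "(\<Prod>w\<in>V - {u}. x (g w)) = x (g v) * (\<Prod>w\<in>V - {u} - {v}. x (g w))"
            using V uv by (intro prod.remove) auto
          finally show ?thesis .
        qed
        also have "\<dots> \<le> x (g u) * (x (g v) * 1)"
          using r uv by (intro mult_left_mono prod_le_1) auto
        also have "\<dots> \<le> e2"
        proof -
          note cases = lessThan_3_cases[OF PiE_mem[OF g uv(1)]] lessThan_3_cases[OF PiE_mem[OF g uv(2)]]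
          have "0 \<le> x 0 * x 1" "0 \<le> x 1 * x 2" "0 \<le> x 2 * x 0" using x by simp_all
          then show ?thesis using cases uv(3) unfolding e2_def
            by (elim disjE) (simp_all add: mult.commute)
        qed
        finally have "(\<Prod>w\<in>V. x (g w)) \<le> e2" .
        moreover have "0 \<le> (\<Prod>w\<in>V. x (g w))" using r by (intro prod_nonneg) auto
        ultimately have "\<bar>d g\<bar> * \<bar>\<Prod>v\<in>V. x (g v)\<bar> \<le> 1 * e2"
          using d1 by (intro mult_mono) auto
        then show ?thesis by (simp add: abs_mult)
      qed
      then have "\<bar>p\<bar> \<le> (\<Sum>g\<in>?G. e2)"
        unfolding p_def by (intro order_trans[OF sum_abs] sum_mono)
      then show ?thesis by (simp add: N_def)
    qed
    define u where "u i = x i - 1/3" for i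
    define U where "U = sqrt ((u 0)\<^sup>2 + (u 1)\<^sup>2 + (u 2)\<^sup>2)"
    have U2: "U\<^sup>2 = (2/3) * (1 - 3 * e2)"
      unfolding U_def u_def e2_def using sum_le_third_pairs(2)[OF x] by (simp add: real_sqrt_pow2)
    have uU: "\<bar>u i\<bar> \<le> U" if "i \<in> {..<3}" for i
    proof -
      have "(u i)\<^sup>2 \<le> (u 0)\<^sup>2 + (u 1)\<^sup>2 + (u 2)\<^sup>2"
        using lessThan_3_cases[OF that] by (elim disjE) simp_all
      then have "sqrt ((u i)\<^sup>2) \<le> U" unfolding U_def by (rule real_sqrt_le_mono)
      then show ?thesis by simp
    qed
    have near_centre: "\<bar>p\<bar> \<le> K2 * U\<^sup>2"
    proof -
      define L where "L g = (\<Sum>v\<in>V. u (g v))" for g :: "nat \<Rightarrow> nat"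
      define q where "q = (1/3::real) ^ card V"
      have L0: "(\<Sum>g\<in>?G. d g * L g) = 0"
      proof -
        have shift: "(\<Sum>g\<in>?G. d g * f g) = (\<Sum>g\<in>?G. d g * f (rot V g))" for f
          using sum.reindex_bij_betw[OF bij_rot[of V], of "\<lambda>g. d g * f g"] rot by simp
        have "(\<Sum>g\<in>?G. d g * L g) + (\<Sum>g\<in>?G. d g * L (rot V g)) + (\<Sum>g\<in>?G. d g * L (rot V (rot V g)))
          = (\<Sum>g\<in>?G. d g * (L g + L (rot V g) + L (rot V (rot V g))))"
          by (simp add: sum.distrib algebra_simps)
        \<comment> \<open>Along an orbit of \<open>rot\<close> each vertex takes every colour once,
          and \<open>u 0 + u 1 + u 2 = 0\<close>.\<close>
        also have "\<dots> = 0"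
        proof (rule sum.neutral, rule ballI)
          fix g assume g: "g \<in> ?G"
          have "L g + L (rot V g) + L (rot V (rot V g)) =
              (\<Sum>v\<in>V. u (g v) + u (rot V g v) + u (rot V (rot V g) v))"
            unfolding L_def by (simp add: sum.distrib)
          also have "\<dots> = 0"
          proof (rule sum.neutral, rule ballI)
            fix v assume v: "v \<in> V"
            note lessThan_3_cases[OF PiE_mem[OF g v]]
            then show "u (g v) + u (rot V g v) + u (rot V (rot V g) v) = 0"
              using v x(4) by (elim disjE) (simp_all add: rot_def u_def numeral_2_eq_2)
          qed
          finally show "d g * (L g + L (rot V g) + L (rot V (rot V g))) = 0" by simp
        qed
        finally show ?thesis using shift[of L] shift[of "\<lambda>g. L (rot V g)"] by simp
      qed
      have "p = (\<Sum>g\<in>?G. d g * ((\<Prod>v\<in>V. x (g v)) - q - 3 * q * L g))"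
      proof -
        have "(\<Sum>g\<in>?G. d g * ((\<Prod>v\<in>V. x (g v)) - q - 3 * q * L g)) =
           p - q * (\<Sum>g\<in>?G. d g) - 3 * q * (\<Sum>g\<in>?G. d g * L g)"
          unfolding p_def by (simp add: sum_subtractf sum.distrib sum_distrib_left algebra_simps)
        then show ?thesis using L0 sum0 by simp
      qed
      also have "\<bar>\<dots>\<bar> \<le> (\<Sum>g\<in>?G. 3 * (real (card V))\<^sup>2 * U\<^sup>2)"
      proof (rule order_trans[OF sum_abs sum_mono])
        fix g assume g: "g \<in> ?G"
        have gi: "g v \<in> {..<3}" if "v \<in> V" for v using g that by auto
        have "\<bar>(\<Prod>v\<in>V. 1/3 + u (g v)) - (1/3) ^ card V - 3 * (1/3) ^ card V * (\<Sum>v\<in>V. u (g v))\<bar>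
            \<le> 3 * (real (card V))\<^sup>2 * U\<^sup>2"
        proof (rule prod_perturb_third[OF V])
          show "0 \<le> U" by (simp add: U_def)
          show "\<bar>u (g v)\<bar> \<le> U" if "v \<in> V" for v using uU[OF gi[OF that]] .
          show "\<bar>1/3 + u (g v)\<bar> \<le> 1" if "v \<in> V" for v using x1[OF gi[OF that]] by (simp add: u_def)
        qed
        then have "\<bar>(\<Prod>v\<in>V. x (g v)) - q - 3 * q * L g\<bar> \<le> 3 * (real (card V))\<^sup>2 * U\<^sup>2"
          by (simp add: u_def q_def L_def)
        then have "\<bar>d g\<bar> * \<bar>(\<Prod>v\<in>V. x (g v)) - q - 3 * q * L g\<bar> \<le> 1 * (3 * (real (card V))\<^sup>2 * U\<^sup>2)"
          using d1 by (intro mult_mono) auto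
        then show "\<bar>d g * ((\<Prod>v\<in>V. x (g v)) - q - 3 * q * L g)\<bar> \<le> 3 * (real (card V))\<^sup>2 * U\<^sup>2"
          by (simp add: abs_mult)
      qed
      finally show ?thesis by (simp add: K2_def N_def mult_ac)
    qed
    have "0 \<le> (2/3) * (1 - 3 * e2)" using zero_le_power2[of U] unfolding U2 .
    then have e3: "3 * e2 \<le> 1" by simp
    \<comment> \<open>\<open>e2\<close> is 1/3 at the centre and 0 at the vertices; 1/6 lies
      between. Above it \<open>4 * e2\<close> is at least 2/3, below it
      \<open>2 * (1 - 3 * e2)\<close> is at least 1.\<close>
    have "\<bar>p\<bar> \<le> K * (e2 * (1 - 3 * e2))"
    proof (cases "e2 \<ge> 1/6")
      case True
      have "\<bar>p\<bar> \<le> K2 * (2/3) * (1 - 3 * e2)" using near_centre U2 by (simp add: mult_ac)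
      also have "\<dots> \<le> K2 * (4 * e2) * (1 - 3 * e2)"
        using True K2 e3 by (intro mult_right_mono mult_left_mono) auto
      also have "\<dots> = (4 * K2) * (e2 * (1 - 3 * e2))" by simp
      also have "\<dots> \<le> K * (e2 * (1 - 3 * e2))"
        using N e2 e3 by (intro mult_right_mono) (auto simp: K_def)
      finally show ?thesis .
    next
      case False
      have "N * e2 * 1 \<le> N * e2 * (2 * (1 - 3 * e2))" using False N e2 by (intro mult_left_mono) auto
      with near_vertex have "\<bar>p\<bar> \<le> 2 * N * (e2 * (1 - 3 * e2))" by (simp add: mult_ac)
      also have "\<dots> \<le> K * (e2 * (1 - 3 * e2))"
        using K2 e2 e3 by (intro mult_right_mono) (auto simp: K_def)
      finally show ?thesis .
    qed
    also have "\<dots> \<le> K * (e2 - 9 * (x 0 * x 1 * x 2))"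
      using sum_le_third_pairs(1)[OF x] K2 N by (intro mult_left_mono) (auto simp: e2_def K_def)
    finally show "\<bar>\<Sum>g\<in>V \<rightarrow>\<^sub>E {..<3}. d g * (\<Prod>v\<in>V. x (g v))\<bar> \<le>
      K * (x 0 * x 1 + x 1 * x 2 + x 2 * x 0 - 9 * (x 0 * x 1 * x 2))"
      by (simp add: p_def e2_def)
  qed
qed

section \<open>Cyclic partitions and imbalance\<close>

text \<open>Homomorphisms from \<open>F\<close> to the directed triangle with loops: the colourings
  that a homomorphism into a cyclically partitioned tournament can induce.\<close>

definition compat :: "tournament \<Rightarrow> (nat \<Rightarrow> nat) set" where
  "compat F = {g \<in> verts F \<rightarrow>\<^sub>E {..<3}. \<forall>(u, v) \<in> arcs F. g v = g u \<or> g v = (g u + 1) mod 3}"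

definition fibre :: "tournament \<Rightarrow> (nat \<Rightarrow> nat) \<Rightarrow> nat \<Rightarrow> tournament" where
  "fibre F g i = induced F {v. g v = i}"

lemma verts_fibre [simp]: "verts (fibre F g i) = {v \<in> verts F. g v = i}"
  by (auto simp: fibre_def)

lemma arcs_fibre [simp]: "(u, v) \<in> arcs (fibre F g i) \<longleftrightarrow> (u, v) \<in> arcs F \<and> g u = i \<and> g v = i"
  by (auto simp: fibre_def)

text \<open>Unlike in \<open>cyclic_triple\<close>, a part may be all of \<open>verts T\<close>, and
  the parts are indexed so that colours can address them.\<close>

definition cyclic_partition :: "tournament \<Rightarrow> (nat \<Rightarrow> nat set) \<Rightarrow> bool" where
  "cyclic_partition T P \<longleftrightarrow> verts T = P 0 \<union> P 1 \<union> P 2 \<and>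
     P 0 \<inter> P 1 = {} \<and> P 1 \<inter> P 2 = {} \<and> P 2 \<inter> P 0 = {} \<and>
     P 0 \<times> P 1 \<subseteq> arcs T \<and> P 1 \<times> P 2 \<subseteq> arcs T \<and> P 2 \<times> P 0 \<subseteq> arcs T"

lemma cyclic_partitionD:
  assumes "cyclic_partition T P"
  shows "i \<in> {..<3} \<Longrightarrow> P i \<subseteq> verts T"
    "i \<in> {..<3} \<Longrightarrow> j \<in> {..<3} \<Longrightarrow> v \<in> P i \<Longrightarrow> v \<in> P j \<Longrightarrow> i = j"
    "v \<in> verts T \<Longrightarrow> \<exists>i\<in>{..<3}. v \<in> P i"
    "i \<in> {..<3} \<Longrightarrow> u \<in> P i \<Longrightarrow> v \<in> P ((i + 1) mod 3) \<Longrightarrow> (u, v) \<in> arcs T"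
proof -
  note defs = assms[unfolded cyclic_partition_def]
  show "P i \<subseteq> verts T" if i: "i \<in> {..<3}"
    using lessThan_3_cases[OF i] defs by (elim disjE) auto
  show "i = j" if i: "i \<in> {..<3}" "j \<in> {..<3}" "v \<in> P i" "v \<in> P j"
    using lessThan_3_cases[OF i(1)] lessThan_3_cases[OF i(2)] i(3,4) defs
    by (elim disjE) (blast | simp)+
  show "\<exists>i\<in>{..<3}. v \<in> P i" if "v \<in> verts T"
  proof -
    from that defs have "v \<in> P 0 \<or> v \<in> P 1 \<or> v \<in> P 2" by blast
    then show ?thesis by (elim disjE) (rule bexI, assumption, simp)+
  qed
  show "(u, v) \<in> arcs T" if i: "i \<in> {..<3}" "u \<in> P i" "v \<in> P ((i + 1) mod 3)"
    using lessThan_3_cases[OF i(1)] i(2,3) defs by (elim disjE) (auto simp: numeral_2_eq_2)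
qed

lemma cyclic_partition_fracs:
  assumes "cyclic_partition T P" "tsize T > 0"
  shows "real (card (P 0)) / tsize T + real (card (P 1)) / tsize T + real (card (P 2)) / tsize T = 1"
proof -
  have "finite (P i)" if "i \<in> {..<3}" for i
    using cyclic_partitionD(1)[OF assms(1) that] by (rule finite_sub)
  then have "finite (P 0)" "finite (P 1)" "finite (P 2)" by simp_all
  then have "tsize T = card (P 0) + card (P 1) + card (P 2)"
  proof -
    have "(P 0 \<union> P 1) \<inter> P 2 = {}" "P 0 \<inter> P 1 = {}" "verts T = P 0 \<union> P 1 \<union> P 2"
      using assms(1) unfolding cyclic_partition_def by blast+
    then show ?thesis using \<open>finite (P 0)\<close> \<open>finite (P 1)\<close> \<open>finite (P 2)\<close>
      unfolding tsize_def by (simp only: card_Un_disjoint finite_UnI)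
  qed
  then have "real (tsize T) = real (card (P 0)) + real (card (P 1)) + real (card (P 2))" by simp
  then show ?thesis using assms(2) by (simp add: add_divide_distrib[symmetric])
qed

text \<open>A homomorphism is the same as a compatible colouring of \<open>F\<close> together with a
  homomorphism of each colour class into its part: arcs between different classes are preserved
  automatically, because consecutive parts are completely joined.\<close>

lemma card_homs_split:
  assumes P: "cyclic_partition T P"
  shows "card (homs F T) =
    (\<Sum>g\<in>compat F. \<Prod>i<3. card (homs (fibre F g i) (induced T (P i))))"
proof -
  note PD = cyclic_partitionD[OF P]
  define col where "col x = (THE i. i \<in> {..<3::nat} \<and> x \<in> P i)" for x
  have colI: "col x = i" if "i \<in> {..<3}" "x \<in> P i" for x i
    unfolding col_def using that PD(2) by (intro the_equality) auto
  have col: "col x \<in> {..<3}" "x \<in> P (col x)" if "x \<in> verts T" for x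
    using PD(3)[OF that] colI by auto
  have col_arc: "col y = col x \<or> col y = (col x + 1) mod 3" if "(x, y) \<in> arcs T" for x y
  proof (rule ccontr)
    assume neg: "\<not> ?thesis"
    have xy: "x \<in> verts T" "y \<in> verts T" using arcs_vertsD[OF that] .
    then have "col x = (col y + 1) mod 3"
      using neg lessThan_3_cases[OF col(1)[OF xy(1)]] lessThan_3_cases[OF col(1)[OF xy(2)]]
      by (elim disjE) (simp_all add: numeral_2_eq_2)
    then have "(y, x) \<in> arcs T" using PD(4)[OF col(1)[OF xy(2)] col(2)[OF xy(2)]] col(2)[OF xy(1)] by simp
    then show False using that arcs_asym by blast
  qed
  let ?H = "\<lambda>g. \<Pi>\<^sub>E i\<in>{..<3}. homs (fibre F g i) (induced T (P i))"
  have "bij_betw (\<lambda>h. (\<lambda>v\<in>verts F. col (h v),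
        \<lambda>i\<in>{..<3}. \<lambda>v\<in>{v \<in> verts F. col (h v) = i}. h v)) (homs F T) (Sigma (compat F) ?H)"
  proof (rule bij_betw_byWitness[where f' = "\<lambda>(g, k). \<lambda>v\<in>verts F. k (g v) v"])
    show "\<forall>h\<in>homs F T. (\<lambda>(g, k). \<lambda>v\<in>verts F. k (g v) v) (\<lambda>v\<in>verts F. col (h v),
        \<lambda>i\<in>{..<3}. \<lambda>v\<in>{v \<in> verts F. col (h v) = i}. h v) = h"
    proof (intro ballI ext)
      fix h v assume h: "h \<in> homs F T"
      show "(\<lambda>(g, k). \<lambda>v\<in>verts F. k (g v) v) (\<lambda>v\<in>verts F. col (h v),
        \<lambda>i\<in>{..<3}. \<lambda>v\<in>{v \<in> verts F. col (h v) = i}. h v) v = h v"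
        using homsD(2,3)[OF h, of v] col(1)[of "h v"] by (cases "v \<in> verts F") auto
    qed
    show "\<forall>p\<in>Sigma (compat F) ?H. (\<lambda>h. (\<lambda>v\<in>verts F. col (h v),
        \<lambda>i\<in>{..<3}. \<lambda>v\<in>{v \<in> verts F. col (h v) = i}. h v)) ((\<lambda>(g, k). \<lambda>v\<in>verts F. k (g v) v) p) = p"
    proof (intro ballI)
      fix p assume "p \<in> Sigma (compat F) ?H"
      then obtain g k where p: "p = (g, k)" and g: "g \<in> compat F" and k: "k \<in> ?H g" by (elim SigmaE)
      have g3: "g v \<in> {..<3}" if "v \<in> verts F" for v using g that by (auto simp: compat_def)
      have kP: "k (g v) v \<in> P (g v)" if "v \<in> verts F" for v
        using homsD(2)[OF PiE_mem[OF k g3[OF that]]] that by auto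
      have c: "col (k (g v) v) = g v" if "v \<in> verts F" for v
        using colI[OF g3[OF that] kP[OF that]] .
      have "(\<lambda>v\<in>verts F. col ((\<lambda>v\<in>verts F. k (g v) v) v)) = g"
        using c g by (intro ext) (auto simp: compat_def PiE_def extensional_def)
      moreover have "(\<lambda>i\<in>{..<3}. \<lambda>v\<in>{v \<in> verts F. col ((\<lambda>v\<in>verts F. k (g v) v) v) = i}.
          (\<lambda>v\<in>verts F. k (g v) v) v) = k"
      proof (rule ext)
        fix i
        show "(\<lambda>i\<in>{..<3}. \<lambda>v\<in>{v \<in> verts F. col ((\<lambda>v\<in>verts F. k (g v) v) v) = i}.
          (\<lambda>v\<in>verts F. k (g v) v) v) i = k i"
        proof (cases "i \<in> {..<3}")
          case True
          have "(\<lambda>v\<in>{v \<in> verts F. col ((\<lambda>v\<in>verts F. k (g v) v) v) = i}. (\<lambda>v\<in>verts F. k (g v) v) v) v = k i v" for v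
            using homsD(3)[OF PiE_mem[OF k True], of v] c by auto
          then show ?thesis using True by (simp only: restrict_apply' ext)
        next
          case False
          then show ?thesis using k by (simp add: PiE_def extensional_def)
        qed
      qed
      ultimately show "(\<lambda>h. (\<lambda>v\<in>verts F. col (h v),
        \<lambda>i\<in>{..<3}. \<lambda>v\<in>{v \<in> verts F. col (h v) = i}. h v)) ((\<lambda>(g, k). \<lambda>v\<in>verts F. k (g v) v) p) = p"
        unfolding p prod.case by blast
    qed
    show "(\<lambda>h. (\<lambda>v\<in>verts F. col (h v),
        \<lambda>i\<in>{..<3}. \<lambda>v\<in>{v \<in> verts F. col (h v) = i}. h v)) ` homs F T \<subseteq> Sigma (compat F) ?H"
    proof (intro image_subsetI SigmaI PiE_I)
      fix h assume h: "h \<in> homs F T"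
      show "(\<lambda>v\<in>verts F. col (h v)) \<in> compat F"
        unfolding compat_def
      proof (intro CollectI conjI ballI)
        show "(\<lambda>v\<in>verts F. col (h v)) \<in> verts F \<rightarrow>\<^sub>E {..<3}" using col(1) homsD(2)[OF h] by auto
        fix e assume "e \<in> arcs F"
        then obtain u v where e: "e = (u, v)" "(u, v) \<in> arcs F" by (cases e) auto
        then show "case e of (u, v) \<Rightarrow> (\<lambda>v\<in>verts F. col (h v)) v = (\<lambda>v\<in>verts F. col (h v)) u \<or>
          (\<lambda>v\<in>verts F. col (h v)) v = ((\<lambda>v\<in>verts F. col (h v)) u + 1) mod 3"
          using col_arc[OF homsD(1)[OF h e(2)]] arcs_vertsD[OF e(2)] by simp
      qed
      fix i :: nat
      show "(\<lambda>i\<in>{..<3}. \<lambda>v\<in>{v \<in> verts F. col (h v) = i}. h v) i = undefined" if "i \<notin> {..<3}"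
        using that by simp
      assume i: "i \<in> {..<3}"
      have "(\<lambda>v\<in>{v \<in> verts F. col (h v) = i}. h v) \<in>
          homs (fibre F (\<lambda>v\<in>verts F. col (h v)) i) (induced T (P i))"
        unfolding homs_def
      proof (intro CollectI conjI allI impI)
        show "(\<lambda>v\<in>{v \<in> verts F. col (h v) = i}. h v) \<in>
            verts (fibre F (\<lambda>v\<in>verts F. col (h v)) i) \<rightarrow>\<^sub>E verts (induced T (P i))"
          using homsD(2)[OF h] col(2) by (auto cong: conj_cong)
        fix u v assume "(u, v) \<in> arcs (fibre F (\<lambda>v\<in>verts F. col (h v)) i)"
        then have uv: "(u, v) \<in> arcs F" "u \<in> verts F" "v \<in> verts F" "col (h u) = i" "col (h v) = i"
          using arcs_vertsD[of u v F] by auto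
        then have "h u \<in> P i" "h v \<in> P i" using col(2) homsD(2)[OF h] by metis+
        then show "((\<lambda>v\<in>{v \<in> verts F. col (h v) = i}. h v) u,
            (\<lambda>v\<in>{v \<in> verts F. col (h v) = i}. h v) v) \<in> arcs (induced T (P i))"
          using uv homsD(1)[OF h uv(1)] by simp
      qed
      then show "(\<lambda>i\<in>{..<3}. \<lambda>v\<in>{v \<in> verts F. col (h v) = i}. h v) i \<in>
          homs (fibre F (\<lambda>v\<in>verts F. col (h v)) i) (induced T (P i))" using i by simp
    qed
    show "(\<lambda>(g, k). \<lambda>v\<in>verts F. k (g v) v) ` Sigma (compat F) ?H \<subseteq> homs F T"
    proof (intro image_subsetI, clarify)
      fix g k assume g: "g \<in> compat F" and k: "k \<in> ?H g"
      have g3: "g v \<in> {..<3}" if "v \<in> verts F" for v using g that by (auto simp: compat_def)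
      have kP: "k (g v) v \<in> P (g v)" "k (g v) v \<in> verts T" if "v \<in> verts F" for v
        using homsD(2)[OF PiE_mem[OF k g3[OF that]]] that by auto
      show "(\<lambda>v\<in>verts F. k (g v) v) \<in> homs F T"
        unfolding homs_def
      proof (intro CollectI conjI allI impI)
        show "(\<lambda>v\<in>verts F. k (g v) v) \<in> verts F \<rightarrow>\<^sub>E verts T" using kP by auto
        fix u v assume uv: "(u, v) \<in> arcs F"
        note V = arcs_vertsD[OF uv]
        have "(k (g u) u, k (g v) v) \<in> arcs T"
        proof (cases "g v = g u")
          case True
          then have "(k (g u) u, k (g u) v) \<in> arcs (induced T (P (g u)))"
            using homsD(1)[OF PiE_mem[OF k g3[OF V(1)]], of u v] uv by simp
          then show ?thesis using True by simp
        next
          case False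
          then have "g v = (g u + 1) mod 3" using g uv by (auto simp: compat_def)
          then show ?thesis using PD(4)[OF g3[OF V(1)] kP(1)[OF V(1)]] kP(1)[OF V(2)] by simp
        qed
        then show "((\<lambda>v\<in>verts F. k (g v) v) u, (\<lambda>v\<in>verts F. k (g v) v) v) \<in> arcs T"
          using V by simp
      qed
    qed
  qed
  then have "card (homs F T) = card (Sigma (compat F) ?H)" by (rule bij_betw_same_card)
  also have "\<dots> = (\<Sum>g\<in>compat F. card (?H g))"
  proof (rule card_SigmaI)
    show "finite (compat F)"
      by (rule finite_subset[of _ "verts F \<rightarrow>\<^sub>E {..<3}"]) (auto simp: compat_def intro: finite_PiE)
    show "\<forall>g\<in>compat F. finite (?H g)" by (auto intro!: finite_PiE)
  qed
  also have "\<dots> = (\<Sum>g\<in>compat F. \<Prod>i<3. card (homs (fibre F g i) (induced T (P i))))"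
    by (simp add: card_PiE)
  finally show ?thesis .
qed

section \<open>Directed triangles and Goodman's identity\<close>

lift_definition cyc3 :: tournament is "({0, 1, 2}, {(0, 1), (1, 2), (2, 0)})"
  by (auto simp: is_tournament_def)

lemma verts_cyc3 [simp]: "verts cyc3 = {0, 1, 2}" by transfer simp
lemma arcs_cyc3 [simp]: "arcs cyc3 = {(0, 1), (1, 2), (2, 0)}" by transfer simp
lemma tsize_cyc3 [simp]: "tsize cyc3 = 3" by (simp add: tsize_def)

text \<open>The diagonal value makes \<open>half_arc_sum\<close> hold for \<open>x = y\<close> too,
  so that sums over all tuples need no exceptions.\<close>

definition half_arc :: "tournament \<Rightarrow> nat \<Rightarrow> nat \<Rightarrow> real" where
  "half_arc T x y = (if x = y then 1/2 else if (x, y) \<in> arcs T then 1 else 0)"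

lemma half_arc_sum: "x \<in> verts T \<Longrightarrow> y \<in> verts T \<Longrightarrow> half_arc T x y + half_arc T y x = 1"
  using arcs_iff_not[of x T y] by (auto simp: half_arc_def)

lemma sum_half_arc:
  assumes x: "x \<in> verts T" shows "(\<Sum>y\<in>verts T. half_arc T x y) = real (outdegree T x) + 1/2"
proof -
  have "(\<Sum>y\<in>verts T. half_arc T x y) =
      (\<Sum>y\<in>verts T. (if y = x then 1/2 else 0)) + (\<Sum>y\<in>verts T. (if (x, y) \<in> arcs T then 1 else 0))"
    unfolding sum.distrib[symmetric] by (rule sum.cong) (auto simp: half_arc_def)
  also have "(\<Sum>y\<in>verts T. (if (x, y) \<in> arcs T then 1 else 0)) = real (card {y \<in> verts T. (x, y) \<in> arcs T})"
    by (simp add: sum.inter_filter[symmetric])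
  also have "{y \<in> verts T. (x, y) \<in> arcs T} = {y. (x, y) \<in> arcs T}"
    using arcs_vertsD(2)[of x _ T] by blast
  also have "(\<Sum>y\<in>verts T. (if y = x then 1/2 else 0 :: real)) = 1/2"
    using x by simp
  finally show ?thesis by (simp add: outdegree_def)
qed

lemma card_homs_cyc3:
  "card (homs cyc3 T) = card {(x, y, z). (x, y) \<in> arcs T \<and> (y, z) \<in> arcs T \<and> (z, x) \<in> arcs T}"
proof (rule bij_betw_same_card)
  show "bij_betw (\<lambda>h. (h 0, h 1, h 2)) (homs cyc3 T)
    {(x, y, z). (x, y) \<in> arcs T \<and> (y, z) \<in> arcs T \<and> (z, x) \<in> arcs T}"
  proof (rule bij_betw_byWitness[where f' = "\<lambda>(x, y, z). \<lambda>v\<in>verts cyc3. if v = 0 then x else if v = 1 then y else z"])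
    show "\<forall>h\<in>homs cyc3 T. (\<lambda>(x, y, z). \<lambda>v\<in>verts cyc3. if v = 0 then x else if v = 1 then y else z)
        (h 0, h 1, h 2) = h"
    proof (intro ballI ext)
      fix h v assume "h \<in> homs cyc3 T"
      then show "(\<lambda>(x, y, z). \<lambda>v\<in>verts cyc3. if v = 0 then x else if v = 1 then y else z)
        (h 0, h 1, h 2) v = h v"
        using homsD(3)[of h cyc3 T v] by auto
    qed
    show "(\<lambda>h. (h 0, h 1, h 2)) ` homs cyc3 T \<subseteq>
      {(x, y, z). (x, y) \<in> arcs T \<and> (y, z) \<in> arcs T \<and> (z, x) \<in> arcs T}"
    proof (rule image_subsetI)
      fix h assume h: "h \<in> homs cyc3 T"
      show "(h 0, h 1, h 2) \<in> {(x, y, z). (x, y) \<in> arcs T \<and> (y, z) \<in> arcs T \<and> (z, x) \<in> arcs T}"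
        using homsD(1)[OF h, of 0 1] homsD(1)[OF h, of 1 2] homsD(1)[OF h, of 2 0] by simp
    qed
    show "(\<lambda>(x, y, z). \<lambda>v\<in>verts cyc3. if v = 0 then x else if v = 1 then y else z) `
      {(x, y, z). (x, y) \<in> arcs T \<and> (y, z) \<in> arcs T \<and> (z, x) \<in> arcs T} \<subseteq> homs cyc3 T"
    proof clarify
      fix x y z assume arcs: "(x, y) \<in> arcs T" "(y, z) \<in> arcs T" "(z, x) \<in> arcs T"
      then have "x \<in> verts T" "y \<in> verts T" "z \<in> verts T" using arcs_vertsD by blast+
      then show "(\<lambda>v\<in>verts cyc3. if v = 0 then x else if v = 1 then y else z) \<in> homs cyc3 T"
        using arcs by (auto simp: homs_def)
    qed
  qed auto
qed

text \<open>Goodman's identity; the shifts by \<open>1/2\<close> come from counting each vertex as half an out-neighbour of itself.\<close>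

lemma homs_cyc3_outdegree:
  "real (card (homs cyc3 T)) + real (tsize T) / 8 = real (tsize T) ^ 3 / 8
     - 3/2 * (\<Sum>v\<in>verts T. (real (outdegree T v) + 1/2 - real (tsize T) / 2)\<^sup>2)"
proof -
  let ?V = "verts T" let ?W = "half_arc T" let ?n = "real (tsize T)"
  define d where "d x = (\<Sum>y\<in>?V. ?W x y)" for x
  have d: "d x = real (outdegree T x) + 1/2" if "x \<in> ?V" for x
    unfolding d_def using sum_half_arc[OF that] .
  define K where "K = (\<Sum>x\<in>?V. \<Sum>y\<in>?V. \<Sum>z\<in>?V. ?W x y * ?W y z * ?W z x)"
  define Tr where "Tr = (\<Sum>x\<in>?V. \<Sum>y\<in>?V. \<Sum>z\<in>?V. ?W x y * ?W y z * ?W x z)"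
  define Q where "Q = (\<Sum>x\<in>?V. (d x)\<^sup>2)"
  have in_sum: "(\<Sum>x\<in>?V. ?W x y) = ?n - d y" if y: "y \<in> ?V" for y
  proof -
    have "(\<Sum>x\<in>?V. ?W x y) + d y = (\<Sum>x\<in>?V. 1)"
      unfolding d_def sum.distrib[symmetric] using y by (intro sum.cong refl half_arc_sum) auto
    then show ?thesis by (simp add: tsize_def)
  qed
  have sum_d: "(\<Sum>x\<in>?V. d x) = ?n\<^sup>2 / 2"
  proof -
    have "(\<Sum>x\<in>?V. d x) = (\<Sum>y\<in>?V. \<Sum>x\<in>?V. ?W x y)" unfolding d_def by (rule sum.swap)
    also have "\<dots> = (\<Sum>y\<in>?V. ?n - d y)" by (intro sum.cong refl in_sum)
    also have "\<dots> = ?n * ?n - (\<Sum>x\<in>?V. d x)" by (simp add: sum_subtractf tsize_def)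
    finally show ?thesis by (simp add: power2_eq_square)
  qed
  \<comment> \<open>Of two out-neighbours of \<open>x\<close> one beats the other: insert
    \<open>?W y z + ?W z y = 1\<close> and use the symmetry in \<open>y\<close> and
    \<open>z\<close>.\<close>
  have QTr: "Q = 2 * Tr"
  proof -
    have "Q = (\<Sum>x\<in>?V. \<Sum>y\<in>?V. \<Sum>z\<in>?V. ?W x y * ?W x z)"
      unfolding Q_def d_def power2_eq_square by (simp add: sum_product)
    also have "\<dots> = (\<Sum>x\<in>?V. \<Sum>y\<in>?V. \<Sum>z\<in>?V. ?W x y * ?W x z * (?W y z + ?W z y))"
      by (intro sum.cong refl) (simp add: half_arc_sum)
    also have "\<dots> = Tr + (\<Sum>x\<in>?V. \<Sum>y\<in>?V. \<Sum>z\<in>?V. ?W x y * ?W x z * ?W z y)"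
      unfolding Tr_def by (simp add: sum.distrib algebra_simps)
    also have "(\<Sum>x\<in>?V. \<Sum>y\<in>?V. \<Sum>z\<in>?V. ?W x y * ?W x z * ?W z y) = Tr"
      unfolding Tr_def by (subst (2) sum.swap) (simp add: mult_ac)
    finally show ?thesis by simp
  qed
  \<comment> \<open>A directed path \<open>x\<close>, \<open>y\<close>, \<open>z\<close> closes
    either to a directed or to a transitive triangle.\<close>
  have "K + Tr = (\<Sum>x\<in>?V. \<Sum>y\<in>?V. \<Sum>z\<in>?V. ?W x y * ?W y z)"
  proof -
    have "K + Tr = (\<Sum>x\<in>?V. \<Sum>y\<in>?V. \<Sum>z\<in>?V. ?W x y * ?W y z * (?W z x + ?W x z))"
      unfolding K_def Tr_def by (simp add: sum.distrib algebra_simps)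
    also have "\<dots> = (\<Sum>x\<in>?V. \<Sum>y\<in>?V. \<Sum>z\<in>?V. ?W x y * ?W y z)"
      by (intro sum.cong refl) (simp add: half_arc_sum)
    finally show ?thesis .
  qed
  also have "\<dots> = (\<Sum>y\<in>?V. \<Sum>x\<in>?V. ?W x y * d y)"
    unfolding d_def by (subst sum.swap) (simp add: sum_distrib_left)
  also have "\<dots> = (\<Sum>y\<in>?V. (?n - d y) * d y)"
    by (intro sum.cong refl) (simp add: in_sum sum_distrib_right[symmetric])
  also have "\<dots> = ?n * (\<Sum>y\<in>?V. d y) - Q"
    unfolding Q_def by (simp add: algebra_simps power2_eq_square sum_subtractf sum_distrib_left)
  finally have K: "K = ?n ^ 3 / 2 - 3/2 * Q"
    using sum_d QTr by (simp add: power2_eq_square power3_eq_cube)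
  have "(\<Sum>v\<in>?V. (d v - ?n / 2)\<^sup>2) = Q - ?n * (\<Sum>v\<in>?V. d v) + ?n * (?n / 2)\<^sup>2"
    unfolding Q_def by (simp add: power2_diff sum.distrib sum_subtractf sum_distrib_right sum_distrib_left[symmetric] tsize_def mult_ac)
  then have S: "(\<Sum>v\<in>?V. (d v - ?n / 2)\<^sup>2) = Q - ?n ^ 3 / 4"
    unfolding sum_d by (simp add: power2_eq_square power3_eq_cube)
  have "K = (\<Sum>(x, y, z)\<in>?V \<times> ?V \<times> ?V. ?W x y * ?W y z * ?W z x)"
    unfolding K_def by (simp add: sum.cartesian_product)
  \<comment> \<open>If exactly two of the vertices coincide, the product contains both directions of
    one arc and is 0; \<open>x = y = z\<close> contributes \<open>(1/2) ^ 3\<close>.\<close>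
  also have "\<dots> = (\<Sum>(x, y, z)\<in>?V \<times> ?V \<times> ?V.
      (if (x, y) \<in> arcs T \<and> (y, z) \<in> arcs T \<and> (z, x) \<in> arcs T then 1 else 0) + (if y = x \<and> z = x then 1/8 else 0))"
  proof (intro sum.cong refl, clarify)
    fix x y z assume "x \<in> ?V" "y \<in> ?V" "z \<in> ?V"
    show "?W x y * ?W y z * ?W z x =
      (if (x, y) \<in> arcs T \<and> (y, z) \<in> arcs T \<and> (z, x) \<in> arcs T then 1 else 0) + (if y = x \<and> z = x then 1/8 else 0)"
      using arcs_asym[of x y T] arcs_asym[of y z T] arcs_asym[of z x T] by (simp add: half_arc_def)
  qed
  also have "\<dots> = real (card {(x, y, z). (x, y) \<in> arcs T \<and> (y, z) \<in> arcs T \<and> (z, x) \<in> arcs T})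
      + (\<Sum>x\<in>?V. \<Sum>y\<in>?V. \<Sum>z\<in>?V. if y = x \<and> z = x then 1/8 else 0)"
  proof -
    have "(\<Sum>(x, y, z)\<in>?V \<times> ?V \<times> ?V.
       if (x, y) \<in> arcs T \<and> (y, z) \<in> arcs T \<and> (z, x) \<in> arcs T then 1 else 0) =
       (\<Sum>p\<in>?V \<times> ?V \<times> ?V. if p \<in> {(x, y, z). (x, y) \<in> arcs T \<and> (y, z) \<in> arcs T \<and> (z, x) \<in> arcs T} then 1 else (0::real))"
      by (intro sum.cong) (auto split: if_splits)
    also have "\<dots> = real (card (?V \<times> ?V \<times> ?V \<inter> {(x, y, z). (x, y) \<in> arcs T \<and> (y, z) \<in> arcs T \<and> (z, x) \<in> arcs T}))"
      by (simp add: sum.If_cases)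
    also have "?V \<times> ?V \<times> ?V \<inter> {(x, y, z). (x, y) \<in> arcs T \<and> (y, z) \<in> arcs T \<and> (z, x) \<in> arcs T} =
        {(x, y, z). (x, y) \<in> arcs T \<and> (y, z) \<in> arcs T \<and> (z, x) \<in> arcs T}"
      by (auto dest: arcs_vertsD)
    finally show ?thesis by (simp add: sum.cartesian_product sum.distrib case_prod_unfold)
  qed
  also have "(\<Sum>x\<in>?V. \<Sum>y\<in>?V. \<Sum>z\<in>?V. if y = x \<and> z = x then 1/8 else 0) = ?n / 8"
  proof -
    have "(\<Sum>y\<in>?V. \<Sum>z\<in>?V. if y = x \<and> z = x then 1/8 else (0::real)) = 1/8" if "x \<in> ?V" for x
    proof -
      have "(\<Sum>z\<in>?V. if y = x \<and> z = x then 1/8 else (0::real)) = (if y = x then 1/8 else 0)" for y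
        using that by (cases "y = x") simp_all
      then show ?thesis using that by simp
    qed
    then have "(\<Sum>x\<in>?V. \<Sum>y\<in>?V. \<Sum>z\<in>?V. if y = x \<and> z = x then 1/8 else 0) = (\<Sum>x\<in>?V. 1/8 :: real)"
      by (intro sum.cong refl)
    then show ?thesis by (simp add: tsize_def)
  qed
  finally have "K = real (card (homs cyc3 T)) + ?n / 8" by (simp add: card_homs_cyc3)
  moreover have "(\<Sum>v\<in>?V. (real (outdegree T v) + 1/2 - ?n / 2)\<^sup>2) = (\<Sum>v\<in>?V. (d v - ?n / 2)\<^sup>2)"
    by (intro sum.cong refl) (simp add: d)
  ultimately show ?thesis using K S by linarith
qed

text \<open>By Goodman's identity \<open>1/8\<close> is the largest value that the density of
  \<open>cyc3\<close> can approach, and the deviation from it is a multiple of the variance of the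
  outdegrees up to terms that vanish with growing size.\<close>

definition imbalance :: "tournament \<Rightarrow> real" where
  "imbalance T = 1/8 - hom_density cyc3 T"

lemma imbalance_le: "imbalance T \<le> 1/8"
  using hom_density_nonneg by (simp add: imbalance_def)

lemma imbalance_outdegree:
  assumes "0 < tsize T"
  shows "imbalance T = 1 / (8 * real (tsize T) ^ 2) + 3/2 *
    ((\<Sum>v\<in>verts T. (real (outdegree T v) + 1/2 - real (tsize T) / 2)\<^sup>2) / real (tsize T) ^ 3)"
proof -
  define n where "n = real (tsize T)"
  define N where "N = real (card (homs cyc3 T))"
  define S where "S = (\<Sum>v\<in>verts T. (real (outdegree T v) + 1/2 - real (tsize T) / 2)\<^sup>2)"
  have n: "0 < n" using assms by (simp add: n_def)
  have N: "N = n ^ 3 / 8 - 3/2 * S - n / 8"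
    using homs_cyc3_outdegree[of T] by (simp add: n_def N_def S_def)
  have "1/8 - N / n ^ 3 = 1 / (8 * n ^ 2) + 3/2 * (S / n ^ 3)"
    unfolding N using n by (simp add: field_simps power2_eq_square power3_eq_cube)
  then show ?thesis by (simp add: imbalance_def hom_density_def n_def N_def S_def)
qed

lemma imbalance_nonneg: "0 \<le> imbalance T"
proof (cases "tsize T = 0")
  case True
  then show ?thesis by (simp add: imbalance_def hom_density_def)
next
  case False
  have "0 \<le> (\<Sum>v\<in>verts T. (real (outdegree T v) + 1/2 - real (tsize T) / 2)\<^sup>2)"
    by (intro sum_nonneg) simp
  then show ?thesis using False by (simp add: imbalance_outdegree)
qed

section \<open>Homomorphism densities as polynomials in the part sizes\<close>

lemma compat_PiE: "g \<in> compat F \<Longrightarrow> g \<in> verts F \<rightarrow>\<^sub>E {..<3}"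
  by (simp add: compat_def)

lemma finite_compat [simp]: "finite (compat F)"
  by (rule finite_subset[of _ "verts F \<rightarrow>\<^sub>E {..<3}"]) (auto simp: compat_def intro: finite_PiE)

lemma prod_fibres:
  assumes g: "g \<in> verts F \<rightarrow>\<^sub>E {..<3}"
  shows "(\<Prod>i<3. x i ^ tsize (fibre F g i)) = (\<Prod>v\<in>verts F. x (g v) :: real)"
proof -
  have "(\<Prod>v\<in>verts F. x (g v)) = (\<Prod>i<3. \<Prod>v | v \<in> verts F \<and> g v = i. x (g v))"
    using g by (intro prod.group[symmetric]) auto
  also have "\<dots> = (\<Prod>i<3. x i ^ tsize (fibre F g i))"
    by (intro prod.cong refl) (simp add: tsize_def)
  finally show ?thesis ..
qed

lemma hom_density_split:
  assumes P: "cyclic_partition T P" and n: "0 < tsize T"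
  shows "hom_density F T = (\<Sum>g\<in>compat F.
    (\<Prod>v\<in>verts F. real (card (P (g v))) / real (tsize T)) *
    (\<Prod>i<3. hom_density (fibre F g i) (induced T (P i))))"
proof -
  let ?n = "real (tsize T)"
  have sz: "tsize (induced T (P i)) = card (P i)" if "i < 3" for i
    using cyclic_partitionD(1)[OF P, of i] that by (simp add: tsize_induced)
  have "hom_density F T = (\<Sum>g\<in>compat F. \<Prod>i<3. real (card (homs (fibre F g i) (induced T (P i))))) / ?n ^ tsize F"
    unfolding hom_density_def card_homs_split[OF P] by simp
  also have "\<dots> = (\<Sum>g\<in>compat F. (\<Prod>i<3. real (card (homs (fibre F g i) (induced T (P i))))) / ?n ^ tsize F)"
    by (rule sum_divide_distrib)
  also have "\<dots> = (\<Sum>g\<in>compat F.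
    (\<Prod>v\<in>verts F. real (card (P (g v))) / ?n) *
    (\<Prod>i<3. hom_density (fibre F g i) (induced T (P i))))"
  proof (rule sum.cong[OF refl])
    fix g assume g: "g \<in> compat F"
    \<comment> \<open>\<open>hom_density_eq\<close> is used rather than a division by the part size,
      since a part may be empty.\<close>
    have "(\<Prod>i<3. real (card (homs (fibre F g i) (induced T (P i))))) =
      (\<Prod>i<3. hom_density (fibre F g i) (induced T (P i)) * real (card (P i)) ^ tsize (fibre F g i))"
      by (intro prod.cong refl) (simp add: hom_density_eq sz)
    also have "\<dots> = (\<Prod>i<3. hom_density (fibre F g i) (induced T (P i))) * (\<Prod>v\<in>verts F. real (card (P (g v))))"
      using prod_fibres[OF compat_PiE[OF g], of "\<lambda>i. real (card (P i))"] by (simp add: prod.distrib)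
    also have "(\<Prod>v\<in>verts F. real (card (P (g v)))) = (\<Prod>v\<in>verts F. real (card (P (g v))) / ?n) * ?n ^ tsize F"
      using n unfolding tsize_def[of F] by (simp add: prod_dividef)
    finally show "(\<Prod>i<3. real (card (homs (fibre F g i) (induced T (P i))))) / ?n ^ tsize F =
      (\<Prod>v\<in>verts F. real (card (P (g v))) / ?n) * (\<Prod>i<3. hom_density (fibre F g i) (induced T (P i)))"
      using n by simp
  qed
  finally show ?thesis .
qed

definition colour :: "tournament \<Rightarrow> nat \<Rightarrow> nat \<Rightarrow> nat" where
  "colour F i = (\<lambda>v\<in>verts F. i)"

text \<open>The colourings all of whose fibres are smaller than \<open>F\<close>, which makes
  induction on the size of \<open>F\<close> possible.\<close>

definition ncompat :: "tournament \<Rightarrow> (nat \<Rightarrow> nat) set" where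
  "ncompat F = {g \<in> compat F. \<exists>u\<in>verts F. \<exists>v\<in>verts F. g u \<noteq> g v}"

lemma finite_ncompat [simp]: "finite (ncompat F)"
  by (simp add: ncompat_def)

lemma fibre_colour: "fibre F (colour F i) i = F"
  by (rule tournament_eqI) (auto simp: colour_def dest: arcs_vertsD)

lemma tsize_fibre_colour: "j \<noteq> i \<Longrightarrow> tsize (fibre F (colour F i) j) = 0"
  by (auto simp: tsize_def colour_def)

lemma hom_density_tsize_0: "tsize F = 0 \<Longrightarrow> hom_density F T = 1"
proof -
  assume "tsize F = 0"
  then have "verts F = {}" by (simp add: tsize_def)
  moreover from this have "arcs F = {}" using arcs_subset[of F] by auto
  ultimately have "homs F T = {\<lambda>_. undefined}" by (simp add: homs_def)
  then show ?thesis using \<open>tsize F = 0\<close> by (simp add: hom_density_def)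
qed

lemma compat_eq: "verts F \<noteq> {} \<Longrightarrow> compat F = colour F ` {..<3} \<union> ncompat F"
proof (intro subset_antisym subsetI)
  fix g assume V: "verts F \<noteq> {}" and g: "g \<in> compat F"
  show "g \<in> colour F ` {..<3} \<union> ncompat F"
  proof (cases "g \<in> ncompat F")
    case False
    obtain u where u: "u \<in> verts F" using V by blast
    have "g = colour F (g u)"
    proof
      fix v show "g v = colour F (g u) v"
      proof (cases "v \<in> verts F")
        case True
        then have "g u = g v" using False g u unfolding ncompat_def by blast
        then show ?thesis using True by (simp add: colour_def)
      next
        case False
        then show ?thesis using compat_PiE[OF g] by (simp add: colour_def PiE_def extensional_def)
      qed
    qed
    moreover have "g u \<in> {..<3}" using PiE_mem[OF compat_PiE[OF g] u] .
    ultimately show ?thesis by blast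
  qed simp
next
  fix g assume "g \<in> colour F ` {..<3} \<union> ncompat F"
  moreover have "colour F i \<in> compat F" if "i \<in> {..<3}" for i
    using that arcs_subset[of F] by (auto simp: compat_def colour_def)
  ultimately show "g \<in> compat F" by (auto simp: ncompat_def)
qed

text \<open>Isolates the terms in which \<open>F\<close> itself recurs inside one part. For empty
  \<open>F\<close> the three constant colourings coincide, whence the hypothesis.\<close>

lemma hom_density_split_nonconst:
  assumes P: "cyclic_partition T P" and n: "0 < tsize T" and F: "verts F \<noteq> {}"
  shows "hom_density F T =
    (\<Sum>i<3. (real (card (P i)) / real (tsize T)) ^ tsize F * hom_density F (induced T (P i))) +
    (\<Sum>g\<in>ncompat F. (\<Prod>v\<in>verts F. real (card (P (g v))) / real (tsize T)) *
      (\<Prod>i<3. hom_density (fibre F g i) (induced T (P i))))"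
proof -
  let ?f = "\<lambda>g. (\<Prod>v\<in>verts F. real (card (P (g v))) / real (tsize T)) *
      (\<Prod>i<3. hom_density (fibre F g i) (induced T (P i)))"
  obtain u where u: "u \<in> verts F" using F by blast
  have inj: "inj_on (colour F) {..<3}"
    by (rule inj_onI) (metis colour_def restrict_apply' u)
  have "hom_density F T = (\<Sum>g\<in>colour F ` {..<3}. ?f g) + (\<Sum>g\<in>ncompat F. ?f g)"
    unfolding hom_density_split[OF P n] compat_eq[OF F]
    by (intro sum.union_disjoint) (auto simp: ncompat_def colour_def)
  also have "(\<Sum>g\<in>colour F ` {..<3}. ?f g) = (\<Sum>i<3. ?f (colour F i))"
    by (simp add: sum.reindex[OF inj])
  also have "\<dots> = (\<Sum>i<3. (real (card (P i)) / real (tsize T)) ^ tsize F * hom_density F (induced T (P i)))"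
  proof (rule sum.cong[OF refl])
    fix i :: nat assume i: "i \<in> {..<3}"
    have "(\<Prod>v\<in>verts F. real (card (P (colour F i v))) / real (tsize T)) = (real (card (P i)) / real (tsize T)) ^ tsize F"
      by (simp add: colour_def tsize_def)
    moreover have "(\<Prod>j<3. hom_density (fibre F (colour F i) j) (induced T (P j))) =
        (\<Prod>j<3. if j = i then hom_density F (induced T (P i)) else 1)"
      by (intro prod.cong refl) (simp add: fibre_colour tsize_fibre_colour hom_density_tsize_0)
    moreover have "\<dots> = hom_density F (induced T (P i))" using i by simp
    ultimately show "?f (colour F i) = (real (card (P i)) / real (tsize T)) ^ tsize F * hom_density F (induced T (P i))"
      by simp
  qed
  finally show ?thesis .
qed

lemma tsize_1_hom_density: "tsize F = 1 \<Longrightarrow> 0 < tsize T \<Longrightarrow> hom_density F T = 1"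
proof -
  assume F: "tsize F = 1" and T: "0 < tsize T"
  then obtain a where a: "verts F = {a}" by (auto simp: tsize_def card_1_singleton_iff)
  then have "arcs F = {}" using arcs_subset[of F] arcs_irrefl[of a F] by auto
  then have "homs F T = verts F \<rightarrow>\<^sub>E verts T" by (simp add: homs_def)
  then have "card (homs F T) = tsize T" using a by (simp add: card_PiE tsize_def)
  then show ?thesis using F T by (simp add: hom_density_def)
qed

text \<open>\<open>F\<close> is a single arc, and \<open>n * n = 2 * card (arcs T) + n\<close> for
  \<open>n = tsize T\<close>. The correction of order \<open>1 / n\<close> is the reason for the
  summand \<open>1 / tsize T\<close> in \<open>hom_error\<close>.\<close>

lemma tsize_2_hom_density:
  assumes F: "tsize F = 2" and T: "0 < tsize T"
  shows "hom_density F T = 1/2 - 1/2 * (1 / real (tsize T))"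
proof -
  obtain a b where ab: "verts F = {a, b}" "a \<noteq> b" using F by (auto simp: tsize_def card_2_iff)
  obtain a b where ab: "verts F = {a, b}" "(a, b) \<in> arcs F"
  proof (cases "(a, b) \<in> arcs F")
    case True then show ?thesis using that ab by blast
  next
    case False
    then have "(b, a) \<in> arcs F" using arcs_total[of a F b] ab by auto
    then show ?thesis using that[of b a] ab by auto
  qed
  have ne: "a \<noteq> b" and nba: "(b, a) \<notin> arcs F" using ab(2) arcs_asym by auto
  have "e = (a, b)" if "e \<in> arcs F" for e
  proof -
    have "e \<in> {a, b} \<times> {a, b}" using that arcs_subset[of F] ab(1) by blast
    moreover have "e \<noteq> (a, a)" "e \<noteq> (b, b)" "e \<noteq> (b, a)" using that nba by auto
    ultimately show ?thesis by blast
  qed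
  then have arcsF: "arcs F = {(a, b)}" using ab(2) by blast
  have "bij_betw (\<lambda>h. (h a, h b)) (homs F T) (arcs T)"
  proof (rule bij_betw_byWitness[where f' = "\<lambda>(x, y). \<lambda>v\<in>verts F. if v = a then x else y"])
    show "\<forall>h\<in>homs F T. (\<lambda>(x, y). \<lambda>v\<in>verts F. if v = a then x else y) (h a, h b) = h"
    proof (intro ballI ext)
      fix h v assume "h \<in> homs F T"
      then show "(\<lambda>(x, y). \<lambda>v\<in>verts F. if v = a then x else y) (h a, h b) v = h v"
        using homsD(3)[of h F T v] ab(1) by auto
    qed
    show "(\<lambda>h. (h a, h b)) ` homs F T \<subseteq> arcs T" using homsD(1)[OF _ ab(2)] by auto
    show "(\<lambda>(x, y). \<lambda>v\<in>verts F. if v = a then x else y) ` arcs T \<subseteq> homs F T"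
    proof clarify
      fix x y assume xy: "(x, y) \<in> arcs T"
      then show "(\<lambda>v\<in>verts F. if v = a then x else y) \<in> homs F T"
        using arcs_vertsD[OF xy] ne by (auto simp: homs_def arcsF ab(1))
    qed
  qed (use ab ne in auto)
  then have card: "card (homs F T) = card (arcs T)" by (rule bij_betw_same_card)
  have fin: "finite (arcs T)" using arcs_subset finite_subset by (metis finite_SigmaI finite_verts)
  have "verts T \<times> verts T = arcs T \<union> (arcs T)\<inverse> \<union> Id_on (verts T)"
    using arcs_total[of _ T] arcs_subset[of T] by (auto simp: Id_on_def)
  then have "card (verts T \<times> verts T) = card (arcs T \<union> (arcs T)\<inverse>) + card (Id_on (verts T))"
  proof -
    have "(arcs T \<union> (arcs T)\<inverse>) \<inter> Id_on (verts T) = {}" by (auto simp: Id_on_def)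
    moreover have "finite (Id_on (verts T))" by (simp add: Id_on_def)
    ultimately show ?thesis using fin by (simp only: \<open>verts T \<times> verts T = _\<close> card_Un_disjoint finite_UnI finite_converse)
  qed
  also have "card (arcs T \<union> (arcs T)\<inverse>) = card (arcs T) + card ((arcs T)\<inverse>)"
    using fin by (intro card_Un_disjoint) (use arcs_asym in auto)
  also have "card (Id_on (verts T)) = tsize T"
    unfolding Id_on_def tsize_def by (simp add: UNION_singleton_eq_range card_image inj_on_def)
  finally have "tsize T * tsize T = 2 * card (homs F T) + tsize T"
    using fin by (simp add: card_cartesian_product card tsize_def)
  then have "real (tsize T) * real (tsize T) = 2 * real (card (homs F T)) + real (tsize T)"
    by (metis of_nat_add of_nat_mult of_nat_numeral)
  then show ?thesis using T F by (simp add: hom_density_def field_simps power2_eq_square)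
qed

lemma sum_lessThan_3: "(\<Sum>i<3::nat. f i) = f 0 + f 1 + (f 2 :: 'a :: comm_monoid_add)"
  by (simp add: numeral_3_eq_3 numeral_2_eq_2)

lemma prod_lessThan_3: "(\<Prod>i<3::nat. f i) = f 0 * f 1 * (f 2 :: 'a :: comm_monoid_mult)"
  by (simp add: numeral_3_eq_3 numeral_2_eq_2)

text \<open>Each arc raises the colour by 0 or 1, and the three increments around the triangle add
  up to 0 modulo 3, so they are all 0 or all 1.\<close>

lemma ncompat_cyc3: "ncompat cyc3 = (\<lambda>k. \<lambda>v\<in>{0, 1, 2}. (v + k) mod 3) ` {..<3}"
proof (intro subset_antisym subsetI)
  fix g assume g: "g \<in> ncompat cyc3"
  then have c: "g \<in> compat cyc3" and nc: "\<not> (g 0 = g 1 \<and> g 1 = g 2)" by (auto simp: ncompat_def)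
  have r: "g 0 \<in> {..<3}" "g 1 \<in> {..<3}" "g 2 \<in> {..<3}" using PiE_mem[OF compat_PiE[OF c]] by simp_all
  have e: "g 1 = g 0 \<or> g 1 = (g 0 + 1) mod 3" "g 2 = g 1 \<or> g 2 = (g 1 + 1) mod 3"
    "g 0 = g 2 \<or> g 0 = (g 2 + 1) mod 3" using c by (simp_all add: compat_def)
  have "g 1 = (1 + g 0) mod 3 \<and> g 2 = (2 + g 0) mod 3"
    using lessThan_3_cases[OF r(1)] e nc by (elim disjE) simp_all
  moreover have "g v = undefined" if "v \<notin> {0, 1, 2}" for v
    using compat_PiE[OF c] that by (simp add: PiE_def extensional_def)
  ultimately have "g = (\<lambda>v\<in>{0, 1, 2}. (v + g 0) mod 3)"
    using r(1) by (intro ext) (auto simp: restrict_def)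
  then show "g \<in> (\<lambda>k. \<lambda>v\<in>{0, 1, 2}. (v + k) mod 3) ` {..<3}" using r(1) by blast
next
  fix g assume "g \<in> (\<lambda>k. \<lambda>v\<in>{0, 1, 2}. (v + k) mod 3) ` {..<3::nat}"
  then obtain k where k: "k \<in> {..<3::nat}" "g = (\<lambda>v\<in>{0, 1, 2}. (v + k) mod 3)" by blast
  show "g \<in> ncompat cyc3"
    using lessThan_3_cases[OF k(1)] unfolding k(2) ncompat_def compat_def
    by (elim disjE) (auto simp: numeral_2_eq_2)
qed

text \<open>With \<open>e2\<close>, \<open>e3\<close> the elementary symmetric functions of the
  sizes, the non-constant colourings of \<open>cyc3\<close> contribute \<open>3 * e3\<close> and the
  constant ones \<open>x i ^ 3\<close> times the density of a part. Since the \<open>x i\<close> sum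
  to 1, \<open>1 - (x 0 ^ 3 + x 1 ^ 3 + x 2 ^ 3) = 3 * (e2 - e3)\<close>.\<close>

lemma imbalance_split:
  assumes P: "cyclic_partition T P" and n: "0 < tsize T"
  defines "x \<equiv> \<lambda>i. real (card (P i)) / real (tsize T)"
  shows "imbalance T = (\<Sum>i<3. x i ^ 3 * imbalance (induced T (P i))) +
    3/8 * (x 0 * x 1 + x 1 * x 2 + x 2 * x 0 - 9 * (x 0 * x 1 * x 2))"
proof -
  have x1: "x 0 + x 1 + x 2 = 1" unfolding x_def by (rule cyclic_partition_fracs[OF P n])
  have inj: "inj_on (\<lambda>k. \<lambda>v\<in>{0, 1, 2}. (v + k) mod 3) {..<3::nat}"
  proof (rule inj_onI)
    fix k l :: nat assume kl: "k \<in> {..<3}" "l \<in> {..<3}" and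
      "(\<lambda>v\<in>{0, 1, 2}. (v + k) mod 3) = (\<lambda>v\<in>{0, 1, 2}. (v + l) mod 3)"
    then have "(\<lambda>v\<in>{0, 1, 2}. (v + k) mod 3) 0 = (\<lambda>v\<in>{0, 1, 2}. (v + l) mod 3) 0" by simp
    then show "k = l" using kl by simp
  qed
  have t: "(\<Prod>v\<in>verts cyc3. x (g v)) * (\<Prod>i<3. hom_density (fibre cyc3 g i) (induced T (P i))) = x 0 * x 1 * x 2"
    if g: "g \<in> ncompat cyc3" for g
  proof -
    obtain k where k: "k \<in> {..<3::nat}" "g = (\<lambda>v\<in>{0, 1, 2}. (v + k) mod 3)" using g unfolding ncompat_cyc3 by blast
    have p: "(\<Prod>v\<in>verts cyc3. x (g v)) = x 0 * x 1 * x 2"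
      using lessThan_3_cases[OF k(1)] unfolding k(2) by (elim disjE) (simp_all add: numeral_2_eq_2 mult_ac)
    show ?thesis
    \<comment> \<open>In an empty part the density of a single vertex is 0 and not 1, but then the
      monomial vanishes.\<close>
    proof (cases "x 0 * x 1 * x 2 = 0")
      case True then show ?thesis using p by simp
    next
      case False
      have "hom_density (fibre cyc3 g i) (induced T (P i)) = 1" if i: "i \<in> {..<3}" for i
      proof (rule tsize_1_hom_density)
        have "{v \<in> verts cyc3. g v = i} = {(i + (3 - k)) mod 3}"
          using lessThan_3_cases[OF k(1)] lessThan_3_cases[OF i] unfolding k(2)
          by (elim disjE) (auto simp: numeral_2_eq_2)
        then show "tsize (fibre cyc3 g i) = 1" by (simp add: tsize_def)
        have "x i \<noteq> 0" using lessThan_3_cases[OF i] False by (elim disjE) auto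
        then show "0 < tsize (induced T (P i))"
          using cyclic_partitionD(1)[OF P i] by (simp add: tsize_induced x_def)
      qed
      then show ?thesis using p by simp
    qed
  qed
  have "hom_density cyc3 T = (\<Sum>i<3. x i ^ 3 * hom_density cyc3 (induced T (P i))) + 3 * (x 0 * x 1 * x 2)"
    unfolding hom_density_split_nonconst[OF P n, of cyc3, simplified tsize_cyc3, folded x_def, simplified]
    using t card_image[OF inj] by (simp add: ncompat_cyc3 x_def)
  then have "imbalance T = (\<Sum>i<3. x i ^ 3 * imbalance (induced T (P i))) +
     (1/8 * (1 - (x 0 ^ 3 + x 1 ^ 3 + x 2 ^ 3)) - 3 * (x 0 * x 1 * x 2))"
    by (simp add: imbalance_def sum_lessThan_3 algebra_simps)
  also have "1/8 * (1 - (x 0 ^ 3 + x 1 ^ 3 + x 2 ^ 3)) - 3 * (x 0 * x 1 * x 2) =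
    3/8 * (x 0 * x 1 + x 1 * x 2 + x 2 * x 0 - 9 * (x 0 * x 1 * x 2))"
  proof -
    have x2: "x 2 = 1 - x 0 - x 1" using x1 by simp
    show ?thesis unfolding x2 by (simp add: power3_eq_cube field_simps)
  qed
  finally show ?thesis .
qed

lemma cyclic_triple_partition:
  "cyclic_triple T A B C \<Longrightarrow> cyclic_partition T (\<lambda>i. if i = 0 then A else if i = 1 then B else C)"
  by (auto simp: cyclic_triple_def cyclic_partition_def)

section \<open>Invariance under rotating the colours\<close>

lemma rot_compat:
  assumes g: "g \<in> verts F \<rightarrow>\<^sub>E {..<3}"
  shows "rot (verts F) g \<in> compat F \<longleftrightarrow> g \<in> compat F"
proof -
  have key: "(rot (verts F) g v = rot (verts F) g u \<or> rot (verts F) g v = (rot (verts F) g u + 1) mod 3) \<longleftrightarrow>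
     (g v = g u \<or> g v = (g u + 1) mod 3)" if "(u, v) \<in> arcs F" for u v
  proof -
    have V: "u \<in> verts F" "v \<in> verts F" using arcs_vertsD[OF that] .
    show ?thesis
      using lessThan_3_cases[OF PiE_mem[OF g V(1)]] lessThan_3_cases[OF PiE_mem[OF g V(2)]] V
      by (elim disjE) (simp_all add: rot_def)
  qed
  have "(\<forall>(u, v)\<in>arcs F. rot (verts F) g v = rot (verts F) g u \<or> rot (verts F) g v = (rot (verts F) g u + 1) mod 3)
    \<longleftrightarrow> (\<forall>(u, v)\<in>arcs F. g v = g u \<or> g v = (g u + 1) mod 3)"
  proof (rule ball_cong[OF refl])
    fix e assume "e \<in> arcs F"
    then show "(case e of (u, v) \<Rightarrow> rot (verts F) g v = rot (verts F) g u \<or>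
        rot (verts F) g v = (rot (verts F) g u + 1) mod 3) \<longleftrightarrow>
      (case e of (u, v) \<Rightarrow> g v = g u \<or> g v = (g u + 1) mod 3)"
      by (cases e) (simp only: prod.case key)
  qed
  then show ?thesis using g rot_PiE[OF g] unfolding compat_def mem_Collect_eq by blast
qed

lemma rot_noncst:
  assumes g: "g \<in> V \<rightarrow>\<^sub>E {..<3}" and "u \<in> V" "v \<in> V"
  shows "rot V g u = rot V g v \<longleftrightarrow> g u = g v"
  using lessThan_3_cases[OF PiE_mem[OF g assms(2)]] lessThan_3_cases[OF PiE_mem[OF g assms(3)]] assms(2,3)
  by (elim disjE) (simp_all add: rot_def)

lemma fibre_rot:
  assumes g: "g \<in> verts F \<rightarrow>\<^sub>E {..<3}" and i: "i \<in> {..<3}"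
  shows "fibre F (rot (verts F) g) ((i + 1) mod 3) = fibre F g i"
proof -
  have "rot (verts F) g v = (i + 1) mod 3 \<longleftrightarrow> g v = i" if v: "v \<in> verts F" for v
    using lessThan_3_cases[OF PiE_mem[OF g v]] lessThan_3_cases[OF i] v
    by (elim disjE) (simp_all add: rot_def)
  then show ?thesis by (intro tournament_eqI) (auto simp: fibre_def dest: arcs_vertsD)
qed

lemma prod_fibre_rot:
  assumes g: "g \<in> verts F \<rightarrow>\<^sub>E {..<3}"
  shows "(\<Prod>i<3. f (fibre F (rot (verts F) g) i)) = (\<Prod>i<3. f (fibre F g i) :: real)"
  using fibre_rot[OF g, of 0] fibre_rot[OF g, of 1] fibre_rot[OF g, of 2]
  unfolding prod_lessThan_3 by (simp add: numeral_2_eq_2 mult_ac)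

section \<open>Near-balanced decomposable tournaments\<close>

text \<open>The error is graded by the size of \<open>F\<close>. A fibre of size 2 must not be
  charged with the imbalance of its part: its weight \<open>x ^ 2 * (1 - x)\<close> exceeds, for
  small \<open>x\<close>, the weight \<open>x ^ 3\<close> with which that imbalance enters the
  imbalance of the whole.\<close>

definition hom_error :: "tournament \<Rightarrow> tournament \<Rightarrow> real" where
  "hom_error F T = (if 3 \<le> tsize F then imbalance T else 0) + (if 2 \<le> tsize F then 1 / real (tsize T) else 0)"

lemma hom_error_nonneg: "0 \<le> hom_error F T"
  by (simp add: hom_error_def imbalance_nonneg)

text \<open>The value \<open>f\<close> is forced by the recursion for the limit: \<open>f = (\<Sum>g. c g) / 3 ^ m + 3 * f / 3 ^ m\<close>, where
  \<open>g\<close> runs over the non-constant colourings.\<close>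

lemma colouring_polynomial_bound:
  fixes fl :: "tournament \<Rightarrow> real"
  assumes m: "2 \<le> tsize F" and fl: "\<And>g i. g \<in> ncompat F \<Longrightarrow> i < 3 \<Longrightarrow> 0 \<le> fl (fibre F g i) \<and> fl (fibre F g i) \<le> 1"
  defines "c \<equiv> \<lambda>g. \<Prod>i<3. fl (fibre F g i)"
  shows "\<exists>f K. 0 \<le> f \<and> f \<le> 1 \<and> 0 \<le> K \<and> (\<forall>x :: nat \<Rightarrow> real. (\<forall>i<3. 0 \<le> x i) \<and> x 0 + x 1 + x 2 = 1 \<longrightarrow>
    \<bar>(\<Sum>g\<in>ncompat F. (\<Prod>v\<in>verts F. x (g v)) * c g) + f * (\<Sum>i<3. x i ^ tsize F) - f\<bar> \<le>
      K * (x 0 * x 1 + x 1 * x 2 + x 2 * x 0 - 9 * (x 0 * x 1 * x 2)))"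
proof -
  let ?V = "verts F"
  let ?G = "?V \<rightarrow>\<^sub>E {..<3::nat}"
  let ?C = "colour F ` {..<3}"
  have fin: "finite ?G" by (intro finite_PiE) auto
  have V: "?V \<noteq> {}" using m by (auto simp: tsize_def)
  then obtain u where u: "u \<in> ?V" by blast
  have inj: "inj_on (colour F) {..<3}"
    by (rule inj_onI) (metis colour_def restrict_apply' u)
  have C: "?C \<subseteq> ?G" by (auto simp: colour_def)
  have nc: "ncompat F \<subseteq> ?G - ?C"
    using compat_PiE by (auto simp: ncompat_def colour_def)
  have cardG: "card ?G = 3 ^ tsize F" by (simp add: card_PiE tsize_def)
  have cardC: "card ?C = 3" by (simp add: card_image[OF inj])
  have card_nc: "real (card (?G - ?C)) = 3 ^ tsize F - 3"
    using C cardG cardC fin card_mono[OF fin C] by (simp add: card_Diff_subset finite_subset of_nat_diff)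
  have big: "(3::real) ^ tsize F - 3 > 0"
  proof -
    have "(3::real) ^ 1 < 3 ^ tsize F" using m by (intro power_strict_increasing) auto
    then show ?thesis by simp
  qed
  have c01: "0 \<le> c g" "c g \<le> 1" if "g \<in> ncompat F" for g
    unfolding c_def using fl[OF that] by (auto intro!: prod_nonneg prod_le_1)
  define f where "f = (\<Sum>g\<in>ncompat F. c g) / (3 ^ tsize F - 3)"
  have f0: "0 \<le> f" unfolding f_def using big c01 by (intro divide_nonneg_pos sum_nonneg) auto
  have f1: "f \<le> 1"
  proof -
    have "(\<Sum>g\<in>ncompat F. c g) \<le> real (card (ncompat F))"
      using sum_bounded_above[of "ncompat F" c 1] c01 by simp
    also have "\<dots> \<le> real (card (?G - ?C))" using nc fin by (intro of_nat_mono card_mono) auto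
    finally show ?thesis unfolding f_def card_nc using big by simp
  qed
  \<comment> \<open>As \<open>x 0 + x 1 + x 2 = 1\<close>, the sum of all monomials is 1.
    Multiplying the last \<open>f\<close> by this sum makes the expression homogeneous with
    coefficients \<open>d\<close>, and the choice of \<open>f\<close> makes these sum to 0.\<close>
  define d where "d g = (if g \<in> ?G - ?C then (if g \<in> ncompat F then c g else 0) - f else 0)" for g
  have ncC: "g \<in> ?C \<longleftrightarrow> (\<forall>u\<in>?V. \<forall>v\<in>?V. g u = g v)" if g: "g \<in> ?G" for g
  proof
    assume eq: "\<forall>u\<in>?V. \<forall>v\<in>?V. g u = g v"
    have "g = colour F (g u)"
    proof
      fix v
      show "g v = colour F (g u) v"
      proof (cases "v \<in> ?V")
        case True
        then have "g v = g u" using eq u by blast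
        then show ?thesis using True by (simp add: colour_def)
      next
        case False
        then show ?thesis using g by (simp add: colour_def PiE_def extensional_def)
      qed
    qed
    then show "g \<in> ?C" using PiE_mem[OF g u] by blast
  qed (auto simp: colour_def)
  have rotC: "rot ?V g \<in> ?C \<longleftrightarrow> g \<in> ?C" if g: "g \<in> ?G" for g
    unfolding ncC[OF g] ncC[OF rot_PiE[OF g]] using rot_noncst[OF g] by blast
  have rotnc: "rot ?V g \<in> ncompat F \<longleftrightarrow> g \<in> ncompat F" if g: "g \<in> ?G" for g
    unfolding ncompat_def mem_Collect_eq rot_compat[OF g] using rot_noncst[OF g] by blast
  have "\<exists>K\<ge>0. \<forall>x :: nat \<Rightarrow> real. (\<forall>i<3. 0 \<le> x i) \<and> x 0 + x 1 + x 2 = 1 \<longrightarrow>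
    \<bar>\<Sum>g\<in>?G. d g * (\<Prod>v\<in>?V. x (g v))\<bar> \<le>
      K * (x 0 * x 1 + x 1 * x 2 + x 2 * x 0 - 9 * (x 0 * x 1 * x 2))"
  proof (rule rotation_invariant_polynomial_bound)
    show "finite ?V" by simp
    show "d (rot ?V g) = d g" if g: "g \<in> ?G" for g
    proof -
      have "c (rot ?V g) = c g" unfolding c_def by (rule prod_fibre_rot[OF g])
      then show ?thesis using rotC[OF g] rotnc[OF g] rot_PiE[OF g] g by (simp add: d_def)
    qed
    show "d g = 0" if "g \<in> ?G" "\<forall>u\<in>?V. \<forall>v\<in>?V. g u = g v" for g
    proof -
      have "g \<in> ?C" using ncC[OF that(1)] that(2) by blast
      then show ?thesis by (simp add: d_def)
    qed
    show "(\<Sum>g\<in>?G. d g) = 0"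
    proof -
      have "(\<Sum>g\<in>?G. d g) = (\<Sum>g\<in>?G - ?C. (if g \<in> ncompat F then c g else 0) - f)"
        unfolding d_def using fin by (intro sum.mono_neutral_cong_right) auto
      also have "\<dots> = (\<Sum>g\<in>?G - ?C. if g \<in> ncompat F then c g else 0) - real (card (?G - ?C)) * f"
        by (simp add: sum_subtractf)
      also have "(\<Sum>g\<in>?G - ?C. if g \<in> ncompat F then c g else 0) = (\<Sum>g\<in>ncompat F. c g)"
        using nc fin by (simp add: sum.inter_restrict[symmetric] Int_absorb1)
      also have "\<dots> = real (card (?G - ?C)) * f"
        unfolding f_def card_nc using big by simp
      finally show ?thesis by simp
    qed
    show "\<bar>d g\<bar> \<le> 1" for g
    proof (cases "g \<in> ncompat F")
      case True then show ?thesis using c01[OF True] f0 f1 unfolding d_def by auto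
    next
      case False then show ?thesis using f0 f1 unfolding d_def by auto
    qed
  qed
  then obtain K where K: "0 \<le> K" and bound: "\<And>x :: nat \<Rightarrow> real. (\<forall>i<3. 0 \<le> x i) \<and> x 0 + x 1 + x 2 = 1 \<Longrightarrow>
    \<bar>\<Sum>g\<in>?G. d g * (\<Prod>v\<in>?V. x (g v))\<bar> \<le>
      K * (x 0 * x 1 + x 1 * x 2 + x 2 * x 0 - 9 * (x 0 * x 1 * x 2))" by blast
  have "(\<Sum>g\<in>?G. d g * (\<Prod>v\<in>?V. x (g v))) =
      (\<Sum>g\<in>ncompat F. (\<Prod>v\<in>?V. x (g v)) * c g) + f * (\<Sum>i<3. x i ^ tsize F) - f"
    if x: "x 0 + x 1 + x 2 = 1" for x :: "nat \<Rightarrow> real"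
  proof -
    let ?X = "\<lambda>g. \<Prod>v\<in>?V. x (g v)"
    have all: "(\<Sum>g\<in>?G. ?X g) = 1"
    proof -
      have "(\<Sum>g\<in>?G. ?X g) = (\<Prod>v\<in>?V. \<Sum>i<3. x i)"
        by (rule prod_sum_PiE[symmetric]) auto
      also have "(\<Sum>i<3. x i) = 1" using x by (simp add: sum_lessThan_3)
      finally show ?thesis by simp
    qed
    have "(\<Sum>g\<in>?C. ?X g) = (\<Sum>i<3. x i ^ tsize F)"
      by (subst sum.reindex[OF inj]) (simp add: colour_def tsize_def)
    then have rest: "(\<Sum>g\<in>?G - ?C. ?X g) = 1 - (\<Sum>i<3. x i ^ tsize F)"
      using sum.subset_diff[OF C fin, of ?X] all by simp
    have "(\<Sum>g\<in>?G. d g * ?X g) = (\<Sum>g\<in>?G - ?C. (if g \<in> ncompat F then ?X g * c g else 0) - f * ?X g)"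
      unfolding d_def using fin by (intro sum.mono_neutral_cong_right) (auto simp: algebra_simps)
    also have "\<dots> = (\<Sum>g\<in>?G - ?C. if g \<in> ncompat F then ?X g * c g else 0) - f * (\<Sum>g\<in>?G - ?C. ?X g)"
      by (simp add: sum_subtractf sum_distrib_left)
    also have "(\<Sum>g\<in>?G - ?C. if g \<in> ncompat F then ?X g * c g else 0) = (\<Sum>g\<in>ncompat F. ?X g * c g)"
      using nc fin by (simp add: sum.inter_restrict[symmetric] Int_absorb1)
    finally show ?thesis unfolding rest by (simp add: algebra_simps)
  qed
  then show ?thesis using f0 f1 K bound by (intro exI[of _ f] exI[of _ K]) auto
qed

text \<open>The budget closes exactly. With \<open>q i\<close> the imbalance of part
  \<open>i\<close>, \<open>r = 1 / tsize T\<close> and \<open>m = tsize F\<close>, the error of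
  \<open>T\<close> consists of the \<open>x i ^ 3 * q i\<close>, of \<open>3/8 * G\<close> and of
  \<open>r\<close>. The recurring terms use up \<open>x i ^ m * q i + x i ^ 2 * r\<close>, the
  smaller fibres \<open>(x i ^ 3 - x i ^ m) * q i + x i * (1 - x i) * r\<close>, and the polynomial
  in the sizes \<open>3/8 * G\<close>. Hence the constant \<open>K\<close> of the parts serves for
  \<open>T\<close> as well, whatever the depth of the decomposition.\<close>

lemma hom_density_step:
  assumes P: "cyclic_partition T P" and n: "0 < tsize T" and m: "3 \<le> tsize F"
    and f01: "0 \<le> f" "f \<le> 1"
    and fl01: "\<And>g i. g \<in> ncompat F \<Longrightarrow> i < 3 \<Longrightarrow> 0 \<le> fl (fibre F g i) \<and> fl (fibre F g i) \<le> 1"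
    and Kp: "0 \<le> Kp" "\<And>x :: nat \<Rightarrow> real. (\<forall>i<3. 0 \<le> x i) \<and> x 0 + x 1 + x 2 = 1 \<Longrightarrow>
    \<bar>(\<Sum>g\<in>ncompat F. (\<Prod>v\<in>verts F. x (g v)) * (\<Prod>i<3. fl (fibre F g i))) + f * (\<Sum>i<3. x i ^ tsize F) - f\<bar> \<le>
      Kp * (x 0 * x 1 + x 1 * x 2 + x 2 * x 0 - 9 * (x 0 * x 1 * x 2))"
    and Kl: "\<And>F'. 0 \<le> Kl F'"
    and part: "\<And>F' i. tsize F' < tsize F \<Longrightarrow> i < 3 \<Longrightarrow> P i \<noteq> {} \<or> tsize F' = 0 \<Longrightarrow>
      \<bar>hom_density F' (induced T (P i)) - fl F'\<bar> \<le> Kl F' * hom_error F' (induced T (P i))"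
    and K: "(\<Sum>g\<in>ncompat F. \<Sum>i<3. Kl (fibre F g i)) \<le> K" "8/3 * Kp \<le> K" "0 \<le> K"
    and IH: "\<And>i. i < 3 \<Longrightarrow> P i \<noteq> {} \<Longrightarrow>
      \<bar>hom_density F (induced T (P i)) - f\<bar> \<le> K * hom_error F (induced T (P i))"
  shows "\<bar>hom_density F T - f\<bar> \<le> K * hom_error F T"
proof -
  define x where "x i = real (card (P i)) / real (tsize T)" for i
  define r where "r = 1 / real (tsize T)"
  define m' where "m' = tsize F"
  define T' where "T' i = induced T (P i)" for i
  define q where "q i = imbalance (T' i)" for i
  define G where "G = x 0 * x 1 + x 1 * x 2 + x 2 * x 0 - 9 * (x 0 * x 1 * x 2)"
  define X where "X g = (\<Prod>v\<in>verts F. x (g v))" for g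
  have x0: "0 \<le> x i" for i by (simp add: x_def)
  have x1: "x 0 + x 1 + x 2 = 1" unfolding x_def by (rule cyclic_partition_fracs[OF P n])
  have xle: "x i \<le> 1" if "i < 3" for i
    using lessThan_3_cases[of i] that x0[of 0] x0[of 1] x0[of 2] x1 by auto
  have q0: "0 \<le> q i" for i by (simp add: q_def imbalance_nonneg)
  have r0: "0 \<le> r" by (simp add: r_def)
  have V: "verts F \<noteq> {}" using m by (auto simp: tsize_def)
  have sz: "tsize (T' i) = card (P i)" if "i < 3" for i
    using cyclic_partitionD(1)[OF P, of i] that by (simp add: tsize_induced T'_def)
  have finP: "finite (P i)" if "i < 3" for i
    using cyclic_partitionD(1)[OF P, of i] that finite_sub by simp
  have xr: "x i * (1 / real (tsize (T' i))) = r" if "i < 3" "P i \<noteq> {}" for i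
    using that finP[OF that(1)] by (simp add: x_def r_def sz)
  have xz: "x i = 0" if "P i = {}" for i using that by (simp add: x_def)
  have err_T: "hom_error F T = (\<Sum>i<3. x i ^ 3 * q i) + 3/8 * G + r"
    unfolding hom_error_def imbalance_split[OF P n] G_def q_def T'_def x_def r_def using m by simp
  have step1: "\<bar>x i ^ m' * (hom_density F (T' i) - f)\<bar> \<le> K * (x i ^ m' * q i + x i ^ 2 * r)" if i: "i < 3" for i
  proof (cases "P i = {}")
    case True
    then show ?thesis using xz[OF True] m by (simp add: m'_def power_0_left)
  next
    case False
    have "\<bar>x i ^ m' * (hom_density F (T' i) - f)\<bar> = x i ^ m' * \<bar>hom_density F (T' i) - f\<bar>"
      using x0 by (simp add: abs_mult)
    also have "\<dots> \<le> x i ^ m' * (K * hom_error F (T' i))"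
      using IH[OF i False] x0 by (intro mult_left_mono) (auto simp: T'_def)
    also have "hom_error F (T' i) = q i + 1 / real (tsize (T' i))"
      using m by (simp add: hom_error_def q_def)
    also have "x i ^ m' * (K * (q i + 1 / real (tsize (T' i)))) =
        K * (x i ^ m' * q i + x i ^ (m' - 1) * (x i * (1 / real (tsize (T' i)))))"
      using m power_minus_mult[of m' "x i"] unfolding m'_def by (simp add: algebra_simps)
    also have "\<dots> = K * (x i ^ m' * q i + x i ^ (m' - 1) * r)" by (simp only: xr[OF i False])
    also have "\<dots> \<le> K * (x i ^ m' * q i + x i ^ 2 * r)"
      using m r0 K x0 xle[OF i] unfolding m'_def
      by (intro mult_left_mono add_left_mono mult_right_mono power_decreasing) auto
    finally show ?thesis .
  qed
  have step2: "X g * \<bar>hom_density (fibre F g i) (T' i) - fl (fibre F g i)\<bar> \<le>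
      Kl (fibre F g i) * ((x i ^ 3 - x i ^ m') * q i + x i * (1 - x i) * r)" if g: "g \<in> ncompat F" and i: "i < 3" for g i
  proof -
    define F' where "F' = fibre F g i"
    define k where "k = tsize F'"
    have gP: "g \<in> verts F \<rightarrow>\<^sub>E {..<3}" using g compat_PiE by (simp add: ncompat_def)
    obtain u v where uv: "u \<in> verts F" "v \<in> verts F" "g u \<noteq> g v" using g by (auto simp: ncompat_def)
    obtain w where w: "w \<in> verts F" "g w \<noteq> i" using uv by metis
    have k: "k < m'"
    proof -
      have "card {v \<in> verts F. g v = i} < card (verts F)" using w by (intro psubset_card_mono) auto
      then show ?thesis by (simp add: k_def F'_def m'_def tsize_def)
    qed
    have X0: "0 \<le> X g" unfolding X_def by (intro prod_nonneg) (simp add: x0)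
    have xm: "x i ^ m' \<le> x i ^ 3" using m x0 xle[OF i] unfolding m'_def by (intro power_decreasing) auto
    have rhs0: "0 \<le> Kl F' * ((x i ^ 3 - x i ^ m') * q i + x i * (1 - x i) * r)"
      using Kl q0 x0 xle[OF i] r0 xm by (intro mult_nonneg_nonneg add_nonneg_nonneg) auto
    \<comment> \<open>The factor \<open>1 - x i\<close> comes from a vertex \<open>w\<close> outside
      the fibre, \<open>x i ^ k\<close> from the fibre itself.\<close>
    have Xle: "X g \<le> x i ^ k * (1 - x i)"
    proof -
      have gw: "g w < 3" using PiE_mem[OF gP w(1)] by simp
      have A: "{v \<in> verts F. g v = i} \<subseteq> verts F - {w}" using w by auto
      have r: "0 \<le> x (g v)" "x (g v) \<le> 1" if "v \<in> verts F" for v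
        using x0 xle PiE_mem[OF gP that] by auto
      have "X g = x (g w) * (\<Prod>v\<in>verts F - {w}. x (g v))"
        unfolding X_def using w by (simp add: prod.remove)
      also have "(\<Prod>v\<in>verts F - {w}. x (g v)) = (\<Prod>v\<in>verts F - {w} - {v \<in> verts F. g v = i}. x (g v)) *
          (\<Prod>v | v \<in> verts F \<and> g v = i. x (g v))"
        using A by (intro prod.subset_diff) auto
      also have "(\<Prod>v | v \<in> verts F \<and> g v = i. x (g v)) = x i ^ k"
        by (simp add: k_def F'_def tsize_def)
      also have "x (g w) * ((\<Prod>v\<in>verts F - {w} - {v \<in> verts F. g v = i}. x (g v)) * x i ^ k) \<le>
          (1 - x i) * (1 * x i ^ k)"
      proof (intro mult_mono)
        show "x (g w) \<le> 1 - x i"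
          using lessThan_3_cases[of i] lessThan_3_cases[of "g w"] i gw w(2) x1 x0[of 0] x0[of 1] x0[of 2] by auto
        show "(\<Prod>v\<in>verts F - {w} - {v \<in> verts F. g v = i}. x (g v)) \<le> 1"
          using r by (intro prod_le_1) auto
        show "0 \<le> (\<Prod>v\<in>verts F - {w} - {v \<in> verts F. g v = i}. x (g v)) * x i ^ k"
          using r x0 by (intro mult_nonneg_nonneg prod_nonneg) auto
      qed (use xle[OF i] x0 in auto)
      finally show ?thesis by (simp add: mult.commute)
    qed
    show ?thesis
    proof (cases "k \<ge> 2")
      case False
      show ?thesis
      \<comment> \<open>Fibres with at most one vertex have density exactly \<open>fl\<close>,
        unless the vertex has to go into an empty part; then the weight \<open>X g\<close> is
        0.\<close>
      proof (cases "P i = {} \<and> k \<noteq> 0")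
        case True
        then have "X g \<le> 0" using Xle xz by (simp add: power_0_left)
        then show ?thesis using X0 rhs0 by (simp add: F'_def)
      next
        case nonempty: False
        have "\<bar>hom_density F' (T' i) - fl F'\<bar> \<le> Kl F' * hom_error F' (T' i)"
          unfolding T'_def using part[of F' i] nonempty k i by (auto simp: k_def m'_def)
        also have "hom_error F' (T' i) = 0" using False by (simp add: hom_error_def k_def)
        finally show ?thesis using rhs0 by (simp add: F'_def)
      qed
    next
      case True
      show ?thesis
      proof (cases "P i = {}")
        case empty: True
        then have "X g \<le> 0" using Xle xz True by (simp add: power_0_left)
        then show ?thesis using X0 rhs0 by (simp add: F'_def)
      next
        case nonempty: False
        define e where "e = (if 3 \<le> k then q i else 0)"
        have "\<bar>hom_density F' (T' i) - fl F'\<bar> \<le> Kl F' * hom_error F' (T' i)"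
          unfolding T'_def using part[of F' i] nonempty k i by (auto simp: k_def m'_def)
        then have "X g * \<bar>hom_density F' (T' i) - fl F'\<bar> \<le> X g * (Kl F' * hom_error F' (T' i))"
          using X0 by (rule mult_left_mono)
        also have "\<dots> \<le> (x i ^ k * (1 - x i)) * (Kl F' * hom_error F' (T' i))"
          using Xle Kl hom_error_nonneg by (intro mult_right_mono) auto
        also have "hom_error F' (T' i) = e + 1 / real (tsize (T' i))"
          using True by (simp add: hom_error_def k_def q_def e_def)
        also have "(x i ^ k * (1 - x i)) * (Kl F' * (e + 1 / real (tsize (T' i)))) =
            Kl F' * (x i ^ k * (1 - x i) * e + x i ^ (k - 1) * (1 - x i) * (x i * (1 / real (tsize (T' i)))))"
          using True power_minus_mult[of k "x i"] by (simp add: algebra_simps)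
        also have "\<dots> = Kl F' * (x i ^ k * (1 - x i) * e + x i ^ (k - 1) * (1 - x i) * r)"
          by (simp only: xr[OF i nonempty])
        also have "\<dots> \<le> Kl F' * ((x i ^ 3 - x i ^ m') * q i + x i * (1 - x i) * r)"
        proof (intro mult_left_mono add_mono mult_right_mono)
          have "x i ^ (k - 1) \<le> x i ^ 1" using True x0 xle[OF i] by (intro power_decreasing) auto
          then show "x i ^ (k - 1) \<le> x i" by simp
          show "x i ^ k * (1 - x i) * e \<le> (x i ^ 3 - x i ^ m') * q i"
          proof (cases "3 \<le> k")
            case k3: True
            \<comment> \<open>Here \<open>3 \<le> k < m'\<close>, so that \<open>m'\<close> is at
              least 4 and \<open>x i ^ m' \<le> x i ^ 4\<close>.\<close>
            have "x i ^ k * (1 - x i) \<le> x i ^ 3 * (1 - x i)"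
              using k3 x0 xle[OF i] by (intro mult_right_mono power_decreasing) auto
            also have "\<dots> = x i ^ 3 - x i ^ 4" by (simp add: algebra_simps eval_nat_numeral)
            also have "\<dots> \<le> x i ^ 3 - x i ^ m'"
              using k3 k x0 xle[OF i] by (intro diff_left_mono power_decreasing) auto
            finally show ?thesis using k3 q0 by (simp add: e_def mult_right_mono)
          next
            case False
            then show ?thesis using xm q0 by (simp add: e_def)
          qed
        qed (use r0 xle[OF i] Kl in auto)
        finally show ?thesis by (simp add: F'_def)
      qed
    qed
  qed
  have step2': "\<bar>X g * ((\<Prod>i<3. hom_density (fibre F g i) (T' i)) - (\<Prod>i<3. fl (fibre F g i)))\<bar> \<le>
      (\<Sum>i<3. Kl (fibre F g i) * ((x i ^ 3 - x i ^ m') * q i + x i * (1 - x i) * r))" if g: "g \<in> ncompat F" for g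
  proof -
    have X0: "0 \<le> X g" unfolding X_def by (intro prod_nonneg) (simp add: x0)
    have "\<bar>(\<Prod>i<3. hom_density (fibre F g i) (T' i)) - (\<Prod>i<3. fl (fibre F g i))\<bar> \<le>
        (\<Sum>i<3. \<bar>hom_density (fibre F g i) (T' i) - fl (fibre F g i)\<bar>)"
      using norm_prod_diff[of "{..<3}" "\<lambda>i. hom_density (fibre F g i) (T' i)" "\<lambda>i. fl (fibre F g i)"]
        hom_density_nonneg hom_density_le_1 fl01[OF g] by simp
    then have "X g * \<bar>(\<Prod>i<3. hom_density (fibre F g i) (T' i)) - (\<Prod>i<3. fl (fibre F g i))\<bar> \<le>
        X g * (\<Sum>i<3. \<bar>hom_density (fibre F g i) (T' i) - fl (fibre F g i)\<bar>)"
      using X0 by (rule mult_left_mono)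
    also have "\<dots> = (\<Sum>i<3. X g * \<bar>hom_density (fibre F g i) (T' i) - fl (fibre F g i)\<bar>)"
      by (rule sum_distrib_left)
    also have "\<dots> \<le> (\<Sum>i<3. Kl (fibre F g i) * ((x i ^ 3 - x i ^ m') * q i + x i * (1 - x i) * r))"
      using step2[OF g] by (intro sum_mono) auto
    finally show ?thesis using X0 by (simp add: abs_mult)
  qed
  define B where "B i = (x i ^ 3 - x i ^ m') * q i + x i * (1 - x i) * r" for i
  have B0: "0 \<le> B i" if i: "i < 3" for i
  proof -
    have "x i ^ m' \<le> x i ^ 3" using m x0 xle[OF i] unfolding m'_def by (intro power_decreasing) auto
    then show ?thesis using q0 x0 xle[OF i] r0 unfolding B_def
      by (intro mult_nonneg_nonneg add_nonneg_nonneg) auto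
  qed
  have total2: "(\<Sum>g\<in>ncompat F. \<Sum>i<3. Kl (fibre F g i) * B i) \<le> K * (\<Sum>i<3. B i)"
  proof -
    have Bi: "B i \<le> (\<Sum>i<3. B i)" if "i < 3" for i
      using B0 that by (intro member_le_sum) auto
    have "(\<Sum>g\<in>ncompat F. \<Sum>i<3. Kl (fibre F g i) * B i) \<le> (\<Sum>g\<in>ncompat F. \<Sum>i<3. Kl (fibre F g i) * (\<Sum>i<3. B i))"
      using Bi Kl by (intro sum_mono mult_left_mono) auto
    also have "\<dots> = (\<Sum>g\<in>ncompat F. \<Sum>i<3. Kl (fibre F g i)) * (\<Sum>i<3. B i)"
      by (simp add: sum_distrib_right)
    also have "\<dots> \<le> K * (\<Sum>i<3. B i)"
      using K B0 by (intro mult_right_mono sum_nonneg) auto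
    finally show ?thesis .
  qed
  have G0: "0 \<le> G"
  proof -
    define e2 where "e2 = x 0 * x 1 + x 1 * x 2 + x 2 * x 0"
    have "0 \<le> (2/3) * (1 - 3 * e2)"
      unfolding e2_def sum_le_third_pairs(2)[OF x0 x0 x0 x1, symmetric] by simp
    moreover have "0 \<le> e2" using x0 by (simp add: e2_def)
    ultimately have "0 \<le> e2 * (1 - 3 * e2)" by simp
    then show ?thesis using sum_le_third_pairs(1)[OF x0 x0 x0 x1] by (simp add: e2_def G_def)
  qed
  define S1 where "S1 = (\<Sum>i<3. x i ^ m' * (hom_density F (T' i) - f))"
  define S2 where "S2 = (\<Sum>g\<in>ncompat F. X g * ((\<Prod>i<3. hom_density (fibre F g i) (T' i)) - (\<Prod>i<3. fl (fibre F g i))))"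
  define S3 where "S3 = (\<Sum>g\<in>ncompat F. X g * (\<Prod>i<3. fl (fibre F g i))) + f * (\<Sum>i<3. x i ^ m') - f"
  have "hom_density F T - f = S1 + S2 + S3"
    unfolding hom_density_split_nonconst[OF P n V] S1_def S2_def S3_def X_def x_def T'_def m'_def
    by (simp add: algebra_simps sum_subtractf sum_distrib_left)
  moreover have "\<bar>S1\<bar> \<le> (\<Sum>i<3. K * (x i ^ m' * q i + x i ^ 2 * r))"
    unfolding S1_def using step1 by (intro order_trans[OF sum_abs] sum_mono) auto
  moreover have "\<bar>S2\<bar> \<le> K * (\<Sum>i<3. B i)"
    unfolding S2_def using step2' by (intro order_trans[OF _ total2] order_trans[OF sum_abs] sum_mono) (auto simp: B_def)
  moreover have "\<bar>S3\<bar> \<le> K * (3/8 * G)"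
  proof -
    have "\<bar>S3\<bar> \<le> Kp * G"
      unfolding S3_def X_def m'_def G_def using x0 x1 by (intro Kp(2)) auto
    also have "\<dots> \<le> K * (3/8 * G)" using mult_right_mono[OF K(2) G0] by simp
    finally show ?thesis .
  qed
  ultimately have "\<bar>hom_density F T - f\<bar> \<le>
      (\<Sum>i<3. K * (x i ^ m' * q i + x i ^ 2 * r)) + K * (\<Sum>i<3. B i) + K * (3/8 * G)" by linarith
  also have "\<dots> = K * ((\<Sum>i<3. x i ^ 3 * q i) + 3/8 * G + (x 0 + x 1 + x 2) * r)"
    unfolding B_def sum_lessThan_3 by (simp add: algebra_simps power2_eq_square)
  also have "\<dots> = K * hom_error F T" using x1 err_T by simp
  finally show ?thesis .
qed

text \<open>Outer induction on the size of \<open>F\<close>, inner induction along the decomposition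
  of \<open>T\<close>. Both \<open>f\<close> and \<open>K\<close> are fixed before the inner
  induction; that \<open>f\<close> depends on \<open>F\<close> only is what makes the limit
  unique.\<close>

lemma hom_density_near_balanced:
  "\<exists>f K. 0 \<le> f \<and> f \<le> 1 \<and> 0 \<le> K \<and> (\<forall>T. C3_decomposable T \<longrightarrow> 0 < tsize T \<longrightarrow>
     \<bar>hom_density F T - f\<bar> \<le> K * hom_error F T)"
proof (induction "tsize F" arbitrary: F rule: less_induct)
  case less
  consider "tsize F = 0" | "tsize F = 1" | "tsize F = 2" | "3 \<le> tsize F" by linarith
  then show ?case
  proof cases
    case 1
    then show ?thesis
      by (intro exI[of _ 1] exI[of _ 0]) (simp add: hom_density_tsize_0)
  next
    case 2
    then show ?thesis
      by (intro exI[of _ 1] exI[of _ 0]) (simp add: tsize_1_hom_density)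
  next
    case 3
    then show ?thesis
      by (intro exI[of _ "1/2"]) (simp add: tsize_2_hom_density hom_error_def)
  next
    case 4
    define good where "good F' f K \<longleftrightarrow> 0 \<le> f \<and> f \<le> 1 \<and> 0 \<le> K \<and> (\<forall>T. C3_decomposable T \<longrightarrow> 0 < tsize T \<longrightarrow>
       \<bar>hom_density F' T - f\<bar> \<le> K * hom_error F' T)" for F' f K
    \<comment> \<open>The values are chosen for all \<open>F'\<close>, with \<open>Kl\<close>
      nonnegative everywhere, so that sums over fibres need no side condition.\<close>
    have "\<exists>f K. (tsize F' < tsize F \<longrightarrow> good F' f K) \<and> 0 \<le> K" for F'
      using less(1)[of F'] unfolding good_def by (cases "tsize F' < tsize F") auto
    then obtain fl Kl where "\<And>F'. (tsize F' < tsize F \<longrightarrow> good F' (fl F') (Kl F')) \<and> 0 \<le> Kl F'" by metis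
    then have good: "\<And>F'. tsize F' < tsize F \<Longrightarrow> good F' (fl F') (Kl F')" and Kl: "\<And>F'. 0 \<le> Kl F'" by auto
    have small: "tsize (fibre F g i) < tsize F" if g: "g \<in> ncompat F" for g i
    proof -
      obtain u v where uv: "u \<in> verts F" "v \<in> verts F" "g u \<noteq> g v" using g by (auto simp: ncompat_def)
      obtain w where w: "w \<in> verts F" "g w \<noteq> i" using uv by metis
      then have "card {v \<in> verts F. g v = i} < card (verts F)" by (intro psubset_card_mono) auto
      then show ?thesis by (simp add: tsize_def)
    qed
    have fl01: "0 \<le> fl (fibre F g i) \<and> fl (fibre F g i) \<le> 1" if "g \<in> ncompat F" "i < 3" for g i
      using good[OF small[OF that(1)]] by (simp add: good_def)
    have m2: "2 \<le> tsize F" using 4 by simp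
    obtain f Kp where fK: "0 \<le> f \<and> f \<le> 1 \<and> 0 \<le> Kp \<and> (\<forall>x :: nat \<Rightarrow> real. (\<forall>i<3. 0 \<le> x i) \<and> x 0 + x 1 + x 2 = 1 \<longrightarrow>
        \<bar>(\<Sum>g\<in>ncompat F. (\<Prod>v\<in>verts F. x (g v)) * (\<Prod>i<3. fl (fibre F g i))) + f * (\<Sum>i<3. x i ^ tsize F) - f\<bar> \<le>
        Kp * (x 0 * x 1 + x 1 * x 2 + x 2 * x 0 - 9 * (x 0 * x 1 * x 2)))"
    proof (rule exE[OF colouring_polynomial_bound[where fl = fl, OF m2]])
      show "0 \<le> fl (fibre F g i) \<and> fl (fibre F g i) \<le> 1" if "g \<in> ncompat F" "i < 3" for g i
        using that by (rule fl01)
    qed (elim exE, rule that)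
    then have f: "0 \<le> f" "f \<le> 1" and Kp: "0 \<le> Kp" by blast+
    note bound = fK[THEN conjunct2, THEN conjunct2, THEN conjunct2, rule_format]
    define C where "C = (\<Sum>g\<in>ncompat F. \<Sum>i<3. Kl (fibre F g i))"
    have C: "0 \<le> C" unfolding C_def using Kl by (intro sum_nonneg) auto
    \<comment> \<open>The 1 settles single vertices, \<open>C\<close> the smaller fibres, and
      \<open>8/3 * Kp\<close> the polynomial in the sizes, which is paid from the gain
      \<open>3/8 * G\<close> of the imbalance.\<close>
    define K where "K = 1 + C + 8/3 * Kp"
    have K: "1 \<le> K" using C Kp by (simp add: K_def)
    \<comment> \<open>An empty part is not covered by \<open>good\<close>; the value at the empty
      tournament is recovered by testing on a single vertex.\<close>
    have zero: "fl F' = 1" if "tsize F' = 0" for F'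
    proof -
      have "C3_decomposable (transitive_tournament 1)" by (rule C3_decomposable.small) (simp add: tsize_def)
      moreover have "0 < tsize (transitive_tournament 1)" by (simp add: tsize_def)
      ultimately have "\<bar>hom_density F' (transitive_tournament 1) - fl F'\<bar> \<le> Kl F' * hom_error F' (transitive_tournament 1)"
        using good[of F'] that 4 unfolding good_def by auto
      then show ?thesis using that by (simp add: hom_density_tsize_0 hom_error_def)
    qed
    have "0 < tsize T \<longrightarrow> \<bar>hom_density F T - f\<bar> \<le> K * hom_error F T" if "C3_decomposable T" for T
      using that
    proof (induction rule: C3_decomposable.induct)
      case (small T)
      show ?case
      proof
        assume "0 < tsize T"
        then have n: "tsize T = 1" using small by simp
        have "\<bar>hom_density F T - f\<bar> \<le> 1" using f hom_density_nonneg[of F T] hom_density_le_1[of F T] by linarith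
        also have "1 \<le> K * hom_error F T"
        proof -
          have "1 * 1 \<le> K * hom_error F T"
            using K n 4 imbalance_nonneg[of T] by (intro mult_mono) (auto simp: hom_error_def)
          then show ?thesis by simp
        qed
        finally show "\<bar>hom_density F T - f\<bar> \<le> K * hom_error F T" .
      qed
    next
      case (step T A B C')
      define P where "P i = (if i = 0 then A else if i = 1 then B else C')" for i :: nat
      have P: "cyclic_partition T P"
        using cyclic_triple_partition[OF step(2)] unfolding P_def .
      have decP: "C3_decomposable (induced T (P i))" for i using step by (simp add: P_def)
      have posP: "0 < tsize (induced T (P i))" if "i < 3" "P i \<noteq> {}" for i
        using that cyclic_partitionD(1)[OF P, of i] finite_sub[of "P i" T] by (simp add: tsize_induced card_gt_0_iff)
      have IH: "\<bar>hom_density F (induced T (P i)) - f\<bar> \<le> K * hom_error F (induced T (P i))"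
        if "i < 3" "P i \<noteq> {}" for i
        using posP[OF that] step.IH by (auto simp: P_def)
      show ?case
      proof
        assume n: "0 < tsize T"
        show "\<bar>hom_density F T - f\<bar> \<le> K * hom_error F T"
        proof (rule hom_density_step[OF P n 4 f fl01 Kp bound Kl])
          fix F' and i :: nat assume F': "tsize F' < tsize F" and i: "i < 3" and ne: "P i \<noteq> {} \<or> tsize F' = 0"
          show "\<bar>hom_density F' (induced T (P i)) - fl F'\<bar> \<le> Kl F' * hom_error F' (induced T (P i))"
          proof (cases "P i = {}")
            case True
            then have "tsize F' = 0" using ne by simp
            then show ?thesis using zero Kl hom_error_nonneg by (simp add: hom_density_tsize_0)
          next
            case False
            then show ?thesis using good[OF F'] decP posP[OF i] unfolding good_def by blast
          qed
        next
          show "(\<Sum>g\<in>ncompat F. \<Sum>i<3. Kl (fibre F g i)) \<le> K" using Kp by (simp add: K_def C_def)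
          show "8/3 * Kp \<le> K" using C by (simp add: K_def)
          show "0 \<le> K" using K by simp
        qed (use IH in auto)
      qed
    qed
    then show ?thesis using f K by (intro exI[of _ f] exI[of _ K]) auto
  qed
qed

section \<open>Positive homomorphisms and sampling\<close>

lemma class_of_exists: obtains T where "H = class_of T"
  by (metis Quotient3_abs_rep Quotient3_tclass)

lemma tdensity_nonneg: "0 \<le> tdensity F H"
  by (rule class_of_exists[of H]) (simp add: tdensity.abs_eq tdensity_raw_def)

lemma card_copies_le:
  assumes X: "X \<subseteq> verts T" shows "card (copies T F X) \<le> card X choose csize F"
proof -
  have "card (copies T F X) \<le> card {W. W \<subseteq> X \<and> card W = csize F}"
    using card_copies[OF X] finite_sub[OF X] by (intro card_mono) (auto simp: copies_def)
  then show ?thesis using finite_sub[OF X] by (simp add: n_subsets)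
qed

lemma tdensity_le_1: "tdensity F H \<le> 1"
proof (rule class_of_exists[of H])
  fix T assume H: "H = class_of T"
  have "tdensity F H = real (card (copies T F (verts T))) / real (card (verts T) choose csize F)"
    unfolding H using tdensity_avg[of "verts T" T F] by (simp add: avg_def)
  also have "\<dots> \<le> 1"
    using card_copies_le[of "verts T" T F] by (auto simp: divide_le_eq_1)
  finally show ?thesis .
qed

text \<open>For \<open>a, b \<le> n\<close>, the probability that a random \<open>b\<close>-subset
  of an \<open>n\<close>-set meets a fixed \<open>a\<close>-subset.\<close>

definition overlap :: "nat \<Rightarrow> nat \<Rightarrow> nat \<Rightarrow> real" where
  "overlap a b n = 1 - real ((n - a) choose b) / real (n choose b)"

lemma overlap_tendsto: "(\<lambda>n. overlap a b n) \<longlonglongrightarrow> 0"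
proof -
  let ?r = "\<lambda>s. fact b * real (s choose b) / real s ^ b"
  have lim: "filterlim (\<lambda>n. n - a) at_top sequentially"
    by (rule filterlim_minus_const_nat_at_top)
  have 1: "(\<lambda>n. ?r (n - a)) \<longlonglongrightarrow> 1" by (rule falling_ratio_tendsto[OF lim])
  have 2: "(\<lambda>n. ?r n) \<longlonglongrightarrow> 1" by (rule falling_ratio_tendsto[OF filterlim_ident])
  have "(\<lambda>n. 1 - real a / real n) \<longlonglongrightarrow> 1 - 0"
    by (intro tendsto_diff tendsto_const lim_const_over_n)
  then have "(\<lambda>n. ?r (n - a) / ?r n * (1 - real a / real n) ^ b) \<longlonglongrightarrow> 1 / 1 * (1 - 0) ^ b"
    by (intro tendsto_mult tendsto_divide tendsto_power 1 2) auto
  then have "(\<lambda>n. real ((n - a) choose b) / real (n choose b)) \<longlonglongrightarrow> 1 / 1 * (1 - 0) ^ b"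
  proof (rule Lim_transform_eventually)
    show "\<forall>\<^sub>F n in sequentially. ?r (n - a) / ?r n * (1 - real a / real n) ^ b =
        real ((n - a) choose b) / real (n choose b)"
    proof (rule eventually_sequentiallyI[of "a + 1"])
      fix n assume n: "a + 1 \<le> n"
      have "1 - real a / real n = real (n - a) / real n" using n by (simp add: of_nat_diff diff_divide_distrib)
      moreover have "real (n - a) \<noteq> 0" "real n \<noteq> 0" using n by auto
      ultimately show "?r (n - a) / ?r n * (1 - real a / real n) ^ b =
        real ((n - a) choose b) / real (n choose b)"
        by (simp add: power_divide)
    qed
  qed
  then show ?thesis unfolding overlap_def using tendsto_diff[OF tendsto_const, of _ 1 sequentially 1] by simp
qed

text \<open>Conditioning a uniform choice among \<open>M'\<close> sets on a family of
  \<open>M\<close> of them changes the probability of an event by at most that of the complement;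
  \<open>D\<close> counts the event inside the family, \<open>E\<close> outside.\<close>

lemma ratio_diff_bound:
  fixes D E M M' :: real
  assumes "0 \<le> D" "D \<le> M" "0 < M" "M \<le> M'" "0 \<le> E" "E \<le> M' - M"
  shows "\<bar>D / M - (D + E) / M'\<bar> \<le> 1 - M / M'"
proof -
  have M': "0 < M'" using assms by linarith
  have MM: "0 \<le> 1 - M / M'" using assms M' by simp
  define p where "p = D / M * (1 - M / M')"
  define e where "e = E / M'"
  have eq: "D / M - (D + E) / M' = p - e"
    unfolding p_def e_def using assms M' by (simp add: field_simps)
  have "0 \<le> p" unfolding p_def using assms MM by (intro mult_nonneg_nonneg) auto
  moreover have "p \<le> 1 * (1 - M / M')"
    unfolding p_def using assms MM by (intro mult_right_mono) auto
  moreover have "0 \<le> e" unfolding e_def using assms M' by simp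
  moreover have "e \<le> 1 - M / M'"
  proof -
    have "e \<le> (M' - M) / M'" unfolding e_def using assms M' by (intro divide_right_mono) auto
    then show ?thesis using M' by (simp add: diff_divide_distrib)
  qed
  ultimately show ?thesis unfolding eq by simp
qed

text \<open>Choosing the second set without avoiding the first changes the probability by at most
  that of an intersection. This is why densities become multiplicative in the limit.\<close>

lemma tdensity2_approx:
  assumes l: "csize F + csize G \<le> csize H"
  shows "\<bar>tdensity2 F G H - tdensity F H * tdensity G H\<bar> \<le> overlap (csize F) (csize G) (csize H)"
proof (rule class_of_exists[of H])
  fix T assume H: "H = class_of T"
  let ?V = "verts T" let ?n = "card (verts T)"
  have n: "csize H = ?n" by (simp add: H tsize_def)
  define p where "p = tdensity G H"
  define e where "e = overlap (csize F) (csize G) ?n"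
  have pG: "tdensity G H = real (card (copies T G ?V)) / real (?n choose csize G)"
    unfolding H using tdensity_avg[of ?V T G] by (simp add: avg_def)
  have close: "\<bar>avg T G (\<lambda>_. 1) (?V - W) - p\<bar> \<le> e" if W: "W \<in> copies T F ?V" for W
  proof -
    have WV: "W \<subseteq> ?V" "card W = csize F" using W card_copies[of ?V T W F] by (auto simp: copies_def)
    have cW: "card (?V - W) = ?n - csize F"
      using WV finite_subset[OF WV(1)] by (simp add: card_Diff_subset)
    define D where "D = real (card (copies T G (?V - W)))"
    define E where "E = real (card (copies T G ?V - copies T G (?V - W)))"
    have sub: "copies T G (?V - W) \<subseteq> copies T G ?V" by (auto simp: copies_def)
    have DE: "real (card (copies T G ?V)) = D + E"
      unfolding D_def E_def using sub finite_copies[of ?V T G]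
      by (simp add: card_Diff_subset finite_subset card_mono of_nat_diff)
    have D: "D \<le> real ((?n - csize F) choose csize G)"
      unfolding D_def using card_copies_le[of "?V - W" T G] cW by simp
    have E: "E \<le> real (?n choose csize G) - real ((?n - csize F) choose csize G)"
    proof -
      let ?S = "\<lambda>X. {U. U \<subseteq> X \<and> card U = csize G}"
      have "card (copies T G ?V - copies T G (?V - W)) \<le> card (?S ?V - ?S (?V - W))"
        using card_copies[of ?V T _ G] by (intro card_mono) (auto simp: copies_def)
      also have "\<dots> = card (?S ?V) - card (?S (?V - W))"
        by (intro card_Diff_subset) auto
      also have "card (?S ?V) = ?n choose csize G" by (simp add: n_subsets)
      also have "card (?S (?V - W)) = (?n - csize F) choose csize G"
        using cW by (simp add: n_subsets)
      finally have "real (card (copies T G ?V - copies T G (?V - W))) \<le>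
          real ((?n choose csize G) - ((?n - csize F) choose csize G))" by (rule of_nat_mono)
      then show ?thesis unfolding E_def by (simp add: of_nat_diff binomial_right_mono)
    qed
    have "0 < real ((?n - csize F) choose csize G)" using l n by simp
    then have "\<bar>D / real ((?n - csize F) choose csize G) - (D + E) / real (?n choose csize G)\<bar> \<le> e"
      unfolding e_def overlap_def using D E
      by (intro ratio_diff_bound) (auto simp: D_def E_def binomial_right_mono)
    then show ?thesis using cW by (simp add: avg_def p_def pG DE D_def[symmetric])
  qed
  have C: "real (?n choose csize F) > 0" using l n by simp
  have "tdensity2 F G H = avg T F (avg T G (\<lambda>_. 1)) ?V"
    unfolding H using tdensity2_avg[of ?V T F G] by simp
  moreover have "tdensity F H * p = (\<Sum>W\<in>copies T F ?V. p) / real (?n choose csize F)"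
    unfolding H using tdensity_avg[of ?V T F] by (simp add: avg_def)
  ultimately have "tdensity2 F G H - tdensity F H * p =
      (\<Sum>W\<in>copies T F ?V. avg T G (\<lambda>_. 1) (?V - W) - p) / real (?n choose csize F)"
    unfolding avg_def[of T F] by (simp add: sum_subtractf diff_divide_distrib)
  also have "\<bar>\<dots>\<bar> \<le> (real (card (copies T F ?V)) * e) / real (?n choose csize F)"
  proof -
    have "\<bar>\<Sum>W\<in>copies T F ?V. avg T G (\<lambda>_. 1) (?V - W) - p\<bar> \<le> (\<Sum>W\<in>copies T F ?V. e)"
      using close by (intro order_trans[OF sum_abs] sum_mono)
    then show ?thesis using C by (simp add: divide_right_mono abs_divide)
  qed
  also have "\<dots> \<le> e"
  proof -
    have "0 \<le> e" unfolding e_def overlap_def using l n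
      by (simp add: divide_le_eq_1 binomial_right_mono)
    then have "real (card (copies T F ?V)) * e \<le> real (?n choose csize F) * e"
      using card_copies_le[of ?V T F] by (intro mult_right_mono) auto
    then show ?thesis using C by (simp add: divide_le_eq mult.commute)
  qed
  finally show ?thesis by (simp add: p_def e_def n)
qed

section \<open>Limits of convergent sequences are positive homomorphisms\<close>

lemma abs_flag_cases: obtains f where "x = abs_flag_algebra f"
  by (metis Quotient3_abs_rep Quotient3_flag_algebra)

lemma abs_flag_eq_lext: "abs_flag_algebra f = lext flag f"
proof -
  have "abs_flag_algebra (lext gen f) = lext flag f"
    unfolding lext_def flag_def by (simp add: abs_flag_sum scaleR_abs_flag)
  then show ?thesis by (simp add: lext_id)
qed

lemma linear_flag_eqI:
  assumes "linear \<phi>" "linear \<psi>" "\<And>F. \<phi> (flag F) = \<psi> (flag F)"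
  shows "\<phi> = (\<psi> :: flag_algebra \<Rightarrow> real)"
proof
  fix x
  show "\<phi> x = \<psi> x"
    by (rule abs_flag_cases[of x])
      (simp add: abs_flag_eq_lext linear_comp_lext[OF assms(1)] linear_comp_lext[OF assms(2)] assms(3))
qed

lemma tconverges_unique:
  assumes "\<phi> \<in> pos_homs" "\<psi> \<in> pos_homs" "tconverges Ts \<phi>" "tconverges Ts \<psi>"
  shows "\<phi> = \<psi>"
proof (rule linear_flag_eqI)
  show "linear \<phi>" "linear \<psi>" using assms by (auto simp: pos_homs_def)
  show "\<phi> (flag F) = \<psi> (flag F)" for F
    using assms(3,4) LIMSEQ_unique unfolding tconverges_def by blast
qed

lemma strictly_increasing_sizes:
  assumes "\<And>n. tsize (Ts n) < tsize (Ts (Suc n))"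
  shows "filterlim (\<lambda>n. tsize (Ts n)) at_top sequentially"
  using assms by (intro filterlim_subseq strict_monoI_Suc)

lemma tconverges_sizes:
  "tconverges Ts \<phi> \<Longrightarrow> filterlim (\<lambda>n. tsize (Ts n)) at_top sequentially"
  by (intro strictly_increasing_sizes) (simp add: tconverges_def)

lemma lext_tendsto:
  assumes "\<And>a. (\<lambda>n. h n a) \<longlonglongrightarrow> (L a :: real)"
  shows "(\<lambda>n. lext (h n) f) \<longlonglongrightarrow> lext L f"
  unfolding lext_def by (intro tendsto_sum tendsto_scaleR tendsto_const assms)

lemma opl_verts: "opl T f (\<lambda>_. 1) (verts T) = lext (\<lambda>F. tdensity F (class_of T)) f"
  unfolding opl_def using tdensity_avg[of "verts T" T] by simp

text \<open>The limits of the densities extend linearly. The extension respects the relations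
  because these vanish on all large tournaments, and it is multiplicative because joint densities
  approach products.\<close>

lemma convergent_sequence_limit:
  assumes inc: "\<And>n. tsize (Ts n) < tsize (Ts (Suc n))"
    and conv: "\<And>F. convergent (\<lambda>n. tdensity F (class_of (Ts n)))"
  obtains \<phi> where "\<phi> \<in> pos_homs" "tconverges Ts \<phi>"
proof -
  define L where "L F = lim (\<lambda>n. tdensity F (class_of (Ts n)))" for F
  have L: "(\<lambda>n. tdensity F (class_of (Ts n))) \<longlonglongrightarrow> L F" for F
    using conv unfolding L_def by (simp add: convergent_LIMSEQ_iff)
  have sizes: "filterlim (\<lambda>n. tsize (Ts n)) at_top sequentially"
    by (rule strictly_increasing_sizes) (rule inc)
  have large_ev: "\<forall>\<^sub>F n in sequentially. P (Ts n) (verts (Ts n))" if large: "large P" for P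
  proof -
    obtain l where l: "\<And>T X. X \<subseteq> verts T \<Longrightarrow> l \<le> card X \<Longrightarrow> P T X" using large by blast
    have "\<forall>\<^sub>F n in sequentially. l \<le> tsize (Ts n)"
      using sizes by (simp add: filterlim_at_top)
    then show ?thesis by (rule eventually_mono) (use l in \<open>simp add: tsize_def\<close>)
  qed
  define \<phi> where "\<phi> x = lext L (rep_flag_algebra x)" for x
  have \<phi>: "\<phi> (abs_flag_algebra f) = lext L f" for f
  proof -
    have "rep_flag_algebra (abs_flag_algebra f) - f \<in> density_relations"
      using Quotient3_rel_rep Quotient3_abs_rep[OF Quotient3_flag_algebra] Quotient3_flag_algebra
      by (metis flag_algebra.abs_eq_iff)
    then have ev: "\<forall>\<^sub>F n in sequentially. opl (Ts n) (rep_flag_algebra (abs_flag_algebra f)) (\<lambda>_. 1) (verts (Ts n)) =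
        opl (Ts n) f (\<lambda>_. 1) (verts (Ts n))"
      by (intro large_ev) (simp add: density_relations_diff_iff)
    have lim: "(\<lambda>n. opl (Ts n) g (\<lambda>_. 1) (verts (Ts n))) \<longlonglongrightarrow> lext L g" for g
      unfolding opl_verts by (intro lext_tendsto L)
    show ?thesis unfolding \<phi>_def
      by (rule LIMSEQ_unique[OF Lim_transform_eventually[OF lim ev] lim])
  qed
  have flag: "\<phi> (flag F) = L F" for F by (simp add: flag_def \<phi>)
  have lin: "linear \<phi>"
  proof (rule linearI)
    fix x y :: flag_algebra and c :: real
    obtain f where f: "x = abs_flag_algebra f" by (rule abs_flag_cases)
    obtain g where g: "y = abs_flag_algebra g" by (rule abs_flag_cases)
    show "\<phi> (x + y) = \<phi> x + \<phi> y"
      unfolding f g plus_flag_algebra.abs_eq \<phi> by (rule linear_add[OF linear_lext])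
    show "\<phi> (c *\<^sub>R x) = c *\<^sub>R \<phi> x"
      unfolding f scaleR_flag_algebra.abs_eq \<phi> by (rule linear_scale[OF linear_lext])
  qed
  have mult: "\<phi> (x * y) = \<phi> x * \<phi> y" for x y
  proof -
    obtain f where f: "x = abs_flag_algebra f" by (rule abs_flag_cases)
    obtain g where g: "y = abs_flag_algebra g" by (rule abs_flag_cases)
    have t2: "(\<lambda>n. tdensity2 F G (class_of (Ts n))) \<longlonglongrightarrow> L F * L G" for F G
    proof -
      have "(\<lambda>n. overlap (csize F) (csize G) (tsize (Ts n))) \<longlonglongrightarrow> 0"
        using filterlim_compose[OF overlap_tendsto sizes] .
      moreover have "\<forall>\<^sub>F n in sequentially. csize F + csize G \<le> tsize (Ts n)"
        using sizes by (simp add: filterlim_at_top)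
      then have "\<forall>\<^sub>F n in sequentially. norm (tdensity2 F G (class_of (Ts n)) -
          tdensity F (class_of (Ts n)) * tdensity G (class_of (Ts n))) \<le> overlap (csize F) (csize G) (tsize (Ts n))"
      proof (rule eventually_mono)
        fix n assume "csize F + csize G \<le> tsize (Ts n)"
        then show "norm (tdensity2 F G (class_of (Ts n)) - tdensity F (class_of (Ts n)) * tdensity G (class_of (Ts n)))
            \<le> overlap (csize F) (csize G) (tsize (Ts n))"
          using tdensity2_approx[of F G "class_of (Ts n)"] by simp
      qed
      ultimately have "(\<lambda>n. tdensity2 F G (class_of (Ts n)) -
          tdensity F (class_of (Ts n)) * tdensity G (class_of (Ts n))) \<longlonglongrightarrow> 0"
        by (rule Lim_null_comparison[rotated])
      from tendsto_add[OF this tendsto_mult[OF L[of F] L[of G]]] show ?thesis by simp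
    qed
    have "(\<lambda>n. lext (\<lambda>F. lext (\<lambda>G. tdensity2 F G (class_of (Ts n))) g) f) \<longlonglongrightarrow> lext (\<lambda>F. lext (\<lambda>G. L F * L G) g) f"
      by (intro lext_tendsto t2)
    moreover have "opl T f (opl T g (\<lambda>_. 1)) (verts T) = lext (\<lambda>F. lext (\<lambda>G. tdensity2 F G (class_of T)) g) f" for T
      unfolding opl_def avg_lext using tdensity2_avg[of "verts T" T] by simp
    ultimately have "(\<lambda>n. opl (Ts n) f (opl (Ts n) g (\<lambda>_. 1)) (verts (Ts n))) \<longlonglongrightarrow> lext (\<lambda>F. lext (\<lambda>G. L F * L G) g) f"
      by simp
    moreover have "\<forall>\<^sub>F n in sequentially. opl (Ts n) f (opl (Ts n) g (\<lambda>_. 1)) (verts (Ts n)) =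
        opl (Ts n) (formal_mult f g) (\<lambda>_. 1) (verts (Ts n))"
      by (rule eventually_mono[OF large_ev[OF opl_formal_mult[of f g]]]) simp
    ultimately have "(\<lambda>n. opl (Ts n) (formal_mult f g) (\<lambda>_. 1) (verts (Ts n))) \<longlonglongrightarrow> lext (\<lambda>F. lext (\<lambda>G. L F * L G) g) f"
      by (rule Lim_transform_eventually)
    moreover have "(\<lambda>n. opl (Ts n) (formal_mult f g) (\<lambda>_. 1) (verts (Ts n))) \<longlonglongrightarrow> lext L (formal_mult f g)"
      unfolding opl_verts by (intro lext_tendsto L)
    ultimately have "lext L (formal_mult f g) = lext (\<lambda>F. lext (\<lambda>G. L F * L G) g) f"
      by (rule LIMSEQ_unique[rotated])
    also have "\<dots> = lext L f * lext L g"
    proof -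
      have "lext (\<lambda>G. c * L G) g = c * lext L g" for c
        by (simp add: lext_def sum_distrib_left mult_ac)
      moreover have "lext (\<lambda>F. L F * c) f = lext L f * c" for c
        unfolding lext_def sum_distrib_right by (simp add: mult_ac)
      ultimately show ?thesis by simp
    qed
    finally show ?thesis unfolding f g times_flag_algebra.abs_eq \<phi> .
  qed
  have one: "\<phi> 1 = 1"
  proof -
    have "tdensity (class_of empty_tournament) (class_of T) = 1" for T
      using tdensity_avg[of "verts T" T "class_of empty_tournament"] by (simp add: avg_empty)
    then have "(\<lambda>n. 1) \<longlonglongrightarrow> L (class_of empty_tournament)" using L[of "class_of empty_tournament"] by simp
    then have "L (class_of empty_tournament) = 1" by (simp add: LIMSEQ_const_iff)
    then show ?thesis by (simp add: flag_empty[symmetric] flag)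
  qed
  have "0 \<le> L F" for F using LIMSEQ_le_const[OF L] tdensity_nonneg by blast
  moreover have "L F \<le> 1" for F using LIMSEQ_le_const2[OF L] tdensity_le_1 by blast
  ultimately have "\<phi> \<in> pos_homs" using lin mult one flag by (simp add: pos_homs_def)
  moreover have "tconverges Ts \<phi>" using inc L flag by (simp add: tconverges_def)
  ultimately show ?thesis by (rule that)
qed

text \<open>The values of \<open>\<phi>\<close> on the flags of size \<open>l\<close> form a probability distribution; under it the density of
  each \<open>F\<close> has mean \<open>\<phi> F\<close> and vanishing variance, because \<open>\<phi>\<close> is multiplicative.\<close>

lemma pos_hom_sampling:
  assumes \<phi>: "\<phi> \<in> pos_homs"
  obtains Ts where "tconverges Ts \<phi>" "\<And>n. 0 < \<phi> (flag (class_of (Ts n)))"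
proof -
  have lin: "linear \<phi>" and one: "\<phi> 1 = 1" and mult: "\<And>x y. \<phi> (x * y) = \<phi> x * \<phi> y"
    and pos: "\<And>F. 0 \<le> \<phi> (flag F)" using \<phi> by (auto simp: pos_homs_def)
  define w where "w H = \<phi> (flag H)" for H
  have w0: "0 \<le> w H" for H by (simp add: w_def pos)
  have sum1: "(\<Sum>H | csize H = l. w H * tdensity F H) = w F" if "csize F \<le> l" for F l
    unfolding w_def
    using arg_cong[OF flag_relation[OF that], of \<phi>]
    by (simp add: linear_sum[OF lin] linear_scale[OF lin] mult.commute)
  have sum2: "(\<Sum>H | csize H = l. w H * tdensity2 F F H) = w F * w F" if "csize F + csize F \<le> l" for F l
    unfolding w_def mult[symmetric]
    by (subst flag_mult[OF that]) (simp add: linear_sum[OF lin] linear_scale[OF lin] mult.commute)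
  have sum0: "(\<Sum>H | csize H = l. w H) = 1" for l
  proof -
    have "tdensity (class_of empty_tournament) H = 1" for H
    proof -
      obtain T where "H = class_of T" by (rule class_of_exists)
      then show ?thesis
        using tdensity_avg[of "verts T" T "class_of empty_tournament"] by (simp add: avg_empty)
    qed
    then show ?thesis using sum1[of "class_of empty_tournament" l] one
      by (simp add: tsize_def w_def flag_empty)
  qed
  \<comment> \<open>The second moment comes from \<open>sum2\<close>, that is, from
    multiplicativity; replacing the square of a density by \<open>tdensity2\<close> costs only the
    overlap.\<close>
  have var: "(\<Sum>H | csize H = l. w H * (tdensity F H - w F)\<^sup>2) \<le> overlap (csize F) (csize F) l"
    if l: "csize F + csize F \<le> l" for F l
  proof -
    let ?e = "overlap (csize F) (csize F) l"
    have "(\<Sum>H | csize H = l. w H * (tdensity F H - w F)\<^sup>2) \<le>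
        (\<Sum>H | csize H = l. w H * (tdensity2 F F H + ?e - 2 * w F * tdensity F H + w F * w F))"
    proof (intro sum_mono mult_left_mono w0)
      fix H assume "H \<in> {H. csize H = l}"
      then have "\<bar>tdensity2 F F H - tdensity F H * tdensity F H\<bar> \<le> ?e" using tdensity2_approx[of F F H] l by simp
      then show "(tdensity F H - w F)\<^sup>2 \<le> tdensity2 F F H + ?e - 2 * w F * tdensity F H + w F * w F"
        by (simp add: power2_eq_square algebra_simps)
    qed
    also have "\<dots> = (\<Sum>H | csize H = l. w H * tdensity2 F F H) + ?e * (\<Sum>H | csize H = l. w H)
        - 2 * w F * (\<Sum>H | csize H = l. w H * tdensity F H) + w F * w F * (\<Sum>H | csize H = l. w H)"
      by (simp add: algebra_simps sum.distrib sum_subtractf sum_distrib_left)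
    also have "\<dots> = ?e" using sum0 sum1[of F l] sum2[OF l] l by simp
    finally show ?thesis .
  qed
  define S where "S k = {F. csize F \<le> k}" for k
  have finS: "finite (S k)" for k
  proof -
    have "S k = (\<Union>l\<le>k. {F. csize F = l})" by (auto simp: S_def)
    then show ?thesis by (simp add: finite_classes)
  qed
  have ex: "\<exists>T. N < tsize T \<and> 0 < w (class_of T) \<and>
      (\<forall>F\<in>S k. (tdensity F (class_of T) - w F)\<^sup>2 \<le> 1 / real (Suc k))" for N k
  proof -
    have "(\<lambda>l. \<Sum>F\<in>S k. overlap (csize F) (csize F) l) \<longlonglongrightarrow> (\<Sum>F\<in>S k. 0)"
      by (intro tendsto_sum overlap_tendsto)
    then have "\<forall>\<^sub>F l in sequentially. (\<Sum>F\<in>S k. overlap (csize F) (csize F) l) < 1 / real (Suc k)"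
      by (rule order_tendstoD) simp
    moreover have "\<forall>\<^sub>F l in sequentially. max (Suc N) (k + k) \<le> l" by (rule eventually_ge_at_top)
    ultimately have "\<forall>\<^sub>F l in sequentially. (\<Sum>F\<in>S k. overlap (csize F) (csize F) l) < 1 / real (Suc k) \<and>
        max (Suc N) (k + k) \<le> l" by (rule eventually_conj)
    then obtain l where l: "(\<Sum>F\<in>S k. overlap (csize F) (csize F) l) < 1 / real (Suc k)" "Suc N \<le> l" "k + k \<le> l"
      by (auto simp: eventually_sequentially)
    define V where "V H = (\<Sum>F\<in>S k. (tdensity F H - w F)\<^sup>2)" for H
    have "(\<Sum>H | csize H = l. w H * V H) = (\<Sum>F\<in>S k. \<Sum>H | csize H = l. w H * (tdensity F H - w F)\<^sup>2)"
      unfolding V_def sum_distrib_left by (rule sum.swap)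
    also have "\<dots> \<le> (\<Sum>F\<in>S k. overlap (csize F) (csize F) l)"
      using l(3) by (intro sum_mono var) (auto simp: S_def)
    also have "\<dots> < 1 / real (Suc k)" by (rule l(1))
    finally have less: "(\<Sum>H | csize H = l. w H * V H) < 1 / real (Suc k)" .
    \<comment> \<open>If the weighted mean of \<open>V\<close> is below \<open>1 / Suc k\<close>,
      some \<open>H\<close> of positive weight satisfies the bound; the positivity later excludes
      flags of density 0.\<close>
    have "\<exists>H. csize H = l \<and> 0 < w H \<and> V H \<le> 1 / real (Suc k)"
    proof (rule ccontr)
      assume neg: "\<not> ?thesis"
      have "1 / real (Suc k) * (\<Sum>H | csize H = l. w H) \<le> (\<Sum>H | csize H = l. w H * V H)"
        unfolding sum_distrib_left
      proof (rule sum_mono)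
        fix H assume H: "H \<in> {H. csize H = l}"
        show "1 / real (Suc k) * w H \<le> w H * V H"
        proof (cases "w H = 0")
          case False
          then have "0 < w H" using w0[of H] by simp
          then have "1 / real (Suc k) < V H" using neg H by fastforce
          then show ?thesis using w0[of H] mult_left_mono[of "1 / real (Suc k)" "V H" "w H"] by (simp add: mult.commute)
        qed simp
      qed
      then show False using less sum0[of l] by simp
    qed
    then obtain H where H: "csize H = l" "0 < w H" "V H \<le> 1 / real (Suc k)" by blast
    obtain T where T: "H = class_of T" by (rule class_of_exists)
    have "(tdensity F H - w F)\<^sup>2 \<le> 1 / real (Suc k)" if F: "F \<in> S k" for F
    proof -
      have "(tdensity F H - w F)\<^sup>2 \<le> V H" unfolding V_def using finS F by (intro member_le_sum) auto
      then show ?thesis using H(3) by linarith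
    qed
    then show ?thesis using H l(2) T by (intro exI[of _ T]) auto
  qed
  define Q where "Q k T \<longleftrightarrow> 0 < w (class_of T) \<and> (\<forall>F\<in>S k. (tdensity F (class_of T) - w F)\<^sup>2 \<le> 1 / real (Suc k))" for k T
  have exQ: "\<exists>T. Q k T \<and> N < tsize T" for N k using ex unfolding Q_def by blast
  then have "\<exists>Ts. \<forall>n. Q n (Ts n) \<and> tsize (Ts n) < tsize (Ts (Suc n))"
    by (intro dependent_nat_choice) blast+
  then obtain Ts where Ts: "\<And>n. Q n (Ts n)" "\<And>n. tsize (Ts n) < tsize (Ts (Suc n))" by blast
  have "(\<lambda>n. tdensity F (class_of (Ts n))) \<longlonglongrightarrow> \<phi> (flag F)" for F
  proof -
    have "(\<lambda>n. (tdensity F (class_of (Ts n)) - w F)\<^sup>2) \<longlonglongrightarrow> 0"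
    proof (rule Lim_null_comparison)
      show "\<forall>\<^sub>F n in sequentially. norm ((tdensity F (class_of (Ts n)) - w F)\<^sup>2) \<le> 1 / real (Suc n)"
      proof (rule eventually_sequentiallyI[of "csize F"])
        fix n assume "csize F \<le> n"
        then have "F \<in> S n" by (simp add: S_def)
        then show "norm ((tdensity F (class_of (Ts n)) - w F)\<^sup>2) \<le> 1 / real (Suc n)"
          using Ts(1)[of n] unfolding Q_def real_norm_def abs_power2 by blast
      qed
      show "(\<lambda>n. 1 / real (Suc n)) \<longlonglongrightarrow> 0" by (rule LIMSEQ_Suc[OF lim_1_over_n])
    qed
    then have "(\<lambda>n. tdensity F (class_of (Ts n)) - w F) \<longlonglongrightarrow> 0" by simp
    then show ?thesis unfolding w_def by (rule LIM_zero_cancel)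
  qed
  then have "tconverges Ts \<phi>" using Ts(2) by (simp add: tconverges_def)
  moreover have "0 < \<phi> (flag (class_of (Ts n)))" for n using Ts(1)[of n] by (simp add: Q_def w_def)
  ultimately show ?thesis by (rule that)
qed

text \<open>Expanding \<open>F\<close> in the flags of the size of \<open>H\<close> gives a sum of
  nonnegative terms equal to 0.\<close>

lemma pos_hom_zero_subtournament:
  assumes \<phi>: "\<phi> \<in> pos_homs" and zero: "\<phi> (flag F) = 0" and pos: "0 < \<phi> (flag H)" and le: "csize F \<le> csize H"
  shows "tdensity F H = 0"
proof (rule ccontr)
  assume "tdensity F H \<noteq> 0"
  then have "0 < tdensity F H" using tdensity_nonneg[of F H] by simp
  have lin: "linear \<phi>" and nn: "\<And>F. 0 \<le> \<phi> (flag F)" using \<phi> by (auto simp: pos_homs_def)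
  have "0 < tdensity F H * \<phi> (flag H)" using \<open>0 < tdensity F H\<close> pos by simp
  also have "\<dots> \<le> (\<Sum>H' | csize H' = csize H. tdensity F H' * \<phi> (flag H'))"
  proof (rule member_le_sum[of H "{H'. csize H' = csize H}" "\<lambda>H'. tdensity F H' * \<phi> (flag H')"])
    show "0 \<le> tdensity F H' * \<phi> (flag H')" for H'
      by (intro mult_nonneg_nonneg tdensity_nonneg nn)
    show "finite {H'. csize H' = csize H}" by (rule finite_classes)
  qed simp
  also have "\<dots> = \<phi> (flag F)"
    using arg_cong[OF flag_relation[OF le], of \<phi>] by (simp add: linear_sum[OF lin] linear_scale[OF lin])
  finally show False using zero by simp
qed

section \<open>The forbidden configuration\<close>

text \<open>The excluded eight arcs are those common to \<open>T\<^sub>5\<^sup>8\<close>, \<open>T\<^sub>5\<^sup>1\<^sup>0\<close> and \<open>T\<^sub>5\<^sup>1\<^sup>2\<close> under suitable labellings.\<close>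

definition zfree :: "tournament \<Rightarrow> bool" where
  "zfree T \<longleftrightarrow> (\<forall>v a w b w'. \<not> ((v, a) \<in> arcs T \<and> (v, w) \<in> arcs T \<and> (b, v) \<in> arcs T \<and> (w', v) \<in> arcs T \<and>
     (a, b) \<in> arcs T \<and> (w, b) \<in> arcs T \<and> (a, w') \<in> arcs T \<and> (w', w) \<in> arcs T))"

lemma zfreeD:
  "zfree T \<Longrightarrow> (v, a) \<in> arcs T \<Longrightarrow> (v, w) \<in> arcs T \<Longrightarrow> (b, v) \<in> arcs T \<Longrightarrow> (w', v) \<in> arcs T \<Longrightarrow>
     (a, b) \<in> arcs T \<Longrightarrow> (w, b) \<in> arcs T \<Longrightarrow> (a, w') \<in> arcs T \<Longrightarrow> (w', w) \<in> arcs T \<Longrightarrow> False"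
  unfolding zfree_def by blast

lemma zfree_induced: "zfree T \<Longrightarrow> zfree (induced T W)"
  unfolding zfree_def[of "induced T W"]
proof (intro allI notI, elim conjE)
  fix v a w b w'
  assume "zfree T" "(v, a) \<in> arcs (induced T W)" "(v, w) \<in> arcs (induced T W)"
    "(b, v) \<in> arcs (induced T W)" "(w', v) \<in> arcs (induced T W)" "(a, b) \<in> arcs (induced T W)"
    "(w, b) \<in> arcs (induced T W)" "(a, w') \<in> arcs (induced T W)" "(w', w) \<in> arcs (induced T W)"
  then show False by (intro zfreeD[of T v a w b w']) simp_all
qed

text \<open>The colour rises by 0 or 1 at each of the three steps and returns to its start, so all
  increments agree.\<close>

lemma mod_3_cycle:
  fixes x y z :: nat
  assumes "x \<in> {..<3}" "y = x \<or> y = (x + 1) mod 3" "z = y \<or> z = (y + 1) mod 3" "x = z \<or> x = (z + 1) mod 3"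
  shows "(y = x \<and> z = x) \<or> (y = (x + 1) mod 3 \<and> z = (x + 2) mod 3)"
proof -
  have "y \<in> {..<3}" "z \<in> {..<3}" using assms by auto
  from lessThan_3_cases[OF assms(1)] lessThan_3_cases[OF this(1)] lessThan_3_cases[OF this(2)]
  show ?thesis by (elim disjE) (use assms in simp_all)
qed

text \<open>In a cyclic partition every directed triangle lies in one part or meets all three.\<close>

lemma C3_decomposable_imp_zfree: "C3_decomposable T \<Longrightarrow> zfree T"
proof (induction rule: C3_decomposable.induct)
  case (small T)
  have "x = y" if "(x, y) \<in> arcs T" for x y
    using small arcs_vertsD[OF that] card_le_Suc0_iff_eq[OF finite_verts[of T]] by (simp add: tsize_def)
  then show ?case unfolding zfree_def by (metis arcs_irrefl)
next
  case (step T A B C)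
  define P where "P i = (if i = 0 then A else if i = 1 then B else C)" for i :: nat
  have P: "cyclic_partition T P"
    using cyclic_triple_partition[OF step(2)] unfolding P_def .
  note PD = cyclic_partitionD[OF P]
  have zP: "zfree (induced T (P i))" for i using step by (simp add: P_def)
  define col where "col x = (THE i. i \<in> {..<3::nat} \<and> x \<in> P i)" for x
  have col: "col x \<in> {..<3} \<and> x \<in> P (col x)" if x: "x \<in> verts T" for x
  proof -
    obtain i where i: "i \<in> {..<3}" "x \<in> P i" using PD(3)[OF x] by blast
    then have "col x = i" unfolding col_def using PD(2) by (intro the_equality) auto
    then show ?thesis using i by simp
  qed
  have col_arc: "col y = col x \<or> col y = (col x + 1) mod 3" if xy: "(x, y) \<in> arcs T" for x y
  proof (rule ccontr)
    assume neg: "\<not> ?thesis"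
    note x = col[OF arcs_vertsD(1)[OF xy]] and y = col[OF arcs_vertsD(2)[OF xy]]
    have "col x = (col y + 1) mod 3"
      using neg lessThan_3_cases[OF conjunct1[OF x]] lessThan_3_cases[OF conjunct1[OF y]]
      by (elim disjE) (simp_all add: numeral_2_eq_2)
    then have "(y, x) \<in> arcs T" using PD(4)[of "col y" y x] x y by simp
    then show False using xy arcs_asym by blast
  qed
  show ?case
    unfolding zfree_def
  proof (intro allI notI, elim conjE)
    fix v a w b w'
    assume arcs: "(v, a) \<in> arcs T" "(v, w) \<in> arcs T" "(b, v) \<in> arcs T" "(w', v) \<in> arcs T"
      "(a, b) \<in> arcs T" "(w, b) \<in> arcs T" "(a, w') \<in> arcs T" "(w', w) \<in> arcs T"
    have V: "v \<in> verts T" "a \<in> verts T" "w \<in> verts T" "b \<in> verts T" "w' \<in> verts T"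
      using arcs arcs_vertsD by blast+
    note r = lessThan_3_cases[OF conjunct1[OF col[OF V(1)]]]
    have tri: "(col y = col v \<and> col z = col v) \<or> (col y = (col v + 1) mod 3 \<and> col z = (col v + 2) mod 3)"
      if "(v, y) \<in> arcs T" "(y, z) \<in> arcs T" "(z, v) \<in> arcs T" for y z
      using mod_3_cycle[OF conjunct1[OF col[OF V(1)]] col_arc[OF that(1)] col_arc[OF that(2)] col_arc[OF that(3)]] .
    have ne: "(col v + 1) mod 3 \<noteq> col v" "(col v + 2) mod 3 \<noteq> col v" "(col v + 1) mod 3 \<noteq> (col v + 2) mod 3"
      "((col v + 2) mod 3 + 1) mod 3 = col v"
      using r by (elim disjE, simp_all)+
    \<comment> \<open>The triangles \<open>v a b\<close>, \<open>v w b\<close> and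
      \<open>v a w'\<close> overlap in arcs at \<open>v\<close>, so if one meets three parts, all
      do. Then \<open>w\<close> has the colour after that of \<open>v\<close> and \<open>w'\<close>
      the colour before it, and the arc from \<open>w'\<close> to \<open>w\<close> would go
      backwards.\<close>
    have "col a = col v \<and> col w = col v \<and> col b = col v \<and> col w' = col v"
      using tri[OF arcs(1,5,3)] tri[OF arcs(2,6,3)] tri[OF arcs(1,7,4)] col_arc[OF arcs(8)] ne
      by metis
    then have "a \<in> P (col v)" "w \<in> P (col v)" "b \<in> P (col v)" "w' \<in> P (col v)" "v \<in> P (col v)"
      using col[OF V(1)] col[OF V(2)] col[OF V(3)] col[OF V(4)] col[OF V(5)] by simp_all
    then show False using zfreeD[OF zP[of "col v"], of v a w b w'] arcs by simp
  qed
qed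

text \<open>For a directed triangle \<open>a b c\<close>, \<open>cls b c\<close> consists of the
  vertices that can replace \<open>a\<close>, and \<open>S\<close> is the union of the three such
  classes. Excluding the configuration joins the classes cyclically. A vertex outside
  \<open>S\<close> beats the whole triangle or loses to all of it, and then it does so with all of
  \<open>S\<close>. For a triangle with \<open>S\<close> of maximal size, no loser beats a winner,
  and strong connectivity then leaves neither.\<close>

lemma zfree_strong_split:
  assumes z: "zfree T" and strong: "\<And>X. X \<noteq> {} \<Longrightarrow> X \<subset> verts T \<Longrightarrow> \<not> X \<times> (verts T - X) \<subseteq> arcs T"
    and n: "2 \<le> tsize T"
  shows "\<exists>A B C. cyclic_triple T A B C"
proof -
  let ?V = "verts T" and ?R = "\<lambda>x y. (x, y) \<in> arcs T"
  define tri where "tri a b c \<longleftrightarrow> ?R a b \<and> ?R b c \<and> ?R c a" for a b c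
  define cls where "cls b c = {w. ?R w b \<and> ?R c w}" for b c
  have V: "a \<in> ?V" "b \<in> ?V" "c \<in> ?V" if "tri a b c" for a b c
    using that arcs_vertsD unfolding tri_def by blast+
  define S where "S a b c = cls b c \<union> cls c a \<union> cls a b" for a b c
  have SV: "S a b c \<subseteq> ?V" for a b c using arcs_vertsD by (auto simp: S_def cls_def)
  have "?V \<noteq> {}" using n by (auto simp: tsize_def)
  \<comment> \<open>\<open>X\<close> consists of \<open>v\<close> and its in-neighbours. Strong
    connectivity gives an arc into \<open>X\<close> from an out-neighbour of \<open>v\<close>, which
    closes a directed triangle.\<close>
  have ex_tri: "\<exists>a b c. tri a b c"
  proof -
    obtain v where v: "v \<in> ?V" using \<open>?V \<noteq> {}\<close> by blast
    have "\<not> (?V - {v} \<noteq> {} \<and> (?V - {v}) \<times> {v} \<subseteq> arcs T)"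
      using strong[of "?V - {v}"] v by (auto simp: Diff_Diff_Int Int_absorb1)
    moreover have "?V - {v} \<noteq> {}"
    proof
      assume "?V - {v} = {}"
      then have "?V = {v}" using v by blast
      then show False using n by (simp add: tsize_def)
    qed
    ultimately obtain o' where o': "?R v o'" using arcs_total[of _ T v] v by blast
    define X where "X = {x \<in> ?V. x = v \<or> ?R x v}"
    have "X \<noteq> {}" "X \<subset> ?V"
      using v o' arcs_vertsD[OF o'] arcs_asym[OF o'] by (auto simp: X_def)
    then have "\<not> X \<times> (?V - X) \<subseteq> arcs T" by (rule strong)
    then obtain x y where xy: "x \<in> X" "y \<in> ?V" "y \<notin> X" "\<not> ?R x y" by blast
    have vy: "?R v y" using xy v arcs_total[of v T y] by (auto simp: X_def)
    then have "x \<noteq> v" using xy by blast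
    then have "?R x v" "?R y x" using xy arcs_total[of x T y] by (auto simp: X_def)
    then show ?thesis using vy by (auto simp: tri_def)
  qed
  have finite_tri: "finite {card (S a b c) | a b c. tri a b c}"
  proof (rule finite_subset)
    show "{card (S a b c) | a b c. tri a b c} \<subseteq> {..card ?V}"
      using SV card_mono[OF finite_verts[of T]] by auto
  qed simp
  define m where "m = Max {card (S a b c) | a b c. tri a b c}"
  have "m \<in> {card (S a b c) | a b c. tri a b c}"
    unfolding m_def using finite_tri ex_tri by (intro Max_in) blast+
  then obtain a b c where t: "tri a b c" and m: "card (S a b c) = m" by blast
  have max: "card (S a' b' c') \<le> card (S a b c)" if "tri a' b' c'" for a' b' c'
    unfolding m m_def using finite_tri that by (intro Max_ge) blast+
  have t1: "?R a b" "?R b c" "?R c a" using t by (auto simp: tri_def)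
  have abc: "a \<in> ?V" "b \<in> ?V" "c \<in> ?V" using V[OF t] by auto
  \<comment> \<open>Otherwise \<open>c\<close>, \<open>a\<close>, \<open>w\<close>,
    \<open>b\<close>, \<open>w'\<close> form the excluded configuration. The claim is kept general
    in the triangle, since it is applied to rotated and modified ones.\<close>
  have cross: "?R w w'" if tr: "tri a b c" and w: "w \<in> cls b c" and w': "w' \<in> cls c a" for a b c w w'
  proof (rule ccontr)
    assume neg: "\<not> ?R w w'"
    have r: "?R a b" "?R b c" "?R c a" "?R w b" "?R c w" "?R w' c" "?R a w'"
      using tr w w' by (auto simp: tri_def cls_def)
    have "w \<noteq> w'" using r arcs_asym by blast
    then have "?R w' w" using neg arcs_total[of w T w'] r arcs_vertsD by metis
    then show False using zfreeD[OF z, of c a w b w'] r by blast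
  qed
  have tri_rot: "tri b c a" "tri c a b" using t by (auto simp: tri_def)
  have out: "x \<in> S a b c \<or> (?R x a \<and> ?R x b \<and> ?R x c) \<or> (?R a x \<and> ?R b x \<and> ?R c x)" if x: "x \<in> ?V" for x
  proof (cases "x = a \<or> x = b \<or> x = c")
    case True then show ?thesis using t1 by (auto simp: S_def cls_def)
  next
    case False
    then show ?thesis
      using arcs_total[OF x abc(1)] arcs_total[OF x abc(2)] arcs_total[OF x abc(3)]
      unfolding S_def cls_def by blast
  qed
  \<comment> \<open>If \<open>w\<close> beat \<open>u\<close>, then in the triangle
    \<open>w b c\<close> the vertex \<open>a\<close> could replace \<open>w\<close> and
    \<open>u\<close> could replace \<open>b\<close>, so \<open>cross\<close> would give an arc from
    \<open>a\<close> to \<open>u\<close>.\<close>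
  have up1: "?R u w" if tr: "tri a b c" and u: "?R u a" "?R u b" "?R u c" and w: "w \<in> cls b c" for a b c u w
  proof (rule ccontr)
    assume neg: "\<not> ?R u w"
    have r: "?R a b" "?R b c" "?R c a" "?R w b" "?R c w" using tr w by (auto simp: tri_def cls_def)
    have "u \<noteq> w" using u r arcs_asym by blast
    then have wu: "?R w u" using neg arcs_total[of u T w] r u arcs_vertsD by metis
    have "tri w b c" using r by (simp add: tri_def)
    moreover have "a \<in> cls b c" "u \<in> cls c w" using r u wu by (auto simp: cls_def)
    ultimately have "?R a u" by (rule cross)
    then show False using u arcs_asym by blast
  qed
  have down1: "?R w d" if tr: "tri a b c" and d: "?R a d" "?R b d" "?R c d" and w: "w \<in> cls b c" for a b c d w
  proof (rule ccontr)
    assume neg: "\<not> ?R w d"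
    have r: "?R a b" "?R b c" "?R c a" "?R w b" "?R c w" using tr w by (auto simp: tri_def cls_def)
    have "d \<noteq> w" using d r arcs_asym by blast
    then have dw: "?R d w" using neg arcs_total[of w T d] r d arcs_vertsD by metis
    have "tri c w b" using r by (simp add: tri_def)
    moreover have "d \<in> cls w b" "a \<in> cls b c" using r d dw by (auto simp: cls_def)
    ultimately have "?R d a" by (rule cross)
    then show False using d arcs_asym by blast
  qed
  have up: "?R u w" if "?R u a" "?R u b" "?R u c" "w \<in> S a b c" for u w
    using that up1[OF t, of u w] up1[OF tri_rot(1), of u w] up1[OF tri_rot(2), of u w]
    unfolding S_def by blast
  have down: "?R w d" if "?R a d" "?R b d" "?R c d" "w \<in> S a b c" for d w
    using that down1[OF t, of d w] down1[OF tri_rot(1), of d w] down1[OF tri_rot(2), of d w]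
    unfolding S_def by blast
  define U where "U = {u. ?R u a \<and> ?R u b \<and> ?R u c}"
  define D where "D = {d. ?R a d \<and> ?R b d \<and> ?R c d}"
  have UDV: "U \<subseteq> ?V" "D \<subseteq> ?V" using arcs_vertsD by (auto simp: U_def D_def)
  have aS: "a \<in> S a b c" using t1 by (auto simp: S_def cls_def)
  have part: "?V = S a b c \<union> U \<union> D" 
  proof (rule subset_antisym)
    show "?V \<subseteq> S a b c \<union> U \<union> D" using out unfolding U_def D_def by blast
  qed (use SV UDV in blast)
  \<comment> \<open>Such an arc gives the triangle \<open>a d u\<close>, in which all of
    \<open>S a b c\<close> can replace \<open>a\<close>, and \<open>d\<close> is new, against
    maximality.\<close>
  have noDU: "\<not> ?R d u" if d: "d \<in> D" and u: "u \<in> U" for d u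
  proof
    assume du: "?R d u"
    have "tri a d u" using du d u by (auto simp: tri_def U_def D_def)
    moreover have "insert d (S a b c) \<subseteq> S a d u"
    proof -
      have "S a b c \<subseteq> cls d u"
        using up down u d unfolding cls_def U_def D_def by blast
      moreover have "d \<in> cls u a" using d du by (auto simp: cls_def D_def)
      ultimately show ?thesis by (auto simp: S_def)
    qed
    moreover have "d \<notin> S a b c"
      using d t1 arcs_asym unfolding S_def cls_def D_def by blast
    ultimately have "card (S a b c) < card (S a d u)"
      using SV finite_subset[OF SV finite_verts] by (intro psubset_card_mono) auto
    then show False using max[OF \<open>tri a d u\<close>] by simp
  qed
  have disj: "S a b c \<inter> U = {}" "S a b c \<inter> D = {}" "U \<inter> D = {}"
    using arcs_asym unfolding S_def cls_def U_def D_def by blast+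
  have "U = {}"
  proof (rule ccontr)
    assume ne: "U \<noteq> {}"
    have "U \<times> (?V - U) \<subseteq> arcs T"
    proof (rule subsetI, clarify)
      fix u x assume u: "u \<in> U" and x: "x \<in> ?V" "x \<notin> U"
      show "?R u x"
      proof (cases "x \<in> S a b c")
        case True then show ?thesis using up u by (auto simp: U_def)
      next
        case False
        then have "x \<in> D" using x part by blast
        then have "\<not> ?R x u" "x \<noteq> u" using noDU u disj by blast+
        then show ?thesis using arcs_total[of u T x] u x UDV by blast
      qed
    qed
    moreover have "U \<subset> ?V" using UDV aS SV disj by blast
    ultimately show False using strong[OF ne] by blast
  qed
  have "D = {}"
  proof (rule ccontr)
    assume ne: "D \<noteq> {}"
    have "S a b c \<times> (?V - S a b c) \<subseteq> arcs T"
      using down part \<open>U = {}\<close> unfolding D_def by blast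
    moreover have "S a b c \<subset> ?V" using ne disj SV UDV by blast
    ultimately show False using strong[of "S a b c"] aS by blast
  qed
  have VS: "?V = cls b c \<union> cls c a \<union> cls a b" using part \<open>U = {}\<close> \<open>D = {}\<close> by (simp add: S_def)
  have in_cls: "a \<in> cls b c" "b \<in> cls c a" "c \<in> cls a b" using t1 by (auto simp: cls_def)
  have d: "cls b c \<inter> cls c a = {}" "cls c a \<inter> cls a b = {}" "cls b c \<inter> cls a b = {}"
    using arcs_asym unfolding cls_def by blast+
  have "cyclic_triple T (cls b c) (cls c a) (cls a b)"
    unfolding cyclic_triple_def
  proof (intro conjI)
    show "cls b c \<subset> ?V" "cls c a \<subset> ?V" "cls a b \<subset> ?V" using VS in_cls d by blast+
    show "cls b c \<inter> cls c a = {}" "cls c a \<inter> cls a b = {}" "cls b c \<inter> cls a b = {}" by (fact d)+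
    show "cls b c \<union> cls c a \<union> cls a b = ?V" using VS by simp
    show "cls b c \<times> cls c a \<subseteq> arcs T" "cls c a \<times> cls a b \<subseteq> arcs T" "cls a b \<times> cls b c \<subseteq> arcs T"
      using cross[OF t] cross[OF tri_rot(1)] cross[OF tri_rot(2)] by blast+
  qed
  then show ?thesis by blast
qed

text \<open>A tournament that is not strong splits into a dominating set, the rest, and an empty
  third part; strong ones are covered by \<open>zfree_strong_split\<close>.\<close>

lemma zfree_imp_C3_decomposable: "zfree T \<Longrightarrow> C3_decomposable T"
proof (induction "tsize T" arbitrary: T rule: less_induct)
  case less
  show ?case
  proof (cases "tsize T \<le> 1")
    case True then show ?thesis by (rule C3_decomposable.small)
  next
    case False
    have "\<exists>A B C. cyclic_triple T A B C"
    proof (cases "\<exists>X. X \<noteq> {} \<and> X \<subset> verts T \<and> X \<times> (verts T - X) \<subseteq> arcs T")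
      case True
      then obtain X where X: "X \<noteq> {}" "X \<subset> verts T" "X \<times> (verts T - X) \<subseteq> arcs T" by blast
      then have "cyclic_triple T X (verts T - X) {}" unfolding cyclic_triple_def by blast
      then show ?thesis by blast
    next
      case strong: False
      show ?thesis by (rule zfree_strong_split[OF less(2)]) (use strong False in auto)
    qed
    then obtain A B C where c: "cyclic_triple T A B C" by blast
    then have sub: "A \<subset> verts T" "B \<subset> verts T" "C \<subset> verts T" by (auto simp: cyclic_triple_def)
    have "C3_decomposable (induced T X)" if "X \<subset> verts T" for X
    proof (rule less(1))
      show "tsize (induced T X) < tsize T"
        using that psubset_card_mono[OF finite_verts that] by (simp add: tsize_induced) (simp add: tsize_def)
      show "zfree (induced T X)" by (rule zfree_induced[OF less(2)])
    qed
    then show ?thesis using c sub False by (intro C3_decomposable.step[of T A B C]) auto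
  qed
qed

section \<open>The three tournaments behind the forbidden configuration\<close>

lemma verts_T5 [simp]:
  "verts T5_8 = {1, 2, 3, 4, 5}" "verts T5_9 = {1, 2, 3, 4, 5}" "verts T5_10 = {1, 2, 3, 4, 5}"
  "verts T5_11 = {1, 2, 3, 4, 5}" "verts T5_12 = {0, 1, 2, 3, 4}"
  by (transfer, simp)+

lemma arcs_T5:
  "arcs T5_8 = {(1, 2), (1, 3), (1, 4), (2, 3), (2, 4), (2, 5), (3, 4), (4, 5), (5, 1), (5, 3)}"
  "arcs T5_9 = {(1, 2), (1, 3), (1, 4), (2, 3), (2, 4), (3, 4), (3, 5), (4, 5), (5, 1), (5, 2)}"
  "arcs T5_10 = {(1, 2), (1, 4), (2, 3), (2, 4), (3, 1), (3, 4), (3, 5), (4, 5), (5, 1), (5, 2)}"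
  "arcs T5_11 = {(2, 3), (3, 4), (4, 2), (1, 2), (1, 3), (1, 4), (2, 5), (3, 5), (4, 5), (5, 1)}"
  "arcs T5_12 = {(0, 1), (1, 2), (2, 3), (3, 4), (4, 0), (0, 2), (1, 3), (2, 4), (3, 0), (4, 1)}"
  by (transfer, simp)+

lemma tsize_T5 [simp]:
  "tsize T5_8 = 5" "tsize T5_9 = 5" "tsize T5_10 = 5" "tsize T5_11 = 5" "tsize T5_12 = 5"
  by (simp_all add: tsize_def)

lemma zfree_homs_empty:
  assumes "zfree T" shows "homs T5_8 T = {}" "homs T5_10 T = {}" "homs T5_12 T = {}"
proof -
  show "homs T5_8 T = {}"
  proof (rule equals0I)
    fix h assume "h \<in> homs T5_8 T"
    from homsD(1)[OF this] show False
      by (intro zfreeD[OF assms, of "h 5" "h 1" "h 3" "h 4" "h 2"]) (simp_all add: arcs_T5)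
  qed
  show "homs T5_10 T = {}"
  proof (rule equals0I)
    fix h assume "h \<in> homs T5_10 T"
    from homsD(1)[OF this] show False
      by (intro zfreeD[OF assms, of "h 2" "h 3" "h 4" "h 5" "h 1"]) (simp_all add: arcs_T5)
  qed
  show "homs T5_12 T = {}"
  proof (rule equals0I)
    fix h assume "h \<in> homs T5_12 T"
    from homsD(1)[OF this] show False
      by (intro zfreeD[OF assms, of "h 0" "h 2" "h 1" "h 3" "h 4"]) (simp_all add: arcs_T5)
  qed
qed

text \<open>The two arcs left open in the excluded configuration decide which of the three tournaments it is.\<close>

lemma homs_empty_zfree:
  assumes "homs T5_8 T = {}" "homs T5_10 T = {}" "homs T5_12 T = {}" shows "zfree T"
  unfolding zfree_def
proof (intro allI notI, elim conjE)
  fix v a w b w'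
  assume arcs: "(v, a) \<in> arcs T" "(v, w) \<in> arcs T" "(b, v) \<in> arcs T" "(w', v) \<in> arcs T"
      "(a, b) \<in> arcs T" "(w, b) \<in> arcs T" "(a, w') \<in> arcs T" "(w', w) \<in> arcs T"
  have V: "v \<in> verts T" "a \<in> verts T" "w \<in> verts T" "b \<in> verts T" "w' \<in> verts T"
    using arcs arcs_vertsD by blast+
  have ne: "a \<noteq> w" "b \<noteq> w'" using arcs arcs_asym by blast+
  consider "(a, w) \<in> arcs T" "(b, w') \<in> arcs T" | "(a, w) \<in> arcs T" "(w', b) \<in> arcs T"
    | "(w, a) \<in> arcs T" "(b, w') \<in> arcs T" | "(w, a) \<in> arcs T" "(w', b) \<in> arcs T"
    using arcs_total[OF V(2,3) ne(1)] arcs_total[OF V(4,5) ne(2)] by blast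
  then show False
  proof cases
    case 1
    have "(\<lambda>i\<in>verts T5_10. if i = 1 then w' else if i = 2 then v else if i = 3 then a else if i = 4 then w else b) \<in> homs T5_10 T"
      unfolding homs_def using arcs 1 V by (auto simp: arcs_T5)
    then show ?thesis using assms by blast
  next
    case 2
    have "(\<lambda>i\<in>verts T5_8. if i = 1 then a else if i = 2 then w' else if i = 3 then w else if i = 4 then b else v) \<in> homs T5_8 T"
      unfolding homs_def using arcs 2 V by (auto simp: arcs_T5)
    then show ?thesis using assms by blast
  next
    case 3
    have "(\<lambda>i\<in>verts T5_12. if i = 0 then v else if i = 1 then w else if i = 2 then a else if i = 3 then b else w') \<in> homs T5_12 T"
      unfolding homs_def using arcs 3 V by (auto simp: arcs_T5)
    then show ?thesis using assms by blast
  next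
    case 4
    have "(\<lambda>i\<in>verts T5_10. if i = 1 then w else if i = 2 then a else if i = 3 then w' else if i = 4 then b else v) \<in> homs T5_10 T"
      unfolding homs_def using arcs 4 V by (auto simp: arcs_T5)
    then show ?thesis using assms by blast
  qed
qed

text \<open>Turns decomposability into the absence of homomorphisms, a condition that isomorphisms
  and densities can see.\<close>

lemma C3_decomposable_iff_homs:
  "C3_decomposable T \<longleftrightarrow> homs T5_8 T = {} \<and> homs T5_10 T = {} \<and> homs T5_12 T = {}"
  by (rule iffI)
    (simp add: zfree_homs_empty C3_decomposable_imp_zfree, simp add: zfree_imp_C3_decomposable homs_empty_zfree)

text \<open>The value \<open>f\<close> of \<open>hom_density_near_balanced\<close> depends only on
  \<open>F\<close>, so both sequences have the same limit. Applied to the same sequence twice, this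
  proves convergence.\<close>

lemma hom_density_limit_unique:
  assumes dec: "\<And>n. C3_decomposable (Ts n)" "\<And>n. C3_decomposable (Ts' n)"
    and sizes: "filterlim (\<lambda>n. tsize (Ts n)) at_top sequentially" "filterlim (\<lambda>n. tsize (Ts' n)) at_top sequentially"
    and bal: "(\<lambda>n. imbalance (Ts n)) \<longlonglongrightarrow> 0" "(\<lambda>n. imbalance (Ts' n)) \<longlonglongrightarrow> 0"
  obtains f where "(\<lambda>n. hom_density F (Ts n)) \<longlonglongrightarrow> f" "(\<lambda>n. hom_density F (Ts' n)) \<longlonglongrightarrow> f"
proof -
  obtain f K where K: "0 \<le> K" and bound: "\<And>T. C3_decomposable T \<Longrightarrow> 0 < tsize T \<Longrightarrow>
     \<bar>hom_density F T - f\<bar> \<le> K * hom_error F T"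
    using hom_density_near_balanced[of F] by blast
  have "(\<lambda>n. hom_density F (Us n)) \<longlonglongrightarrow> f"
    if dec: "\<And>n. C3_decomposable (Us n)" and sizes: "filterlim (\<lambda>n. tsize (Us n)) at_top sequentially"
      and bal: "(\<lambda>n. imbalance (Us n)) \<longlonglongrightarrow> 0" for Us
  proof -
    have "(\<lambda>n. 1 / real (tsize (Us n))) \<longlonglongrightarrow> 0"
      using filterlim_compose[OF lim_1_over_n sizes] .
    then have "(\<lambda>n. K * (imbalance (Us n) + 1 / real (tsize (Us n)))) \<longlonglongrightarrow> K * (0 + 0)"
      using bal by (intro tendsto_intros)
    then have lim: "(\<lambda>n. K * (imbalance (Us n) + 1 / real (tsize (Us n)))) \<longlonglongrightarrow> 0" by simp
    have "\<forall>\<^sub>F n in sequentially. 1 \<le> tsize (Us n)" using sizes by (simp add: filterlim_at_top)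
    then have "\<forall>\<^sub>F n in sequentially. norm (hom_density F (Us n) - f) \<le> K * (imbalance (Us n) + 1 / real (tsize (Us n)))"
    proof (rule eventually_mono)
      fix n assume "1 \<le> tsize (Us n)"
      then have "\<bar>hom_density F (Us n) - f\<bar> \<le> K * hom_error F (Us n)" using bound dec by simp
      also have "\<dots> \<le> K * (imbalance (Us n) + 1 / real (tsize (Us n)))"
        using K imbalance_nonneg by (intro mult_left_mono) (auto simp: hom_error_def)
      finally show "norm (hom_density F (Us n) - f) \<le> K * (imbalance (Us n) + 1 / real (tsize (Us n)))" by simp
    qed
    then have "(\<lambda>n. hom_density F (Us n) - f) \<longlonglongrightarrow> 0" using lim by (rule Lim_null_comparison)
    then show ?thesis by (rule LIM_zero_cancel)
  qed
  from this[OF dec(1) sizes(1) bal(1)] this[OF dec(2) sizes(2) bal(2)] show ?thesis by (rule that)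
qed

section \<open>Invariance under isomorphism\<close>

lemma card_homs_le_tiso_left:
  assumes "tiso F F'" shows "card (homs F' T) \<le> card (homs F T)"
proof -
  obtain f where f: "bij_betw f (verts F) (verts F')"
    "\<And>u v. u \<in> verts F \<Longrightarrow> v \<in> verts F \<Longrightarrow> (u, v) \<in> arcs F \<longleftrightarrow> (f u, f v) \<in> arcs F'"
    using assms unfolding tiso_def by blast
  have im: "f ` verts F = verts F'" using f(1) by (simp add: bij_betw_def)
  show ?thesis
  proof (rule card_inj_on_le)
    show "inj_on (\<lambda>h. \<lambda>v\<in>verts F. h (f v)) (homs F' T)"
    proof (rule inj_onI, rule ext)
      fix h k w assume hk: "h \<in> homs F' T" "k \<in> homs F' T"
        and eq: "(\<lambda>v\<in>verts F. h (f v)) = (\<lambda>v\<in>verts F. k (f v))"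
      show "h w = k w"
      proof (cases "w \<in> verts F'")
        case True
        then obtain v where v: "v \<in> verts F" "w = f v" using im by blast
        then show ?thesis using fun_cong[OF eq, of v] by simp
      next
        case False
        then show ?thesis using homsD(3) hk by metis
      qed
    qed
    show "(\<lambda>h. \<lambda>v\<in>verts F. h (f v)) ` homs F' T \<subseteq> homs F T"
    proof (rule image_subsetI)
      fix h assume h: "h \<in> homs F' T"
      show "(\<lambda>v\<in>verts F. h (f v)) \<in> homs F T"
        unfolding homs_def
      proof (intro CollectI conjI allI impI)
        show "(\<lambda>v\<in>verts F. h (f v)) \<in> verts F \<rightarrow>\<^sub>E verts T"
          using homsD(2)[OF h] im by auto
        fix u v assume uv: "(u, v) \<in> arcs F"
        note V = arcs_vertsD[OF uv]
        show "((\<lambda>v\<in>verts F. h (f v)) u, (\<lambda>v\<in>verts F. h (f v)) v) \<in> arcs T"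
          using homsD(1)[OF h, of "f u" "f v"] f(2)[OF V] uv V by simp
      qed
    qed
  qed simp
qed

lemma hom_density_tiso_left:
  assumes "tiso F F'" shows "hom_density F T = hom_density F' T"
  using card_homs_le_tiso_left[OF assms] card_homs_le_tiso_left[OF tiso_sym[OF assms]] tiso_tsize[OF assms]
  by (simp add: hom_density_def le_antisym)

lemma card_copies_tiso:
  assumes "tiso T T'" shows "card (copies T F (verts T)) = card (copies T' F (verts T'))"
proof -
  have "tsize T = tsize T'" "class_of T = class_of T'" using assms tiso_tsize class_of_eq_iff by blast+
  then have "real (card (copies T F (verts T))) / real (tsize T choose csize F) =
      real (card (copies T' F (verts T'))) / real (tsize T choose csize F)"
    using tdensity_avg[of "verts T" T F] tdensity_avg[of "verts T'" T' F] by (simp add: avg_def tsize_def)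
  moreover have "card (copies T F (verts T)) = 0 \<and> card (copies T' F (verts T')) = 0" if "tsize T choose csize F = 0"
    using card_copies_le[of "verts T" T F] card_copies_le[of "verts T'" T' F] \<open>tsize T = tsize T'\<close> that
    unfolding tsize_def by (metis le_zero_eq order_refl)
  ultimately show ?thesis by (cases "tsize T choose csize F = 0") auto
qed

lemma card_homs_tiso: "tiso T T' \<Longrightarrow> card (homs F T) = card (homs F T')"
  unfolding card_homs[of F T] card_homs[of F T'] by (simp add: card_copies_tiso)

lemma hom_density_tiso: "tiso T T' \<Longrightarrow> hom_density F T = hom_density F T'"
  by (simp add: hom_density_def card_homs_tiso tiso_tsize)

lemma tiso_C3_decomposable: "tiso T T' \<Longrightarrow> C3_decomposable T \<Longrightarrow> C3_decomposable T'"
  unfolding C3_decomposable_iff_homs by (metis card_homs_tiso card_0_eq finite_homs)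

lemma tiso_induced:
  assumes f: "bij_betw f (verts T) (verts T')"
    "\<And>u v. u \<in> verts T \<Longrightarrow> v \<in> verts T \<Longrightarrow> (u, v) \<in> arcs T \<longleftrightarrow> (f u, f v) \<in> arcs T'"
    and W: "W \<subseteq> verts T"
  shows "tiso (induced T W) (induced T' (f ` W))"
  using tiso_induced_image[OF f W] by (simp add: class_of_eq_iff tiso_sym)

text \<open>Serves the blow-ups, whose parts are only isomorphic to smaller blow-ups.\<close>

lemma tiso_equally_C3_decomposable:
  "tiso T T' \<Longrightarrow> equally_C3_decomposable k T \<Longrightarrow> equally_C3_decomposable k T'"
proof (induction k arbitrary: T T')
  case 0
  then show ?case using tiso_C3_decomposable by simp
next
  case (Suc k)
  note iso = Suc.prems(1) and eq = Suc.prems(2)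
  show ?case
  proof (cases "tsize T' \<le> 1")
    case False
    then have "\<not> tsize T \<le> 1" using tiso_tsize[OF iso] by simp
    then obtain A B C where t: "cyclic_triple T A B C" and
      dec: "C3_decomposable (induced T A)" "C3_decomposable (induced T B)" "C3_decomposable (induced T C)"
      and size: "Max {card A, card B, card C} - Min {card A, card B, card C} \<le> 1"
      and eqs: "equally_C3_decomposable k (induced T A)" "equally_C3_decomposable k (induced T B)"
        "equally_C3_decomposable k (induced T C)"
      using eq by auto
    obtain f where f: "bij_betw f (verts T) (verts T')"
      "\<And>u v. u \<in> verts T \<Longrightarrow> v \<in> verts T \<Longrightarrow> (u, v) \<in> arcs T \<longleftrightarrow> (f u, f v) \<in> arcs T'"
      using iso unfolding tiso_def by blast
    have sub: "A \<subseteq> verts T" "B \<subseteq> verts T" "C \<subseteq> verts T" using t by (auto simp: cyclic_triple_def)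
    have isos: "tiso (induced T X) (induced T' (f ` X))" if "X \<subseteq> verts T" for X
      by (rule tiso_induced[OF f(1) _ that]) (rule f(2))
    have inj: "inj_on f (verts T)" and im: "f ` verts T = verts T'" using f(1) by (auto simp: bij_betw_def)
    have card: "card (f ` A) = card A" "card (f ` B) = card B" "card (f ` C) = card C"
      using sub inj by (auto intro!: card_image inj_on_subset[OF inj])
    have psub: "f ` X \<subset> verts T'" if "X \<subset> verts T" for X
      using that inj im by (metis image_strict_mono)
    have disj: "f ` X \<inter> f ` Y = {}" if "X \<subseteq> verts T" "Y \<subseteq> verts T" "X \<inter> Y = {}" for X Y
      using inj_on_image_Int[OF inj that(1,2)] that(3) by simp
    have arcs: "f ` X \<times> f ` Y \<subseteq> arcs T'" if "X \<subseteq> verts T" "Y \<subseteq> verts T" "X \<times> Y \<subseteq> arcs T" for X Y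
    proof clarify
      fix x y assume "x \<in> X" "y \<in> Y"
      then show "(f x, f y) \<in> arcs T'" using f(2)[of x y] that by blast
    qed
    have t': "A \<subset> verts T" "B \<subset> verts T" "C \<subset> verts T" "A \<inter> B = {}" "B \<inter> C = {}" "A \<inter> C = {}"
      "A \<union> B \<union> C = verts T" "A \<times> B \<subseteq> arcs T" "B \<times> C \<subseteq> arcs T" "C \<times> A \<subseteq> arcs T"
      using t unfolding cyclic_triple_def by blast+
    have "f ` A \<union> f ` B \<union> f ` C = verts T'" using t'(7) im by (metis image_Un)
    then have "cyclic_triple T' (f ` A) (f ` B) (f ` C)"
      unfolding cyclic_triple_def
      using psub[OF t'(1)] psub[OF t'(2)] psub[OF t'(3)] disj[OF sub(1,2) t'(4)] disj[OF sub(2,3) t'(5)]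
        disj[OF sub(1,3) t'(6)] arcs[OF sub(1,2) t'(8)] arcs[OF sub(2,3) t'(9)] arcs[OF sub(3,1) t'(10)]
      by (intro conjI)
    moreover have "C3_decomposable (induced T' (f ` A)) \<and> C3_decomposable (induced T' (f ` B)) \<and>
        C3_decomposable (induced T' (f ` C))"
      using dec sub[THEN isos] tiso_C3_decomposable by blast
    moreover have "equally_C3_decomposable k (induced T' (f ` A)) \<and> equally_C3_decomposable k (induced T' (f ` B)) \<and>
        equally_C3_decomposable k (induced T' (f ` C))"
      using eqs sub[THEN isos] Suc.IH by blast
    ultimately show ?thesis using size card by (simp only: equally_C3_decomposable.simps) metis
  qed simp
qed

section \<open>The cyclic join and its parts\<close>

lemma arcs_cyclic_join: "(x, y) \<in> arcs (cyclic_join T) \<longleftrightarrow> x div 3 \<in> verts (T (x mod 3)) \<and> y div 3 \<in> verts (T (y mod 3)) \<and>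
   (if x mod 3 = y mod 3 then (x div 3, y div 3) \<in> arcs (T (x mod 3)) else y mod 3 = (x mod 3 + 1) mod 3)"
  by transfer simp

definition part3 :: "nat \<Rightarrow> nat set" where
  "part3 i = {x. x mod 3 = i}"

lemma tiso_cyclic_join_part:
  assumes i: "i \<in> {..<3}" shows "tiso (T i) (induced (cyclic_join T) (part3 i \<inter> verts (cyclic_join T)))"
proof -
  have m: "i mod 3 = i" "i div 3 = 0" using i by auto
  have "bij_betw (\<lambda>v. 3 * v + i) (verts (T i)) (verts (induced (cyclic_join T) (part3 i \<inter> verts (cyclic_join T))))"
    by (rule bij_betw_byWitness[where f' = "\<lambda>x. x div 3"])
      (use i in \<open>auto simp: verts_cyclic_join part3_def m\<close>)
  then show ?thesis unfolding tiso_def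
    by (intro exI[of _ "\<lambda>v. 3 * v + i"]) (auto simp: arcs_cyclic_join verts_cyclic_join part3_def m)
qed

text \<open>The hypothesis makes every part a proper subset, as \<open>cyclic_triple\<close>
  demands.\<close>

lemma cyclic_triple_cyclic_join:
  assumes "\<And>i. i \<in> {..<3} \<Longrightarrow> tsize (T i) < tsize (cyclic_join T)"
  shows "cyclic_triple (cyclic_join T) (part3 0 \<inter> verts (cyclic_join T)) (part3 1 \<inter> verts (cyclic_join T))
    (part3 2 \<inter> verts (cyclic_join T))"
proof -
  let ?V = "verts (cyclic_join T)"
  have card: "card (part3 i \<inter> ?V) = tsize (T i)" if "i \<in> {..<3}" for i
    using tiso_tsize[OF tiso_cyclic_join_part[OF that, of T]] by (simp add: tsize_induced)
  have psub: "part3 i \<inter> ?V \<subset> ?V" if "i \<in> {..<3}" for i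
    using card[OF that] assms[OF that] by (auto simp: tsize_def)
  have all: "x mod 3 = 0 \<or> x mod 3 = 1 \<or> x mod 3 = 2" for x :: nat using lessThan_3_cases[of "x mod 3"] by simp
  show ?thesis
    unfolding cyclic_triple_def
  proof (intro conjI)
    show "part3 0 \<inter> ?V \<subset> ?V" "part3 1 \<inter> ?V \<subset> ?V" "part3 2 \<inter> ?V \<subset> ?V" using psub by simp_all
    show "part3 0 \<inter> ?V \<union> part3 1 \<inter> ?V \<union> part3 2 \<inter> ?V = ?V" using all by (auto simp: part3_def)
  qed (auto simp: part3_def arcs_cyclic_join verts_cyclic_join numeral_2_eq_2)
qed

section \<open>Recursive blow-ups\<close>

lemma C3_blowup_small: "n \<le> 2 \<Longrightarrow> C3_blowup n = transitive_tournament n"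
  by (simp add: C3_blowup.simps[of n])

lemma C3_blowup_large: "2 < n \<Longrightarrow> C3_blowup n = cyclic_join (\<lambda>i. C3_blowup ((n + 2 - i) div 3))"
  by (simp add: C3_blowup.simps[of n])

lemma C3_blowup_triple:
  assumes n: "2 < n"
  defines "P \<equiv> \<lambda>i. part3 i \<inter> verts (C3_blowup n)"
  shows "cyclic_triple (C3_blowup n) (P 0) (P 1) (P 2)"
    "i \<in> {..<3} \<Longrightarrow> tiso (C3_blowup ((n + 2 - i) div 3)) (induced (C3_blowup n) (P i))"
    "i \<in> {..<3} \<Longrightarrow> card (P i) = (n + 2 - i) div 3"
proof -
  let ?T = "\<lambda>i. C3_blowup ((n + 2 - i) div 3)"
  note eq = C3_blowup_large[OF n]
  have lt: "tsize (?T i) < tsize (cyclic_join ?T)" for i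
  proof -
    have "(n + 2 - i) div 3 < n" using n by auto
    then show ?thesis unfolding tsize_C3_blowup eq[symmetric] .
  qed
  show "cyclic_triple (C3_blowup n) (P 0) (P 1) (P 2)"
    unfolding P_def eq by (rule cyclic_triple_cyclic_join[of ?T, OF lt])
  show iso: "tiso (?T i) (induced (C3_blowup n) (P i))" if "i \<in> {..<3}" for i
    unfolding P_def eq using tiso_cyclic_join_part[OF that, of ?T] .
  show "card (P i) = (n + 2 - i) div 3" if "i \<in> {..<3}" for i
    using tiso_tsize[OF iso[OF that]] by (simp add: tsize_C3_blowup tsize_induced P_def)
qed

text \<open>The third part is empty; the sizes 1, 1, 0 still differ by at most 1, as equal
  decomposability requires.\<close>

lemma transitive_tournament_2_triple: "cyclic_triple (transitive_tournament 2) {0} {1} {}"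
proof -
  have "arcs (transitive_tournament 2) = {(i, j). i < j \<and> j < 2}" by transfer simp
  moreover have "{(i, j). i < j \<and> j < (2::nat)} = {(0, 1)}" by auto
  moreover have "verts (transitive_tournament 2) = {0, 1}" by auto
  ultimately show ?thesis by (simp add: cyclic_triple_def psubset_eq insert_commute)
qed

lemma C3_decomposable_C3_blowup: "C3_decomposable (C3_blowup n)"
proof (induction n rule: less_induct)
  case (less n)
  consider "n \<le> 1" | "n = 2" | "2 < n" by linarith
  then show ?case
  proof cases
    case 1
    then show ?thesis by (intro C3_decomposable.small) (simp add: tsize_C3_blowup)
  next
    case 2
    have d: "C3_decomposable (induced (transitive_tournament 2) X)" if "card X \<le> 1" "X \<subseteq> {..<2}" for X
      by (rule C3_decomposable.small) (use that in \<open>simp add: tsize_induced\<close>)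
    show ?thesis unfolding 2 C3_blowup_small[OF order_refl]
      by (rule C3_decomposable.step[OF _ transitive_tournament_2_triple]) (simp_all add: d tsize_def)
  next
    case 3
    have dec: "C3_decomposable (induced (C3_blowup n) (part3 i \<inter> verts (C3_blowup n)))" if i: "i \<in> {..<3}" for i
    proof (rule tiso_C3_decomposable[OF C3_blowup_triple(2)[OF 3 i]])
      show "C3_decomposable (C3_blowup ((n + 2 - i) div 3))" using 3 by (intro less) auto
    qed
    show ?thesis
      by (rule C3_decomposable.step[OF _ C3_blowup_triple(1)[OF 3]]) (use 3 dec in \<open>simp_all add: tsize_C3_blowup\<close>)
  qed
qed

lemma equally_C3_decomposable_C3_blowup: "equally_C3_decomposable k (C3_blowup n)"
proof (induction k arbitrary: n)
  case 0
  then show ?case by (simp add: C3_decomposable_C3_blowup)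
next
  case (Suc k)
  have small: "equally_C3_decomposable k T" if "tsize T \<le> 1" for k T
    using that by (cases k) (auto intro: C3_decomposable.small)
  consider "n \<le> 1" | "n = 2" | "2 < n" by linarith
  then show ?case
  proof cases
    case 1
    then show ?thesis by (simp add: tsize_C3_blowup)
  next
    case 2
    have X: "tsize (induced (transitive_tournament 2) X) \<le> 1" if "X \<in> {{0}, {1}, {}}" for X
      using that by (auto simp: tsize_def)
    have "C3_decomposable (induced (transitive_tournament 2) X) \<and> equally_C3_decomposable k (induced (transitive_tournament 2) X)"
      if "X \<in> {{0}, {1}, {}}" for X using X[OF that] small C3_decomposable.small by blast
    from this[of "{0}"] this[of "{1}"] this[of "{}"] show ?thesis
      unfolding 2 C3_blowup_small[OF order_refl] equally_C3_decomposable.simps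
      using transitive_tournament_2_triple by (intro disjI2 exI[of _ "{0}"] exI[of _ "{1}"] exI[of _ "{}"]) simp
  next
    case 3
    define P where "P i = part3 i \<inter> verts (C3_blowup n)" for i
    have t: "cyclic_triple (C3_blowup n) (P 0) (P 1) (P 2)" unfolding P_def by (rule C3_blowup_triple(1)[OF 3])
    have card: "card (P i) = (n + 2 - i) div 3" if "i \<in> {..<3}" for i
      unfolding P_def by (rule C3_blowup_triple(3)[OF 3 that])
    have iso: "tiso (C3_blowup ((n + 2 - i) div 3)) (induced (C3_blowup n) (P i))" if "i \<in> {..<3}" for i
      unfolding P_def by (rule C3_blowup_triple(2)[OF 3 that])
    have parts: "C3_decomposable (induced (C3_blowup n) (P i)) \<and> equally_C3_decomposable k (induced (C3_blowup n) (P i))"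
      if "i \<in> {..<3}" for i
      using tiso_C3_decomposable[OF iso[OF that] C3_decomposable_C3_blowup]
        tiso_equally_C3_decomposable[OF iso[OF that] Suc.IH] by blast
    have "Max {card (P 0), card (P 1), card (P 2)} - Min {card (P 0), card (P 1), card (P 2)} \<le> 1"
    proof -
      have "card (P 0) = (n + 2) div 3" "card (P 1) = (n + 1) div 3" "card (P 2) = n div 3"
        using card[of 0] card[of 1] card[of 2] by simp_all
      moreover have "n div 3 \<le> (n + 1) div 3" "(n + 1) div 3 \<le> (n + 2) div 3" "(n + 2) div 3 \<le> n div 3 + 1"
        by linarith+
      moreover have "Max {a, b, c} - Min {a, b, c} \<le> 1" if "c \<le> b" "b \<le> a" "a \<le> c + 1" for a b c :: nat
        using that by (auto simp: max_def min_def)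
      ultimately show ?thesis by metis
    qed
    then show ?thesis unfolding equally_C3_decomposable.simps
      using t parts[of 0] parts[of 1] parts[of 2] by (intro disjI2 exI[of _ "P 0"] exI[of _ "P 1"] exI[of _ "P 2"]) simp
  qed
qed

text \<open>Both rest on identities in the squared differences, which are at most 1. The excess is
  linear in \<open>a + b + c\<close> while the main terms are cubic, so for part sizes it becomes
  negligible.\<close>

lemma cube_sum_near_equal:
  fixes a b c :: real
  assumes "0 \<le> a" "0 \<le> b" "0 \<le> c" "\<bar>a - b\<bar> \<le> 1" "\<bar>b - c\<bar> \<le> 1" "\<bar>c - a\<bar> \<le> 1"
  shows "(a + b + c) * (a * b + b * c + c * a) - 9 * (a * b * c) \<le> a + b + c"
    "9 * (a ^ 3 + b ^ 3 + c ^ 3) \<le> (a + b + c) ^ 3 + 12 * (a + b + c)"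
proof -
  have sq: "(a - b)\<^sup>2 \<le> 1" "(b - c)\<^sup>2 \<le> 1" "(c - a)\<^sup>2 \<le> 1"
    using assms by (simp_all add: abs_square_le_1)
  have "(a + b + c) * (a * b + b * c + c * a) - 9 * (a * b * c) = a * (b - c)\<^sup>2 + b * (c - a)\<^sup>2 + c * (a - b)\<^sup>2"
    by (simp add: power2_eq_square algebra_simps)
  also have "\<dots> \<le> a * 1 + b * 1 + c * 1"
    using assms sq by (intro add_mono mult_left_mono) auto
  finally show "(a + b + c) * (a * b + b * c + c * a) - 9 * (a * b * c) \<le> a + b + c" by simp
  have "9 * (a ^ 3 + b ^ 3 + c ^ 3) - (a + b + c) ^ 3 =
      4 * (a + b + c) * ((a - b)\<^sup>2 + (b - c)\<^sup>2 + (c - a)\<^sup>2) - 3 * (a * (b - c)\<^sup>2 + b * (c - a)\<^sup>2 + c * (a - b)\<^sup>2)"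
    by (simp add: power2_eq_square power3_eq_cube algebra_simps)
  also have "\<dots> \<le> 4 * (a + b + c) * (1 + 1 + 1) - 0"
    using assms sq by (intro diff_mono mult_left_mono add_mono) auto
  finally show "9 * (a ^ 3 + b ^ 3 + c ^ 3) \<le> (a + b + c) ^ 3 + 12 * (a + b + c)" by simp
qed

text \<open>Each level of nearly equal parts multiplies the imbalance by about
  \<open>3 * (1/3) ^ 3 = 1/9\<close>, starting from the trivial bound \<open>1/8\<close>; rounding
  the part sizes costs at most \<open>2 / tsize T\<close> per level.\<close>

lemma equally_C3_decomposable_imbalance:
  "equally_C3_decomposable k T \<Longrightarrow> 0 < tsize T \<Longrightarrow> imbalance T \<le> 1/8 * (1/9) ^ k + 2 * real k / real (tsize T)"
proof (induction k arbitrary: T)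
  case 0
  then show ?case using imbalance_le by simp
next
  case (Suc k)
  define n where "n = real (tsize T)"
  define c where "c = 1/8 * (1/9 :: real) ^ k"
  have c: "0 \<le> c" "c \<le> 1/8" by (auto simp: c_def power_le_one)
  have n0: "0 < n" using Suc.prems by (simp add: n_def)
  show ?case
  proof (cases "tsize T \<le> 1")
    case True
    then have "tsize T = 1" using Suc.prems by simp
    then show ?thesis using imbalance_le[of T] by (simp add: add_increasing)
  next
    case False
    then obtain A B C where t: "cyclic_triple T A B C"
      and size: "Max {card A, card B, card C} - Min {card A, card B, card C} \<le> 1"
      and eqs: "equally_C3_decomposable k (induced T A)" "equally_C3_decomposable k (induced T B)"
        "equally_C3_decomposable k (induced T C)"
      using Suc.prems(1) by auto
    define P where "P i = (if i = 0 then A else if i = 1 then B else C)" for i :: nat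
    have P: "cyclic_partition T P" using cyclic_triple_partition[OF t] unfolding P_def .
    have T0: "0 < tsize T" by (rule Suc.prems)
    define x where "x i = real (card (P i)) / n" for i
    have near: "\<bar>real (card A) - real (card B)\<bar> \<le> 1" "\<bar>real (card B) - real (card C)\<bar> \<le> 1"
      "\<bar>real (card C) - real (card A)\<bar> \<le> 1"
    proof -
      have "card X \<le> card Y + 1" if "X \<in> {A, B, C}" "Y \<in> {A, B, C}" for X Y
      proof -
        have "card X \<le> Max {card A, card B, card C}" using that by (intro Max_ge) auto
        moreover have "Min {card A, card B, card C} \<le> card Y" using that by (intro Min_le) auto
        ultimately show ?thesis using size by linarith
      qed
      then have "card A \<le> card B + 1" "card B \<le> card A + 1" "card B \<le> card C + 1" "card C \<le> card B + 1"
        "card C \<le> card A + 1" "card A \<le> card C + 1" by blast+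
      then show "\<bar>real (card A) - real (card B)\<bar> \<le> 1" "\<bar>real (card B) - real (card C)\<bar> \<le> 1"
        "\<bar>real (card C) - real (card A)\<bar> \<le> 1" by linarith+
    qed
    have x1: "x 0 + x 1 + x 2 = 1" unfolding x_def n_def by (rule cyclic_partition_fracs[OF P T0])
    have x0: "0 \<le> x i" for i using n0 by (simp add: x_def)
    have abc: "x 0 = real (card A) / n" "x 1 = real (card B) / n" "x 2 = real (card C) / n"
      by (simp_all add: x_def P_def)
    have nABC: "real (card A) + real (card B) + real (card C) = n"
      using x1 n0 unfolding abc by (simp add: add_divide_distrib[symmetric])
    note cs = cube_sum_near_equal[OF _ _ _ near, unfolded nABC, OF of_nat_0_le_iff of_nat_0_le_iff of_nat_0_le_iff]
    have G: "x 0 * x 1 + x 1 * x 2 + x 2 * x 0 - 9 * (x 0 * x 1 * x 2) \<le> 1 / n"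
    proof -
      have "x 0 * x 1 + x 1 * x 2 + x 2 * x 0 - 9 * (x 0 * x 1 * x 2) =
        (n * (real (card A) * real (card B) + real (card B) * real (card C) + real (card C) * real (card A)) -
          9 * (real (card A) * real (card B) * real (card C))) / n ^ 3"
        unfolding abc using n0 by (simp add: field_simps power3_eq_cube)
      also have "\<dots> \<le> n / n ^ 3" using cs(1) n0 by (intro divide_right_mono) auto
      also have "\<dots> \<le> 1 / n" using n0 False by (simp add: field_simps power3_eq_cube n_def)
      finally show ?thesis .
    qed
    have cub: "x 0 ^ 3 + x 1 ^ 3 + x 2 ^ 3 \<le> 1/9 + 12/9 / n"
    proof -
      have "x 0 ^ 3 + x 1 ^ 3 + x 2 ^ 3 = (9 * (real (card A) ^ 3 + real (card B) ^ 3 + real (card C) ^ 3)) / (9 * n ^ 3)"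
        unfolding abc using n0 by (simp add: power_divide add_divide_distrib)
      also have "\<dots> \<le> (n ^ 3 + 12 * n) / (9 * n ^ 3)" using cs(2) n0 by (intro divide_right_mono) auto
      also have "\<dots> = 1/9 + 12/9 * (1 / n ^ 2)" using n0 by (simp add: field_simps power2_eq_square power3_eq_cube)
      also have "\<dots> \<le> 1/9 + 12/9 * (1 / n)"
        using n0 False by (intro add_left_mono mult_left_mono divide_left_mono) (auto simp: power2_eq_square n_def)
      finally show ?thesis by simp
    qed
    have part: "x i ^ 3 * imbalance (induced T (P i)) \<le> x i ^ 3 * c + x i * (2 * real k / n)" if i: "i \<in> {..<3}" for i
    proof (cases "card (P i) = 0")
      case True then show ?thesis by (simp add: x_def)
    next
      case False
      have ts: "tsize (induced T (P i)) = card (P i)" using cyclic_partitionD(1)[OF P i] by (simp add: tsize_induced)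
      have "equally_C3_decomposable k (induced T (P i))" using eqs by (simp add: P_def)
      then have "imbalance (induced T (P i)) \<le> c + 2 * real k / real (card (P i))"
        using Suc.IH[of "induced T (P i)"] False unfolding ts c_def by simp
      then have "x i ^ 3 * imbalance (induced T (P i)) \<le> x i ^ 3 * (c + 2 * real k / real (card (P i)))"
        using x0 by (intro mult_left_mono) auto
      also have "\<dots> = x i ^ 3 * c + x i ^ 2 * (2 * real k / n)"
        using False n0 by (simp add: x_def field_simps power2_eq_square power3_eq_cube)
      also have "\<dots> \<le> x i ^ 3 * c + x i * (2 * real k / n)"
      proof -
        have "x i \<le> 1" using lessThan_3_cases[OF i] x0[of 0] x0[of 1] x0[of 2] x1 by auto
        then have "x i ^ 2 \<le> x i" using x0[of i] by (simp add: power2_eq_square mult_left_le)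
        then show ?thesis using n0 by (intro add_left_mono mult_right_mono) auto
      qed
      finally show ?thesis .
    qed
    have "imbalance T = (\<Sum>i<3. x i ^ 3 * imbalance (induced T (P i))) +
        3/8 * (x 0 * x 1 + x 1 * x 2 + x 2 * x 0 - 9 * (x 0 * x 1 * x 2))"
      unfolding x_def n_def by (rule imbalance_split[OF P T0])
    also have "\<dots> \<le> (\<Sum>i<3. x i ^ 3 * c + x i * (2 * real k / n)) + 3/8 * (1 / n)"
      using part G by (intro add_mono sum_mono mult_left_mono) auto
    also have "\<dots> = (x 0 ^ 3 + x 1 ^ 3 + x 2 ^ 3) * c + (x 0 + x 1 + x 2) * (2 * real k / n) + 3/8 * (1 / n)"
      unfolding sum_lessThan_3 by (simp add: algebra_simps add_divide_distrib)
    also have "\<dots> \<le> (1/9 + 12/9 / n) * c + 1 * (2 * real k / n) + 3/8 * (1 / n)"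
      using mult_right_mono[OF cub c(1)] unfolding x1 by simp
    also have "\<dots> = c / 9 + 2 * real k / n + (12/9 * c + 3/8) / n"
      using n0 by (simp add: field_simps)
    \<comment> \<open>As \<open>c \<le> 1/8\<close>, the constant \<open>12/9 * c + 3/8\<close> is
      at most \<open>13/24\<close>.\<close>
    also have "\<dots> \<le> c / 9 + 2 * real k / n + 2 / n"
      using c n0 by (intro add_left_mono divide_right_mono) auto
    also have "\<dots> = 1/8 * (1/9) ^ Suc k + 2 * real (Suc k) / n"
      by (simp add: c_def add_divide_distrib algebra_simps)
    finally show ?thesis by (simp add: n_def)
  qed
qed

text \<open>A blow-up is \<open>k\<close>-equally decomposable for every \<open>k\<close>, so
  \<open>k\<close> can be fixed before \<open>n\<close> grows.\<close>

lemma imbalance_C3_blowup: "(\<lambda>n. imbalance (C3_blowup n)) \<longlonglongrightarrow> 0"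
proof (rule LIMSEQ_I)
  fix e :: real assume e: "0 < e"
  obtain k where k: "(1/9 :: real) ^ k < e" using real_arch_pow_inv[OF e, of "1/9"] by auto
  obtain N where N: "4 * real k / e < real N" using reals_Archimedean2 by blast
  show "\<exists>N. \<forall>n\<ge>N. norm (imbalance (C3_blowup n) - 0) < e"
  proof (intro exI[of _ "Suc N"] allI impI)
    fix n assume n: "Suc N \<le> n"
    then have "4 * real k / e < real n" using N by linarith
    then have "2 * real k / real n < e / 2" using e n by (simp add: field_simps)
    moreover have "imbalance (C3_blowup n) \<le> 1/8 * (1/9) ^ k + 2 * real k / real n"
      using equally_C3_decomposable_imbalance[OF equally_C3_decomposable_C3_blowup, of n k] n
      by (simp add: tsize_C3_blowup)
    ultimately show "norm (imbalance (C3_blowup n) - 0) < e" using k e imbalance_nonneg[of "C3_blowup n"] by simp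
  qed
qed

section \<open>Lower bounds for homomorphism densities in the blow-ups\<close>

lemma rot_ncompat: "g \<in> ncompat F \<Longrightarrow> rot (verts F) g \<in> ncompat F"
  using rot_compat[of g F] rot_noncst[of g "verts F"] compat_PiE[of g F] unfolding ncompat_def by blast

text \<open>All three parts of the blow-up of size \<open>3 * n\<close> are blow-ups of size exactly
  \<open>n\<close>. Of the non-constant colourings only the orbit of \<open>g\<close> under rotation
  is kept: three colourings with equal contributions.\<close>

lemma C3_blowup_3n_lower_bound:
  assumes g: "g \<in> ncompat F" and n: "1 \<le> n"
  shows "3 * (1/3) ^ tsize F * (hom_density F (C3_blowup n) + (\<Prod>i<3. hom_density (fibre F g i) (C3_blowup n)))
    \<le> hom_density F (C3_blowup (3 * n))"
proof -
  let ?T = "C3_blowup (3 * n)" and ?V = "verts F"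
  have n3: "2 < 3 * n" using n by simp
  have div: "(3 * n + 2 - i) div 3 = n" if "i \<in> {..<3}" for i
    using lessThan_3_cases[OF that] by (elim disjE) simp_all
  define P where "P i = (if i = 0 then part3 0 \<inter> verts ?T else if i = 1 then part3 1 \<inter> verts ?T else part3 2 \<inter> verts ?T)" for i :: nat
  have P: "cyclic_partition ?T P" unfolding P_def by (rule cyclic_triple_partition[OF C3_blowup_triple(1)[OF n3]])
  have Pi: "P i = part3 i \<inter> verts ?T" if "i \<in> {..<3}" for i
    using lessThan_3_cases[OF that] by (elim disjE) (simp_all add: P_def)
  have card: "card (P i) = n" if i: "i \<in> {..<3}" for i
    unfolding Pi[OF i] C3_blowup_triple(3)[OF n3 i] by (rule div[OF i])
  have h: "hom_density F' (induced ?T (P i)) = hom_density F' (C3_blowup n)" if i: "i \<in> {..<3}" for F' i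
    using hom_density_tiso[OF C3_blowup_triple(2)[OF n3 i], of F'] unfolding Pi[OF i] div[OF i] by simp
  have T: "0 < tsize ?T" using n by (simp add: tsize_C3_blowup)
  have V: "?V \<noteq> {}" using g by (auto simp: ncompat_def)
  then obtain v where v: "v \<in> ?V" by blast
  have gP: "g \<in> ?V \<rightarrow>\<^sub>E {..<3}" using g compat_PiE by (simp add: ncompat_def)
  define p where "p = (\<Prod>i<3. hom_density (fibre F g i) (C3_blowup n))"
  define S where "S = {g, rot ?V g, rot ?V (rot ?V g)}"
  have S: "S \<subseteq> ncompat F" using g rot_ncompat unfolding S_def by blast
  have cS: "card S = 3"
  proof -
    have "g v \<noteq> rot ?V g v" "g v \<noteq> rot ?V (rot ?V g) v" "rot ?V g v \<noteq> rot ?V (rot ?V g) v"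
      using lessThan_3_cases[OF PiE_mem[OF gP v]] v by (elim disjE; simp add: rot_def)+
    then have "g \<noteq> rot ?V g" "g \<noteq> rot ?V (rot ?V g)" "rot ?V g \<noteq> rot ?V (rot ?V g)" by metis+
    then show ?thesis by (simp add: S_def)
  qed
  let ?f = "\<lambda>g. (\<Prod>v\<in>?V. real (card (P (g v))) / real (tsize ?T)) *
      (\<Prod>i<3. hom_density (fibre F g i) (induced ?T (P i)))"
  have f: "?f k = (1/3) ^ tsize F * (\<Prod>i<3. hom_density (fibre F k i) (C3_blowup n))" if k: "k \<in> ncompat F" for k
  proof -
    have kP: "k \<in> ?V \<rightarrow>\<^sub>E {..<3}" using k compat_PiE by (simp add: ncompat_def)
    have "(\<Prod>v\<in>?V. real (card (P (k v))) / real (tsize ?T)) = (\<Prod>v\<in>?V. 1/3)"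
    proof (rule prod.cong[OF refl])
      fix v assume "v \<in> ?V"
      then have "card (P (k v)) = n" by (intro card PiE_mem[OF kP])
      then show "real (card (P (k v))) / real (tsize ?T) = 1/3" using n by (simp add: tsize_C3_blowup)
    qed
    then show ?thesis using h by (simp add: tsize_def)
  qed
  have "(\<Sum>k\<in>S. ?f k) = (\<Sum>k\<in>S. (1/3) ^ tsize F * p)"
  proof (rule sum.cong[OF refl])
    fix k assume k: "k \<in> S"
    have "(\<Prod>i<3. hom_density (fibre F k i) (C3_blowup n)) = p"
      using k prod_fibre_rot[OF gP, of "\<lambda>F. hom_density F (C3_blowup n)"]
        prod_fibre_rot[OF rot_PiE[OF gP], of "\<lambda>F. hom_density F (C3_blowup n)"]
      unfolding S_def p_def by auto
    then show "?f k = (1/3) ^ tsize F * p" using f k S by auto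
  qed
  also have "\<dots> = 3 * (1/3) ^ tsize F * p" using cS by simp
  finally have sumS: "(\<Sum>k\<in>S. ?f k) = 3 * (1/3) ^ tsize F * p" .
  have "(\<Sum>i<3. (real (card (P i)) / real (tsize ?T)) ^ tsize F * hom_density F (induced ?T (P i))) =
      (\<Sum>i<3::nat. (1/3) ^ tsize F * hom_density F (C3_blowup n))"
    using n card h by (intro sum.cong refl) (simp add: tsize_C3_blowup)
  then have "hom_density F ?T = 3 * (1/3) ^ tsize F * hom_density F (C3_blowup n) + (\<Sum>k\<in>ncompat F. ?f k)"
    unfolding hom_density_split_nonconst[OF P T V] by simp
  moreover have "(\<Sum>k\<in>S. ?f k) \<le> (\<Sum>k\<in>ncompat F. ?f k)"
    using S by (intro sum_mono2 mult_nonneg_nonneg prod_nonneg) (auto simp: hom_density_nonneg)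
  ultimately show ?thesis unfolding sumS p_def[symmetric] by (simp add: algebra_simps)
qed

text \<open>Follows along the sizes \<open>3 * n\<close>. The inequality amounts to
  \<open>p \<le> (3 ^ (tsize F - 1) - 1) * f\<close>, hence to \<open>p / 80 \<le> f\<close> for
  five vertices.\<close>

lemma C3_blowup_limit_lower_bound:
  assumes g: "g \<in> ncompat F" and f: "(\<lambda>n. hom_density F (C3_blowup n)) \<longlonglongrightarrow> f"
    and p: "(\<lambda>n. \<Prod>i<3. hom_density (fibre F g i) (C3_blowup n)) \<longlonglongrightarrow> p"
  shows "3 * (1/3) ^ tsize F * (f + p) \<le> f"
proof (rule LIMSEQ_le)
  show "(\<lambda>n. 3 * (1/3) ^ tsize F * (hom_density F (C3_blowup n) + (\<Prod>i<3. hom_density (fibre F g i) (C3_blowup n))))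
    \<longlonglongrightarrow> 3 * (1/3) ^ tsize F * (f + p)"
    by (intro tendsto_intros f p)
  have "filterlim (\<lambda>n::nat. 3 * n) sequentially sequentially"
    by (intro filterlim_subseq strict_monoI) simp
  from filterlim_compose[OF f this] show "(\<lambda>n. hom_density F (C3_blowup (3 * n))) \<longlonglongrightarrow> f" .
  show "\<exists>N. \<forall>n\<ge>N. 3 * (1/3) ^ tsize F * (hom_density F (C3_blowup n) + (\<Prod>i<3. hom_density (fibre F g i) (C3_blowup n)))
    \<le> hom_density F (C3_blowup (3 * n))"
    using C3_blowup_3n_lower_bound[OF g] by blast
qed

lemma C3_blowup_sizes: "filterlim (\<lambda>n. tsize (C3_blowup n)) at_top sequentially"
  unfolding tsize_C3_blowup by (rule filterlim_ident)

lemma hom_density_small_limit: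
  "tsize F = 1 \<Longrightarrow> (\<lambda>n. hom_density F (C3_blowup n)) \<longlonglongrightarrow> 1"
  "tsize F = 2 \<Longrightarrow> (\<lambda>n. hom_density F (C3_blowup n)) \<longlonglongrightarrow> 1/2"
  "tiso cyc3 F \<Longrightarrow> (\<lambda>n. hom_density F (C3_blowup n)) \<longlonglongrightarrow> 1/8"
proof -
  have ev: "\<forall>\<^sub>F n in sequentially. 0 < tsize (C3_blowup n)"
    by (rule eventually_sequentiallyI[of 1]) (simp add: tsize_C3_blowup)
  show "(\<lambda>n. hom_density F (C3_blowup n)) \<longlonglongrightarrow> 1" if "tsize F = 1"
    by (rule tendsto_eventually, rule eventually_mono[OF ev]) (rule tsize_1_hom_density[OF that])
  show "(\<lambda>n. hom_density F (C3_blowup n)) \<longlonglongrightarrow> 1/2" if F: "tsize F = 2"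
  proof -
    have "(\<lambda>n. 1/2 - 1/2 * (1 / real n)) \<longlonglongrightarrow> 1/2 - 1/2 * 0"
      by (intro tendsto_intros lim_1_over_n)
    then have "(\<lambda>n. 1/2 - 1/2 * (1 / real n)) \<longlonglongrightarrow> 1/2" by simp
    then show ?thesis
      by (rule Lim_transform_eventually)
        (rule eventually_mono[OF ev], simp add: tsize_2_hom_density[OF F] tsize_C3_blowup)
  qed
  show "(\<lambda>n. hom_density F (C3_blowup n)) \<longlonglongrightarrow> 1/8" if "tiso cyc3 F"
  proof -
    have "(\<lambda>n. 1/8 - imbalance (C3_blowup n)) \<longlonglongrightarrow> 1/8 - 0"
      by (intro tendsto_intros imbalance_C3_blowup)
    then show ?thesis by (simp add: imbalance_def hom_density_tiso_left[OF that])
  qed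
qed

text \<open>The colour classes \<open>{1, 2}\<close>, \<open>{3, 4}\<close>, \<open>{5}\<close> have
  densities \<open>1/2\<close>, \<open>1/2\<close>, \<open>1\<close>, so \<open>f\<close> is at
  least \<open>(1/4) / 80\<close>.\<close>

lemma T5_9_C3_blowup:
  assumes f: "(\<lambda>n. hom_density T5_9 (C3_blowup n)) \<longlonglongrightarrow> f" shows "1/320 \<le> f"
proof -
  define g where "g = (\<lambda>v\<in>verts T5_9. if v \<le> 2 then 0 else if v \<le> 4 then 1 else 2 :: nat)"
  have g: "g \<in> ncompat T5_9" by (auto simp: g_def ncompat_def compat_def arcs_T5)
  have "{v \<in> verts T5_9. g v = 0} = {1, 2}" "{v \<in> verts T5_9. g v = 1} = {3, 4}" "{v \<in> verts T5_9. g v = 2} = {5}"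
    by (auto simp: g_def)
  then have size: "tsize (fibre T5_9 g 0) = 2" "tsize (fibre T5_9 g 1) = 2" "tsize (fibre T5_9 g 2) = 1"
    unfolding tsize_def verts_fibre by simp_all
  have "(\<lambda>n. \<Prod>i<3. hom_density (fibre T5_9 g i) (C3_blowup n)) \<longlonglongrightarrow> 1/2 * (1/2) * 1"
    unfolding prod_lessThan_3 by (intro tendsto_mult hom_density_small_limit size)
  from C3_blowup_limit_lower_bound[OF g f this] show ?thesis by (simp add: eval_nat_numeral)
qed

text \<open>The directed triangle \<open>2, 3, 4\<close> goes into one part and has density
  \<open>1/8\<close> there, so \<open>f\<close> is at least \<open>(1/8) / 80\<close>.\<close>

lemma T5_11_C3_blowup:
  assumes f: "(\<lambda>n. hom_density T5_11 (C3_blowup n)) \<longlonglongrightarrow> f" shows "1/640 \<le> f"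
proof -
  define g where "g = (\<lambda>v\<in>verts T5_11. if v = 1 then 2 else if v = 5 then 1 else 0 :: nat)"
  have g: "g \<in> ncompat T5_11" by (auto simp: g_def ncompat_def compat_def arcs_T5)
  have fib: "{v \<in> verts T5_11. g v = 0} = {2, 3, 4}" "{v \<in> verts T5_11. g v = 1} = {5}" "{v \<in> verts T5_11. g v = 2} = {1}"
    by (auto simp: g_def)
  have size: "tsize (fibre T5_11 g 1) = 1" "tsize (fibre T5_11 g 2) = 1"
    unfolding tsize_def verts_fibre fib by simp_all
  have "tiso cyc3 (fibre T5_11 g 0)"
    unfolding tiso_def verts_fibre fib
  proof (intro exI[of _ "\<lambda>v. v + 2"] conjI ballI)
    show "bij_betw (\<lambda>v. v + 2) (verts cyc3) {2, 3, 4}" by (auto simp: bij_betw_def)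
  qed (auto simp: g_def arcs_T5)
  then have "(\<lambda>n. \<Prod>i<3. hom_density (fibre T5_11 g i) (C3_blowup n)) \<longlonglongrightarrow> 1/8 * 1 * 1"
    unfolding prod_lessThan_3 by (intro tendsto_mult hom_density_small_limit size)
  from C3_blowup_limit_lower_bound[OF g f this] show ?thesis by (simp add: eval_nat_numeral)
qed

section \<open>Sum-of-squares certificates\<close>

definition cyc_triangle :: "(nat \<Rightarrow> nat \<Rightarrow> bool) \<Rightarrow> nat \<Rightarrow> nat \<Rightarrow> nat \<Rightarrow> bool" where
  "cyc_triangle R a b c \<longleftrightarrow> R a b \<and> R b c \<and> R c a"

definition arc_sign :: "(nat \<Rightarrow> nat \<Rightarrow> bool) \<Rightarrow> nat \<Rightarrow> nat \<Rightarrow> int" where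
  "arc_sign R a b = (if R a b then 1 else - 1)"

text \<open>Depends only on how many of \<open>a\<close>, \<open>b\<close>, \<open>c\<close> beat
  \<open>w\<close>. In the blow-up limit this and the next three functions have mean 0 in
  \<open>w\<close> for almost every directed triangle, and so has \<open>vertex_pair\<close> over
  pairs: their squares must vanish where the bound is attained.\<close>

definition majority :: "(nat \<Rightarrow> nat \<Rightarrow> bool) \<Rightarrow> nat \<Rightarrow> nat \<Rightarrow> nat \<Rightarrow> nat \<Rightarrow> int" where
  "majority R a b c w = (if R a w then if R b w then if R c w then 2 else 1 else if R c w then 1 else - 1
     else if R b w then if R c w then 1 else - 1 else if R c w then - 1 else - 2)"

text \<open>Nonzero exactly for the \<open>w\<close> that can replace \<open>a\<close> in the
  triangle.\<close>

definition twin_sign :: "(nat \<Rightarrow> nat \<Rightarrow> bool) \<Rightarrow> nat \<Rightarrow> nat \<Rightarrow> nat \<Rightarrow> nat \<Rightarrow> int" where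
  "twin_sign R a b c w = (if R w b \<and> R c w then if R a w then 1 else - 1 else 0)"

definition dominance :: "(nat \<Rightarrow> nat \<Rightarrow> bool) \<Rightarrow> nat \<Rightarrow> nat \<Rightarrow> nat \<Rightarrow> nat \<Rightarrow> int" where
  "dominance R a b c w = (if R a w then if R b w then if R c w then 1 else 0 else 0
     else if R b w then 0 else if R c w then 0 else - 1)"

text \<open>Compares the \<open>w\<close> that can replace \<open>a\<close> with those that can
  replace \<open>b\<close>, hence the sizes of two parts.\<close>

definition twin_diff :: "(nat \<Rightarrow> nat \<Rightarrow> bool) \<Rightarrow> nat \<Rightarrow> nat \<Rightarrow> nat \<Rightarrow> nat \<Rightarrow> int" where
  "twin_diff R a b c w = (if R w b \<and> R c w then 1 else if R w c \<and> R a w then - 1 else 0)"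

definition vertex_pair :: "(nat \<Rightarrow> nat \<Rightarrow> bool) \<Rightarrow> nat \<Rightarrow> nat \<Rightarrow> nat \<Rightarrow> int" where
  "vertex_pair R a u w = (if R a u then if R a w then 1 else if R u w \<and> R w a then 2 else - 2
     else if R a w then - 2 else 1)"

text \<open>For a fixed directed triangle \<open>a, b, c\<close>, or a fixed vertex \<open>a\<close>, every summand below is a
  product of the same function of disjoint groups of the remaining vertices, so that summing over all
  5-tuples gives squares; the summand of the arc signs gives the fourth moment of the degrees. Functions
  and weights were obtained by solving the semidefinite programme numerically and rounding.\<close>

definition sos11 :: "(nat \<Rightarrow> nat \<Rightarrow> bool) \<Rightarrow> nat \<Rightarrow> nat \<Rightarrow> nat \<Rightarrow> nat \<Rightarrow> nat \<Rightarrow> int" where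
  "sos11 R a b c d e =
     (if cyc_triangle R a b c then 20 * (majority R a b c d * majority R a b c e) +
        180 * (twin_sign R a b c d * twin_sign R a b c e) else 0) +
     5 * (arc_sign R a b * arc_sign R a c * (arc_sign R a d * arc_sign R a e))"

definition sos9 :: "(nat \<Rightarrow> nat \<Rightarrow> bool) \<Rightarrow> nat \<Rightarrow> nat \<Rightarrow> nat \<Rightarrow> nat \<Rightarrow> nat \<Rightarrow> int" where
  "sos9 R a b c d e =
     (if cyc_triangle R a b c then 112 * (dominance R a b c d * dominance R a b c e) +
        24 * (twin_diff R a b c d * twin_diff R a b c e) else 0) +
     4 * (vertex_pair R a b c * vertex_pair R a d e) +
     arc_sign R a b * arc_sign R a c * (arc_sign R a d * arc_sign R a e)"

text \<open>The configuration excluded by \<open>zfree\<close>, with its vertices in the same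
  order.\<close>

definition zpat :: "(nat \<Rightarrow> nat \<Rightarrow> bool) \<Rightarrow> nat \<Rightarrow> nat \<Rightarrow> nat \<Rightarrow> nat \<Rightarrow> nat \<Rightarrow> bool" where
  "zpat R a b c d e \<longleftrightarrow> R a b \<and> R a c \<and> R d a \<and> R e a \<and> R b d \<and> R c d \<and> R b e \<and> R e c"

definition pat11 :: "(nat \<Rightarrow> nat \<Rightarrow> bool) \<Rightarrow> nat \<Rightarrow> nat \<Rightarrow> nat \<Rightarrow> nat \<Rightarrow> nat \<Rightarrow> bool" where
  "pat11 R a b c d e \<longleftrightarrow> R b c \<and> R c d \<and> R d b \<and> R a b \<and> R a c \<and> R a d \<and> R b e \<and> R c e \<and> R d e \<and> R e a"

definition pat9 :: "(nat \<Rightarrow> nat \<Rightarrow> bool) \<Rightarrow> nat \<Rightarrow> nat \<Rightarrow> nat \<Rightarrow> nat \<Rightarrow> nat \<Rightarrow> bool" where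
  "pat9 R a b c d e \<longleftrightarrow> R a b \<and> R a c \<and> R a d \<and> R b c \<and> R b d \<and> R c d \<and> R c e \<and> R d e \<and> R e a \<and> R e b"

text \<open>The constants \<open>640\<close> and \<open>320\<close> are the reciprocals of the homomorphism densities in the blow-ups;
  \<open>24\<close> and \<open>16\<close> are slack that penalises the forbidden configuration.\<close>

definition cert11 :: "(nat \<Rightarrow> nat \<Rightarrow> bool) \<Rightarrow> nat \<Rightarrow> nat \<Rightarrow> nat \<Rightarrow> nat \<Rightarrow> nat \<Rightarrow> int" where
  "cert11 R a b c d e = 1 - (if pat11 R a b c d e then 640 else 0) - sos11 R a b c d e
     - (if zpat R a b c d e then 24 else 0)"

definition cert9 :: "(nat \<Rightarrow> nat \<Rightarrow> bool) \<Rightarrow> nat \<Rightarrow> nat \<Rightarrow> nat \<Rightarrow> nat \<Rightarrow> nat \<Rightarrow> int" where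
  "cert9 R a b c d e = 1 - (if pat9 R a b c d e then 320 else 0) - sos9 R a b c d e
     - (if zpat R a b c d e then 16 else 0)"

text \<open>The tournament on \<open>0, \<dots>, 4\<close> with the Hamiltonian path \<open>0 \<rightarrow> 1 \<rightarrow> 2 \<rightarrow> 3 \<rightarrow> 4\<close>; the bits give the arcs
  \<open>02, 03, 04, 13, 14, 24\<close>.\<close>

definition path_tournament :: "bool list \<Rightarrow> nat \<Rightarrow> nat \<Rightarrow> bool" where
  "path_tournament b i j = (if i = j then False else if j = Suc i then True else if i = Suc j then False else
     if i = 0 then (if j = 2 then b ! 0 else if j = 3 then b ! 1 else b ! 2)
     else if j = 0 then (if i = 2 then \<not> b ! 0 else if i = 3 then \<not> b ! 1 else \<not> b ! 2)
     else if i = 1 then (if j = 3 then b ! 3 else b ! 4)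
     else if j = 1 then (if i = 3 then \<not> b ! 3 else \<not> b ! 4)
     else if i = 2 then b ! 5 else \<not> b ! 5)"

definition at5 :: "(nat \<Rightarrow> nat \<Rightarrow> nat \<Rightarrow> nat \<Rightarrow> nat \<Rightarrow> 'b) \<Rightarrow> nat list \<Rightarrow> 'b" where
  "at5 f l = f (l ! 0) (l ! 1) (l ! 2) (l ! 3) (l ! 4)"

text \<open>Only this symmetrised value matters, since each 5-set is met in all its 120
  orders.\<close>

definition perm_total :: "((nat \<Rightarrow> nat \<Rightarrow> bool) \<Rightarrow> nat \<Rightarrow> nat \<Rightarrow> nat \<Rightarrow> nat \<Rightarrow> nat \<Rightarrow> int) \<Rightarrow> bool list \<Rightarrow> int" where
  "perm_total C b = sum_list (map (at5 (C (path_tournament b))) (permutations_of_set_list [0, 1, 2, 3, 4]))"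

text \<open>Every tournament on five vertices has a Hamiltonian path, so the 64 choices of the six
  remaining arcs cover all of them; each is settled by evaluation.\<close>

lemma total_cert11: "list_all (\<lambda>b. 0 \<le> perm_total cert11 b) (product_lists (replicate 6 [True, False]))"
  by code_simp

lemma total_cert9: "list_all (\<lambda>b. 0 \<le> perm_total cert9 b) (product_lists (replicate 6 [True, False]))"
  by code_simp

text \<open>A certificate looks only at the arcs among its arguments, which lets it be transported
  from any 5-set to the vertices \<open>0\<close> to \<open>4\<close>.\<close>

definition arc_local :: "((nat \<Rightarrow> nat \<Rightarrow> bool) \<Rightarrow> nat \<Rightarrow> nat \<Rightarrow> nat \<Rightarrow> nat \<Rightarrow> nat \<Rightarrow> int) \<Rightarrow> bool" where
  "arc_local C \<longleftrightarrow> (\<forall>R M f a b c d e. (\<forall>i\<in>{a, b, c, d, e}. \<forall>j\<in>{a, b, c, d, e}. R (f i) (f j) = M i j) \<longrightarrow>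
     C R (f a) (f b) (f c) (f d) (f e) = C M a b c d e)"

lemma arc_local_cert: "arc_local cert11" "arc_local cert9"
  unfolding arc_local_def cert11_def cert9_def sos11_def sos9_def cyc_triangle_def arc_sign_def majority_def
    twin_sign_def dominance_def twin_diff_def vertex_pair_def zpat_def pat11_def pat9_def
  by (intro allI impI, simp)+

text \<open>Redei's theorem by insertion. The claim about the head lets the induction prepend
  \<open>a\<close>: the new head is \<open>x\<close> or the old one, and \<open>a\<close> beats
  both.\<close>

lemma hamiltonian_path_insert:
  assumes total: "\<And>u v. u \<in> insert x (set l) \<Longrightarrow> v \<in> insert x (set l) \<Longrightarrow> u \<noteq> v \<Longrightarrow> R u v \<or> R v u"
    and l: "successively R l" "distinct l" "x \<notin> set l"
  shows "\<exists>l'. successively R l' \<and> distinct l' \<and> set l' = insert x (set l) \<and> (l = [] \<or> hd l' \<in> {x, hd l})"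
  using assms
proof (induction l)
  case Nil
  then show ?case by (intro exI[of _ "[x]"]) simp
next
  case (Cons a l)
  show ?case
  proof (cases "R x a")
    case True
    then show ?thesis using Cons.prems by (intro exI[of _ "x # a # l"]) auto
  next
    case False
    then have ax: "R a x" using Cons.prems(1)[of a x] Cons.prems(4) by auto
    have "successively R l" using Cons.prems(2) by (cases l) auto
    then have "\<exists>l'. successively R l' \<and> distinct l' \<and> set l' = insert x (set l) \<and> (l = [] \<or> hd l' \<in> {x, hd l})"
      using Cons.prems by (intro Cons.IH Cons.prems(1)) auto
    then obtain l' where l': "successively R l'" "distinct l'" "set l' = insert x (set l)" "l = [] \<or> hd l' \<in> {x, hd l}"
      by blast
    have "l' \<noteq> []" using l'(3) by auto
    then obtain y ys where y: "l' = y # ys" by (cases l') auto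
    have "R a y"
    proof (cases l)
      case Nil
      then have "y = x" using l'(3) y by auto
      then show ?thesis using ax by simp
    next
      case (Cons b m)
      then have "y = x \<or> y = b" using l'(4) y by auto
      then show ?thesis using ax Cons.prems(2) Cons by auto
    qed
    then have "successively R (a # l')" using l'(1) y by simp
    moreover have "distinct (a # l')" using l' Cons.prems by auto
    ultimately show ?thesis using l'(3) by (intro exI[of _ "a # l'"]) auto
  qed
qed

lemma hamiltonian_path:
  assumes "finite Y" "Y \<subseteq> verts T"
  shows "\<exists>l. successively (\<lambda>u v. (u, v) \<in> arcs T) l \<and> distinct l \<and> set l = Y"
  using assms
proof (induction Y rule: finite_induct)
  case empty
  then show ?case by (intro exI[of _ "[]"]) simp
next
  case (insert x Y)
  then obtain l where l: "successively (\<lambda>u v. (u, v) \<in> arcs T) l" "distinct l" "set l = Y" by auto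
  have "\<exists>l'. successively (\<lambda>u v. (u, v) \<in> arcs T) l' \<and> distinct l' \<and> set l' = insert x (set l) \<and> (l = [] \<or> hd l' \<in> {x, hd l})"
    using l insert.hyps insert.prems by (intro hamiltonian_path_insert arcs_total) auto
  then show ?case using l(3) by blast
qed

text \<open>A Hamiltonian path identifies \<open>Y\<close> with one of the tournaments
  \<open>path_tournament b\<close>; the sum over all orders does not depend on the path
  chosen.\<close>

lemma certificate_on_5_sets:
  assumes C: "arc_local C" and pos: "list_all (\<lambda>b. 0 \<le> perm_total C b) (product_lists (replicate 6 [True, False]))"
    and Y: "Y \<subseteq> verts T" "card Y = 5"
  shows "0 \<le> (\<Sum>l\<in>permutations_of_set Y. at5 (C (\<lambda>u v. (u, v) \<in> arcs T)) l)"
proof -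
  let ?R = "\<lambda>u v. (u, v) \<in> arcs T"
  have "finite Y" using Y(1) by (rule finite_sub)
  then obtain l where l: "successively ?R l" "distinct l" "set l = Y" using hamiltonian_path Y(1) by blast
  then have "length l = 5" using Y(2) distinct_card by fastforce
  then obtain p q r s t where pq: "l = [p, q, r, s, t]"
    by (auto simp: length_Suc_conv eval_nat_numeral)
  have path: "?R p q" "?R q r" "?R r s" "?R s t" using l(1) by (auto simp: pq)
  have ne: "p \<noteq> q" "p \<noteq> r" "p \<noteq> s" "p \<noteq> t" "q \<noteq> r" "q \<noteq> s" "q \<noteq> t" "r \<noteq> s" "r \<noteq> t" "s \<noteq> t"
    using l(2) by (auto simp: pq)
  have V: "p \<in> verts T" "q \<in> verts T" "r \<in> verts T" "s \<in> verts T" "t \<in> verts T" using Y(1) l(3) by (auto simp: pq)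
  define b where "b = [?R p r, ?R p s, ?R p t, ?R q s, ?R q t, ?R r t]"
  have I: "i = 0 \<or> i = 1 \<or> i = 2 \<or> i = 3 \<or> i = 4" if "i \<in> {0, 1, 2, 3, 4 :: nat}" for i using that by simp
  have rev_arcs: "?R r p = (\<not> ?R p r)" "?R s p = (\<not> ?R p s)" "?R t p = (\<not> ?R p t)" "?R s q = (\<not> ?R q s)"
    "?R t q = (\<not> ?R q t)" "?R t r = (\<not> ?R r t)"
    using ne V arcs_iff_not by metis+
  have back_arcs: "\<not> ?R q p" "\<not> ?R r q" "\<not> ?R s r" "\<not> ?R t s" using path arcs_asym by blast+
  have M: "?R (l ! i) (l ! j) = path_tournament b i j" if "i \<in> {0, 1, 2, 3, 4}" "j \<in> {0, 1, 2, 3, 4}" for i j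
    using I[OF that(1)] I[OF that(2)]
    by (elim disjE) (simp_all add: pq path_tournament_def b_def path back_arcs rev_arcs)
  have Yim: "Y = (!) l ` {0, 1, 2, 3, 4}" using l(3) by (simp add: pq)
  have inj: "inj_on ((!) l) {0, 1, 2, 3, 4}" using ne by (auto simp: pq inj_on_def)
  have "(\<Sum>k\<in>permutations_of_set Y. at5 (C ?R) k) =
      (\<Sum>k\<in>permutations_of_set {0, 1, 2, 3, 4}. at5 (C ?R) (map ((!) l) k))"
    unfolding Yim permutations_of_set_image_inj[OF inj]
  proof (rule sum.reindex[unfolded o_def])
    show "inj_on (map ((!) l)) (permutations_of_set {0, 1, 2, 3, 4})"
      by (rule inj_onI, rule map_inj_on) (use inj in \<open>auto simp: permutations_of_set_def\<close>)
  qed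
  also have "\<dots> = (\<Sum>k\<in>permutations_of_set {0, 1, 2, 3, 4}. at5 (C (path_tournament b)) k)"
  proof (rule sum.cong[OF refl])
    fix k assume "k \<in> permutations_of_set {0, 1, 2, 3, 4 :: nat}"
    then have k: "set k = {0, 1, 2, 3, 4}" "distinct k" by (auto simp: permutations_of_set_def)
    then have len: "length k = 5" using distinct_card[of k] by simp
    have sub: "{k ! 0, k ! 1, k ! 2, k ! 3, k ! 4} \<subseteq> {0, 1, 2, 3, 4}"
      unfolding k(1)[symmetric] using len by (auto intro!: nth_mem)
    have "C ?R (l ! (k ! 0)) (l ! (k ! 1)) (l ! (k ! 2)) (l ! (k ! 3)) (l ! (k ! 4)) =
        C (path_tournament b) (k ! 0) (k ! 1) (k ! 2) (k ! 3) (k ! 4)"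
    proof (rule C[unfolded arc_local_def, rule_format])
      fix i j assume ij: "i \<in> {k ! 0, k ! 1, k ! 2, k ! 3, k ! 4}" "j \<in> {k ! 0, k ! 1, k ! 2, k ! 3, k ! 4}"
      show "?R (l ! i) (l ! j) = path_tournament b i j" by (rule M[OF subsetD[OF sub ij(1)] subsetD[OF sub ij(2)]])
    qed
    then show "at5 (C ?R) (map ((!) l) k) = at5 (C (path_tournament b)) k" using len by (simp add: at5_def)
  qed
  also have "\<dots> = perm_total C b"
  proof -
    have "permutations_of_set {0, 1, 2, 3, 4} = set (permutations_of_set_list [0, 1, 2, 3, 4 :: nat])"
      using permutations_of_list[of "[0, 1, 2, 3, 4 :: nat]"] by simp
    then show ?thesis unfolding perm_total_def
      by (simp add: sum_list_distinct_conv_sum_set distinct_permutations_of_set_list)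
  qed
  also have "0 \<le> \<dots>"
  proof -
    have "b \<in> set (product_lists (replicate 6 [True, False]))"
      unfolding b_def product_lists_set mem_Collect_eq by (simp add: numeral_eq_Suc)
    then show ?thesis using pos by (simp add: list_all_iff del: product_lists_set)
  qed
  finally show ?thesis .
qed

section \<open>Summation over 5-tuples with and without repetitions\<close>

definition lists5 :: "nat set \<Rightarrow> nat list set" where
  "lists5 V = {l. set l \<subseteq> V \<and> length l = 5}"

text \<open>Squares appear only when the five entries run independently over \<open>lists5\<close>,
  whereas the certificates are verified on distinct entries. Lists with repetitions are of order
  \<open>card V ^ 4\<close> in number and are treated as an error.\<close>

definition dlists5 :: "nat set \<Rightarrow> nat list set" where
  "dlists5 V = {l. set l \<subseteq> V \<and> length l = 5 \<and> distinct l}"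

lemma finite_lists5 [simp]: "finite V \<Longrightarrow> finite (lists5 V)"
  unfolding lists5_def by (rule finite_lists_length_eq)

lemma dlists5_subset: "dlists5 V \<subseteq> lists5 V"
  by (auto simp: dlists5_def lists5_def)

lemma card_lists5: "finite V \<Longrightarrow> card (lists5 V) = card V ^ 5"
  unfolding lists5_def by (rule card_lists_length_eq)

text \<open>The 10 is \<open>1 + 2 + 3 + 4\<close>, the number of pairs of positions; in terms of
  \<open>m = n - 5\<close> the difference has nonnegative coefficients.\<close>

lemma falling_5_lower_bound:
  assumes "5 \<le> n" shows "int n ^ 5 - 10 * int n ^ 4 \<le> int (\<Prod>{n - 5 + 1..n})"
proof -
  obtain m where m: "n = m + 5" using assms by (metis le_add_diff_inverse2)
  have "{n - 5 + 1..n} = {m + 1, m + 2, m + 3, m + 4, m + 5}" unfolding m by auto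
  then have "int (\<Prod>{n - 5 + 1..n}) = (int m + 1) * (int m + 2) * (int m + 3) * (int m + 4) * (int m + 5)"
    by (simp add: algebra_simps)
  moreover have "(x + 1) * (x + 2) * (x + 3) * (x + 4) * (x + 5) - ((x + 5) ^ 5 - 10 * (x + 5) ^ 4)
      = 35 * x ^ 3 + 475 * x ^ 2 + 2149 * x + 3245" for x :: int
    by algebra
  moreover have "0 \<le> 35 * int m ^ 3 + 475 * int m ^ 2 + 2149 * int m + 3245" by simp
  moreover have "int n = int m + 5" by (simp add: m)
  ultimately show ?thesis by (metis diff_ge_0_iff_ge)
qed

lemma card_repeating_lists5:
  assumes V: "finite V"
  shows "int (card (lists5 V - dlists5 V)) \<le> 10 * int (card V) ^ 4"
proof -
  have fin: "finite (dlists5 V)" using dlists5_subset finite_lists5[OF V] by (rule finite_subset)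
  have "int (card (lists5 V - dlists5 V)) = int (card V) ^ 5 - int (card (dlists5 V))"
    using card_Diff_subset[OF fin dlists5_subset] card_mono[OF finite_lists5[OF V] dlists5_subset] card_lists5[OF V]
    by (simp add: of_nat_diff)
  moreover have "int (card V) ^ 5 - 10 * int (card V) ^ 4 \<le> int (card (dlists5 V))"
  proof (cases "5 \<le> card V")
    case True
    have "dlists5 V = {l. length l = 5 \<and> distinct l \<and> set l \<subseteq> V}" by (auto simp: dlists5_def)
    then show ?thesis using falling_5_lower_bound[OF True] card_lists_distinct_length_eq[OF V True] by simp
  next
    case False
    then have "int (card V) * int (card V) ^ 4 \<le> 10 * int (card V) ^ 4"
      by (intro mult_right_mono) auto
    then show ?thesis by (simp add: eval_nat_numeral)
  qed
  ultimately show ?thesis by linarith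
qed

lemma sum_lists_Suc:
  fixes f :: "'a list \<Rightarrow> int"
  shows "(\<Sum>l | set l \<subseteq> V \<and> length l = Suc k. f l) = (\<Sum>a\<in>V. \<Sum>l | set l \<subseteq> V \<and> length l = k. f (a # l))"
proof -
  have "(\<Sum>l | set l \<subseteq> V \<and> length l = Suc k. f l) = (\<Sum>(a, l)\<in>V \<times> {l. set l \<subseteq> V \<and> length l = k}. f (a # l))"
    by (rule sum.reindex_bij_witness[of _ "\<lambda>(a, l). a # l" "\<lambda>l. (hd l, tl l)"])
      (auto simp: length_Suc_conv)
  then show ?thesis by (simp add: sum.cartesian_product)
qed

lemma sum_lists5: "(\<Sum>l\<in>lists5 V. at5 f l) = (\<Sum>a\<in>V. \<Sum>b\<in>V. \<Sum>c\<in>V. \<Sum>d\<in>V. \<Sum>e\<in>V. f a b c d e :: int)"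
proof -
  have 0: "{l. set l \<subseteq> V \<and> length l = 0} = {[]}" by auto
  have "lists5 V = {l. set l \<subseteq> V \<and> length l = Suc (Suc (Suc (Suc (Suc 0))))}"
    by (auto simp: lists5_def)
  then show ?thesis unfolding at5_def by (simp only: sum_lists_Suc 0) (simp add: eval_nat_numeral)
qed

lemma sum_dlists5:
  fixes f :: "nat list \<Rightarrow> int"
  assumes V: "finite V"
  shows "(\<Sum>l\<in>dlists5 V. f l) = (\<Sum>Y | Y \<subseteq> V \<and> card Y = 5. \<Sum>l\<in>permutations_of_set Y. f l)"
proof -
  have fin: "finite (dlists5 V)" using dlists5_subset finite_lists5[OF V] by (rule finite_subset)
  have "(\<Sum>l\<in>dlists5 V. f l) = (\<Sum>Y | Y \<subseteq> V \<and> card Y = 5. \<Sum>l | l \<in> dlists5 V \<and> set l = Y. f l)"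
    using V fin by (intro sum.group[symmetric]) (auto simp: dlists5_def distinct_card)
  also have "\<dots> = (\<Sum>Y | Y \<subseteq> V \<and> card Y = 5. \<Sum>l\<in>permutations_of_set Y. f l)"
    by (intro sum.cong refl) (auto simp: dlists5_def permutations_of_set_def distinct_card)
  finally show ?thesis .
qed

lemma sum_squares_triangle:
  "0 \<le> (\<Sum>a\<in>V. \<Sum>b\<in>V. \<Sum>c\<in>V. \<Sum>d\<in>V. \<Sum>e\<in>V. if t a b c then k * (f a b c d * f a b c e) else (0 :: int))"
  if "0 \<le> k"
proof (rule sum_nonneg, rule sum_nonneg, rule sum_nonneg)
  fix a b c
  have "(\<Sum>d\<in>V. \<Sum>e\<in>V. if t a b c then k * (f a b c d * f a b c e) else 0) =
      (if t a b c then k * ((\<Sum>d\<in>V. f a b c d) * (\<Sum>e\<in>V. f a b c e)) else 0)"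
  proof (cases "t a b c")
    case True
    have e: "(\<Sum>d\<in>V. f a b c d) * (\<Sum>e\<in>V. f a b c e) = (\<Sum>d\<in>V. \<Sum>e\<in>V. f a b c d * f a b c e)"
      by (rule sum_product)
    show ?thesis unfolding e using True by (simp add: sum_distrib_left)
  qed simp
  also have "\<dots> \<ge> 0" using that by simp
  finally show "0 \<le> (\<Sum>d\<in>V. \<Sum>e\<in>V. if t a b c then k * (f a b c d * f a b c e) else 0)" .
qed

lemma sum_squares_vertex:
  fixes f :: "'a \<Rightarrow> 'a \<Rightarrow> 'a \<Rightarrow> int"
  shows "(\<Sum>a\<in>V. \<Sum>b\<in>V. \<Sum>c\<in>V. \<Sum>d\<in>V. \<Sum>e\<in>V. f a b c * f a d e) = (\<Sum>a\<in>V. (\<Sum>b\<in>V. \<Sum>c\<in>V. f a b c)\<^sup>2)"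
proof (rule sum.cong[OF refl])
  fix a
  have "(\<Sum>b\<in>V. \<Sum>c\<in>V. \<Sum>d\<in>V. \<Sum>e\<in>V. f a b c * f a d e) =
      (\<Sum>b\<in>V. \<Sum>c\<in>V. f a b c * (\<Sum>d\<in>V. \<Sum>e\<in>V. f a d e))"
    by (simp add: sum_distrib_left)
  then show "(\<Sum>b\<in>V. \<Sum>c\<in>V. \<Sum>d\<in>V. \<Sum>e\<in>V. f a b c * f a d e) = (\<Sum>b\<in>V. \<Sum>c\<in>V. f a b c)\<^sup>2"
    by (simp add: sum_distrib_right power2_eq_square)
qed

lemma sum_arc_signs:
  "(\<Sum>a\<in>V. \<Sum>b\<in>V. \<Sum>c\<in>V. \<Sum>d\<in>V. \<Sum>e\<in>V. arc_sign R a b * arc_sign R a c * (arc_sign R a d * arc_sign R a e)) =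
    (\<Sum>a\<in>V. (\<Sum>b\<in>V. arc_sign R a b) ^ 4)"
proof -
  have "(\<Sum>b\<in>V. \<Sum>c\<in>V. arc_sign R a b * arc_sign R a c)\<^sup>2 = (\<Sum>b\<in>V. arc_sign R a b) ^ 4" for a
  proof -
    have "(\<Sum>b\<in>V. \<Sum>c\<in>V. arc_sign R a b * arc_sign R a c) = (\<Sum>b\<in>V. arc_sign R a b) * (\<Sum>c\<in>V. arc_sign R a c)"
      by (simp add: sum_product)
    then show ?thesis by (simp add: eval_nat_numeral)
  qed
  then show ?thesis using sum_squares_vertex[of "\<lambda>a b c. arc_sign R a b * arc_sign R a c" V] by simp
qed

lemma sum_sos11: "5 * (\<Sum>a\<in>V. (\<Sum>b\<in>V. arc_sign R a b) ^ 4) \<le> (\<Sum>l\<in>lists5 V. at5 (sos11 R) l)"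
proof -
  let ?s = "\<lambda>f. \<Sum>a\<in>V. \<Sum>b\<in>V. \<Sum>c\<in>V. \<Sum>d\<in>V. \<Sum>e\<in>V. (f a b c d e :: int)"
  have eq: "sos11 R a b c d e = (if cyc_triangle R a b c then 20 * (majority R a b c d * majority R a b c e) else 0) +
      (if cyc_triangle R a b c then 180 * (twin_sign R a b c d * twin_sign R a b c e) else 0) +
      5 * (arc_sign R a b * arc_sign R a c * (arc_sign R a d * arc_sign R a e))" for a b c d e
    by (simp add: sos11_def)
  have "(\<Sum>l\<in>lists5 V. at5 (sos11 R) l) =
      ?s (\<lambda>a b c d e. if cyc_triangle R a b c then 20 * (majority R a b c d * majority R a b c e) else 0) +
      ?s (\<lambda>a b c d e. if cyc_triangle R a b c then 180 * (twin_sign R a b c d * twin_sign R a b c e) else 0) +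
      5 * ?s (\<lambda>a b c d e. arc_sign R a b * arc_sign R a c * (arc_sign R a d * arc_sign R a e))"
    unfolding sum_lists5 eq sum.distrib sum_distrib_left ..
  then show ?thesis
    using sum_squares_triangle[of 20 "cyc_triangle R" "majority R" V]
      sum_squares_triangle[of 180 "cyc_triangle R" "twin_sign R" V] unfolding sum_arc_signs by simp
qed

lemma sum_sos9: "(\<Sum>a\<in>V. (\<Sum>b\<in>V. arc_sign R a b) ^ 4) \<le> (\<Sum>l\<in>lists5 V. at5 (sos9 R) l)"
proof -
  let ?s = "\<lambda>f. \<Sum>a\<in>V. \<Sum>b\<in>V. \<Sum>c\<in>V. \<Sum>d\<in>V. \<Sum>e\<in>V. (f a b c d e :: int)"
  have eq: "sos9 R a b c d e = (if cyc_triangle R a b c then 112 * (dominance R a b c d * dominance R a b c e) else 0) +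
      (if cyc_triangle R a b c then 24 * (twin_diff R a b c d * twin_diff R a b c e) else 0) +
      4 * (vertex_pair R a b c * vertex_pair R a d e) +
      arc_sign R a b * arc_sign R a c * (arc_sign R a d * arc_sign R a e)" for a b c d e
    by (simp add: sos9_def)
  have "(\<Sum>l\<in>lists5 V. at5 (sos9 R) l) =
      ?s (\<lambda>a b c d e. if cyc_triangle R a b c then 112 * (dominance R a b c d * dominance R a b c e) else 0) +
      ?s (\<lambda>a b c d e. if cyc_triangle R a b c then 24 * (twin_diff R a b c d * twin_diff R a b c e) else 0) +
      4 * ?s (\<lambda>a b c d e. vertex_pair R a b c * vertex_pair R a d e) +
      ?s (\<lambda>a b c d e. arc_sign R a b * arc_sign R a c * (arc_sign R a d * arc_sign R a e))"
    unfolding sum_lists5 eq sum.distrib sum_distrib_left ..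
  moreover have "0 \<le> ?s (\<lambda>a b c d e. vertex_pair R a b c * vertex_pair R a d e)"
    unfolding sum_squares_vertex by (intro sum_nonneg) simp
  ultimately show ?thesis
    using sum_squares_triangle[of 112 "cyc_triangle R" "dominance R" V]
      sum_squares_triangle[of 24 "cyc_triangle R" "twin_diff R" V] unfolding sum_arc_signs by simp
qed

lemma arc_sign_bound: "\<bar>arc_sign R a b * arc_sign R a c * (arc_sign R a d * arc_sign R a e)\<bar> = 1"
  by (simp add: arc_sign_def abs_mult)

lemma abs_mult_bound: "\<bar>x\<bar> \<le> k \<Longrightarrow> \<bar>y\<bar> \<le> k \<Longrightarrow> \<bar>x * y\<bar> \<le> k * (k :: int)"
  unfolding abs_mult by (intro mult_mono) auto

text \<open>The bound is \<open>20 * 4 + 180 * 1 + 5\<close>; it controls the lists with repeated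
  entries.\<close>

lemma sos11_bound: "sos11 R a b c d e \<le> 265"
proof -
  have "\<bar>majority R a b c w\<bar> \<le> 2" for w by (simp add: majority_def)
  then have "\<bar>majority R a b c d * majority R a b c e\<bar> \<le> 2 * 2" by (intro abs_mult_bound)
  moreover have "\<bar>twin_sign R a b c w\<bar> \<le> 1" for w by (simp add: twin_sign_def)
  then have "\<bar>twin_sign R a b c d * twin_sign R a b c e\<bar> \<le> 1 * 1" by (intro abs_mult_bound)
  moreover have "(if t then 20 * x + 180 * y else 0) + 5 * z \<le> 265"
    if "\<bar>x\<bar> \<le> 2 * 2" "\<bar>y\<bar> \<le> 1 * 1" "\<bar>z\<bar> = 1" for t and x y z :: int
    using that by (cases t) auto
  ultimately show ?thesis using arc_sign_bound[of R a b c d e] unfolding sos11_def by blast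
qed

text \<open>The bound is \<open>112 + 24 + 4 * 4 + 1\<close>.\<close>

lemma sos9_bound: "sos9 R a b c d e \<le> 153"
proof -
  have "\<bar>dominance R a b c w\<bar> \<le> 1" for w by (simp add: dominance_def)
  then have "\<bar>dominance R a b c d * dominance R a b c e\<bar> \<le> 1 * 1" by (intro abs_mult_bound)
  moreover have "\<bar>twin_diff R a b c w\<bar> \<le> 1" for w by (simp add: twin_diff_def)
  then have "\<bar>twin_diff R a b c d * twin_diff R a b c e\<bar> \<le> 1 * 1" by (intro abs_mult_bound)
  moreover have "\<bar>vertex_pair R a u w\<bar> \<le> 2" for u w by (simp add: vertex_pair_def)
  then have "\<bar>vertex_pair R a b c * vertex_pair R a d e\<bar> \<le> 2 * 2" by (intro abs_mult_bound)
  moreover have "(if t then 112 * x + 24 * y else 0) + 4 * w + z \<le> 153"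
    if "\<bar>x\<bar> \<le> 1 * 1" "\<bar>y\<bar> \<le> 1 * 1" "\<bar>w\<bar> \<le> 2 * 2" "\<bar>z\<bar> = 1" for t and x y w z :: int
    using that by (cases t) auto
  ultimately show ?thesis using arc_sign_bound[of R a b c d e] unfolding sos9_def by blast
qed

lemma sum_pattern:
  "finite S \<Longrightarrow> (\<Sum>l\<in>S. if at5 P l then k else 0) = k * int (card {l \<in> S. at5 P l})"
  by (simp add: sum.inter_filter[symmetric])

text \<open>Sums the certificate over distinct 5-tuples. The square part is then completed to all
  tuples, where it is at least \<open>ks\<close> times the fourth moment; the added tuples cost at
  most \<open>10 * K * card V ^ 4\<close>.\<close>

lemma certificate_inequality:
  fixes T :: tournament
  defines "R \<equiv> \<lambda>u v. (u, v) \<in> arcs T" and "V \<equiv> verts T"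
  assumes C: "C = (\<lambda>R a b c d e. 1 - (if P R a b c d e then k else 0) - sos R a b c d e - (if zpat R a b c d e then kz else 0))"
    and loc: "arc_local C" and pos: "list_all (\<lambda>b. 0 \<le> perm_total C b) (product_lists (replicate 6 [True, False]))"
    and sos: "ks * (\<Sum>a\<in>V. (\<Sum>b\<in>V. arc_sign R a b) ^ 4) \<le> (\<Sum>l\<in>lists5 V. at5 (sos R) l)"
    and bound: "\<And>a b c d e. sos R a b c d e \<le> K" and K: "0 \<le> K"
  shows "k * int (card {l \<in> dlists5 V. at5 (P R) l}) + kz * int (card {l \<in> dlists5 V. at5 (zpat R) l}) +
    ks * (\<Sum>a\<in>V. (\<Sum>b\<in>V. arc_sign R a b) ^ 4) \<le> int (card V) ^ 5 + 10 * K * int (card V) ^ 4"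
proof -
  have fV: "finite V" by (simp add: V_def)
  have fin: "finite (dlists5 V)" using dlists5_subset finite_lists5[OF fV] by (rule finite_subset)
  have "0 \<le> (\<Sum>l\<in>dlists5 V. at5 (C R) l)"
    unfolding sum_dlists5[OF fV]
  proof (rule sum_nonneg)
    fix Y assume "Y \<in> {Y. Y \<subseteq> V \<and> card Y = 5}"
    then show "0 \<le> (\<Sum>l\<in>permutations_of_set Y. at5 (C R) l)"
      using certificate_on_5_sets[OF loc pos, of Y T] unfolding R_def V_def by blast
  qed
  also have "\<dots> = int (card (dlists5 V)) - k * int (card {l \<in> dlists5 V. at5 (P R) l}) -
      (\<Sum>l\<in>dlists5 V. at5 (sos R) l) - kz * int (card {l \<in> dlists5 V. at5 (zpat R) l})"
  proof -
    have "at5 (C R) l = 1 - (if at5 (P R) l then k else 0) - at5 (sos R) l - (if at5 (zpat R) l then kz else 0)" for l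
      by (simp add: C at5_def)
    then show ?thesis by (simp add: sum_subtractf sum_pattern[OF fin])
  qed
  finally have main: "0 \<le> int (card (dlists5 V)) - k * int (card {l \<in> dlists5 V. at5 (P R) l}) -
      (\<Sum>l\<in>dlists5 V. at5 (sos R) l) - kz * int (card {l \<in> dlists5 V. at5 (zpat R) l})" .
  have "(\<Sum>l\<in>lists5 V. at5 (sos R) l) = (\<Sum>l\<in>lists5 V - dlists5 V. at5 (sos R) l) + (\<Sum>l\<in>dlists5 V. at5 (sos R) l)"
    using finite_lists5[OF fV] dlists5_subset by (intro sum.subset_diff)
  moreover have "(\<Sum>l\<in>lists5 V - dlists5 V. at5 (sos R) l) \<le> int (card (lists5 V - dlists5 V)) * K"
    using sum_bounded_above[of "lists5 V - dlists5 V" "at5 (sos R)" K] bound by (simp add: at5_def)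
  moreover have "int (card (lists5 V - dlists5 V)) * K \<le> 10 * K * int (card V) ^ 4"
    using mult_right_mono[OF card_repeating_lists5[OF fV] K] by (simp add: mult_ac)
  moreover have "int (card (dlists5 V)) \<le> int (card V) ^ 5"
    using card_mono[OF finite_lists5[OF fV] dlists5_subset] card_lists5[OF fV] by (metis of_nat_le_iff of_nat_power)
  ultimately show ?thesis using main sos by linarith
qed

text \<open>The diagonal term \<open>b = a\<close> counts as \<open>-1\<close>, hence
  \<open>tsize T\<close> and not \<open>tsize T - 1\<close>.\<close>

lemma sum_arc_sign:
  assumes a: "a \<in> verts T"
  shows "(\<Sum>b\<in>verts T. arc_sign (\<lambda>u v. (u, v) \<in> arcs T) a b) = 2 * int (outdegree T a) - int (tsize T)"
proof -
  have "(\<Sum>b\<in>verts T. arc_sign (\<lambda>u v. (u, v) \<in> arcs T) a b) = (\<Sum>b\<in>verts T. 2 * (if (a, b) \<in> arcs T then 1 else 0) - 1)"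
    by (intro sum.cong refl) (simp add: arc_sign_def)
  also have "\<dots> = 2 * int (card {b \<in> verts T. (a, b) \<in> arcs T}) - int (tsize T)"
    by (simp add: sum_subtractf sum_distrib_left[symmetric] sum.inter_filter[symmetric] tsize_def)
  also have "{b \<in> verts T. (a, b) \<in> arcs T} = {b. (a, b) \<in> arcs T}" using arcs_vertsD(2) by blast
  finally show ?thesis by (simp add: outdegree_def)
qed

text \<open>A homomorphism is determined by the list of its values along \<open>vs\<close>, and this
  list is distinct because homomorphisms are injective.\<close>

lemma card_homs_le_pattern:
  assumes l: "set vs = verts F" "distinct vs" "length vs = 5"
    and P: "\<And>h. (\<And>u v. (u, v) \<in> arcs F \<Longrightarrow> (h u, h v) \<in> arcs T) \<Longrightarrow> at5 P (map h vs)"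
  shows "card (homs F T) \<le> card {l \<in> dlists5 (verts T). at5 P l}"
proof (rule card_inj_on_le)
  show "inj_on (\<lambda>h. map h vs) (homs F T)"
  proof (rule inj_onI, rule ext)
    fix h k v assume hk: "h \<in> homs F T" "k \<in> homs F T" and "map h vs = map k vs"
    then show "h v = k v" using l(1) homsD(3)[OF hk(1), of v] homsD(3)[OF hk(2), of v]
      by (cases "v \<in> verts F") auto
  qed
  show "(\<lambda>h. map h vs) ` homs F T \<subseteq> {l \<in> dlists5 (verts T). at5 P l}"
  proof (rule image_subsetI, rule CollectI, rule conjI)
    fix h assume h: "h \<in> homs F T"
    show "map h vs \<in> dlists5 (verts T)"
      using l homsD(2)[OF h] homs_inj_on[OF h] by (auto simp: dlists5_def distinct_map)
    show "at5 P (map h vs)" using homsD(1)[OF h] by (rule P)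
  qed
  have "finite (dlists5 (verts T))" using dlists5_subset finite_lists5[OF finite_verts] by (rule finite_subset)
  then show "finite {l \<in> dlists5 (verts T). at5 P l}" by simp
qed

lemma card_homs_T5_11_le: "card (homs T5_11 T) \<le> card {l \<in> dlists5 (verts T). at5 (pat11 (\<lambda>u v. (u, v) \<in> arcs T)) l}"
  by (rule card_homs_le_pattern[of "[1, 2, 3, 4, 5]"]) (auto simp: at5_def pat11_def arcs_T5)

lemma card_homs_T5_9_le: "card (homs T5_9 T) \<le> card {l \<in> dlists5 (verts T). at5 (pat9 (\<lambda>u v. (u, v) \<in> arcs T)) l}"
  by (rule card_homs_le_pattern[of "[1, 2, 3, 4, 5]"]) (auto simp: at5_def pat9_def arcs_T5)

text \<open>In each of the three tournaments the listed order of the vertices exhibits the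
  configuration.\<close>

lemma card_homs_zpat_le:
  assumes "F \<in> {T5_8, T5_10, T5_12}"
  shows "card (homs F T) \<le> card {l \<in> dlists5 (verts T). at5 (zpat (\<lambda>u v. (u, v) \<in> arcs T)) l}"
proof -
  have "card (homs T5_8 T) \<le> card {l \<in> dlists5 (verts T). at5 (zpat (\<lambda>u v. (u, v) \<in> arcs T)) l}"
    by (rule card_homs_le_pattern[of "[5, 1, 3, 4, 2]"]) (auto simp: at5_def zpat_def arcs_T5)
  moreover have "card (homs T5_10 T) \<le> card {l \<in> dlists5 (verts T). at5 (zpat (\<lambda>u v. (u, v) \<in> arcs T)) l}"
    by (rule card_homs_le_pattern[of "[2, 3, 4, 5, 1]"]) (auto simp: at5_def zpat_def arcs_T5)
  moreover have "card (homs T5_12 T) \<le> card {l \<in> dlists5 (verts T). at5 (zpat (\<lambda>u v. (u, v) \<in> arcs T)) l}"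
    by (rule card_homs_le_pattern[of "[0, 2, 1, 3, 4]"]) (auto simp: at5_def zpat_def arcs_T5)
  ultimately show ?thesis using assms by blast
qed

section \<open>Degree moments and balancedness\<close>

definition degree_moment4 :: "tournament \<Rightarrow> real" where
  "degree_moment4 T = (\<Sum>a\<in>verts T. (2 * real (outdegree T a) - real (tsize T)) ^ 4) / real (tsize T) ^ 5"

lemma arc_sign_moment:
  "real_of_int (\<Sum>a\<in>verts T. (\<Sum>b\<in>verts T. arc_sign (\<lambda>u v. (u, v) \<in> arcs T) a b) ^ 4) =
    (\<Sum>a\<in>verts T. (2 * real (outdegree T a) - real (tsize T)) ^ 4)"
  unfolding of_int_sum by (intro sum.cong refl) (simp add: sum_arc_sign)

lemma divide_by_size:
  fixes a b m n :: real and k kz ks K :: real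
  assumes n: "0 < n" and le: "k * a + kz * b + ks * m \<le> n ^ 5 + 10 * K * n ^ 4"
  shows "k * (a / n ^ 5) + kz * (b / n ^ 5) + ks * (m / n ^ 5) \<le> 1 + 10 * K / n"
proof -
  have "k * (a / n ^ 5) + kz * (b / n ^ 5) + ks * (m / n ^ 5) = (k * a + kz * b + ks * m) / n ^ 5"
    by (simp add: add_divide_distrib)
  also have "\<dots> \<le> (n ^ 5 + 10 * K * n ^ 4) / n ^ 5" using n le by (intro divide_right_mono) auto
  also have "\<dots> = 1 + 10 * K / n" using n by (simp add: field_simps eval_nat_numeral)
  finally show ?thesis .
qed

text \<open>\<open>2650 = 10 * 265\<close>: ten pairs of positions that may coincide, times
  \<open>sos11_bound\<close>. Each forbidden tournament is bounded separately by the count of the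
  whole configuration.\<close>

lemma T5_11_upper_bound:
  assumes F: "F \<in> {T5_8, T5_10, T5_12}" and n: "0 < tsize T"
  shows "640 * hom_density T5_11 T + 24 * hom_density F T + 5 * degree_moment4 T \<le> 1 + 2650 / real (tsize T)"
proof -
  let ?R = "\<lambda>u v. (u, v) \<in> arcs T"
  have F5: "tsize F = 5" using F by auto
  have "640 * int (card {l \<in> dlists5 (verts T). at5 (pat11 ?R) l}) + 24 * int (card {l \<in> dlists5 (verts T). at5 (zpat ?R) l}) +
    5 * (\<Sum>a\<in>verts T. (\<Sum>b\<in>verts T. arc_sign ?R a b) ^ 4) \<le> int (card (verts T)) ^ 5 + 10 * 265 * int (card (verts T)) ^ 4"
    by (rule certificate_inequality[where C = cert11 and sos = sos11])
      (auto simp: cert11_def arc_local_cert total_cert11 sum_sos11 sos11_bound fun_eq_iff)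
  moreover note card_homs_T5_11_le[of T] card_homs_zpat_le[OF F, of T]
  ultimately have "640 * int (card (homs T5_11 T)) + 24 * int (card (homs F T)) +
    5 * (\<Sum>a\<in>verts T. (\<Sum>b\<in>verts T. arc_sign ?R a b) ^ 4) \<le> int (tsize T) ^ 5 + 10 * 265 * int (tsize T) ^ 4"
    unfolding tsize_def by linarith
  then have "real_of_int (640 * int (card (homs T5_11 T)) + 24 * int (card (homs F T)) +
    5 * (\<Sum>a\<in>verts T. (\<Sum>b\<in>verts T. arc_sign ?R a b) ^ 4)) \<le> real_of_int (int (tsize T) ^ 5 + 10 * 265 * int (tsize T) ^ 4)"
    by (simp only: of_int_le_iff)
  then have "640 * real (card (homs T5_11 T)) + 24 * real (card (homs F T)) +
    5 * (\<Sum>a\<in>verts T. (2 * real (outdegree T a) - real (tsize T)) ^ 4) \<le> real (tsize T) ^ 5 + 10 * 265 * real (tsize T) ^ 4"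
    unfolding of_int_add of_int_mult arc_sign_moment by simp
  from divide_by_size[OF _ this] n show ?thesis
    by (simp add: hom_density_def degree_moment4_def F5)
qed

text \<open>\<open>1530 = 10 * 153\<close>, the error from \<open>sos9_bound\<close>.\<close>

lemma T5_9_upper_bound:
  assumes F: "F \<in> {T5_8, T5_10, T5_12}" and n: "0 < tsize T"
  shows "320 * hom_density T5_9 T + 16 * hom_density F T + 1 * degree_moment4 T \<le> 1 + 1530 / real (tsize T)"
proof -
  let ?R = "\<lambda>u v. (u, v) \<in> arcs T"
  have F5: "tsize F = 5" using F by auto
  have "320 * int (card {l \<in> dlists5 (verts T). at5 (pat9 ?R) l}) + 16 * int (card {l \<in> dlists5 (verts T). at5 (zpat ?R) l}) +
    1 * (\<Sum>a\<in>verts T. (\<Sum>b\<in>verts T. arc_sign ?R a b) ^ 4) \<le> int (card (verts T)) ^ 5 + 10 * 153 * int (card (verts T)) ^ 4"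
    by (rule certificate_inequality[where C = cert9 and sos = sos9])
      (auto simp: cert9_def arc_local_cert total_cert9 sum_sos9 sos9_bound fun_eq_iff)
  moreover note card_homs_T5_9_le[of T] card_homs_zpat_le[OF F, of T]
  ultimately have "320 * int (card (homs T5_9 T)) + 16 * int (card (homs F T)) +
    1 * (\<Sum>a\<in>verts T. (\<Sum>b\<in>verts T. arc_sign ?R a b) ^ 4) \<le> int (tsize T) ^ 5 + 10 * 153 * int (tsize T) ^ 4"
    unfolding tsize_def by linarith
  then have "real_of_int (320 * int (card (homs T5_9 T)) + 16 * int (card (homs F T)) +
    1 * (\<Sum>a\<in>verts T. (\<Sum>b\<in>verts T. arc_sign ?R a b) ^ 4)) \<le> real_of_int (int (tsize T) ^ 5 + 10 * 153 * int (tsize T) ^ 4)"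
    by (simp only: of_int_le_iff)
  then have "320 * real (card (homs T5_9 T)) + 16 * real (card (homs F T)) +
    1 * (\<Sum>a\<in>verts T. (2 * real (outdegree T a) - real (tsize T)) ^ 4) \<le> real (tsize T) ^ 5 + 10 * 153 * real (tsize T) ^ 4"
    unfolding of_int_add of_int_mult arc_sign_moment by simp
  from divide_by_size[OF _ this] n show ?thesis
    by (simp add: hom_density_def degree_moment4_def F5)
qed

lemma degree_moment4_nonneg: "0 \<le> degree_moment4 T"
  unfolding degree_moment4_def by (intro divide_nonneg_nonneg sum_nonneg) auto

lemma sum_square_le_card_mult:
  fixes f :: "'a \<Rightarrow> real"
  shows "(\<Sum>a\<in>A. f a)\<^sup>2 \<le> real (card A) * (\<Sum>a\<in>A. (f a)\<^sup>2)"
  using Cauchy_Schwarz_ineq_sum[of "\<lambda>_. 1" f A] by simp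

text \<open>The second moment of the degrees, which determines the imbalance, is at most the square root of
  their fourth moment.\<close>

lemma imbalance_degree_moment4:
  assumes n: "0 < tsize T"
  shows "imbalance T \<le> 1 / real (tsize T) ^ 2 + sqrt (degree_moment4 T)"
proof -
  define m where "m = real (tsize T)"
  define s where "s a = 2 * real (outdegree T a) - m" for a
  define S where "S = (\<Sum>a\<in>verts T. (s a)\<^sup>2)"
  have m: "1 \<le> m" using n by (simp add: m_def)
  have cardV: "real (card (verts T)) = m" by (simp add: m_def tsize_def)
  have "S\<^sup>2 \<le> m * (\<Sum>a\<in>verts T. (s a) ^ 4)"
    using sum_square_le_card_mult[of "\<lambda>a. (s a)\<^sup>2" "verts T"] unfolding cardV S_def by simp
  then have "(S / m ^ 3)\<^sup>2 \<le> (m * (\<Sum>a\<in>verts T. (s a) ^ 4)) / m ^ 6"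
    unfolding power_divide by (simp add: divide_right_mono power_mult[symmetric])
  also have "\<dots> = degree_moment4 T"
    using m by (simp add: degree_moment4_def m_def[symmetric] s_def eval_nat_numeral)
  finally have root: "S / m ^ 3 \<le> sqrt (degree_moment4 T)" by (rule real_le_rsqrt)
  have "(\<Sum>v\<in>verts T. (real (outdegree T v) + 1/2 - m / 2)\<^sup>2) \<le> (\<Sum>v\<in>verts T. (s v)\<^sup>2 / 2 + 1/2)"
  proof (rule sum_mono)
    fix v
    have "(s v)\<^sup>2 / 2 + 1/2 - (real (outdegree T v) + 1/2 - m / 2)\<^sup>2 = (s v - 1)\<^sup>2 / 4"
      by (simp add: s_def power2_eq_square field_simps)
    then show "(real (outdegree T v) + 1/2 - m / 2)\<^sup>2 \<le> (s v)\<^sup>2 / 2 + 1/2"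
      by (metis diff_ge_0_iff_ge divide_nonneg_nonneg zero_le_numeral zero_le_power2)
  qed
  also have "\<dots> = S / 2 + m / 2"
    by (simp add: sum.distrib S_def sum_divide_distrib cardV)
  finally have Sbound: "(\<Sum>v\<in>verts T. (real (outdegree T v) + 1/2 - m / 2)\<^sup>2) \<le> S / 2 + m / 2" .
  have "imbalance T = 1 / (8 * m ^ 2) + 3/2 * ((\<Sum>v\<in>verts T. (real (outdegree T v) + 1/2 - m / 2)\<^sup>2) / m ^ 3)"
    using imbalance_outdegree[OF n] by (simp add: m_def)
  also have "\<dots> \<le> 1 / (8 * m ^ 2) + 3/2 * ((S / 2 + m / 2) / m ^ 3)"
    using Sbound m by (intro add_left_mono mult_left_mono divide_right_mono) auto
  also have "\<dots> = 7/8 * (1 / m ^ 2) + 3/4 * (S / m ^ 3)"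
    using m by (simp add: field_simps eval_nat_numeral)
  also have "\<dots> \<le> 1 / m ^ 2 + sqrt (degree_moment4 T)"
  proof -
    have "0 \<le> S" unfolding S_def by (intro sum_nonneg) simp
    then have "3/4 * (S / m ^ 3) \<le> 1 * (S / m ^ 3)" using m by (intro mult_right_mono) auto
    moreover have "7/8 * (1 / m ^ 2) \<le> 1 * (1 / m ^ 2)" using m by (intro mult_right_mono) auto
    ultimately show ?thesis using root by linarith
  qed
  finally show ?thesis by (simp add: m_def)
qed

section \<open>Equivalence of the conditions\<close>

text \<open>By Goodman's identity the imbalance is governed by the second moment of the degree
  deviations \<open>x\<close>. These are at most \<open>\<epsilon> n * N n\<close> outside the
  exceptional set \<open>B n\<close> and at most \<open>N n / 2\<close> on it.\<close>

lemma asymptotically_balanced_imp_imbalance: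
  assumes "asymptotically_balanced Ts"
  shows "(\<lambda>n. imbalance (Ts n)) \<longlonglongrightarrow> 0"
proof -
  obtain \<epsilon> where inc: "\<And>n. tsize (Ts n) < tsize (Ts (Suc n))" and \<epsilon>: "\<epsilon> \<longlonglongrightarrow> 0"
    and small: "(\<lambda>n. real (card {v \<in> verts (Ts n).
          \<bar>real (outdegree (Ts n) v) - real (tsize (Ts n)) / 2\<bar> > \<epsilon> n * real (tsize (Ts n))}))
       \<in> o(\<lambda>n. real (tsize (Ts n)))"
    using assms unfolding asymptotically_balanced_def by blast
  define N where "N n = real (tsize (Ts n))" for n
  define x where "x n v = real (outdegree (Ts n) v) - N n / 2" for n v
  define B where "B n = {v \<in> verts (Ts n). \<bar>x n v\<bar> > \<epsilon> n * N n}" for n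
  have sizes: "filterlim (\<lambda>n. tsize (Ts n)) at_top sequentially"
    by (rule strictly_increasing_sizes) (rule inc)
  have inv: "(\<lambda>n. 1 / N n) \<longlonglongrightarrow> 0" unfolding N_def using filterlim_compose[OF lim_1_over_n sizes] .
  have "(\<lambda>n. real (card (B n)) / N n) \<longlonglongrightarrow> 0"
    using smalloD_tendsto[OF small] by (simp add: B_def x_def N_def)
  then have lim: "(\<lambda>n. 2 * (1 / N n)^2 + 3 * (\<epsilon> n)^2 + 3/4 * (real (card (B n)) / N n)) \<longlonglongrightarrow> 2 * 0^2 + 3 * 0^2 + 3/4 * 0"
    using \<epsilon> inv by (intro tendsto_intros)
  have ev: "\<forall>\<^sub>F n in sequentially. 1 \<le> tsize (Ts n)" using sizes by (simp add: filterlim_at_top)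
  show ?thesis
  proof (rule Lim_null_comparison)
    show "\<forall>\<^sub>F n in sequentially. norm (imbalance (Ts n)) \<le> 2 * (1 / N n)^2 + 3 * (\<epsilon> n)^2 + 3/4 * (real (card (B n)) / N n)"
      using ev
    proof (rule eventually_mono)
      fix n assume n: "1 \<le> tsize (Ts n)"
      then have N: "1 \<le> N n" by (simp add: N_def)
      have xb: "\<bar>x n v\<bar> \<le> N n / 2" if "v \<in> verts (Ts n)" for v
      proof -
        have "outdegree (Ts n) v \<le> tsize (Ts n)"
          unfolding outdegree_def tsize_def by (intro card_mono) (auto dest: arcs_vertsD)
    then have "real (outdegree (Ts n) v) \<le> real (tsize (Ts n))" by simp
      then show ?thesis unfolding x_def N_def abs_le_iff by (simp add: field_simps)
      qed
      have "(\<Sum>v\<in>verts (Ts n). (x n v + 1/2)\<^sup>2) \<le>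
          (\<Sum>v\<in>verts (Ts n). 2 * ((\<epsilon> n * N n)\<^sup>2 + (if v \<in> B n then (N n)\<^sup>2 / 4 else 0)) + 1/2)"
      proof (rule sum_mono)
        fix v assume v: "v \<in> verts (Ts n)"
        have "2 * (x n v)\<^sup>2 + 1/2 - (x n v + 1/2)\<^sup>2 = (x n v - 1/2)\<^sup>2"
          by (simp add: power2_eq_square field_simps)
        then have "(x n v + 1/2)\<^sup>2 \<le> 2 * (x n v)\<^sup>2 + 1/2" by (metis diff_ge_0_iff_ge zero_le_power2)
        moreover have "(x n v)\<^sup>2 \<le> (\<epsilon> n * N n)\<^sup>2 + (if v \<in> B n then (N n)\<^sup>2 / 4 else 0)"
        proof (cases "v \<in> B n")
          case True
          have "(x n v)\<^sup>2 \<le> (N n / 2)\<^sup>2" using xb[OF v] by (rule power2_le_iff_abs_le[THEN iffD2, rotated]) (use N in simp)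
          then show ?thesis using True by (simp add: power_divide add_increasing)
        next
          case False
          then have "\<bar>x n v\<bar> \<le> \<epsilon> n * N n" using v by (simp add: B_def)
          then have "\<bar>x n v\<bar>\<^sup>2 \<le> (\<epsilon> n * N n)\<^sup>2" by (intro power_mono) auto
          then show ?thesis using False by simp
        qed
        ultimately show "(x n v + 1/2)\<^sup>2 \<le> 2 * ((\<epsilon> n * N n)\<^sup>2 + (if v \<in> B n then (N n)\<^sup>2 / 4 else 0)) + 1/2"
          by simp
      qed
      also have "\<dots> = N n * (2 * (\<epsilon> n * N n)\<^sup>2 + 1/2) + (\<Sum>v\<in>verts (Ts n). if v \<in> B n then (N n)\<^sup>2 / 2 else 0)"
        proof -
      have "2 * ((\<epsilon> n * N n)\<^sup>2 + (if v \<in> B n then (N n)\<^sup>2 / 4 else 0)) + 1/2 =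
          (2 * (\<epsilon> n * N n)\<^sup>2 + 1/2) + (if v \<in> B n then (N n)\<^sup>2 / 2 else 0)" for v
        by simp
      then show ?thesis by (simp only: sum.distrib) (simp add: N_def tsize_def distrib_left)
    qed
      also have "(\<Sum>v\<in>verts (Ts n). if v \<in> B n then (N n)\<^sup>2 / 2 else 0) = real (card (B n)) * ((N n)\<^sup>2 / 2)"
      proof -
        have "B n \<subseteq> verts (Ts n)" by (auto simp: B_def)
        then show ?thesis by (simp add: sum.inter_restrict[symmetric] Int_absorb1)
      qed
      finally have S: "(\<Sum>v\<in>verts (Ts n). (x n v + 1/2)\<^sup>2) \<le> N n * (2 * (\<epsilon> n * N n)\<^sup>2 + 1/2) + real (card (B n)) * ((N n)\<^sup>2 / 2)" .
      have "imbalance (Ts n) = 1 / (8 * N n ^ 2) + 3/2 * ((\<Sum>v\<in>verts (Ts n). (x n v + 1/2)\<^sup>2) / N n ^ 3)"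
        using imbalance_outdegree[of "Ts n"] n by (simp add: N_def x_def algebra_simps)
      also have "\<dots> \<le> 1 / (8 * N n ^ 2) + 3/2 * ((N n * (2 * (\<epsilon> n * N n)\<^sup>2 + 1/2) + real (card (B n)) * ((N n)\<^sup>2 / 2)) / N n ^ 3)"
        using S N by (intro add_left_mono mult_left_mono divide_right_mono) auto
      also have "\<dots> = 7/8 * (1 / N n)^2 + 3 * (\<epsilon> n)^2 + 3/4 * (real (card (B n)) / N n)"
        using N by (simp add: field_simps power2_eq_square power3_eq_cube)
      also have "\<dots> \<le> 2 * (1 / N n)^2 + 3 * (\<epsilon> n)^2 + 3/4 * (real (card (B n)) / N n)"
        by (intro add_right_mono mult_right_mono) auto
      finally show "norm (imbalance (Ts n)) \<le> 2 * (1 / N n)^2 + 3 * (\<epsilon> n)^2 + 3/4 * (real (card (B n)) / N n)"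
        using imbalance_nonneg[of "Ts n"] by simp
    qed
    show "(\<lambda>n. 2 * (1 / N n)^2 + 3 * (\<epsilon> n)^2 + 3/4 * (real (card (B n)) / N n)) \<longlonglongrightarrow> 0"
      using lim by simp
  qed
qed

text \<open>Chebyshev's inequality. \<open>\<tau>\<close> bounds the normalised second moment; the
  threshold \<open>\<epsilon>\<close>, its fourth root, leaves a fraction of at most
  \<open>\<tau> / \<epsilon>\<^sup>2 = sqrt \<tau>\<close> of exceptional vertices, and both tend to
  0.\<close>

lemma imbalance_imp_asymptotically_balanced:
  assumes inc: "\<And>n. tsize (Ts n) < tsize (Ts (Suc n))" and lim: "(\<lambda>n. imbalance (Ts n)) \<longlonglongrightarrow> 0"
  shows "asymptotically_balanced Ts"
proof -
  define N where "N n = real (tsize (Ts n))" for n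
  define x where "x n v = real (outdegree (Ts n) v) - N n / 2" for n v
  \<comment> \<open>The second summand absorbs the shift by 1/2 in Goodman's identity and makes
    \<open>\<tau> n\<close> positive.\<close>
  define \<tau> where "\<tau> n = 4/3 * imbalance (Ts n) + 1/2 * (1 / N n)^2" for n
  define \<epsilon> where "\<epsilon> n = sqrt (sqrt (\<tau> n))" for n
  define B where "B n = {v \<in> verts (Ts n). \<bar>x n v\<bar> > \<epsilon> n * N n}" for n
  have sizes: "filterlim (\<lambda>n. tsize (Ts n)) at_top sequentially"
    by (rule strictly_increasing_sizes) (rule inc)
  have inv: "(\<lambda>n. 1 / N n) \<longlonglongrightarrow> 0" unfolding N_def using filterlim_compose[OF lim_1_over_n sizes] .
  have "(\<lambda>n. 4/3 * imbalance (Ts n) + 1/2 * (1 / N n)^2) \<longlonglongrightarrow> 4/3 * 0 + 1/2 * 0^2"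
    by (intro tendsto_intros lim inv)
  then have \<tau>: "\<tau> \<longlonglongrightarrow> 0" by (simp add: \<tau>_def[abs_def])
  have sq: "(\<lambda>n. sqrt (\<tau> n)) \<longlonglongrightarrow> 0" using tendsto_real_sqrt[OF \<tau>] by simp
  have \<epsilon>: "\<epsilon> \<longlonglongrightarrow> 0" using tendsto_real_sqrt[OF sq] by (simp add: \<epsilon>_def[abs_def])
  have ev: "\<forall>\<^sub>F n in sequentially. 1 \<le> tsize (Ts n)" using sizes by (simp add: filterlim_at_top)
  have "(\<lambda>n. real (card (B n))) \<in> o(N)"
  proof (rule smalloI_tendsto)
    show "(\<lambda>n. real (card (B n)) / N n) \<longlonglongrightarrow> 0"
    proof (rule Lim_null_comparison[OF _ sq])
      show "\<forall>\<^sub>F n in sequentially. norm (real (card (B n)) / N n) \<le> sqrt (\<tau> n)"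
        using ev
      proof (rule eventually_mono)
        fix n assume n: "1 \<le> tsize (Ts n)"
        then have N: "1 \<le> N n" by (simp add: N_def)
        have \<tau>0: "0 < \<tau> n" using N imbalance_nonneg[of "Ts n"] by (simp add: \<tau>_def add_nonneg_pos)
        have \<epsilon>2: "(\<epsilon> n)\<^sup>2 = sqrt (\<tau> n)" using \<tau>0 by (simp add: \<epsilon>_def)
        have "imbalance (Ts n) = 1 / (8 * N n ^ 2) + 3/2 * ((\<Sum>v\<in>verts (Ts n). (x n v + 1/2)\<^sup>2) / N n ^ 3)"
          using imbalance_outdegree[of "Ts n"] n by (simp add: N_def x_def algebra_simps)
        moreover have "0 \<le> 1 / (8 * N n ^ 2)" by simp
        ultimately have "3/2 * ((\<Sum>v\<in>verts (Ts n). (x n v + 1/2)\<^sup>2) / N n ^ 3) \<le> imbalance (Ts n)" by linarith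
        then have "(\<Sum>v\<in>verts (Ts n). (x n v + 1/2)\<^sup>2) / N n ^ 3 \<le> 2/3 * imbalance (Ts n)" by linarith
        then have S1: "(\<Sum>v\<in>verts (Ts n). (x n v + 1/2)\<^sup>2) \<le> 2/3 * imbalance (Ts n) * N n ^ 3"
          using N by (simp add: pos_divide_le_eq)
        have "(\<Sum>v\<in>verts (Ts n). (x n v)\<^sup>2) \<le> (\<Sum>v\<in>verts (Ts n). 2 * (x n v + 1/2)\<^sup>2 + 1/2)"
        proof (rule sum_mono)
          fix v
          have "2 * (x n v + 1/2)\<^sup>2 + 1/2 - (x n v)\<^sup>2 = (x n v + 1)\<^sup>2" by (simp add: power2_eq_square field_simps)
          then show "(x n v)\<^sup>2 \<le> 2 * (x n v + 1/2)\<^sup>2 + 1/2" by (metis diff_ge_0_iff_ge zero_le_power2)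
        qed
        also have "\<dots> = 2 * (\<Sum>v\<in>verts (Ts n). (x n v + 1/2)\<^sup>2) + N n / 2"
          by (simp add: sum.distrib sum_distrib_left N_def tsize_def)
        also have "\<dots> \<le> 2 * (2/3 * imbalance (Ts n) * N n ^ 3) + N n / 2" using S1 by simp
        also have "\<dots> = \<tau> n * N n ^ 3"
          using N by (simp add: \<tau>_def field_simps power2_eq_square power3_eq_cube)
        finally have S2: "(\<Sum>v\<in>verts (Ts n). (x n v)\<^sup>2) \<le> \<tau> n * N n ^ 3" .
        have "real (card (B n)) * (\<epsilon> n * N n)\<^sup>2 = (\<Sum>v\<in>B n. (\<epsilon> n * N n)\<^sup>2)" by simp
        also have "\<dots> \<le> (\<Sum>v\<in>B n. (x n v)\<^sup>2)"
        proof (rule sum_mono)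
          fix v assume "v \<in> B n"
          then have "\<epsilon> n * N n \<le> \<bar>x n v\<bar>" by (simp add: B_def)
          moreover have "0 \<le> \<epsilon> n * N n" using N \<tau>0 by (simp add: \<epsilon>_def)
          ultimately have "(\<epsilon> n * N n)\<^sup>2 \<le> \<bar>x n v\<bar>\<^sup>2" by (rule power_mono)
          then show "(\<epsilon> n * N n)\<^sup>2 \<le> (x n v)\<^sup>2" by simp
        qed
        also have "\<dots> \<le> (\<Sum>v\<in>verts (Ts n). (x n v)\<^sup>2)" by (intro sum_mono2) (auto simp: B_def)
        also note S2
        finally have "real (card (B n)) * (sqrt (\<tau> n) * N n ^ 2) \<le> sqrt (\<tau> n) * sqrt (\<tau> n) * N n ^ 3"
          using \<tau>0 by (simp add: power_mult_distrib \<epsilon>2)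
        then have "real (card (B n)) * (sqrt (\<tau> n) * N n ^ 2) \<le> (sqrt (\<tau> n) * N n) * (sqrt (\<tau> n) * N n ^ 2)"
          by (simp add: power2_eq_square power3_eq_cube mult_ac)
        then have "real (card (B n)) \<le> sqrt (\<tau> n) * N n"
          using \<tau>0 N by (simp add: mult_le_cancel_right_pos)
        then show "norm (real (card (B n)) / N n) \<le> sqrt (\<tau> n)"
          using N by (simp add: pos_divide_le_eq)
      qed
    qed
    show "\<forall>\<^sub>F n in sequentially. N n \<noteq> 0" using ev by (rule eventually_mono) (simp add: N_def)
  qed
  then show ?thesis unfolding asymptotically_balanced_def
    using inc \<epsilon> by (auto simp: B_def x_def N_def[abs_def])
qed

section \<open>Balance and decomposability of the limit\<close>

lemma tconverges_hom_density:
  "tconverges Ts \<phi> \<Longrightarrow> (\<lambda>n. hom_density F (Ts n)) \<longlonglongrightarrow> aut_ratio F * \<phi> (flag (class_of F))"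
  using tconverges_sizes by (intro tdensity_tendsto_imp_hom_density) (auto simp: tconverges_def)

text \<open>The limiting imbalance is a function of \<open>\<phi>\<close> alone; so if one sequence
  converging to \<open>\<phi>\<close> is asymptotically balanced, all are.\<close>

definition hom_imbalance :: "(flag_algebra \<Rightarrow> real) \<Rightarrow> real" where
  "hom_imbalance \<phi> = 1/8 - aut_ratio cyc3 * \<phi> (flag (class_of cyc3))"

lemma tconverges_imbalance: "tconverges Ts \<phi> \<Longrightarrow> (\<lambda>n. imbalance (Ts n)) \<longlonglongrightarrow> hom_imbalance \<phi>"
  unfolding imbalance_def hom_imbalance_def by (intro tendsto_intros tconverges_hom_density)

text \<open>\<open>phi_C3\<close> is a definite description, so convergence of the blow-ups has to
  be established; it is \<open>hom_density_limit_unique\<close> with both sequences equal.\<close>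

lemma phi_C3: "phi_C3 \<in> pos_homs" "tconverges C3_blowup phi_C3"
proof -
  have inc: "tsize (C3_blowup n) < tsize (C3_blowup (Suc n))" for n by (simp add: tsize_C3_blowup)
  have conv: "convergent (\<lambda>n. tdensity F (class_of (C3_blowup n)))" for F
  proof -
    obtain F0 where F0: "F = class_of F0" by (rule class_of_exists)
    obtain f where "(\<lambda>n. hom_density F0 (C3_blowup n)) \<longlonglongrightarrow> f"
      by (rule hom_density_limit_unique[OF C3_decomposable_C3_blowup C3_decomposable_C3_blowup
          C3_blowup_sizes C3_blowup_sizes imbalance_C3_blowup imbalance_C3_blowup])
    from hom_density_tendsto_imp_tdensity[OF C3_blowup_sizes this] show ?thesis
      unfolding F0 by (rule convergentI)
  qed
  obtain \<phi> where \<phi>: "\<phi> \<in> pos_homs" "tconverges C3_blowup \<phi>"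
    using convergent_sequence_limit[of C3_blowup, OF inc conv] .
  have "phi_C3 = \<phi>" unfolding phi_C3_def
    by (rule the_equality) (use \<phi> tconverges_unique in blast)+
  then show "phi_C3 \<in> pos_homs" "tconverges C3_blowup phi_C3" using \<phi> by simp_all
qed

text \<open>Both limits agree on all flags by \<open>hom_density_limit_unique\<close>, and the flags
  span the algebra.\<close>

lemma eq_phi_C3:
  assumes \<phi>: "\<phi> \<in> pos_homs" "tconverges Ts \<phi>" "hom_imbalance \<phi> = 0" and dec: "\<And>n. C3_decomposable (Ts n)"
  shows "\<phi> = phi_C3"
proof (rule linear_flag_eqI)
  show "linear \<phi>" "linear phi_C3" using \<phi>(1) phi_C3(1) by (auto simp: pos_homs_def)
  fix F
  obtain F0 where F0: "F = class_of F0" by (rule class_of_exists)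
  have bal: "(\<lambda>n. imbalance (Ts n)) \<longlonglongrightarrow> 0" using tconverges_imbalance[OF \<phi>(2)] \<phi>(3) by simp
  obtain f where f: "(\<lambda>n. hom_density F0 (Ts n)) \<longlonglongrightarrow> f" "(\<lambda>n. hom_density F0 (C3_blowup n)) \<longlonglongrightarrow> f"
    by (rule hom_density_limit_unique[OF dec C3_decomposable_C3_blowup tconverges_sizes[OF \<phi>(2)]
        C3_blowup_sizes bal imbalance_C3_blowup])
  have "aut_ratio F0 * \<phi> (flag F) = f" "aut_ratio F0 * phi_C3 (flag F) = f"
    using LIMSEQ_unique[OF tconverges_hom_density[OF \<phi>(2)] f(1)]
      LIMSEQ_unique[OF tconverges_hom_density[OF phi_C3(2)] f(2)] by (simp_all add: F0)
  then show "\<phi> (flag F) = phi_C3 (flag F)" using aut_ratio_pos[of F0] by (metis less_irrefl mult_left_cancel)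
qed

lemma homs_empty_iff_tdensity: "homs F T = {} \<longleftrightarrow> tdensity (class_of F) (class_of T) = 0"
proof -
  have "homs F T = {} \<longleftrightarrow> card (copies T (class_of F) (verts T)) = 0"
    using card_homs[of F T] card_homs_self_pos[of F] by (metis card_0_eq finite_homs mult_is_0 less_irrefl)
  moreover have "card (copies T (class_of F) (verts T)) \<le> tsize T choose tsize F"
    using card_copies_le[of "verts T" T "class_of F"] by (simp add: tsize_def)
  ultimately show ?thesis unfolding tdensity_card_copies
    by (metis divide_eq_0_iff le_zero_eq of_nat_eq_0_iff)
qed

text \<open>An arbitrary sequence converging to \<open>\<phi>\<close> may contain forbidden
  tournaments in vanishing density. The sampled one has flags of positive weight under
  \<open>\<phi>\<close>; these contain none at all, so its members are decomposable.\<close>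

lemma eq_phi_C3_of_zero:
  assumes \<phi>: "\<phi> \<in> pos_homs" "hom_imbalance \<phi> = 0"
    and zero: "\<And>F. F \<in> {T5_8, T5_10, T5_12} \<Longrightarrow> \<phi> (flag (class_of F)) = 0"
  shows "\<phi> = phi_C3"
proof -
  obtain Ts where Ts: "tconverges Ts \<phi>" "\<And>n. 0 < \<phi> (flag (class_of (Ts n)))"
    using pos_hom_sampling[OF \<phi>(1)] by blast
  have "homs F (Ts n) = {}" if F: "F \<in> {T5_8, T5_10, T5_12}" for F n
  proof (cases "tsize F \<le> tsize (Ts n)")
    case True
    then show ?thesis unfolding homs_empty_iff_tdensity
      by (intro pos_hom_zero_subtournament[OF \<phi>(1) zero[OF F] Ts(2)]) simp
  next
    case False
    then show ?thesis unfolding homs_empty_iff_tdensity tdensity_card_copies by (simp add: binomial_eq_0)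
  qed
  then have "C3_decomposable (Ts n)" for n by (simp add: C3_decomposable_iff_homs)
  then show ?thesis by (rule eq_phi_C3[OF \<phi>(1) Ts(1) \<phi>(2)])
qed

lemma C3_decomposable_hom_iff:
  assumes \<phi>: "\<phi> \<in> pos_homs"
  shows "C3_decomposable_hom \<phi> \<longleftrightarrow> (\<forall>F\<in>{T5_8, T5_10, T5_12}. \<phi> (flag (class_of F)) = 0)"
proof -
  have lin: "linear \<phi>" and nn: "\<And>F. 0 \<le> \<phi> (flag F)" using \<phi> by (auto simp: pos_homs_def)
  show ?thesis
    using nn[of "class_of T5_8"] nn[of "class_of T5_10"] nn[of "class_of T5_12"]
    unfolding C3_decomposable_hom_def by (auto simp: linear_add[OF lin])
qed

lemma phi_C3_decomposable: "C3_decomposable_hom phi_C3"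
  unfolding C3_decomposable_hom_iff[OF phi_C3(1)]
proof
  fix F assume F: "F \<in> {T5_8, T5_10, T5_12}"
  have "homs F (C3_blowup n) = {}" for n
    using F C3_decomposable_C3_blowup[of n] by (auto simp: C3_decomposable_iff_homs)
  then have "tdensity (class_of F) (class_of (C3_blowup n)) = 0" for n
    by (simp add: homs_empty_iff_tdensity)
  moreover have "(\<lambda>n. tdensity (class_of F) (class_of (C3_blowup n))) \<longlonglongrightarrow> phi_C3 (flag (class_of F))"
    using phi_C3(2) unfolding tconverges_def by blast
  ultimately have "(\<lambda>n. 0) \<longlonglongrightarrow> phi_C3 (flag (class_of F))" by simp
  then show "phi_C3 (flag (class_of F)) = 0" by (simp add: LIMSEQ_const_iff)
qed

text \<open>Along a sequence converging to \<open>\<phi>\<close>, the difference of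
  \<open>1 + K / tsize\<close> and \<open>k * hom_density X\<close> bounds two nonnegative terms.
  For a maximiser it tends to 0: then the \<open>kz\<close> term kills the forbidden tournaments and
  the \<open>ks\<close> term the degree fluctuations.\<close>

lemma maximizer_iff:
  assumes k: "0 < k" "0 < kz" "0 < ks"
    and upper: "\<And>F T. F \<in> {T5_8, T5_10, T5_12} \<Longrightarrow> 0 < tsize T \<Longrightarrow>
      k * hom_density X T + kz * hom_density F T + ks * degree_moment4 T \<le> 1 + K / real (tsize T)"
    and lower: "\<And>f. (\<lambda>n. hom_density X (C3_blowup n)) \<longlonglongrightarrow> f \<Longrightarrow> 1 / k \<le> f"
    and \<phi>: "\<phi> \<in> pos_homs"
  shows "\<phi> = phi_C3 \<longleftrightarrow> maximizes_density X \<phi>"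
proof -
  let ?x = "\<lambda>\<psi>. \<psi> (flag (class_of X))" and ?a = "aut_ratio X"
  have a: "0 < ?a" by (rule aut_ratio_pos)
  have lim: "(\<lambda>n. 1 + K / real (tsize (Ts n)) - k * hom_density X (Ts n)) \<longlonglongrightarrow> 1 - k * (?a * ?x \<psi>)"
    if "tconverges Ts \<psi>" for Ts \<psi>
  proof -
    have "(\<lambda>n. 1 / real (tsize (Ts n))) \<longlonglongrightarrow> 0"
      using filterlim_compose[OF lim_1_over_n tconverges_sizes[OF that]] .
    then have "(\<lambda>n. 1 + K * (1 / real (tsize (Ts n))) - k * hom_density X (Ts n)) \<longlonglongrightarrow> 1 + K * 0 - k * (?a * ?x \<psi>)"
      by (intro tendsto_intros tconverges_hom_density[OF that])
    then show ?thesis by simp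
  qed
  have ev: "\<forall>\<^sub>F n in sequentially. 0 < tsize (Ts n)" if "tconverges Ts \<psi>" for Ts \<psi>
  proof -
    have "\<forall>\<^sub>F n in sequentially. 1 \<le> tsize (Ts n)" using tconverges_sizes[OF that] by (simp add: filterlim_at_top)
    then show ?thesis by (rule eventually_mono) simp
  qed
  \<comment> \<open>Together with \<open>C3\<close> below this shows that the maximum is exactly
    \<open>1 / k\<close> and is attained by \<open>phi_C3\<close>.\<close>
  have max: "?a * ?x \<psi> \<le> 1 / k" if \<psi>: "\<psi> \<in> pos_homs" for \<psi>
  proof -
    obtain Ts where Ts: "tconverges Ts \<psi>" using pos_hom_sampling[OF \<psi>] by blast
    have "\<forall>\<^sub>F n in sequentially. 0 \<le> 1 + K / real (tsize (Ts n)) - k * hom_density X (Ts n)"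
      using ev[OF Ts]
    proof (rule eventually_mono)
      fix n assume "0 < tsize (Ts n)"
      moreover have "0 \<le> kz * hom_density T5_8 (Ts n)" "0 \<le> ks * degree_moment4 (Ts n)"
        using k hom_density_nonneg degree_moment4_nonneg by simp_all
      ultimately show "0 \<le> 1 + K / real (tsize (Ts n)) - k * hom_density X (Ts n)"
        using upper[of T5_8 "Ts n"] by simp
    qed
    then have "0 \<le> 1 - k * (?a * ?x \<psi>)"
      by (rule tendsto_lowerbound[OF lim[OF Ts] _ trivial_limit_sequentially])
    then show ?thesis using k by (simp add: field_simps)
  qed
  have C3: "1 / k \<le> ?a * ?x phi_C3" by (rule lower[OF tconverges_hom_density[OF phi_C3(2)]])
  show ?thesis
  proof
    assume eq: "\<phi> = phi_C3"
    have "?x \<psi> \<le> ?x phi_C3" if "\<psi> \<in> pos_homs" for \<psi>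
      using max[OF that] C3 a by (meson mult_le_cancel_left_pos order_trans)
    then show "maximizes_density X \<phi>" using eq phi_C3(1) by (simp add: maximizes_density_def)
  next
    assume "maximizes_density X \<phi>"
    then have "?a * ?x phi_C3 \<le> ?a * ?x \<phi>"
      using phi_C3(1) a by (intro mult_left_mono) (auto simp: maximizes_density_def)
    then have le: "1 / k \<le> ?a * ?x \<phi>" using C3 by (rule order_trans[rotated])
    have "?a * ?x \<phi> = 1 / k" using max[OF \<phi>] le by (rule antisym)
    then have "k * (?a * ?x \<phi>) = 1" using k by simp
    obtain Ts where Ts: "tconverges Ts \<phi>" using pos_hom_sampling[OF \<phi>] by blast
    have slack: "(\<lambda>n. 1 + K / real (tsize (Ts n)) - k * hom_density X (Ts n)) \<longlonglongrightarrow> 0"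
      using lim[OF Ts] \<open>k * (?a * ?x \<phi>) = 1\<close> by simp
    have zero: "\<phi> (flag (class_of F)) = 0" if F: "F \<in> {T5_8, T5_10, T5_12}" for F
    proof -
      have "(\<lambda>n. kz * hom_density F (Ts n)) \<longlonglongrightarrow> 0"
      proof (rule Lim_null_comparison[OF _ slack])
        show "\<forall>\<^sub>F n in sequentially. norm (kz * hom_density F (Ts n)) \<le> 1 + K / real (tsize (Ts n)) - k * hom_density X (Ts n)"
          using ev[OF Ts]
        proof (rule eventually_mono)
          fix n assume "0 < tsize (Ts n)"
          moreover have "0 \<le> kz * hom_density F (Ts n)" "0 \<le> ks * degree_moment4 (Ts n)"
            using k hom_density_nonneg degree_moment4_nonneg by simp_all
          ultimately show "norm (kz * hom_density F (Ts n)) \<le> 1 + K / real (tsize (Ts n)) - k * hom_density X (Ts n)"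
            using upper[OF F, of "Ts n"] by simp
        qed
      qed
      moreover have "(\<lambda>n. kz * hom_density F (Ts n)) \<longlonglongrightarrow> kz * (aut_ratio F * \<phi> (flag (class_of F)))"
        by (intro tendsto_intros tconverges_hom_density[OF Ts])
      ultimately have "kz * (aut_ratio F * \<phi> (flag (class_of F))) = 0" by (rule LIMSEQ_unique[rotated])
      then show ?thesis using k aut_ratio_pos[of F] by simp
    qed
    have "(\<lambda>n. ks * degree_moment4 (Ts n)) \<longlonglongrightarrow> 0"
    proof (rule Lim_null_comparison[OF _ slack])
      show "\<forall>\<^sub>F n in sequentially. norm (ks * degree_moment4 (Ts n)) \<le> 1 + K / real (tsize (Ts n)) - k * hom_density X (Ts n)"
        using ev[OF Ts]
      proof (rule eventually_mono)
        fix n assume "0 < tsize (Ts n)"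
        moreover have "0 \<le> kz * hom_density T5_8 (Ts n)" "0 \<le> ks * degree_moment4 (Ts n)"
          using k hom_density_nonneg degree_moment4_nonneg by simp_all
        ultimately show "norm (ks * degree_moment4 (Ts n)) \<le> 1 + K / real (tsize (Ts n)) - k * hom_density X (Ts n)"
          using upper[of T5_8 "Ts n"] by simp
      qed
    qed
    then have "(\<lambda>n. 1 / ks * (ks * degree_moment4 (Ts n))) \<longlonglongrightarrow> 1 / ks * 0" by (intro tendsto_intros)
    then have "(\<lambda>n. degree_moment4 (Ts n)) \<longlonglongrightarrow> 0" using k by simp
    then have "(\<lambda>n. (1 / real (tsize (Ts n))) ^ 2 + sqrt (degree_moment4 (Ts n))) \<longlonglongrightarrow> 0 ^ 2 + sqrt 0"
      using filterlim_compose[OF lim_1_over_n tconverges_sizes[OF Ts]] by (intro tendsto_intros)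
    then have bound: "(\<lambda>n. (1 / real (tsize (Ts n))) ^ 2 + sqrt (degree_moment4 (Ts n))) \<longlonglongrightarrow> 0" by simp
    have "(\<lambda>n. imbalance (Ts n)) \<longlonglongrightarrow> 0"
    proof (rule Lim_null_comparison[OF _ bound])
      show "\<forall>\<^sub>F n in sequentially. norm (imbalance (Ts n)) \<le> (1 / real (tsize (Ts n))) ^ 2 + sqrt (degree_moment4 (Ts n))"
        using ev[OF Ts] by (rule eventually_mono)
          (use imbalance_degree_moment4 imbalance_nonneg in \<open>simp add: power_divide\<close>)
    qed
    then have "hom_imbalance \<phi> = 0" using tconverges_imbalance[OF Ts] LIMSEQ_unique by blast
    then show "\<phi> = phi_C3" using zero by (rule eq_phi_C3_of_zero[OF \<phi>])
  qed
qed

text \<open>The sequence depends on \<open>k\<close> but its limit does not; hence the imbalance of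
  \<open>\<phi>\<close> is at most \<open>1/8 * (1/9) ^ k\<close> for every
  \<open>k\<close>.\<close>

lemma hom_imbalance_eq_0_of_equally:
  assumes "\<And>k. \<exists>Ts. (\<forall>n. equally_C3_decomposable k (Ts n)) \<and> tconverges Ts \<phi>"
  shows "hom_imbalance \<phi> = 0"
proof (rule antisym)
  have le: "hom_imbalance \<phi> \<le> 1/8 * (1/9) ^ k" for k
  proof -
    obtain Ts where Ts: "\<And>n. equally_C3_decomposable k (Ts n)" "tconverges Ts \<phi>" using assms by blast
    have "(\<lambda>n. 1 / real (tsize (Ts n))) \<longlonglongrightarrow> 0"
      using filterlim_compose[OF lim_1_over_n tconverges_sizes[OF Ts(2)]] .
    then have "(\<lambda>n. 1/8 * (1/9) ^ k + 2 * real k * (1 / real (tsize (Ts n)))) \<longlonglongrightarrow> 1/8 * (1/9) ^ k + 2 * real k * 0"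
      by (intro tendsto_intros)
    then have lim: "(\<lambda>n. 1/8 * (1/9) ^ k + 2 * real k / real (tsize (Ts n))) \<longlonglongrightarrow> 1/8 * (1/9) ^ k" by simp
    have "\<forall>\<^sub>F n in sequentially. 1 \<le> tsize (Ts n)" using tconverges_sizes[OF Ts(2)] by (simp add: filterlim_at_top)
    then have "\<forall>\<^sub>F n in sequentially. imbalance (Ts n) \<le> 1/8 * (1/9) ^ k + 2 * real k / real (tsize (Ts n))"
      by (rule eventually_mono) (use equally_C3_decomposable_imbalance[OF Ts(1)] in simp)
    then show ?thesis using tendsto_le[OF _ lim tconverges_imbalance[OF Ts(2)]] by simp
  qed
  have "(\<lambda>k. 1/8 * (1/9 :: real) ^ k) \<longlonglongrightarrow> 1/8 * 0" by (intro tendsto_intros LIMSEQ_power_zero) simp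
  then have lim: "(\<lambda>k. 1/8 * (1/9 :: real) ^ k) \<longlonglongrightarrow> 0" by simp
  show "hom_imbalance \<phi> \<le> 0" by (rule LIMSEQ_le_const[OF lim]) (use le in blast)
  obtain Ts where "tconverges Ts \<phi>" using assms by blast
  then show "0 \<le> hom_imbalance \<phi>"
    using tendsto_lowerbound[OF tconverges_imbalance] imbalance_nonneg by (simp add: eventually_True)
qed

theorem theorem6p12:
  fixes \<phi> :: "flag_algebra \<Rightarrow> real"
  assumes "\<phi> \<in> pos_homs"
  shows "(\<phi> = phi_C3 \<longleftrightarrow> maximizes_density T5_9 \<phi>) \<and>
    (\<phi> = phi_C3 \<longleftrightarrow> maximizes_density T5_11 \<phi>) \<and>
    (\<phi> = phi_C3 \<longleftrightarrow> balanced \<phi> \<and> C3_decomposable_hom \<phi>) \<and>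
    (\<phi> = phi_C3 \<longleftrightarrow>
      (\<forall>k. \<exists>Ts. (\<forall>n. equally_C3_decomposable k (Ts n)) \<and> tconverges Ts \<phi>))"
proof (intro conjI)
  show "\<phi> = phi_C3 \<longleftrightarrow> maximizes_density T5_9 \<phi>"
    by (rule maximizer_iff[of 320 16 1 T5_9 1530])
      (use T5_9_upper_bound T5_9_C3_blowup assms in simp_all)
  show "\<phi> = phi_C3 \<longleftrightarrow> maximizes_density T5_11 \<phi>"
    by (rule maximizer_iff[of 640 24 5 T5_11 2650])
      (use T5_11_upper_bound T5_11_C3_blowup assms in simp_all)
  show "\<phi> = phi_C3 \<longleftrightarrow> balanced \<phi> \<and> C3_decomposable_hom \<phi>"
  proof
    assume "\<phi> = phi_C3"
    moreover have "asymptotically_balanced C3_blowup"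
      by (rule imbalance_imp_asymptotically_balanced[OF _ imbalance_C3_blowup]) (simp add: tsize_C3_blowup)
    ultimately show "balanced \<phi> \<and> C3_decomposable_hom \<phi>"
      using phi_C3(2) phi_C3_decomposable by (auto simp: balanced_def)
  next
    assume bd: "balanced \<phi> \<and> C3_decomposable_hom \<phi>"
    then obtain Ts where Ts: "asymptotically_balanced Ts" "tconverges Ts \<phi>" by (auto simp: balanced_def)
    have "hom_imbalance \<phi> = 0"
      using LIMSEQ_unique[OF tconverges_imbalance[OF Ts(2)] asymptotically_balanced_imp_imbalance[OF Ts(1)]] .
    then show "\<phi> = phi_C3"
      by (rule eq_phi_C3_of_zero[OF assms]) (use bd C3_decomposable_hom_iff[OF assms] in blast)
  qed
  show "\<phi> = phi_C3 \<longleftrightarrow> (\<forall>k. \<exists>Ts. (\<forall>n. equally_C3_decomposable k (Ts n)) \<and> tconverges Ts \<phi>)"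
  proof
    assume "\<phi> = phi_C3"
    then show "\<forall>k. \<exists>Ts. (\<forall>n. equally_C3_decomposable k (Ts n)) \<and> tconverges Ts \<phi>"
      using equally_C3_decomposable_C3_blowup phi_C3(2) by blast
  next
    assume eq: "\<forall>k. \<exists>Ts. (\<forall>n. equally_C3_decomposable k (Ts n)) \<and> tconverges Ts \<phi>"
    \<comment> \<open>The sequence for \<open>k = 0\<close> supplies decomposability; the sequences
      for large \<open>k\<close> are used only for balance.\<close>
    then obtain Ts where Ts: "\<And>n. equally_C3_decomposable 0 (Ts n)" "tconverges Ts \<phi>" by blast
    have "hom_imbalance \<phi> = 0" by (rule hom_imbalance_eq_0_of_equally) (use eq in blast)
    then show "\<phi> = phi_C3" using Ts by (intro eq_phi_C3[OF assms Ts(2)]) simp_all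
  qed
qed

end
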